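(* Fix $\gamma\ge 1$, let $L_n\sim\mu_n$, and define $$K_\gamma^*=\begin{cases}\gamma^2/(2e)-\log\gamma,&1\le\gamma<\sqrt e,\\ 0,&\gamma\ge\sqrt e.\end{cases}$$ (In particular $K_1^*=1/(2e)$ and $K_1^*/\log 2=1/(2e\log 2)=0.2653689\ldots$.) Then, as $n\to\infty$, $$-\frac1n\log\Bigl(\sup_{c>0}u_{n,\gamma,c}(L_n)\Bigr)\longrightarrow K_\gamma^*\quad\text{in probability},$$ and the same limit holds with $\widehat u_{n,\gamma,c}$ in place of $u_{n,\gamma,c}$. Let $N_n$ be deterministic positive integers with $n^{-1}\log N_n\to r$. Consider any direct search procedure (defined in the context) making at most $N_n$ Gaussian queries. (i) If $r<K_\gamma^*$, its joint success probability tends to $0$. (ii) If $r>K_\gamma^*$, the procedure which makes $N_n$ queries, takes $c_j=e^{-1}$ for every query $j$ and returns the shortest nonzero sample has joint success probability tending to $1$.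
   Context: All logarithms are natural. $\mu_n$ is the $\mathrm{SL}(n,\mathbb R)$-invariant probability measure on $\mathbb X_n=\mathrm{SL}(n,\mathbb Z)\backslash\mathrm{SL}(n,\mathbb R)$, identified with the space of lattices of covolume $1$ in $\mathbb R^n$. $\lambda_1(L)$ is the length of a shortest nonzero vector of $L$. $v_n$ is the volume of the Euclidean unit ball in $\mathbb R^n$, $\mathrm{GH}_n=v_n^{-1/n}$, and for $c>0$ the width $s_n(c)>0$ is given by $s_n(c)^2=2\pi\,\mathrm{GH}_n^2/(cn)$. For a lattice $L$ and $s>0$ the discrete Gaussian (zero vector included) is the probability law on $L$ $$D_{L,s}(v)=\frac{e^{-\pi\|v\|^2/s^2}}{\theta_L(s)},\qquad \theta_L(s)=\sum_{w\in L}e^{-\pi\|w\|^2/s^2}.$$ A nonzero $w\in L$ is primitive if it is not $mw'$ with $w'\in L$ and an integer $m\ge2$. Every nonzero $v\in L$ is uniquely $v=mw$ with integer $m\ge1$ and $w$ primitive; put $P_L(v)=w$ and $P_L(0)=0$. Define $$u_{n,\gamma,c}(L)=\Pr_{V\sim D_{L,s_n(c)}}\{0<\|V\|\le\gamma\lambda_1(L)\},\qquad \widehat u_{n,\gamma,c}(L)=\Pr_{V\sim D_{L,s_n(c)}}\{0<\|P_L(V)\|\le\gamma\lambda_1(L)\}.$$ Direct search procedure: at query $j$ it chooses any $c_j>0$ measurably from $L_n$, its internal randomness, and the previous outputs. Conditional on this history and $L_n$, the query returns a fresh draw from $D_{L_n,s_n(c_j)}$. At the end the procedure returns one of its nonzero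 samples, optionally after applying $P_{L_n}$, or reports failure. It succeeds if it returns a nonzero vector of length at most $\gamma\lambda_1(L_n)$. Joint success probability means the probability of success over $L_n\sim\mu_n$ and all sampling and internal randomness. *)

theory Defs
  imports "HOL-Probability.Probability" "Jordan_Normal_Form.Determinant"
begin

section \<open>Vectors, matrices and their Borel structure\<close>

definition euclid_norm :: "real vec \<Rightarrow> real" where
  "euclid_norm v = sqrt (scalar_prod v v)"

definition vec_borel :: "nat \<Rightarrow> real vec measure" where
  "vec_borel n = vimage_algebra (carrier_vec n)
     (\<lambda>v. \<lambda>i\<in>{..<n}. vec_index v i) (Pi\<^sub>M {..<n} (\<lambda>_. borel))"

definition SL :: "nat \<Rightarrow> real mat set" where
  "SL n = {g \<in> carrier_mat n n. det g = 1}"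

definition SL_borel :: "nat \<Rightarrow> real mat measure" where
  "SL_borel n = vimage_algebra (SL n)
     (\<lambda>g. \<lambda>ij\<in>{..<n} \<times> {..<n}. index_mat g ij) (Pi\<^sub>M ({..<n} \<times> {..<n}) (\<lambda>_. borel))"

definition int_vecs :: "nat \<Rightarrow> real vec set" where
  "int_vecs n = {z \<in> carrier_vec n. \<forall>i<n. vec_index z i \<in> \<int>}"

section \<open>The space of lattices of covolume one\<close>

text \<open>The coset of \<open>g\<close> modulo left multiplication by integral matrices of determinant one
  corresponds to the lattice spanned by the rows of \<open>g\<close>; row vectors are handled as
  column vectors through the transpose.\<close>

definition row_lattice :: "nat \<Rightarrow> real mat \<Rightarrow> real vec set" where
  "row_lattice n g = (\<lambda>z. transpose_mat g *\<^sub>v z) ` int_vecs n"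

text \<open>The quotient (final) sigma-algebra; the quotient map is a covering, so this is the
  Borel sigma-algebra of the quotient topology. The measure of \<open>sigma\<close> is zero and plays no
  role: \<open>lattice_space n\<close> is used only as a measurable space.\<close>

definition lattice_space :: "nat \<Rightarrow> real vec set measure" where
  "lattice_space n = sigma (row_lattice n ` SL n)
     {A. A \<subseteq> row_lattice n ` SL n \<and> {g \<in> SL n. row_lattice n g \<in> A} \<in> sets (SL_borel n)}"

text \<open>Right multiplication by \<open>h\<close>: the lattice of \<open>g\<close> goes to the lattice of \<open>g * h\<close>.\<close>

definition lattice_act :: "real mat \<Rightarrow> real vec set \<Rightarrow> real vec set" where
  "lattice_act h L = (\<lambda>x. transpose_mat h *\<^sub>v x) ` L"

text \<open>These conditions determine the measure uniquely.\<close>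

definition invariant_lattice_prob :: "nat \<Rightarrow> real vec set measure \<Rightarrow> bool" where
  "invariant_lattice_prob n M \<longleftrightarrow>
     prob_space M \<and> sets M = sets (lattice_space n) \<and>
     (\<forall>h\<in>SL n. \<forall>A\<in>sets M. emeasure M (lattice_act h ` A) = emeasure M A)"

section \<open>Shortest vectors, primitive vectors, discrete Gaussians\<close>

definition lambda1 :: "nat \<Rightarrow> real vec set \<Rightarrow> real" where
  "lambda1 n L = (INF v\<in>L - {0\<^sub>v n}. euclid_norm v)"

definition primitive :: "nat \<Rightarrow> real vec set \<Rightarrow> real vec \<Rightarrow> bool" where
  "primitive n L w \<longleftrightarrow> w \<in> L \<and> w \<noteq> 0\<^sub>v n \<and>
     \<not> (\<exists>w'\<in>L. \<exists>m::nat. m \<ge> 2 \<and> w = real m \<cdot>\<^sub>v w')"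

definition primitive_part :: "nat \<Rightarrow> real vec set \<Rightarrow> real vec \<Rightarrow> real vec" where
  "primitive_part n L v =
     (if v = 0\<^sub>v n then 0\<^sub>v n
      else (THE w. primitive n L w \<and> (\<exists>m::nat. m \<ge> 1 \<and> v = real m \<cdot>\<^sub>v w)))"

definition GH :: "nat \<Rightarrow> real" where
  "GH n = unit_ball_vol (real n) powr (- 1 / real n)"

definition gauss_width :: "nat \<Rightarrow> real \<Rightarrow> real" where
  "gauss_width n c = sqrt (2 * pi * (GH n)\<^sup>2 / (c * real n))"

definition theta :: "real vec set \<Rightarrow> real \<Rightarrow> real" where
  "theta L s = (\<Sum>\<^sub>\<infinity>w\<in>L. exp (- pi * (euclid_norm w)\<^sup>2 / s\<^sup>2))"

definition discrete_gaussian :: "real vec set \<Rightarrow> real \<Rightarrow> real vec pmf" where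
  "discrete_gaussian L s = embed_pmf
     (\<lambda>v. if v \<in> L then exp (- pi * (euclid_norm v)\<^sup>2 / s\<^sup>2) / theta L s else 0)"

definition u_prob :: "nat \<Rightarrow> real \<Rightarrow> real \<Rightarrow> real vec set \<Rightarrow> real" where
  "u_prob n \<gamma> c L = measure_pmf.prob (discrete_gaussian L (gauss_width n c))
     {v. 0 < euclid_norm v \<and> euclid_norm v \<le> \<gamma> * lambda1 n L}"

definition u_hat_prob :: "nat \<Rightarrow> real \<Rightarrow> real \<Rightarrow> real vec set \<Rightarrow> real" where
  "u_hat_prob n \<gamma> c L = measure_pmf.prob (discrete_gaussian L (gauss_width n c))
     {v. 0 < euclid_norm (primitive_part n L v) \<and>
         euclid_norm (primitive_part n L v) \<le> \<gamma> * lambda1 n L}"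

definition K_star :: "real \<Rightarrow> real" where
  "K_star \<gamma> = (if \<gamma> < sqrt (exp 1) then \<gamma>\<^sup>2 / (2 * exp 1) - ln \<gamma> else 0)"

text \<open>Convergence in probability to a constant of random variables on varying probability
  spaces. Measurability is demanded (for large indices) because \<open>measure\<close> is zero
  on non-measurable sets.\<close>

definition converges_in_prob ::
  "(nat \<Rightarrow> 'a measure) \<Rightarrow> (nat \<Rightarrow> 'a \<Rightarrow> real) \<Rightarrow> real \<Rightarrow> bool" where
  "converges_in_prob M X k \<longleftrightarrow>
     (\<forall>\<^sub>F n in sequentially. X n \<in> borel_measurable (M n)) \<and>
     (\<forall>\<epsilon>>0. (\<lambda>n. measure (M n) {x \<in> space (M n). \<bar>X n x - k\<bar> > \<epsilon>}) \<longlonglongrightarrow> 0)"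

section \<open>Direct search procedures\<close>

text \<open>All decisions depend on the lattice, the internal randomness (a seed of type \<open>'r\<close>
  independent of the lattice and of the samples) and the list of previous outputs, oldest
  first. \<open>stop\<close> allows fewer queries than permitted; \<open>param\<close> is the next \<open>c\<close>. An answer
  \<open>Some (i, p)\<close> names the \<open>i\<close>-th sample, and \<open>p\<close> tells whether to return its primitive part;
  \<open>None\<close> reports failure.\<close>

record 'r direct_search =
  stop :: "real vec set \<Rightarrow> 'r \<Rightarrow> real vec list \<Rightarrow> bool"
  param :: "real vec set \<Rightarrow> 'r \<Rightarrow> real vec list \<Rightarrow> real"
  answer :: "real vec set \<Rightarrow> 'r \<Rightarrow> real vec list \<Rightarrow> (nat \<times> bool) option"

definition history_space :: "nat \<Rightarrow> nat \<Rightarrow> real vec list measure" where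
  "history_space n j = vimage_algebra {xs. length xs = j \<and> set xs \<subseteq> carrier_vec n}
     (\<lambda>xs. \<lambda>i\<in>{..<j}. xs ! i) (Pi\<^sub>M {..<j} (\<lambda>_. vec_borel n))"

definition decision_space :: "nat \<Rightarrow> 'r measure \<Rightarrow> nat \<Rightarrow>
    (real vec set \<times> 'r \<times> real vec list) measure" where
  "decision_space n R j = lattice_space n \<Otimes>\<^sub>M R \<Otimes>\<^sub>M history_space n j"

definition is_direct_search :: "nat \<Rightarrow> nat \<Rightarrow> 'r measure \<Rightarrow> 'r direct_search \<Rightarrow> bool" where
  "is_direct_search n N R A \<longleftrightarrow>
     (\<forall>j<N.
        (\<lambda>(L, \<omega>, xs). stop A L \<omega> xs) \<in> measurable (decision_space n R j) (count_space UNIV) \<and>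
        (\<lambda>(L, \<omega>, xs). param A L \<omega> xs) \<in> borel_measurable (decision_space n R j) \<and>
        (\<forall>(L, \<omega>, xs) \<in> space (decision_space n R j). param A L \<omega> xs > 0)) \<and>
     (\<forall>j\<le>N.
        (\<lambda>(L, \<omega>, xs). answer A L \<omega> xs) \<in> measurable (decision_space n R j) (count_space UNIV) \<and>
        (\<forall>(L, \<omega>, xs) \<in> space (decision_space n R j). \<forall>i p.
           answer A L \<omega> xs = Some (i, p) \<longrightarrow> i < length xs \<and> xs ! i \<noteq> 0\<^sub>v n))"

text \<open>The law of the complete list of outputs, given the lattice and the seed, when the outputs
  so far are \<open>xs\<close> and at most \<open>k\<close> further queries are permitted.\<close>

fun transcript :: "nat \<Rightarrow> 'r direct_search \<Rightarrow> real vec set \<Rightarrow> 'r \<Rightarrow> nat \<Rightarrow> real vec list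
    \<Rightarrow> real vec list pmf" where
  "transcript n A L \<omega> 0 xs = return_pmf xs"
| "transcript n A L \<omega> (Suc k) xs =
     (if stop A L \<omega> xs then return_pmf xs
      else bind_pmf (discrete_gaussian L (gauss_width n (param A L \<omega> xs)))
             (\<lambda>v. transcript n A L \<omega> k (xs @ [v])))"

definition returned :: "nat \<Rightarrow> 'r direct_search \<Rightarrow> real vec set \<Rightarrow> 'r \<Rightarrow> real vec list
    \<Rightarrow> real vec option" where
  "returned n A L \<omega> xs =
     (case answer A L \<omega> xs of
        None \<Rightarrow> None
      | Some (i, p) \<Rightarrow> Some (if p then primitive_part n L (xs ! i) else xs ! i))"

definition succeeds :: "nat \<Rightarrow> real \<Rightarrow> real vec set \<Rightarrow> real vec option \<Rightarrow> bool" where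
  "succeeds n \<gamma> L out \<longleftrightarrow>
     (\<exists>w. out = Some w \<and> w \<noteq> 0\<^sub>v n \<and> euclid_norm w \<le> \<gamma> * lambda1 n L)"

text \<open>The conditional success probability given lattice and seed, averaged over both.
  For a direct search the integrand is measurable and bounded by one.\<close>

definition joint_success :: "nat \<Rightarrow> real \<Rightarrow> real vec set measure \<Rightarrow> 'r measure \<Rightarrow> nat
    \<Rightarrow> 'r direct_search \<Rightarrow> real" where
  "joint_success n \<gamma> M R N A = enn2real
     (\<integral>\<^sup>+ (L, \<omega>). emeasure (measure_pmf (transcript n A L \<omega> N []))
         {xs. succeeds n \<gamma> L (returned n A L \<omega> xs)} \<partial>(M \<Otimes>\<^sub>M R))"

text \<open>Constant parameter \<open>c\<close>, no early stopping; the answer is the first among the shortest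
  nonzero samples.\<close>

definition shortest_sample_search :: "nat \<Rightarrow> real \<Rightarrow> 'r direct_search" where
  "shortest_sample_search n c =
     \<lparr> stop = (\<lambda>L \<omega> xs. False),
       param = (\<lambda>L \<omega> xs. c),
       answer = (\<lambda>L \<omega> xs.
         if \<exists>i<length xs. xs ! i \<noteq> 0\<^sub>v n
         then Some (LEAST i. i < length xs \<and> xs ! i \<noteq> 0\<^sub>v n \<and>
                (\<forall>j<length xs. xs ! j \<noteq> 0\<^sub>v n \<longrightarrow> euclid_norm (xs ! i) \<le> euclid_norm (xs ! j)),
              False)
         else None) \<rparr>"

end

theory Submission
  imports Defs "HOL-Number_Theory.Cong"
begin

text \<open>Siegel's mean value bound and a second moment estimate are obtained without reduction theory.
  Invariance allows an integral over the space of lattices to be replaced by averages over the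
  rescaled sublattices of prime index \<open>p\<close> of a fixed lattice. As \<open>p\<close> tends to infinity, first and
  second moments of such averages reduce to counting the integer points of an ellipsoid, and the
  pairs of them that are dependent modulo \<open>p\<close>. By Markov and Chebyshev, with high probability
  \<open>lambda1\<close> is close to \<open>GH n\<close>, there are at least \<open>x ^ n / 2\<close> vectors of norm at most
  \<open>x * GH n\<close> (\<open>x > 1\<close>), and Gaussian sums exceed their means by subexponential factors only.

  At \<open>c = 1/e\<close> the denominator of the discrete Gaussian is then subexponential, and the mass of the
  vectors of norm about \<open>x * GH n\<close> is \<open>exp (- n * (x\<^sup>2 / (2 * e) - ln x))\<close>, increasing up to
  \<open>x = sqrt e\<close>; the exponent is the one at \<open>x = min \<gamma> (sqrt e)\<close>. No other \<open>c\<close> is better by more than a constant factor,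
  even for primitive parts: translating the line through a short vector by the many lattice points
  of norm at most \<open>sqrt e * GH n\<close> bounds the denominator from below. Query complexity follows by a
  union bound along the transcript and by independence of the samples.\<close>

section \<open>The group SL(n) and integral points\<close>

text \<open>\<open>invariant_lattice_prob\<close> fixes the measure only by its symmetry, and the
  Hecke averages translate on the left, by matrices outside \<open>SLZ n\<close>, which does not
  descend to lattices. The measure is therefore lifted to the group; uniqueness of Haar measure then
  leaves a single scalar \<open>\<Delta>\<close> that has to equal 1. The matrices
  \<open>hecke_mat\<close> reach \<open>p ^ (n - 1)\<close> of the \<open>\<Sum>i<n. p ^ i\<close>
  sublattices of index \<open>p\<close>, so averages and integrals are linked by an inequality only.
  Applied to \<open>1 - F\<close> it bounds the integral of \<open>F \<le> 1\<close> from above, up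
  to an error of order \<open>1 / p\<close>, and upper bounds are all that Markov and Chebyshev ask
  for.

  The constant \<open>1/e\<close>: at parameter \<open>c\<close>, the vectors of norm about
  \<open>x * GH n\<close> contribute about \<open>exp (n * (ln x - c * x\<^sup>2 / 2))\<close> to
  the theta sum. The exponent is largest at \<open>x = 1 / sqrt c\<close>, and its maximum vanishes
  exactly for \<open>c = 1/e\<close>, at \<open>x = sqrt e\<close>. For larger \<open>c\<close> the
  zero vector dominates, for smaller \<open>c\<close> the vectors of norm about
  \<open>GH n / sqrt c\<close>; either way the short vectors lose relative mass.\<close>

definition SLZ :: "nat \<Rightarrow> real mat set" where
  "SLZ n = {A \<in> SL n. \<forall>i<n. \<forall>j<n. index_mat A (i, j) \<in> \<int>}"

lemma SL_carrier: "g \<in> SL n \<Longrightarrow> g \<in> carrier_mat n n"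
  and SL_det: "g \<in> SL n \<Longrightarrow> det g = 1"
  by (auto simp: SL_def)

lemma SL_mult: "g \<in> SL n \<Longrightarrow> h \<in> SL n \<Longrightarrow> g * h \<in> SL n"
  by (auto simp: SL_def det_mult)

lemma SL_one: "1\<^sub>m n \<in> SL n"
  by (auto simp: SL_def)

text \<open>In determinant one the adjugate is the inverse. Inversion is thus polynomial in the
  entries, which later supplies its integrality, its measurability and a norm bound.\<close>

lemma SL_adj:
  assumes "g \<in> SL n"
  shows "adj_mat g \<in> SL n" "g * adj_mat g = 1\<^sub>m n" "adj_mat g * g = 1\<^sub>m n"
proof -
  note c = SL_carrier[OF assms] and d = SL_det[OF assms]
  have s: "(1 :: real) \<cdot>\<^sub>m 1\<^sub>m n = 1\<^sub>m n" by (intro eq_matI) auto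
  show 1: "g * adj_mat g = 1\<^sub>m n" using adj_mat(2)[OF c] d s by simp
  show "adj_mat g * g = 1\<^sub>m n" using adj_mat(3)[OF c] d s by simp
  have "det g * det (adj_mat g) = 1"
    using det_mult[OF c adj_mat(1)[OF c]] 1 by simp
  then show "adj_mat g \<in> SL n" using d adj_mat(1)[OF c] by (simp add: SL_def)
qed

lemma SL_assoc:
  "a \<in> SL n \<Longrightarrow> b \<in> SL n \<Longrightarrow> c \<in> SL n \<Longrightarrow> a * b * c = a * (b * c)"
  by (auto simp: SL_def intro: assoc_mult_mat)

lemma SL_adj_cancel:
  assumes "a \<in> SL n" "b \<in> SL n"
  shows "adj_mat a * (a * b) = b" "a * (adj_mat a * b) = b"
    "b * a * adj_mat a = b" "b * adj_mat a * a = b"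
  using SL_adj[OF assms(1)] assms SL_carrier[OF assms(2)]
  by (simp_all add: SL_assoc[symmetric] SL_assoc[of b n a "adj_mat a"] SL_assoc[of b n "adj_mat a" a])

lemma SL_left_one: "a \<in> SL n \<Longrightarrow> 1\<^sub>m n * a = a"
  and SL_right_one: "a \<in> SL n \<Longrightarrow> a * 1\<^sub>m n = a"
  by (auto dest: SL_carrier)

lemma SL_adj_mult:
  assumes "a \<in> SL n" "b \<in> SL n"
  shows "adj_mat (a * b) = adj_mat b * adj_mat a"
proof -
  have "(adj_mat b * adj_mat a) * (a * b) = 1\<^sub>m n"
    using assms by (simp add: SL_assoc[where n = n] SL_adj SL_adj_cancel[where n = n] SL_mult)
  then have "(adj_mat b * adj_mat a) * (a * b) * adj_mat (a * b) = adj_mat (a * b)"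
    using assms by (simp add: SL_adj SL_mult SL_left_one)
  then show ?thesis
    using SL_adj_cancel(3)[of "a * b" n "adj_mat b * adj_mat a"] assms
    by (simp add: SL_mult SL_adj)
qed

lemma SLZ_SL: "A \<in> SLZ n \<Longrightarrow> A \<in> SL n"
  by (simp add: SLZ_def)

lemma det_Ints:
  assumes "A \<in> carrier_mat m m" "\<And>i j. i < m \<Longrightarrow> j < m \<Longrightarrow> index_mat A (i, j) \<in> (\<int> :: real set)"
  shows "det A \<in> \<int>"
  using assms
  by (auto simp: det_def intro!: Ints_sum Ints_mult Ints_prod Ints_of_int)

lemma SLZ_adj:
  assumes "A \<in> SLZ n"
  shows "adj_mat A \<in> SLZ n"
proof -
  have A: "A \<in> carrier_mat n n" "\<And>i j. i < n \<Longrightarrow> j < n \<Longrightarrow> index_mat A (i, j) \<in> \<int>"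
    using assms by (auto simp: SLZ_def SL_def)
  have "index_mat (adj_mat A) (i, j) \<in> \<int>" if "i < n" "j < n" for i j
  proof -
    have "det (mat_delete A j i) \<in> \<int>"
    proof (rule det_Ints[of _ "n - 1"])
      show "mat_delete A j i \<in> carrier_mat (n - 1) (n - 1)"
        using A(1) by (simp add: mat_delete_def)
      fix k l assume "k < n - 1" "l < n - 1"
      then show "index_mat (mat_delete A j i) (k, l) \<in> \<int>"
        using A by (auto simp: mat_delete_def)
    qed
    then show ?thesis
      using A(1) that by (auto simp: adj_mat_def cofactor_def intro!: Ints_mult Ints_power)
  qed
  with SL_adj(1)[OF SLZ_SL[OF assms]] show ?thesis by (simp add: SLZ_def)
qed

lemma int_vecs_mult:
  assumes "A \<in> carrier_mat n n" "\<And>i j. i < n \<Longrightarrow> j < n \<Longrightarrow> index_mat A (i, j) \<in> \<int>" "z \<in> int_vecs n"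
  shows "A *\<^sub>v z \<in> int_vecs n"
  using assms by (auto simp: int_vecs_def scalar_prod_def intro!: Ints_sum Ints_mult)

lemma row_lattice_mult_subset:
  assumes "A \<in> SLZ n" "g \<in> SL n"
  shows "row_lattice n (A * g) \<subseteq> row_lattice n g"
proof -
  have A: "A \<in> carrier_mat n n" "\<And>i j. i < n \<Longrightarrow> j < n \<Longrightarrow> index_mat A (i, j) \<in> \<int>"
    and g: "g \<in> carrier_mat n n"
    using assms by (auto simp: SLZ_def SL_def)
  have "transpose_mat (A * g) *\<^sub>v z = transpose_mat g *\<^sub>v (transpose_mat A *\<^sub>v z)"
    if "z \<in> carrier_vec n" for z
    using that A(1) g by (simp add: transpose_mult[OF A(1) g] assoc_mult_mat_vec[of _ n n _ n])
  moreover have "transpose_mat A *\<^sub>v z \<in> int_vecs n" if "z \<in> int_vecs n" for z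
    using that A by (intro int_vecs_mult) auto
  ultimately show ?thesis
    by (auto simp: row_lattice_def int_vecs_def)
qed

lemma row_lattice_mult_SLZ:
  assumes "A \<in> SLZ n" "g \<in> SL n"
  shows "row_lattice n (A * g) = row_lattice n g"
  using row_lattice_mult_subset[OF assms]
    row_lattice_mult_subset[OF SLZ_adj[OF assms(1)] SL_mult[OF SLZ_SL[OF assms(1)] assms(2)]]
  by (simp add: SL_adj_cancel[OF SLZ_SL[OF assms(1)] assms(2)])

text \<open>Row \<open>i\<close> of \<open>h\<close> is a lattice vector of \<open>g\<close>, and
  its integer coordinates in the basis \<open>g\<close> form row \<open>i\<close> of
  \<open>h * adj_mat g\<close>. Inclusion is enough, since equal covolume is built into
  \<open>SL n\<close>.\<close>

lemma row_lattice_subset_imp: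
  assumes "h \<in> SL n" "g \<in> SL n" "row_lattice n h \<subseteq> row_lattice n g"
  shows "h * adj_mat g \<in> SLZ n"
proof -
  have c: "h \<in> carrier_mat n n" "g \<in> carrier_mat n n" "adj_mat g \<in> carrier_mat n n"
    using assms SL_adj(1)[OF assms(2)] by (auto dest: SL_carrier)
  have "index_mat (h * adj_mat g) (i, j) \<in> \<int>" if ij: "i < n" "j < n" for i j
  proof -
    have "unit_vec n i \<in> int_vecs n" by (auto simp: int_vecs_def unit_vec_def)
    then have "transpose_mat h *\<^sub>v unit_vec n i \<in> row_lattice n g"
      using assms(3) by (auto simp: row_lattice_def)
    then obtain z where z: "z \<in> int_vecs n" "transpose_mat h *\<^sub>v unit_vec n i = transpose_mat g *\<^sub>v z"
      by (auto simp: row_lattice_def)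
    have zc: "z \<in> carrier_vec n" using z by (simp add: int_vecs_def)
    have "transpose_mat (h * adj_mat g) *\<^sub>v unit_vec n i
        = transpose_mat (adj_mat g) *\<^sub>v (transpose_mat h *\<^sub>v unit_vec n i)"
      using c by (simp add: transpose_mult[OF c(1) c(3)] assoc_mult_mat_vec[of _ n n _ n])
    also have "\<dots> = transpose_mat (adj_mat g) *\<^sub>v (transpose_mat g *\<^sub>v z)" by (simp add: z)
    also have "\<dots> = transpose_mat (g * adj_mat g) *\<^sub>v z"
      using c zc by (simp add: transpose_mult[OF c(2) c(3)] assoc_mult_mat_vec[of _ n n _ n])
    also have "\<dots> = z" using zc by (simp add: SL_adj[OF assms(2)])
    finally have eq: "transpose_mat (h * adj_mat g) *\<^sub>v unit_vec n i = z" .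
    have "index_mat (h * adj_mat g) (i, j) = vec_index (transpose_mat (h * adj_mat g) *\<^sub>v unit_vec n i) j"
      using ij c by (simp add: scalar_prod_right_unit)
    also have "\<dots> \<in> \<int>" using z(1) ij unfolding eq by (simp add: int_vecs_def)
    finally show ?thesis .
  qed
  then show ?thesis
    using SL_mult[OF assms(1) SL_adj(1)[OF assms(2)]] by (simp add: SLZ_def)
qed

definition fib :: "nat \<Rightarrow> real vec set \<Rightarrow> real mat set" where
  "fib n L = {h \<in> SL n. row_lattice n h = L}"

lemma bij_betw_fib:
  assumes "g \<in> SL n"
  shows "bij_betw (\<lambda>A. A * g) (SLZ n) (fib n (row_lattice n g))"
proof (rule bij_betwI[where g = "\<lambda>h. h * adj_mat g"])
  show "(\<lambda>A. A * g) \<in> SLZ n \<rightarrow> fib n (row_lattice n g)"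
    using assms by (auto simp: fib_def row_lattice_mult_SLZ SL_mult SLZ_SL)
  show "(\<lambda>h. h * adj_mat g) \<in> fib n (row_lattice n g) \<rightarrow> SLZ n"
    using assms by (auto simp: fib_def intro: row_lattice_subset_imp)
  show "A * g * adj_mat g = A" if "A \<in> SLZ n" for A
    using that assms by (simp add: SL_adj_cancel SLZ_SL)
  show "h * adj_mat g * g = h" if "h \<in> fib n (row_lattice n g)" for h
    using that assms by (simp add: SL_adj_cancel fib_def)
qed

lemma lattice_act_row_lattice:
  assumes "g \<in> SL n" "h \<in> SL n"
  shows "lattice_act h (row_lattice n g) = row_lattice n (g * h)"
proof -
  have c: "g \<in> carrier_mat n n" "h \<in> carrier_mat n n" using assms by (auto dest: SL_carrier)
  show ?thesis
    unfolding lattice_act_def row_lattice_def image_image transpose_mult[OF c]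
    by (intro image_cong refl assoc_mult_mat_vec[symmetric, of _ n n _ n])
       (use c in \<open>auto simp: int_vecs_def\<close>)
qed

section \<open>Measurability\<close>

lemma space_SL_borel [simp]: "space (SL_borel n) = SL n"
  by (simp add: SL_borel_def)

lemma measurable_SL_borelI:
  assumes "\<And>x. x \<in> space N \<Longrightarrow> f x \<in> SL n"
    and "\<And>i j. i < n \<Longrightarrow> j < n \<Longrightarrow> (\<lambda>x. index_mat (f x) (i, j)) \<in> borel_measurable N"
  shows "f \<in> measurable N (SL_borel n)"
  unfolding SL_borel_def
proof (rule measurable_vimage_algebra2)
  show "f \<in> space N \<rightarrow> SL n" using assms by auto
  show "(\<lambda>x. \<lambda>ij\<in>{..<n} \<times> {..<n}. index_mat (f x) ij) \<in> N \<rightarrow>\<^sub>M Pi\<^sub>M ({..<n} \<times> {..<n}) (\<lambda>_. borel)"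
    using assms by (intro measurable_restrict) auto
qed

lemma measurable_entry [measurable]:
  assumes "i < n" "j < n"
  shows "(\<lambda>g. index_mat g (i, j)) \<in> borel_measurable (SL_borel n)"
proof -
  have "(\<lambda>g. \<lambda>ij\<in>{..<n} \<times> {..<n}. index_mat g ij) \<in> SL_borel n \<rightarrow>\<^sub>M Pi\<^sub>M ({..<n} \<times> {..<n}) (\<lambda>_. borel)"
    unfolding SL_borel_def by (rule measurable_vimage_algebra1) (auto simp: space_PiM)
  moreover have "(\<lambda>x. x (i, j)) \<in> Pi\<^sub>M ({..<n} \<times> {..<n}) (\<lambda>_. borel) \<rightarrow>\<^sub>M (borel :: real measure)"
    using assms by (intro measurable_component_singleton) auto
  ultimately have "(\<lambda>x. x (i, j)) \<circ> (\<lambda>g. \<lambda>ij\<in>{..<n} \<times> {..<n}. index_mat g ij) \<in> borel_measurable (SL_borel n)"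
    by (rule measurable_comp)
  then show ?thesis using assms by (simp add: comp_def)
qed

lemma measurable_SL_mult:
  assumes [measurable]: "f \<in> measurable N (SL_borel n)" "g \<in> measurable N (SL_borel n)"
  shows "(\<lambda>x. f x * g x) \<in> measurable N (SL_borel n)"
proof (rule measurable_SL_borelI)
  have f: "f x \<in> SL n" and g: "g x \<in> SL n" if "x \<in> space N" for x
    using that measurable_space[OF assms(1)] measurable_space[OF assms(2)] by auto
  show "x \<in> space N \<Longrightarrow> f x * g x \<in> SL n" for x using f g by (simp add: SL_mult)
  fix i j assume ij[simp]: "i < n" "j < n"
  have "(\<lambda>x. \<Sum>k\<in>{..<n}. index_mat (f x) (i, k) * index_mat (g x) (k, j)) \<in> borel_measurable N"
  proof (intro borel_measurable_sum borel_measurable_times)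
    fix k assume "k \<in> {..<n}"
    then have [simp]: "k < n" by simp
    show "(\<lambda>x. index_mat (f x) (i, k)) \<in> borel_measurable N"
      by (rule measurable_compose[OF assms(1) measurable_entry]) auto
    show "(\<lambda>x. index_mat (g x) (k, j)) \<in> borel_measurable N"
      by (rule measurable_compose[OF assms(2) measurable_entry]) auto
  qed
  then show "(\<lambda>x. index_mat (f x * g x) (i, j)) \<in> borel_measurable N"
    by (rule measurable_cong[THEN iffD1, rotated])
       (use SL_carrier[OF f] SL_carrier[OF g] in \<open>fastforce simp: scalar_prod_def lessThan_atLeast0\<close>)
qed

lemma measurable_det:
  assumes "\<And>x. x \<in> space N \<Longrightarrow> f x \<in> carrier_mat m m"
    and "\<And>i j. i < m \<Longrightarrow> j < m \<Longrightarrow> (\<lambda>x. index_mat (f x) (i, j) :: real) \<in> borel_measurable N"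
  shows "(\<lambda>x. det (f x)) \<in> borel_measurable N"
proof -
  have "(\<lambda>x. \<Sum>p | p permutes {0..<m}. of_int (sign p) * (\<Prod>i = 0..<m. index_mat (f x) (i, p i)))
      \<in> borel_measurable N"
    by (intro borel_measurable_sum borel_measurable_times borel_measurable_prod borel_measurable_const assms(2))
       (auto dest: permutes_in_image)
  then show ?thesis
    by (rule measurable_cong[THEN iffD1, rotated]) (auto simp: det_def dest!: assms(1))
qed

lemma measurable_adj_mat [measurable]: "adj_mat \<in> measurable (SL_borel n) (SL_borel n)"
proof (rule measurable_SL_borelI)
  show "x \<in> space (SL_borel n) \<Longrightarrow> adj_mat x \<in> SL n" for x by (simp add: SL_adj)
  fix i j assume ij: "i < n" "j < n"
  have "(\<lambda>x. det (mat_delete x j i)) \<in> borel_measurable (SL_borel n)"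
  proof (rule measurable_det[of _ _ "n - 1"])
    show "x \<in> space (SL_borel n) \<Longrightarrow> mat_delete x j i \<in> carrier_mat (n - 1) (n - 1)" for x
      using SL_carrier[of x n] by (auto simp: mat_delete_def)
    fix k l assume kl: "k < n - 1" "l < n - 1"
    have "(\<lambda>x. index_mat x (if k < j then k else Suc k, if l < i then l else Suc l)) \<in> borel_measurable (SL_borel n)"
      using kl ij by (intro measurable_entry) auto
    then show "(\<lambda>x. index_mat (mat_delete x j i) (k, l)) \<in> borel_measurable (SL_borel n)"
      by (rule measurable_cong[THEN iffD1, rotated])
         (use kl in \<open>auto dest!: SL_carrier simp: mat_delete_def\<close>)
  qed
  then have "(\<lambda>x. (-1) ^ (j + i) * det (mat_delete x j i)) \<in> borel_measurable (SL_borel n)"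
    by simp
  then show "(\<lambda>x. index_mat (adj_mat x) (i, j)) \<in> borel_measurable (SL_borel n)"
    by (rule measurable_cong[THEN iffD1, rotated])
       (use ij in \<open>auto dest!: SL_carrier simp: adj_mat_def cofactor_def\<close>)
qed

definition latt :: "nat \<Rightarrow> real vec set set" where
  "latt n = row_lattice n ` SL n"

lemma row_lattice_measurable_aux:
  "sigma_algebra (latt n)
     {A. A \<subseteq> latt n \<and> {g \<in> SL n. row_lattice n g \<in> A} \<in> sets (SL_borel n)}"
proof (rule sigma_algebra_iff2[THEN iffD2], intro conjI ballI allI impI)
  let ?S = "{A. A \<subseteq> latt n \<and> {g \<in> SL n. row_lattice n g \<in> A} \<in> sets (SL_borel n)}"
  show "?S \<subseteq> Pow (latt n)" by auto
  show "{} \<in> ?S" by auto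
  fix A assume "A \<in> ?S"
  moreover have "{g \<in> SL n. row_lattice n g \<in> latt n - A} = space (SL_borel n) - {g \<in> SL n. row_lattice n g \<in> A}"
    by (auto simp: latt_def)
  ultimately show "latt n - A \<in> ?S" 
    using sets.compl_sets[of "{g \<in> SL n. row_lattice n g \<in> A}" "SL_borel n"] by auto
next
  let ?S = "{A. A \<subseteq> latt n \<and> {g \<in> SL n. row_lattice n g \<in> A} \<in> sets (SL_borel n)}"
  fix A :: "nat \<Rightarrow> real vec set set" assume A: "range A \<subseteq> ?S"
  have "{g \<in> SL n. row_lattice n g \<in> (\<Union>i. A i)} = (\<Union>i. {g \<in> SL n. row_lattice n g \<in> A i})" by auto
  moreover have "(\<Union>i. {g \<in> SL n. row_lattice n g \<in> A i}) \<in> sets (SL_borel n)"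
    using A by (intro sets.countable_UN) auto
  ultimately show "(\<Union>i. A i) \<in> ?S" using A by auto
qed

lemma space_lattice_space [simp]: "space (lattice_space n) = latt n"
  by (auto simp: lattice_space_def latt_def intro!: space_measure_of)

lemma sets_lattice_space:
  "sets (lattice_space n) = {A. A \<subseteq> latt n \<and> {g \<in> SL n. row_lattice n g \<in> A} \<in> sets (SL_borel n)}"
  unfolding lattice_space_def latt_def[symmetric]
  by (rule sigma_algebra.sets_measure_of_eq[OF row_lattice_measurable_aux])

lemma measurable_row_lattice [measurable]: "row_lattice n \<in> measurable (SL_borel n) (lattice_space n)"
proof (rule measurableI)
  show "x \<in> space (SL_borel n) \<Longrightarrow> row_lattice n x \<in> space (lattice_space n)" for x
    by (auto simp: latt_def)
  show "A \<in> sets (lattice_space n) \<Longrightarrow> row_lattice n -` A \<inter> space (SL_borel n) \<in> sets (SL_borel n)" for A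
    by (auto simp: sets_lattice_space Int_def vimage_def conj_commute)
qed

text \<open>The universal property of the final sigma-algebra. Measurability on the space of
  lattices is always checked by pulling back to \<open>SL n\<close>.\<close>

lemma measurable_lattice_spaceI:
  assumes "(\<lambda>g. f (row_lattice n g)) \<in> measurable (SL_borel n) N"
  shows "f \<in> measurable (lattice_space n) N"
proof (rule measurableI)
  show "x \<in> space (lattice_space n) \<Longrightarrow> f x \<in> space N" for x
    using measurable_space[OF assms] by (auto simp: latt_def)
  fix A assume "A \<in> sets N"
  from measurable_sets[OF assms this]
  have "{g \<in> SL n. f (row_lattice n g) \<in> A} \<in> sets (SL_borel n)"
    by (simp add: Int_def vimage_def conj_commute)
  moreover have "{g \<in> SL n. row_lattice n g \<in> f -` A \<inter> latt n} = {g \<in> SL n. f (row_lattice n g) \<in> A}"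
    by (auto simp: latt_def)
  ultimately show "f -` A \<inter> space (lattice_space n) \<in> sets (lattice_space n)"
    by (simp add: sets_lattice_space)
qed

section \<open>Lifting a measure from the space of lattices to SL(n)\<close>

lemma nn_integral_ind:
  fixes f :: "'a \<Rightarrow> ennreal"
  shows "(\<integral>\<^sup>+x. f x \<partial>count_space A) = (\<integral>\<^sup>+x. f x * indicator A x \<partial>count_space UNIV)"
  by (subst nn_integral_restrict_space[symmetric]) (auto simp: restrict_count_space)

lemma nn_integral_count_space_mono:
  fixes f :: "'a \<Rightarrow> ennreal"
  assumes "A \<subseteq> B"
  shows "(\<integral>\<^sup>+x. f x \<partial>count_space A) \<le> (\<integral>\<^sup>+x. f x \<partial>count_space B)"
proof -
  have "(\<integral>\<^sup>+x. f x \<partial>count_space A) = (\<integral>\<^sup>+x. f x * indicator A x \<partial>count_space UNIV)"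
    by (rule nn_integral_ind)
  also have "\<dots> \<le> (\<integral>\<^sup>+x. f x * indicator B x \<partial>count_space UNIV)"
    using assms by (intro nn_integral_mono) (auto split: split_indicator)
  also have "\<dots> = (\<integral>\<^sup>+x. f x \<partial>count_space B)"
    by (rule nn_integral_ind[symmetric])
  finally show ?thesis .
qed

lemma nn_integral_count_space_Un_le:
  fixes f :: "'a \<Rightarrow> ennreal"
  shows "(\<integral>\<^sup>+x. f x \<partial>count_space (A \<union> B)) \<le> (\<integral>\<^sup>+x. f x \<partial>count_space A) + (\<integral>\<^sup>+x. f x \<partial>count_space B)"
  unfolding nn_integral_ind[of A] nn_integral_ind[of B] nn_integral_ind[of "A \<union> B"]
  by (subst nn_integral_add[symmetric]) (auto intro!: nn_integral_mono split: split_indicator)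

lemma countable_SLZ: "countable (SLZ n)"
proof -
  let ?F = "\<lambda>f :: nat \<times> nat \<Rightarrow> int. mat n n (\<lambda>ij. real_of_int (f ij))"
  have "SLZ n \<subseteq> ?F ` (PiE ({..<n} \<times> {..<n}) (\<lambda>_. UNIV))"
  proof
    fix A assume A: "A \<in> SLZ n"
    let ?f = "\<lambda>ij\<in>{..<n} \<times> {..<n}. \<lfloor>index_mat A ij\<rfloor>"
    have "A = ?F ?f"
      using A by (intro eq_matI) (auto simp: SLZ_def SL_def)
    moreover have "?f \<in> PiE ({..<n} \<times> {..<n}) (\<lambda>_. UNIV)" by auto
    ultimately show "A \<in> ?F ` (PiE ({..<n} \<times> {..<n}) (\<lambda>_. UNIV))" by (rule image_eqI)
  qed
  moreover have "countable (?F ` (PiE ({..<n} \<times> {..<n}) (\<lambda>_. UNIV)))"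
    by (intro countable_image countable_PiE) auto
  ultimately show ?thesis by (rule countable_subset)
qed

text \<open>Unfolding: a function on the group becomes a function on lattices by summation over all
  bases of determinant one, a coset of \<open>SLZ n\<close>.\<close>

definition lsum :: "nat \<Rightarrow> (real mat \<Rightarrow> ennreal) \<Rightarrow> real vec set \<Rightarrow> ennreal" where
  "lsum n f L = (\<integral>\<^sup>+h. f h \<partial>count_space (fib n L))"

lemma lsum_row_lattice:
  "g \<in> SL n \<Longrightarrow> lsum n f (row_lattice n g) = (\<integral>\<^sup>+A. f (A * g) \<partial>count_space (SLZ n))"
  unfolding lsum_def by (rule nn_integral_bij_count_space[symmetric, OF bij_betw_fib])

lemma lsum_cong:
  "(\<And>g. g \<in> SL n \<Longrightarrow> f g = f' g) \<Longrightarrow> lsum n f L = lsum n f' L"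
  unfolding lsum_def by (intro nn_integral_cong) (auto simp: fib_def)

lemma measurable_SL_left: "a \<in> SL n \<Longrightarrow> (\<lambda>g. a * g) \<in> measurable (SL_borel n) (SL_borel n)"
  by (rule measurable_SL_mult) auto

lemma measurable_SL_right: "a \<in> SL n \<Longrightarrow> (\<lambda>g. g * a) \<in> measurable (SL_borel n) (SL_borel n)"
  by (rule measurable_SL_mult) auto

lemma measurable_lsum [measurable]:
  assumes f: "f \<in> borel_measurable (SL_borel n)"
  shows "lsum n f \<in> borel_measurable (lattice_space n)"
proof (rule measurable_lattice_spaceI)
  interpret sigma_finite_measure "count_space (SLZ n)"
    by (rule sigma_finite_measure_count_space_countable[OF countable_SLZ])
  have "(\<lambda>(A, g). f (A * g)) \<in> borel_measurable (count_space (SLZ n) \<Otimes>\<^sub>M SL_borel n)"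
    using measurable_compose[OF measurable_SL_left f]
    by (intro measurable_pair_measure_countable1 countable_SLZ) (auto dest: SLZ_SL)
  from measurable_pair_swap[OF this]
  have "(\<lambda>g. \<integral>\<^sup>+A. f (A * g) \<partial>count_space (SLZ n)) \<in> borel_measurable (SL_borel n)"
    by (intro borel_measurable_nn_integral) (simp add: case_prod_beta)
  then show "(\<lambda>g. lsum n f (row_lattice n g)) \<in> borel_measurable (SL_borel n)"
    by (rule measurable_cong[THEN iffD1, rotated]) (simp add: lsum_row_lattice)
qed

text \<open>The measure on the group that corresponds to \<open>M\<close> under unfolding, with
  counting measure along the fibres. For an invariant \<open>M\<close> it is a Haar measure on
  \<open>SL n\<close>.\<close>

definition lift :: "nat \<Rightarrow> real vec set measure \<Rightarrow> real mat measure" where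
  "lift n M = measure_of (SL n) (sets (SL_borel n)) (\<lambda>A. \<integral>\<^sup>+L. lsum n (indicator A) L \<partial>M)"

lemma sets_lift [measurable_cong, simp]: "sets (lift n M) = sets (SL_borel n)"
  unfolding lift_def
  using sets.sigma_sets_eq[of "SL_borel n"] sets.space_closed[of "SL_borel n"] by simp

lemma space_lift [simp]: "space (lift n M) = SL n"
  unfolding lift_def using sets.space_closed[of "SL_borel n"] by (simp add: space_measure_of)

lemma emeasure_lift:
  assumes M[measurable_cong]: "sets M = sets (lattice_space n)" and A: "A \<in> sets (SL_borel n)"
  shows "emeasure (lift n M) A = (\<integral>\<^sup>+L. lsum n (indicator A) L \<partial>M)"
proof (rule emeasure_measure_of[OF lift_def])
  show "sets (SL_borel n) \<subseteq> Pow (SL n)" using sets.space_closed[of "SL_borel n"] by simp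
  show "A \<in> sets (lift n M)" using A by simp
  show "positive (sets (lift n M)) (\<lambda>A. \<integral>\<^sup>+L. lsum n (indicator A) L \<partial>M)"
    by (simp add: positive_def lsum_def)
  show "countably_additive (sets (lift n M)) (\<lambda>A. \<integral>\<^sup>+L. lsum n (indicator A) L \<partial>M)"
    unfolding countably_additive_def
  proof (intro allI impI)
    fix A :: "nat \<Rightarrow> real mat set"
    assume A: "range A \<subseteq> sets (lift n M)" "disjoint_family A" "\<Union> (range A) \<in> sets (lift n M)"
    then have [measurable]: "A i \<in> sets (SL_borel n)" for i by auto
    have "(\<Sum>i. \<integral>\<^sup>+L. lsum n (indicator (A i)) L \<partial>M) = (\<integral>\<^sup>+L. (\<Sum>i. lsum n (indicator (A i)) L) \<partial>M)"
      by (rule nn_integral_suminf[symmetric]) measurable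
    also have "\<dots> = (\<integral>\<^sup>+L. lsum n (indicator (\<Union> (range A))) L \<partial>M)"
      unfolding lsum_def by (subst nn_integral_suminf[symmetric]) (auto simp: suminf_indicator[OF A(2)])
    finally show "(\<Sum>i. \<integral>\<^sup>+L. lsum n (indicator (A i)) L \<partial>M) = (\<integral>\<^sup>+L. lsum n (indicator (\<Union> (range A))) L \<partial>M)" .
  qed
qed

lemma nn_integral_lift:
  assumes M[measurable_cong]: "sets M = sets (lattice_space n)"
    and f: "f \<in> borel_measurable (SL_borel n)"
  shows "(\<integral>\<^sup>+g. f g \<partial>lift n M) = (\<integral>\<^sup>+L. lsum n f L \<partial>M)"
proof -
  have "f \<in> borel_measurable (lift n M)"
    using f by (simp cong: measurable_cong_sets)
  then show ?thesis
  proof induct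
    case (cong f g)
    have "lsum n f = lsum n g" using cong(3) by (intro ext lsum_cong) simp
    then show ?case using cong by (simp cong: nn_integral_cong_simp)
  next
    case (set A)
    then show ?case by (simp add: emeasure_lift[OF M])
  next
    case (mult u c)
    then have [measurable]: "u \<in> borel_measurable (SL_borel n)" by (simp cong: measurable_cong_sets)
    from mult show ?case
      by (simp add: nn_integral_cmult lsum_def[of n "\<lambda>x. c * u x"] lsum_def[of n u, symmetric])
  next
    case (add u v)
    then have [measurable]: "u \<in> borel_measurable (SL_borel n)" "v \<in> borel_measurable (SL_borel n)"
      by (simp_all cong: measurable_cong_sets)
    from add show ?case
      by (simp add: nn_integral_add lsum_def[of n "\<lambda>x. v x + u x"] lsum_def[of n u, symmetric] lsum_def[of n v, symmetric])
  next
    case (seq U)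
    then have [measurable]: "U i \<in> borel_measurable (SL_borel n)" for i by (simp cong: measurable_cong_sets)
    have inc: "incseq (\<lambda>i. lsum n (U i))"
      using seq(4) unfolding lsum_def
      by (auto simp: incseq_def le_fun_def intro!: nn_integral_mono)
    have "(\<integral>\<^sup>+g. (\<Squnion> (range U)) g \<partial>lift n M) = (\<integral>\<^sup>+g. (SUP i. U i g) \<partial>lift n M)"
      by (simp add: image_comp SUP_apply)
    also have "\<dots> = (SUP i. \<integral>\<^sup>+g. U i g \<partial>lift n M)"
      using seq by (intro nn_integral_monotone_convergence_SUP) auto
    also have "\<dots> = (SUP i. \<integral>\<^sup>+L. lsum n (U i) L \<partial>M)" using seq by simp
    also have "\<dots> = (\<integral>\<^sup>+L. (SUP i. lsum n (U i) L) \<partial>M)"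
      using inc by (intro nn_integral_monotone_convergence_SUP[symmetric]) auto
    also have "\<dots> = (\<integral>\<^sup>+L. lsum n (\<lambda>g. SUP i. U i g) L \<partial>M)"
      unfolding lsum_def using seq(4)
      by (subst nn_integral_monotone_convergence_SUP) auto
    finally show ?case by (simp add: image_comp SUP_apply)
  qed
qed

section \<open>A weight function\<close>

definition nrm :: "nat \<Rightarrow> real mat \<Rightarrow> real" where
  "nrm n g = (\<Sum>i<n. \<Sum>j<n. \<bar>index_mat g (i, j)\<bar>)"

lemma nrm_nonneg: "0 \<le> nrm n g"
  by (simp add: nrm_def sum_nonneg)

lemma entry_le_nrm: "i < n \<Longrightarrow> j < n \<Longrightarrow> \<bar>index_mat g (i, j)\<bar> \<le> nrm n g"
proof -
  assume ij: "i < n" "j < n"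
  have "\<bar>index_mat g (i, j)\<bar> \<le> (\<Sum>j<n. \<bar>index_mat g (i, j)\<bar>)"
    using ij by (intro member_le_sum) auto
  also have "\<dots> \<le> nrm n g"
    unfolding nrm_def using ij by (intro member_le_sum[of i _ "\<lambda>i. \<Sum>j<n. \<bar>index_mat g (i, j)\<bar>"]) (auto simp: sum_nonneg)
  finally show ?thesis .
qed

lemma nrm_mult:
  assumes "a \<in> carrier_mat n n" "b \<in> carrier_mat n n"
  shows "nrm n (a * b) \<le> nrm n a * nrm n b"
proof -
  have "nrm n (a * b) \<le> (\<Sum>i<n. \<Sum>j<n. \<Sum>k<n. \<bar>index_mat a (i, k)\<bar> * \<bar>index_mat b (k, j)\<bar>)"
    unfolding nrm_def
  proof (intro sum_mono)
    fix i j assume "i \<in> {..<n}" "j \<in> {..<n}"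
    then have "index_mat (a * b) (i, j) = (\<Sum>k<n. index_mat a (i, k) * index_mat b (k, j))"
      using assms by (simp add: scalar_prod_def lessThan_atLeast0)
    then show "\<bar>index_mat (a * b) (i, j)\<bar> \<le> (\<Sum>k<n. \<bar>index_mat a (i, k)\<bar> * \<bar>index_mat b (k, j)\<bar>)"
      by (auto simp: abs_mult[symmetric] intro: sum_abs)
  qed
  also have "\<dots> = (\<Sum>i<n. \<Sum>k<n. \<bar>index_mat a (i, k)\<bar> * (\<Sum>j<n. \<bar>index_mat b (k, j)\<bar>))"
    by (rule sum.cong[OF refl], subst sum.swap, simp add: sum_distrib_left)
  also have "\<dots> \<le> (\<Sum>i<n. \<Sum>k<n. \<bar>index_mat a (i, k)\<bar> * nrm n b)"
  proof (intro sum_mono mult_left_mono)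
    fix k assume "k \<in> {..<n}"
    then show "(\<Sum>j<n. \<bar>index_mat b (k, j)\<bar>) \<le> nrm n b"
      unfolding nrm_def by (intro member_le_sum[of k _ "\<lambda>i. \<Sum>j<n. \<bar>index_mat b (i, j)\<bar>"]) (auto simp: sum_nonneg)
  qed simp
  also have "\<dots> = nrm n a * nrm n b"
    by (simp add: nrm_def[of n a] sum_distrib_right)
  finally show ?thesis .
qed

lemma abs_det_le:
  assumes "A \<in> carrier_mat m m" "\<And>i j. i < m \<Longrightarrow> j < m \<Longrightarrow> \<bar>index_mat A (i, j)\<bar> \<le> (K :: real)"
  shows "\<bar>det A\<bar> \<le> fact m * K ^ m"
proof -
  have "\<bar>det A\<bar> \<le> (\<Sum>p | p permutes {0..<m}. \<bar>of_int (sign p) * (\<Prod>i = 0..<m. index_mat A (i, p i))\<bar>)"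
    using assms(1) by (simp add: det_def sum_abs)
  also have "\<dots> \<le> (\<Sum>p | p permutes {0..<m}. K ^ m)"
  proof (intro sum_mono)
    fix p assume p: "p \<in> {p. p permutes {0..<m}}"
    have "\<bar>of_int (sign p) * (\<Prod>i = 0..<m. index_mat A (i, p i))\<bar> = (\<Prod>i = 0..<m. \<bar>index_mat A (i, p i)\<bar>)"
      by (simp add: abs_mult abs_prod sign_def)
    also have "\<dots> \<le> (\<Prod>i = 0..<m. K)"
      using p permutes_in_image[of p "{0..<m}"] by (intro prod_mono) (auto intro!: assms)
    finally show "\<bar>of_int (sign p) * (\<Prod>i = 0..<m. index_mat A (i, p i))\<bar> \<le> K ^ m" by simp
  qed
  also have "\<dots> = fact m * K ^ m"
    by (simp add: card_permutations[of "{0..<m}" m])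
  finally show ?thesis .
qed

lemma nrm_adj:
  assumes "g \<in> SL n"
  shows "nrm n (adj_mat g) \<le> real n * real n * fact n * (1 + nrm n g) ^ n"
proof -
  have c: "g \<in> carrier_mat n n" using assms by (rule SL_carrier)
  have "\<bar>index_mat (adj_mat g) (i, j)\<bar> \<le> fact n * (1 + nrm n g) ^ n" if ij: "i < n" "j < n" for i j
  proof -
    have "\<bar>index_mat (adj_mat g) (i, j)\<bar> = \<bar>det (mat_delete g j i)\<bar>"
      using ij c by (simp add: adj_mat_def cofactor_def abs_mult power_abs)
    also have "\<dots> \<le> fact (n - 1) * (1 + nrm n g) ^ (n - 1)"
    proof (rule abs_det_le)
      show "mat_delete g j i \<in> carrier_mat (n - 1) (n - 1)" using c by (simp add: mat_delete_def)
      fix k l assume "k < n - 1" "l < n - 1"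
      then have "\<bar>index_mat (mat_delete g j i) (k, l)\<bar> \<le> nrm n g"
        using c ij by (auto simp: mat_delete_def intro!: entry_le_nrm)
      then show "\<bar>index_mat (mat_delete g j i) (k, l)\<bar> \<le> 1 + nrm n g" by simp
    qed
    also have "\<dots> \<le> fact n * (1 + nrm n g) ^ n"
      using nrm_nonneg[of n g] by (intro mult_mono fact_mono power_increasing) auto
    finally show ?thesis .
  qed
  then have "nrm n (adj_mat g) \<le> (\<Sum>i<n. \<Sum>j<n. fact n * (1 + nrm n g) ^ n)"
    unfolding nrm_def by (intro sum_mono) auto
  then show ?thesis by (simp add: algebra_simps)
qed

lemma measurable_nrm [measurable]: "nrm n \<in> borel_measurable (SL_borel n)"
  unfolding nrm_def by (intro borel_measurable_sum borel_measurable_abs measurable_entry) auto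

text \<open>The exponent is a product: \<open>2 * (n * n)\<close> gives each of the
  \<open>n * n\<close> integer entries a square, so that sums over \<open>SLZ n\<close> converge,
  and \<open>n + 1\<close> pays for the growth of \<open>h * adj_mat g\<close> in
  \<open>lsum_decay_bounded\<close>.\<close>

definition decay :: "nat \<Rightarrow> real mat \<Rightarrow> ennreal" where
  "decay n g = ennreal (1 / (1 + nrm n g) ^ ((n + 1) * (2 * (n * n))))"

lemma measurable_decay [measurable]: "decay n \<in> borel_measurable (SL_borel n)"
  unfolding decay_def by measurable

lemma decay_pos: "0 < decay n g" and decay_finite: "decay n g < \<infinity>"
  using nrm_nonneg[of n g] by (simp_all add: decay_def)

lemma int_inverse_square_sum_finite:
  "(\<integral>\<^sup>+k. ennreal (1 / (1 + \<bar>real_of_int k\<bar>)\<^sup>2) \<partial>count_space UNIV) < \<infinity>"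
proof -
  let ?f = "\<lambda>k. ennreal (1 / (1 + \<bar>real_of_int k\<bar>)\<^sup>2)"
  have nat: "(\<Sum>m. ennreal (1 / (1 + real m)\<^sup>2)) < \<infinity>"
  proof -
    have "summable (\<lambda>m. 1 / (1 + real m)\<^sup>2)"
      using summable_ignore_initial_segment[OF inverse_power_summable[of 2, where 'a = real], of 1]
      by (simp add: field_simps power2_eq_square)
    then show ?thesis using ennreal_suminf_neq_top by (simp add: less_top[symmetric])
  qed
  have 1: "(\<integral>\<^sup>+k. ?f k \<partial>count_space (range int)) = (\<Sum>m. ennreal (1 / (1 + real m)\<^sup>2))"
    by (subst nn_integral_bij_count_space[symmetric, of int UNIV])
       (auto simp: bij_betw_def nn_integral_count_space_nat)
  have 2: "(\<integral>\<^sup>+k. ?f k \<partial>count_space (range (\<lambda>m. - int m))) = (\<Sum>m. ennreal (1 / (1 + real m)\<^sup>2))"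
    by (subst nn_integral_bij_count_space[symmetric, of "\<lambda>m. - int m" UNIV])
       (auto simp: bij_betw_def nn_integral_count_space_nat inj_on_def)
  have "UNIV = range int \<union> range (\<lambda>m. - int m)"
    by (auto simp: image_iff) (metis int_cases2)
  then have "(\<integral>\<^sup>+k. ?f k \<partial>count_space UNIV) \<le> (\<integral>\<^sup>+k. ?f k \<partial>count_space (range int)) + (\<integral>\<^sup>+k. ?f k \<partial>count_space (range (\<lambda>m. - int m)))"
    using nn_integral_count_space_Un_le[of "range int" "range (\<lambda>m. - int m)" ?f] by simp
  also have "\<dots> < \<infinity>" unfolding 1 2 using nat by simp
  finally show ?thesis .
qed

text \<open>Every entry is at most \<open>nrm\<close>, so one factor
  \<open>(1 + nrm)\<^sup>2\<close> can be spent on each entry. The sum over all integer matrices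
  then splits into a product of one-dimensional sums.\<close>

lemma SLZ_decay_sum_finite:
  "(\<integral>\<^sup>+A. ennreal (1 / (1 + nrm n A) ^ (2 * (n * n))) \<partial>count_space (SLZ n)) < \<infinity>"
proof -
  define I where "I = {..<n} \<times> {..<n}"
  let ?F = "\<lambda>f :: nat \<times> nat \<Rightarrow> int. mat n n (\<lambda>ij. real_of_int (f ij))"
  define Z where "Z = {f \<in> PiE I (\<lambda>_. UNIV). ?F f \<in> SLZ n}"
  have bij: "bij_betw ?F Z (SLZ n)"
  proof (rule bij_betwI[where g = "\<lambda>A. \<lambda>ij\<in>I. \<lfloor>index_mat A ij\<rfloor>"])
    show "?F \<in> Z \<rightarrow> SLZ n" by (auto simp: Z_def)
    have eq: "?F (\<lambda>ij\<in>I. \<lfloor>index_mat A ij\<rfloor>) = A" if "A \<in> SLZ n" for A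
      using that by (intro eq_matI) (auto simp: SLZ_def SL_def I_def)
    then show "A \<in> SLZ n \<Longrightarrow> ?F (\<lambda>ij\<in>I. \<lfloor>index_mat A ij\<rfloor>) = A" for A .
    show "(\<lambda>A. \<lambda>ij\<in>I. \<lfloor>index_mat A ij\<rfloor>) \<in> SLZ n \<rightarrow> Z" using eq by (auto simp: Z_def)
    show "(\<lambda>ij\<in>I. \<lfloor>index_mat (?F f) ij\<rfloor>) = f" if "f \<in> Z" for f
      using that by (auto simp: Z_def I_def PiE_iff extensional_def fun_eq_iff)
  qed
  interpret product_sigma_finite "\<lambda>_ :: nat \<times> nat. count_space (UNIV :: int set)"
    by (rule product_sigma_finite.intro) (rule sigma_finite_measure_count_space)
  have fI: "finite I" and cI: "card I = n * n" by (auto simp: I_def)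
  have "(\<integral>\<^sup>+A. ennreal (1 / (1 + nrm n A) ^ (2 * (n * n))) \<partial>count_space (SLZ n))
      = (\<integral>\<^sup>+f. ennreal (1 / (1 + nrm n (?F f)) ^ (2 * (n * n))) \<partial>count_space Z)"
    by (rule nn_integral_bij_count_space[OF bij, symmetric])
  also have "\<dots> \<le> (\<integral>\<^sup>+f. (\<Prod>ij\<in>I. ennreal (1 / (1 + \<bar>real_of_int (f ij)\<bar>)\<^sup>2)) \<partial>count_space Z)"
  proof (rule nn_integral_mono)
    fix f
    have "(\<Prod>ij\<in>I. (1 + \<bar>real_of_int (f ij)\<bar>)\<^sup>2) \<le> (\<Prod>ij\<in>I. (1 + nrm n (?F f))\<^sup>2)"
    proof (intro prod_mono conjI power_mono)
      fix ij assume "ij \<in> I"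
      then show "1 + \<bar>real_of_int (f ij)\<bar> \<le> 1 + nrm n (?F f)"
        using entry_le_nrm[of "fst ij" n "snd ij" "?F f"] by (auto simp: I_def)
    qed auto
    also have "\<dots> = (1 + nrm n (?F f)) ^ (2 * (n * n))" by (simp add: cI power_mult)
    finally have "1 / (1 + nrm n (?F f)) ^ (2 * (n * n)) \<le> 1 / (\<Prod>ij\<in>I. (1 + \<bar>real_of_int (f ij)\<bar>)\<^sup>2)"
      by (intro divide_left_mono mult_pos_pos prod_pos) (auto simp: add_pos_nonneg nrm_nonneg)
    also have "\<dots> = (\<Prod>ij\<in>I. 1 / (1 + \<bar>real_of_int (f ij)\<bar>)\<^sup>2)" by (simp add: prod_dividef)
    finally have "ennreal (1 / (1 + nrm n (?F f)) ^ (2 * (n * n))) \<le> ennreal (\<Prod>ij\<in>I. 1 / (1 + \<bar>real_of_int (f ij)\<bar>)\<^sup>2)"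
      by (rule ennreal_leI)
    then show "ennreal (1 / (1 + nrm n (?F f)) ^ (2 * (n * n))) \<le> (\<Prod>ij\<in>I. ennreal (1 / (1 + \<bar>real_of_int (f ij)\<bar>)\<^sup>2))"
      by (simp add: prod_ennreal)
  qed
  also have "\<dots> \<le> (\<integral>\<^sup>+f. (\<Prod>ij\<in>I. ennreal (1 / (1 + \<bar>real_of_int (f ij)\<bar>)\<^sup>2)) \<partial>count_space (PiE I (\<lambda>_. UNIV)))"
    by (rule nn_integral_count_space_mono) (auto simp: Z_def)
  also have "\<dots> = (\<integral>\<^sup>+f. (\<Prod>ij\<in>I. ennreal (1 / (1 + \<bar>real_of_int (f ij)\<bar>)\<^sup>2)) \<partial>Pi\<^sub>M I (\<lambda>_. count_space UNIV))"
    by (subst count_space_PiM_finite[OF fI]) auto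
  also have "\<dots> = (\<Prod>ij\<in>I. \<integral>\<^sup>+k. ennreal (1 / (1 + \<bar>real_of_int k\<bar>)\<^sup>2) \<partial>count_space UNIV)"
    by (rule product_nn_integral_prod[OF fI]) auto
  also have "\<dots> < \<infinity>"
    using int_inverse_square_sum_finite by (simp add: power_less_top_ennreal)
  finally show ?thesis .
qed

text \<open>This uniform bound takes the place of reduction theory. Summing from an arbitrary base
  point would give a bound depending on \<open>L\<close>; a base point \<open>g\<close> of nearly
  least norm in its fibre is dominated by every other element \<open>h\<close>, and with it
  \<open>adj_mat g\<close>.\<close>

lemma lsum_decay_bounded: "\<exists>C<\<infinity>. \<forall>L\<in>latt n. lsum n (decay n) L \<le> C"
proof -
  define c where "c = real n * real n * fact n * 2 ^ n + 1"
  have c: "c \<ge> 1" by (simp add: c_def)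
  define S where "S = (\<integral>\<^sup>+A. ennreal (1 / (1 + nrm n A) ^ (2 * (n * n))) \<partial>count_space (SLZ n))"
  have "lsum n (decay n) L \<le> ennreal (c ^ (2 * (n * n))) * S" if L: "L \<in> latt n" for L
  proof -
    let ?P = "\<lambda>k. \<exists>h\<in>fib n L. nrm n h \<le> real k"
    from L obtain h' where "h' \<in> fib n L" by (auto simp: latt_def fib_def)
    moreover have "nrm n h' \<le> real (nat \<lceil>nrm n h'\<rceil>)" by linarith
    ultimately have ex: "\<exists>k. ?P k" by blast
    \<comment> \<open>Minimising the norm rounded up to an integer guarantees that a minimiser
      exists. The rounding costs the factor 2 in \<open>gmin\<close>.\<close>
    define k where "k = (LEAST k. ?P k)"
    from LeastI_ex[OF ex] obtain g where g: "g \<in> fib n L" "nrm n g \<le> real k"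
      unfolding k_def by blast
    have gmin: "1 + nrm n g \<le> 2 * (1 + nrm n h)" if "h \<in> fib n L" for h
    proof (rule ccontr)
      assume "\<not> ?thesis"
      then have "2 * (1 + nrm n h) < 1 + real k" using g by linarith
      then have "nrm n h \<le> real (k - 1)" "k - 1 < k" using nrm_nonneg[of n h] by (auto simp: of_nat_diff)
      with that not_less_Least[of "k - 1" ?P] show False unfolding k_def[symmetric] by blast
    qed
    have gS: "g \<in> SL n" and gL: "L = row_lattice n g" using g by (auto simp: fib_def)
    have "lsum n (decay n) L = (\<integral>\<^sup>+A. decay n (A * g) \<partial>count_space (SLZ n))"
      unfolding gL by (rule lsum_row_lattice[OF gS])
    also have "\<dots> \<le> (\<integral>\<^sup>+A. ennreal (c ^ (2 * (n * n))) * ennreal (1 / (1 + nrm n A) ^ (2 * (n * n))) \<partial>count_space (SLZ n))"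
    proof (rule nn_integral_mono)
      fix A assume "A \<in> space (count_space (SLZ n))"
      then have A: "A \<in> SLZ n" by simp
      define h where "h = A * g"
      have hfib: "h \<in> fib n L" using A gS gL
        by (simp add: h_def fib_def SL_mult SLZ_SL row_lattice_mult_SLZ)
      \<comment> \<open>Solving for \<open>A\<close> bounds it by a power of \<open>h\<close> alone:
        \<open>adj_mat g\<close> is polynomial in \<open>g\<close>, and \<open>g\<close> is not
        essentially larger than \<open>h\<close>.\<close>
      have "A = h * adj_mat g" using A gS by (simp add: h_def SL_adj_cancel SLZ_SL)
      then have "nrm n A \<le> nrm n h * nrm n (adj_mat g)"
        using nrm_mult[of h n "adj_mat g"] hfib gS by (simp add: fib_def SL_carrier SL_adj)
      also have "\<dots> \<le> nrm n h * (real n * real n * fact n * (2 * (1 + nrm n h)) ^ n)"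
        using gmin[OF hfib] nrm_nonneg[of n g]
        by (intro mult_left_mono order.trans[OF nrm_adj[OF gS]] power_mono nrm_nonneg) auto
      also have "\<dots> \<le> (1 + nrm n h) * (real n * real n * fact n * (2 * (1 + nrm n h)) ^ n)"
        using nrm_nonneg[of n h] by (intro mult_right_mono) auto
      also have "\<dots> = (c - 1) * (1 + nrm n h) ^ (n + 1)"
        unfolding power_mult_distrib c_def by (simp add: mult_ac)
      finally have "1 + nrm n A \<le> 1 + (c - 1) * (1 + nrm n h) ^ (n + 1)" by simp
      also have "\<dots> \<le> (1 + nrm n h) ^ (n + 1) + (c - 1) * (1 + nrm n h) ^ (n + 1)"
        using nrm_nonneg[of n h] by (intro add_right_mono one_le_power) auto
      finally have "1 + nrm n A \<le> c * (1 + nrm n h) ^ (n + 1)" by (simp add: algebra_simps)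
      then have "(1 + nrm n A) ^ (2 * (n * n)) \<le> (c * (1 + nrm n h) ^ (n + 1)) ^ (2 * (n * n))"
        using nrm_nonneg[of n A] by (intro power_mono) auto
      also have "\<dots> = c ^ (2 * (n * n)) * (1 + nrm n h) ^ ((n + 1) * (2 * (n * n)))"
        by (simp only: power_mult_distrib power_mult[symmetric])
      finally have "1 / (1 + nrm n h) ^ ((n + 1) * (2 * (n * n))) \<le> c ^ (2 * (n * n)) * (1 / (1 + nrm n A) ^ (2 * (n * n)))"
        using nrm_nonneg[of n A] nrm_nonneg[of n h] c by (simp add: divide_simps add_nonneg_eq_0_iff)
      then have "decay n h \<le> ennreal (c ^ (2 * (n * n)) * (1 / (1 + nrm n A) ^ (2 * (n * n))))"
        unfolding decay_def by (rule ennreal_leI)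
      also have "\<dots> = ennreal (c ^ (2 * (n * n))) * ennreal (1 / (1 + nrm n A) ^ (2 * (n * n)))"
        using c nrm_nonneg[of n A] by (intro ennreal_mult) auto
      finally show "decay n (A * g) \<le> ennreal (c ^ (2 * (n * n))) * ennreal (1 / (1 + nrm n A) ^ (2 * (n * n)))"
        by (simp add: h_def)
    qed
    also have "\<dots> = ennreal (c ^ (2 * (n * n))) * S"
      unfolding S_def by (rule nn_integral_cmult) auto
    finally show ?thesis .
  qed
  moreover have "ennreal (c ^ (2 * (n * n))) * S < \<infinity>"
    using SLZ_decay_sum_finite unfolding S_def by (simp add: ennreal_mult_less_top)
  ultimately show ?thesis by blast
qed

text \<open>Left translation by \<open>x\<close> is undone by \<open>adj_mat x\<close>, so it
  shrinks \<open>1 + nrm\<close> by at most a constant factor. This makes \<open>G x\<close> finite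
  for every \<open>x\<close>.\<close>

lemma decay_mult_left:
  assumes "x \<in> SL n" 
  shows "\<exists>C<\<infinity>. \<forall>h\<in>SL n. decay n (x * h) \<le> C * decay n h"
proof -
  define c where "c = 1 + nrm n (adj_mat x)"
  let ?d = "(n + 1) * (2 * (n * n))"
  have c: "c \<ge> 1" using nrm_nonneg by (simp add: c_def)
  have "decay n (x * h) \<le> ennreal (c ^ ?d) * decay n h" if h: "h \<in> SL n" for h
  proof -
    have "nrm n h \<le> nrm n (adj_mat x) * nrm n (x * h)"
      using nrm_mult[of "adj_mat x" n "x * h"] assms h by (simp add: SL_adj_cancel SL_carrier SL_adj SL_mult)
    also have "\<dots> \<le> (c - 1) * (1 + nrm n (x * h))"
      using nrm_nonneg by (auto simp: c_def intro!: mult_left_mono)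
    finally have "1 + nrm n h \<le> c * (1 + nrm n (x * h))"
      using nrm_nonneg[of n "x * h"] by (simp add: algebra_simps)
    then have "(1 + nrm n h) ^ ?d \<le> (c * (1 + nrm n (x * h))) ^ ?d"
      using nrm_nonneg[of n h] by (intro power_mono) auto
    also have "\<dots> = c ^ ?d * (1 + nrm n (x * h)) ^ ?d" by (rule power_mult_distrib)
    finally have "1 / (1 + nrm n (x * h)) ^ ?d \<le> c ^ ?d * (1 / (1 + nrm n h) ^ ?d)"
      using nrm_nonneg[of n h] nrm_nonneg[of n "x * h"] c by (simp add: divide_simps add_nonneg_eq_0_iff del: mult_Suc)
    then have "decay n (x * h) \<le> ennreal (c ^ ?d * (1 / (1 + nrm n h) ^ ?d))"
      unfolding decay_def by (rule ennreal_leI)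
    also have "\<dots> = ennreal (c ^ ?d) * decay n h"
      unfolding decay_def using c nrm_nonneg[of n h] by (intro ennreal_mult) auto
    finally show ?thesis .
  qed
  then show ?thesis by (intro exI[of _ "ennreal (c ^ ?d)"]) simp
qed

section \<open>Invariance of the lifted measure, uniqueness of Haar measure and the modular
  function\<close>

locale inv_lattice = prob_space \<mu> for \<mu> :: "real vec set measure" +
  fixes n :: nat
  assumes inv: "invariant_lattice_prob n \<mu>" and n_pos: "0 < n"
begin

lemma sets_mu [measurable_cong]: "sets \<mu> = sets (lattice_space n)"
  using inv by (simp add: invariant_lattice_prob_def)

lemma space_mu: "space \<mu> = latt n"
  using sets_eq_imp_space_eq[OF sets_mu] by simp

abbreviation m :: "real mat measure" where "m \<equiv> lift n \<mu>"

lemma measurable_m_iff: "f \<in> borel_measurable m \<longleftrightarrow> f \<in> borel_measurable (SL_borel n)"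
  by (simp cong: measurable_cong_sets)

lemmas nn_integral_m = nn_integral_lift[OF sets_mu]

lemma lattice_act_cancel:
  assumes "h \<in> SL n" "L \<in> latt n"
  shows "lattice_act h L \<in> latt n" "lattice_act (adj_mat h) (lattice_act h L) = L"
    "lattice_act h (lattice_act (adj_mat h) L) = L"
proof -
  from assms(2) obtain g where g: "g \<in> SL n" "L = row_lattice n g" by (auto simp: latt_def)
  with assms(1) show "lattice_act h L \<in> latt n"
    by (auto simp: latt_def lattice_act_row_lattice SL_mult)
  from g assms(1) show "lattice_act (adj_mat h) (lattice_act h L) = L"
    by (simp add: lattice_act_row_lattice SL_mult SL_adj SL_adj_cancel)
  from g assms(1) show "lattice_act h (lattice_act (adj_mat h) L) = L"
    by (simp add: lattice_act_row_lattice SL_mult SL_adj SL_adj_cancel)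
qed

lemma measurable_lattice_act:
  assumes "h \<in> SL n"
  shows "lattice_act h \<in> measurable (lattice_space n) (lattice_space n)"
proof (rule measurable_lattice_spaceI)
  have "(\<lambda>g. row_lattice n (g * h)) \<in> measurable (SL_borel n) (lattice_space n)"
    by (rule measurable_compose[OF measurable_SL_right[OF assms] measurable_row_lattice])
  then show "(\<lambda>g. lattice_act h (row_lattice n g)) \<in> measurable (SL_borel n) (lattice_space n)"
    by (rule measurable_cong[THEN iffD1, rotated]) (simp add: lattice_act_row_lattice assms)
qed

lemma distr_lattice_act:
  assumes h: "h \<in> SL n"
  shows "distr \<mu> \<mu> (lattice_act h) = \<mu>"
proof (rule measure_eqI)
  fix A assume "A \<in> sets (distr \<mu> \<mu> (lattice_act h))"
  then have A: "A \<in> sets \<mu>" by simp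
  then have A': "A \<subseteq> latt n" using sets.sets_into_space[OF A] space_mu by simp
  have meas: "lattice_act h \<in> measurable \<mu> \<mu>"
    using measurable_lattice_act[OF h] by (simp cong: measurable_cong_sets add: sets_mu)
  have "lattice_act h -` A \<inter> space \<mu> = lattice_act (adj_mat h) ` A"
  proof (intro subset_antisym subsetI)
    fix L assume "L \<in> lattice_act h -` A \<inter> space \<mu>"
    then show "L \<in> lattice_act (adj_mat h) ` A"
      using lattice_act_cancel(2)[OF h] by (auto simp: space_mu intro!: image_eqI[of _ _ "lattice_act h L"])
  next
    fix L assume "L \<in> lattice_act (adj_mat h) ` A"
    then show "L \<in> lattice_act h -` A \<inter> space \<mu>"
      using A' lattice_act_cancel(3)[OF h] lattice_act_cancel(1)[OF SL_adj(1)[OF h]]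
      by (auto simp: space_mu subset_iff)
  qed
  then have "emeasure (distr \<mu> \<mu> (lattice_act h)) A = emeasure \<mu> (lattice_act (adj_mat h) ` A)"
    using A meas by (simp add: emeasure_distr)
  also have "\<dots> = emeasure \<mu> A"
    using inv A SL_adj(1)[OF h] by (auto simp: invariant_lattice_prob_def)
  finally show "emeasure (distr \<mu> \<mu> (lattice_act h)) A = emeasure \<mu> A" .
qed simp

text \<open>Right translation by \<open>y\<close> maps the fibre over \<open>L\<close> onto the
  fibre over \<open>lattice_act y L\<close>, so the claim is the invariance of
  \<open>\<mu>\<close>.\<close>

lemma m_right:
  assumes f: "f \<in> borel_measurable (SL_borel n)" and y: "y \<in> SL n"
  shows "(\<integral>\<^sup>+x. f (x * y) \<partial>m) = (\<integral>\<^sup>+x. f x \<partial>m)"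
proof -
  have eq: "lsum n (\<lambda>x. f (x * y)) L = lsum n f (lattice_act y L)" if "L \<in> latt n" for L
    unfolding lsum_def
  proof (rule nn_integral_bij_count_space, rule bij_betwI[where g = "\<lambda>x. x * adj_mat y"])
    show "(\<lambda>x. x * y) \<in> fib n L \<rightarrow> fib n (lattice_act y L)"
      using y by (auto simp: fib_def SL_mult lattice_act_row_lattice)
    show "(\<lambda>x. x * adj_mat y) \<in> fib n (lattice_act y L) \<rightarrow> fib n L"
      using y lattice_act_cancel(2)[OF y that] 
      by (auto simp: fib_def SL_mult SL_adj lattice_act_row_lattice[symmetric])
  qed (use y in \<open>auto simp: fib_def SL_adj_cancel\<close>)
  have meas: "lattice_act y \<in> measurable \<mu> \<mu>"
    using measurable_lattice_act[OF y] by (simp cong: measurable_cong_sets add: sets_mu)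
  have "(\<integral>\<^sup>+x. f (x * y) \<partial>m) = (\<integral>\<^sup>+L. lsum n (\<lambda>x. f (x * y)) L \<partial>\<mu>)"
    by (rule nn_integral_m) (rule measurable_compose[OF measurable_SL_right[OF y] f])
  also have "\<dots> = (\<integral>\<^sup>+L. lsum n f (lattice_act y L) \<partial>\<mu>)"
    by (intro nn_integral_cong) (simp add: space_mu eq)
  also have "\<dots> = (\<integral>\<^sup>+L. lsum n f L \<partial>distr \<mu> \<mu> (lattice_act y))"
    using f by (subst nn_integral_distr[OF meas]) (auto cong: measurable_cong_sets simp: sets_mu)
  also have "\<dots> = (\<integral>\<^sup>+x. f x \<partial>m)"
    by (simp add: distr_lattice_act[OF y] nn_integral_m[OF f])
  finally show ?thesis .
qed

text \<open>Left translation by an integral matrix permutes each fibre.\<close>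

lemma m_left_SLZ:
  assumes f: "f \<in> borel_measurable (SL_borel n)" and y: "y \<in> SLZ n"
  shows "(\<integral>\<^sup>+x. f (y * x) \<partial>m) = (\<integral>\<^sup>+x. f x \<partial>m)"
proof -
  have yS: "y \<in> SL n" using y by (rule SLZ_SL)
  have eq: "lsum n (\<lambda>x. f (y * x)) L = lsum n f L" for L
    unfolding lsum_def
  proof (rule nn_integral_bij_count_space, rule bij_betwI[where g = "\<lambda>x. adj_mat y * x"])
    show "(\<lambda>x. y * x) \<in> fib n L \<rightarrow> fib n L"
      using y yS by (auto simp: fib_def SL_mult row_lattice_mult_SLZ)
    show "(\<lambda>x. adj_mat y * x) \<in> fib n L \<rightarrow> fib n L"
      using y yS by (auto simp: fib_def SL_mult SL_adj SLZ_adj row_lattice_mult_SLZ)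
  qed (use yS in \<open>auto simp: fib_def SL_adj_cancel\<close>)
  show ?thesis
    using f measurable_compose[OF measurable_SL_left[OF yS] f] by (simp add: nn_integral_m eq)
qed

text \<open>A partition of unity along the fibres: strictly positive with fibre sums 1. It serves
  instead of a fundamental domain when an integral over lattices is rewritten as one over the
  group.\<close>

definition wt :: "real mat \<Rightarrow> ennreal" where
  "wt g = decay n g / lsum n (decay n) (row_lattice n g)"

lemma lsum_decay: 
  assumes "L \<in> latt n"
  shows "0 < lsum n (decay n) L" "lsum n (decay n) L < \<infinity>"
proof -
  from assms obtain h where h: "h \<in> fib n L" by (auto simp: latt_def fib_def)
  have "decay n h \<le> lsum n (decay n) L" unfolding lsum_def by (rule nn_integral_ge_point[OF h])
  then show "0 < lsum n (decay n) L" using decay_pos[of n h] by (rule order.strict_trans2[rotated])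
  show "lsum n (decay n) L < \<infinity>"
    using lsum_decay_bounded[of n] assms by (auto intro: order.strict_trans1)
qed

lemma lsum_wt:
  assumes "L \<in> latt n"
  shows "lsum n wt L = 1"
proof -
  have "lsum n wt L = (\<integral>\<^sup>+h. decay n h / lsum n (decay n) L \<partial>count_space (fib n L))"
    unfolding lsum_def[of n wt] by (intro nn_integral_cong) (auto simp: wt_def fib_def)
  also have "\<dots> = lsum n (decay n) L / lsum n (decay n) L"
    by (simp add: nn_integral_divide lsum_def)
  also have "\<dots> = 1"
    using lsum_decay[OF assms] by (intro ennreal_divide_self) auto
  finally show ?thesis .
qed

lemma measurable_wt [measurable]: "wt \<in> borel_measurable (SL_borel n)"
  unfolding wt_def
  by (intro borel_measurable_divide_ennreal measurable_decay measurable_compose[OF measurable_row_lattice measurable_lsum])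

lemma wt_pos: "g \<in> SL n \<Longrightarrow> 0 < wt g"
  using lsum_decay[of "row_lattice n g"] decay_pos[of n g]
  by (auto simp: wt_def latt_def ennreal_zero_less_divide)

lemma wt_finite: "g \<in> SL n \<Longrightarrow> wt g < \<infinity>"
  using lsum_decay[of "row_lattice n g"] decay_finite[of n g]
  by (auto simp: wt_def latt_def ennreal_divide_eq_top_iff less_top[symmetric])

lemma nn_integral_wt_lattice:
  assumes F[measurable]: "F \<in> borel_measurable (lattice_space n)"
  shows "(\<integral>\<^sup>+g. wt g * F (row_lattice n g) \<partial>m) = (\<integral>\<^sup>+L. F L \<partial>\<mu>)"
proof -
  have "lsum n (\<lambda>g. wt g * F (row_lattice n g)) L = F L" if "L \<in> latt n" for L
  proof -
    have "lsum n (\<lambda>g. wt g * F (row_lattice n g)) L = (\<integral>\<^sup>+g. wt g * F L \<partial>count_space (fib n L))"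
      unfolding lsum_def by (intro nn_integral_cong) (simp add: fib_def)
    also have "\<dots> = lsum n wt L * F L" unfolding lsum_def by (rule nn_integral_multc) auto
    finally show ?thesis by (simp add: lsum_wt[OF that])
  qed
  then show ?thesis
    by (subst nn_integral_m) (auto intro!: nn_integral_cong simp: space_mu)
qed

lemma nn_integral_wt: "(\<integral>\<^sup>+g. wt g \<partial>m) = 1"
  using nn_integral_wt_lattice[of "\<lambda>_. 1"] by (simp add: emeasure_space_1)

text \<open>\<open>wt\<close> is strictly positive and has integral 1, so the sets on which it is at
  least \<open>1 / k\<close> have finite measure and exhaust the group. Fubini for \<open>m\<close>
  depends on this.\<close>

lemma sigma_finite_m: "sigma_finite_measure m"
proof
  let ?A = "\<lambda>k :: nat. {g \<in> SL n. 1 \<le> of_nat k * wt g}"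
  have [measurable]: "?A k \<in> sets (SL_borel n)" for k
  proof -
    have "{g \<in> space (SL_borel n). 1 \<le> of_nat k * wt g} \<in> sets (SL_borel n)" by measurable
    then show ?thesis by simp
  qed
  have "emeasure m (?A k) \<noteq> \<infinity>" for k
  proof -
    have "emeasure m (?A k) = (\<integral>\<^sup>+g. indicator (?A k) g \<partial>m)" by simp
    also have "\<dots> \<le> (\<integral>\<^sup>+g. of_nat k * wt g \<partial>m)"
      by (intro nn_integral_mono) (auto split: split_indicator)
    also have "\<dots> = of_nat k * 1"
      by (subst nn_integral_cmult) (simp_all add: measurable_m_iff nn_integral_wt)
    finally show ?thesis by (auto simp: top_unique)
  qed
  moreover have "(\<Union>k. ?A k) = space m"
  proof (intro subset_antisym subsetI)
    fix g assume g0: "g \<in> space m"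
    from g0 have g: "g \<in> SL n" by simp
    obtain r where r: "wt g = ennreal r" "0 < r"
      using wt_pos[OF g] wt_finite[OF g] by (cases "wt g") auto
    from reals_Archimedean3[OF r(2)] obtain k where "1 < real k * r" by blast
    then have "ennreal 1 \<le> ennreal (real k * r)" by (intro ennreal_leI) simp
    then have "1 \<le> of_nat k * wt g" using r by (simp add: ennreal_mult ennreal_of_nat_eq_real_of_nat)
    with g show "g \<in> (\<Union>k. ?A k)" by auto
  qed auto
  ultimately show "\<exists>A. countable A \<and> A \<subseteq> sets m \<and> \<Union> A = space m \<and> (\<forall>a\<in>A. emeasure m a \<noteq> \<infinity>)"
    by (intro exI[of _ "range ?A"]) auto
qed

sublocale sigma_finite_measure m by (rule sigma_finite_m)
sublocale P: pair_sigma_finite m m by unfold_locales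

text \<open>Being finite and strictly positive, \<open>decay n (x * t) / G x\<close> is a density in
  \<open>t\<close> for each \<open>x\<close>; it is the auxiliary factor in the Haar uniqueness
  argument. Up to normalisation \<open>G\<close> turns out to be the modular function.\<close>

definition G :: "real mat \<Rightarrow> ennreal" where
  "G x = (\<integral>\<^sup>+t. decay n (x * t) \<partial>m)"

lemma measurable_mult2: "(\<lambda>(x, y). x * y) \<in> measurable (m \<Otimes>\<^sub>M m) (SL_borel n)"
proof -
  have "fst \<in> measurable (m \<Otimes>\<^sub>M m) (SL_borel n)" "snd \<in> measurable (m \<Otimes>\<^sub>M m) (SL_borel n)"
    using measurable_fst[of m m] measurable_snd[of m m] by (simp_all cong: measurable_cong_sets)
  from measurable_SL_mult[OF this] show ?thesis by (simp add: case_prod_beta)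
qed

lemma measurable_G [measurable]: "G \<in> borel_measurable (SL_borel n)"
proof -
  have "(\<lambda>x. \<integral>\<^sup>+t. decay n (x * t) \<partial>m) \<in> borel_measurable m"
    using measurable_compose[OF measurable_mult2 measurable_decay]
    by (intro borel_measurable_nn_integral) (simp add: case_prod_beta)
  then show ?thesis unfolding G_def measurable_m_iff .
qed

lemma measurable_decay_left: "x \<in> SL n \<Longrightarrow> (\<lambda>t. decay n (x * t)) \<in> borel_measurable (SL_borel n)"
  by (rule measurable_compose[OF measurable_SL_left measurable_decay])

lemma G_finite: 
  assumes "x \<in> SL n"
  shows "G x < \<infinity>"
proof -
  obtain C where C: "C < \<infinity>" "\<And>h. h \<in> SL n \<Longrightarrow> decay n (x * h) \<le> C * decay n h"
    using decay_mult_left[OF assms] by blast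
  obtain C' where C': "C' < \<infinity>" "\<And>L. L \<in> latt n \<Longrightarrow> lsum n (decay n) L \<le> C'"
    using lsum_decay_bounded[of n] by blast
  have "G x \<le> (\<integral>\<^sup>+t. C * decay n t \<partial>m)"
    unfolding G_def by (intro nn_integral_mono) (auto intro: C)
  also have "\<dots> = C * (\<integral>\<^sup>+t. decay n t \<partial>m)"
    by (rule nn_integral_cmult) (simp add: measurable_m_iff)
  also have "(\<integral>\<^sup>+t. decay n t \<partial>m) \<le> (\<integral>\<^sup>+L. C' \<partial>\<mu>)"
    unfolding nn_integral_m[OF measurable_decay] by (rule nn_integral_mono) (auto intro: C' simp: space_mu)
  also have "(\<integral>\<^sup>+L. C' \<partial>\<mu>) = C'" by (simp add: emeasure_space_1)
  finally have "G x \<le> C * C'" by (simp add: mult_left_mono)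
  also have "\<dots> < \<infinity>" using C C' by (simp add: ennreal_mult_less_top)
  finally show ?thesis .
qed

lemma G_pos:
  assumes "x \<in> SL n"
  shows "0 < G x"
proof (rule ccontr)
  assume "\<not> 0 < G x"
  then have "(\<integral>\<^sup>+t. decay n (x * t) \<partial>m) = 0" by (simp add: G_def)
  then have "AE t in m. decay n (x * t) = 0"
    using measurable_decay_left[OF assms] by (subst (asm) nn_integral_0_iff_AE) (auto simp: measurable_m_iff)
  then have "AE t in m. wt t = 0"
    by eventually_elim (use decay_pos in \<open>simp add: less_le\<close>)
  then have "(\<integral>\<^sup>+g. wt g \<partial>m) = 0"
    by (subst nn_integral_0_iff_AE) (auto simp: measurable_m_iff)
  then show False by (simp add: nn_integral_wt)
qed

text \<open>Up to a factor, a right invariant measure is determined by the functional on the right, which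
  does not depend on \<open>a\<close>: uniqueness of Haar measure, applied to the left translates of \<open>m\<close>.\<close>

lemma m_left_translate:
  assumes f[measurable]: "f \<in> borel_measurable (SL_borel n)" and a: "a \<in> SL n"
  shows "(\<integral>\<^sup>+x. f (a * x) \<partial>m) = G a * (\<integral>\<^sup>+y. f (adj_mat y) / G (adj_mat y) \<partial>m)"
proof -
  define q where "q x = f x / G x" for x
  have q[measurable]: "q \<in> borel_measurable (SL_borel n)"
    unfolding q_def by (intro borel_measurable_divide_ennreal f measurable_G)
  have [measurable]: "fst \<in> measurable (m \<Otimes>\<^sub>M m) (SL_borel n)" "snd \<in> measurable (m \<Otimes>\<^sub>M m) (SL_borel n)"
    using measurable_fst[of m m] measurable_snd[of m m] by (simp_all cong: measurable_cong_sets)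
  have am: "(\<lambda>z. a * fst z) \<in> measurable (m \<Otimes>\<^sub>M m) (SL_borel n)"
    by (rule measurable_SL_mult) (use a in auto)
  have adm: "(\<lambda>z. adj_mat (snd z)) \<in> measurable (m \<Otimes>\<^sub>M m) (SL_borel n)"
    by (rule measurable_compose[OF _ measurable_adj_mat]) measurable
  \<comment> \<open>Integrating \<open>H\<close> over \<open>y\<close> gives
    \<open>f (a * x)\<close>, because the factor \<open>1 / G\<close> in \<open>q\<close> is
    compensated. The substitution of \<open>x * adj_mat y\<close> for \<open>x\<close> turns
    \<open>H\<close> into \<open>K\<close>; the substitution of \<open>y * (a * x)\<close> for
    \<open>y\<close> then frees the argument of \<open>q\<close> from \<open>x\<close>, and the
    double integral factors.\<close>
  define H where "H x y = q (a * x) * decay n (a * x * y)" for x y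
  have Hm: "case_prod H \<in> borel_measurable (m \<Otimes>\<^sub>M m)"
    unfolding H_def case_prod_beta
    by (intro borel_measurable_times_ennreal measurable_compose[OF am q]
         measurable_compose[OF measurable_SL_mult[OF am] measurable_decay]) measurable
  define K where "K x y = q (a * x * adj_mat y) * decay n (a * x)" for x y
  have Km: "case_prod K \<in> borel_measurable (m \<Otimes>\<^sub>M m)"
    unfolding K_def case_prod_beta
    by (intro borel_measurable_times_ennreal measurable_compose[OF am measurable_decay]
         measurable_compose[OF measurable_SL_mult[OF am adm] q])
  have "(\<integral>\<^sup>+x. f (a * x) \<partial>m) = (\<integral>\<^sup>+x. \<integral>\<^sup>+y. H x y \<partial>m \<partial>m)"
  proof (rule nn_integral_cong)
    fix x assume "x \<in> space m"
    then have ax: "a * x \<in> SL n" using a by (simp add: SL_mult)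
    have "(\<integral>\<^sup>+y. H x y \<partial>m) = q (a * x) * G (a * x)"
      unfolding H_def G_def
      by (rule nn_integral_cmult) (simp add: measurable_m_iff measurable_decay_left[OF ax])
    also have "\<dots> = f (a * x)"
      using G_pos[OF ax] G_finite[OF ax] unfolding q_def
      by (simp add: ennreal_divide_times ennreal_times_divide mult_divide_eq_ennreal)
    finally show "f (a * x) = (\<integral>\<^sup>+y. H x y \<partial>m)" ..
  qed
  also have "\<dots> = (\<integral>\<^sup>+y. \<integral>\<^sup>+x. H x y \<partial>m \<partial>m)"
    by (rule P.Fubini'[OF Hm, symmetric])
  also have "\<dots> = (\<integral>\<^sup>+y. \<integral>\<^sup>+x. K x y \<partial>m \<partial>m)"
  proof (rule nn_integral_cong)
    fix y assume "y \<in> space m"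
    then have y: "y \<in> SL n" by simp
    have "(\<lambda>x. H x y) \<in> borel_measurable (SL_borel n)"
      unfolding H_def using a y
      by (intro borel_measurable_times_ennreal measurable_compose[OF measurable_SL_left q]
            measurable_compose[OF measurable_SL_mult[OF measurable_SL_left] measurable_decay]) auto
    from m_right[OF this SL_adj(1)[OF y]]
    have "(\<integral>\<^sup>+x. H x y \<partial>m) = (\<integral>\<^sup>+x. H (x * adj_mat y) y \<partial>m)" ..
    also have "\<dots> = (\<integral>\<^sup>+x. K x y \<partial>m)"
      by (intro nn_integral_cong)
         (use a y in \<open>simp add: H_def K_def SL_assoc[where n = n] SL_mult SL_adj SL_right_one[where n = n]\<close>)
    finally show "(\<integral>\<^sup>+x. H x y \<partial>m) = (\<integral>\<^sup>+x. K x y \<partial>m)" .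
  qed
  also have "\<dots> = (\<integral>\<^sup>+x. \<integral>\<^sup>+y. K x y \<partial>m \<partial>m)"
    by (rule P.Fubini'[OF Km])
  also have "\<dots> = (\<integral>\<^sup>+x. decay n (a * x) * (\<integral>\<^sup>+y. q (adj_mat y) \<partial>m) \<partial>m)"
  proof (rule nn_integral_cong)
    fix x assume "x \<in> space m"
    then have x: "x \<in> SL n" and ax: "a * x \<in> SL n" using a by (simp_all add: SL_mult)
    have "(\<lambda>y. K x y) \<in> borel_measurable (SL_borel n)"
      unfolding K_def
      by (intro borel_measurable_times_ennreal borel_measurable_const
            measurable_compose[OF measurable_compose[OF measurable_adj_mat measurable_SL_left[OF ax]] q])
    from m_right[OF this ax]
    have "(\<integral>\<^sup>+y. K x y \<partial>m) = (\<integral>\<^sup>+y. K x (y * (a * x)) \<partial>m)" ..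
    also have "\<dots> = (\<integral>\<^sup>+y. decay n (a * x) * q (adj_mat y) \<partial>m)"
      by (intro nn_integral_cong)
         (use ax in \<open>simp add: K_def SL_adj_mult[where n = n] SL_adj SL_adj_cancel[where n = n] mult.commute\<close>)
    also have "\<dots> = decay n (a * x) * (\<integral>\<^sup>+y. q (adj_mat y) \<partial>m)"
      by (rule nn_integral_cmult)
         (simp add: measurable_m_iff measurable_compose[OF measurable_adj_mat q])
    finally show "(\<integral>\<^sup>+y. K x y \<partial>m) = decay n (a * x) * (\<integral>\<^sup>+y. q (adj_mat y) \<partial>m)" .
  qed
  also have "\<dots> = G a * (\<integral>\<^sup>+y. q (adj_mat y) \<partial>m)"
    unfolding G_def by (rule nn_integral_multc) (simp add: measurable_m_iff measurable_decay_left[OF a])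
  finally show ?thesis unfolding q_def .
qed

definition \<Delta> :: "real mat \<Rightarrow> ennreal" where
  "\<Delta> a = G a / G (1\<^sub>m n)"

text \<open>In \<open>m_left_translate\<close> the dependence on \<open>a\<close> sits in
  \<open>G a\<close> alone. Dividing by the case of the identity matrix leaves the scalar
  \<open>\<Delta> a\<close>.\<close>

lemma modular:
  assumes f: "f \<in> borel_measurable (SL_borel n)" and a: "a \<in> SL n"
  shows "(\<integral>\<^sup>+x. f (a * x) \<partial>m) = \<Delta> a * (\<integral>\<^sup>+x. f x \<partial>m)"
proof -
  let ?I = "\<integral>\<^sup>+y. f (adj_mat y) / G (adj_mat y) \<partial>m"
  have "(\<integral>\<^sup>+x. f x \<partial>m) = (\<integral>\<^sup>+x. f (1\<^sub>m n * x) \<partial>m)"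
    by (intro nn_integral_cong) (simp add: SL_left_one)
  also have "\<dots> = G (1\<^sub>m n) * ?I" by (rule m_left_translate[OF f SL_one])
  finally have 1: "(\<integral>\<^sup>+x. f x \<partial>m) = G (1\<^sub>m n) * ?I" .
  have "G a = \<Delta> a * G (1\<^sub>m n)"
    using G_pos[OF SL_one[of n]] G_finite[OF SL_one[of n]] unfolding \<Delta>_def
    by (simp add: ennreal_divide_times ennreal_times_divide mult_divide_eq_ennreal)
  then show ?thesis
    unfolding m_left_translate[OF f a] 1 by (simp add: mult.assoc)
qed

lemma modular_unique:
  assumes "x * G (1\<^sub>m n) = y * G (1\<^sub>m n)" shows "x = y"
proof -
  have "x * G (1\<^sub>m n) / G (1\<^sub>m n) = y * G (1\<^sub>m n) / G (1\<^sub>m n)" using assms by simp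
  then show ?thesis
    using G_pos[OF SL_one[of n]] G_finite[OF SL_one[of n]] by (simp add: mult_divide_eq_ennreal)
qed

lemma G_one: "G (1\<^sub>m n) = (\<integral>\<^sup>+x. decay n x \<partial>m)"
  unfolding G_def by (intro nn_integral_cong) (simp add: SL_left_one)

lemma modular_mult:
  assumes "a \<in> SL n" "b \<in> SL n"
  shows "\<Delta> (a * b) = \<Delta> a * \<Delta> b"
proof (rule modular_unique)
  have "\<Delta> (a * b) * G (1\<^sub>m n) = (\<integral>\<^sup>+x. decay n (a * b * x) \<partial>m)"
    unfolding G_one using assms by (intro modular[symmetric]) (auto simp: SL_mult)
  also have "\<dots> = (\<integral>\<^sup>+x. decay n (a * (b * x)) \<partial>m)"
    using assms by (intro nn_integral_cong) (simp add: SL_assoc[where n = n])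
  also have "\<dots> = \<Delta> b * (\<integral>\<^sup>+x. decay n (a * x) \<partial>m)"
    by (rule modular[OF measurable_decay_left[OF assms(1)] assms(2)])
  also have "\<dots> = \<Delta> b * (\<Delta> a * G (1\<^sub>m n))"
    unfolding G_one by (subst modular[OF measurable_decay assms(1)]) simp
  finally show "\<Delta> (a * b) * G (1\<^sub>m n) = \<Delta> a * \<Delta> b * G (1\<^sub>m n)" by (simp add: mult_ac)
qed

lemma modular_SLZ:
  assumes "a \<in> SLZ n"
  shows "\<Delta> a = 1"
proof (rule modular_unique)
  show "\<Delta> a * G (1\<^sub>m n) = 1 * G (1\<^sub>m n)"
    unfolding G_one modular[OF measurable_decay SLZ_SL[OF assms], symmetric]
    using m_left_SLZ[OF measurable_decay assms] by simp
qed

end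

section \<open>Lattice points in coordinates\<close>

text \<open>The row vector \<open>x g\<close>. Coordinates are total functions of which only the
  values below \<open>n\<close> count, so integer, real and rescaled coordinates mix freely;
  equalities are up to \<open>pt_cong\<close>.\<close>

definition pt :: "nat \<Rightarrow> real mat \<Rightarrow> (nat \<Rightarrow> real) \<Rightarrow> real vec" where
  "pt n g x = Matrix.vec n (\<lambda>j. \<Sum>i<n. index_mat g (i, j) * x i)"

lemma pt_carrier: "pt n g x \<in> carrier_vec n"
  by (simp add: pt_def)

lemma pt_cong: "(\<And>i. i < n \<Longrightarrow> x i = y i) \<Longrightarrow> pt n g x = pt n g y"
  unfolding pt_def by (intro eq_vecI) auto

lemma pt_eq_mult: 
  assumes "g \<in> carrier_mat n n"
  shows "transpose_mat g *\<^sub>v Matrix.vec n x = pt n g x"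
  using assms by (intro eq_vecI) (auto simp: pt_def scalar_prod_def lessThan_atLeast0)

lemma row_lattice_pt:
  assumes "g \<in> carrier_mat n n"
  shows "row_lattice n g = range (\<lambda>z :: nat \<Rightarrow> int. pt n g (\<lambda>i. of_int (z i)))"
proof -
  have "int_vecs n = range (\<lambda>z :: nat \<Rightarrow> int. Matrix.vec n (\<lambda>i. of_int (z i)))"
  proof (intro subset_antisym subsetI)
    fix v assume "v \<in> int_vecs n"
    then have eq: "v = Matrix.vec n (\<lambda>i. of_int (\<lfloor>vec_index v i\<rfloor>))"
      by (intro eq_vecI) (auto simp: int_vecs_def)
    show "v \<in> range (\<lambda>z :: nat \<Rightarrow> int. Matrix.vec n (\<lambda>i. of_int (z i)))"
      by (rule image_eqI[where x = "\<lambda>i. \<lfloor>vec_index v i\<rfloor>"]) (rule eq, rule UNIV_I)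
  qed (auto simp: int_vecs_def)
  then show ?thesis by (simp add: row_lattice_def image_image pt_eq_mult[OF assms])
qed

lemma pt_int_mem: "g \<in> carrier_mat n n \<Longrightarrow> pt n g (\<lambda>i. of_int (z i)) \<in> row_lattice n g"
  unfolding row_lattice_pt by (rule rangeI)

lemma pt_mult:
  assumes "A \<in> carrier_mat n n" "g \<in> carrier_mat n n"
  shows "pt n (A * g) x = pt n g (\<lambda>k. \<Sum>i<n. index_mat A (i, k) * x i)"
proof -
  have "pt n (A * g) x = transpose_mat g *\<^sub>v (transpose_mat A *\<^sub>v Matrix.vec n x)"
    using assms
    by (subst pt_eq_mult[symmetric]) (auto simp: transpose_mult[OF assms] assoc_mult_mat_vec[of _ n n _ n])
  also have "\<dots> = transpose_mat g *\<^sub>v Matrix.vec n (\<lambda>k. \<Sum>i<n. index_mat A (i, k) * x i)"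
    by (subst pt_eq_mult[OF assms(1)]) (simp add: pt_def)
  also have "\<dots> = pt n g (\<lambda>k. \<Sum>i<n. index_mat A (i, k) * x i)" by (rule pt_eq_mult[OF assms(2)])
  finally show ?thesis .
qed

lemma pt_recover:
  assumes "g \<in> SL n" "i < n"
  shows "x i = (\<Sum>k<n. index_mat (adj_mat g) (k, i) * vec_index (pt n g x) k)"
proof -
  have c: "g \<in> carrier_mat n n" "adj_mat g \<in> carrier_mat n n"
    using assms SL_adj(1)[OF assms(1)] by (auto dest: SL_carrier)
  have "transpose_mat (adj_mat g) *\<^sub>v (transpose_mat g *\<^sub>v Matrix.vec n x) = transpose_mat (g * adj_mat g) *\<^sub>v Matrix.vec n x"
    using c by (simp add: transpose_mult[OF c] assoc_mult_mat_vec[of _ n n _ n])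
  also have "\<dots> = Matrix.vec n x" by (simp add: SL_adj[OF assms(1)])
  finally have "vec_index (transpose_mat (adj_mat g) *\<^sub>v pt n g x) i = x i"
    using assms(2) by (simp add: pt_eq_mult[OF c(1)])
  moreover have "vec_index (transpose_mat (adj_mat g) *\<^sub>v pt n g x) i
      = (\<Sum>k<n. index_mat (adj_mat g) (k, i) * vec_index (pt n g x) k)"
    using c assms(2) pt_carrier[of n g x] by (simp add: scalar_prod_def lessThan_atLeast0)
  ultimately show ?thesis by simp
qed

lemma pt_inj:
  assumes "g \<in> SL n" "pt n g x = pt n g y" "i < n"
  shows "x i = y i"
  using pt_recover[OF assms(1,3), of x] pt_recover[OF assms(1,3), of y] assms(2) by simp

section \<open>Diagonal and unipotent elements\<close>

definition dg :: "nat \<Rightarrow> (nat \<Rightarrow> real) \<Rightarrow> real mat" where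
  "dg n f = mat n n (\<lambda>(i, j). if i = j then f i else 0)"

lemma dg_carrier: "dg n f \<in> carrier_mat n n"
  by (simp add: dg_def)

lemma det_dg: "det (dg n f) = (\<Prod>i<n. f i)"
proof -
  have "det (dg n f) = prod_list (diag_mat (dg n f))"
    by (rule det_upper_triangular[of _ n]) (auto simp: dg_def)
  also have "diag_mat (dg n f) = map f [0..<n]"
    by (auto simp: diag_mat_def dg_def intro!: map_cong)
  also have "prod_list \<dots> = (\<Prod>i<n. f i)"
    by (simp add: prod.distinct_set_conv_list lessThan_atLeast0 flip: set_upt)
  finally show ?thesis .
qed

lemma index_dg_mult:
  assumes "A \<in> carrier_mat n n" "i < n" "j < n"
  shows "index_mat (dg n f * A) (i, j) = f i * index_mat A (i, j)"
    "index_mat (A * dg n f) (i, j) = index_mat A (i, j) * f j"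
proof -
  have "index_mat (dg n f * A) (i, j) = (\<Sum>k\<in>{0..<n}. (if i = k then f i else 0) * index_mat A (k, j))"
    using assms unfolding dg_def by (simp add: scalar_prod_def)
  also have "\<dots> = (\<Sum>k\<in>{0..<n}. (if k = i then f i * index_mat A (i, j) else 0))"
    by (rule sum.cong) auto
  finally
  show "index_mat (dg n f * A) (i, j) = f i * index_mat A (i, j)" using assms by simp
  have "index_mat (A * dg n f) (i, j) = (\<Sum>k\<in>{0..<n}. index_mat A (i, k) * (if k = j then f k else 0))"
    using assms unfolding dg_def by (simp add: scalar_prod_def)
  also have "\<dots> = (\<Sum>k\<in>{0..<n}. (if k = j then index_mat A (i, j) * f j else 0))"
    by (rule sum.cong) auto
  finally show "index_mat (A * dg n f) (i, j) = index_mat A (i, j) * f j" using assms by simp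
qed

lemma dg_mult: "dg n f * dg n h = dg n (\<lambda>i. f i * h i)"
  using index_dg_mult(1)[OF dg_carrier, of _ n _ f h] 
  by (intro eq_matI) (auto simp: dg_def)

text \<open>The factor that brings a sublattice of index \<open>p\<close> back to covolume
  one.\<close>

definition scale :: "nat \<Rightarrow> nat \<Rightarrow> real" where
  "scale n p = real p powr (- 1 / real n)"

lemma scale_pos: "p > 0 \<Longrightarrow> 0 < scale n p"
  by (simp add: scale_def)

lemma scale_power: "n > 0 \<Longrightarrow> p > 0 \<Longrightarrow> scale n p ^ n * real p = 1"
  unfolding scale_def by (subst powr_power) (auto simp: powr_minus)

definition dgp :: "nat \<Rightarrow> nat \<Rightarrow> nat \<Rightarrow> real mat" where
  "dgp n p i = dg n (\<lambda>k. scale n p * (if k = i then real p else 1))"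

lemma dgp_SL:
  assumes "i < n" "p > 0"
  shows "dgp n p i \<in> SL n"
proof -
  have "(\<Prod>k<n. if k = i then real p else 1) = real p"
    using assms by simp
  then show ?thesis
    using assms scale_power[of n p] by (simp add: SL_def dgp_def dg_carrier det_dg prod.distrib)
qed

text \<open>A transposition has determinant -1; negating one row puts it into \<open>SLZ n\<close>,
  and the sign does not disturb how it moves diagonal entries.\<close>

definition sgn_swap :: "nat \<Rightarrow> nat \<Rightarrow> nat \<Rightarrow> real mat" where
  "sgn_swap n i j = multrow_mat n i (- 1) * swaprows_mat n i j"

lemma sgn_swap:
  assumes "i < n" "j < n" "i \<noteq> j"
  shows "sgn_swap n i j \<in> SLZ n" "sgn_swap n i j * dgp n p i = dgp n p j * sgn_swap n i j"
proof -
  have c: "multrow_mat n i (- 1 :: real) \<in> carrier_mat n n" "swaprows_mat n i j \<in> carrier_mat n n" by auto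
  have cs: "sgn_swap n i j \<in> carrier_mat n n" unfolding sgn_swap_def by (rule mult_carrier_mat[OF c])
  have "sgn_swap n i j = multrow i (- 1) (swaprows_mat n i j)"
    unfolding sgn_swap_def by (rule multrow_mat[symmetric]) auto
  then have entry: "index_mat (sgn_swap n i j) (k, l) = 
      (if k = i then (if l = j then - 1 else 0) else if k = j then (if l = i then 1 else 0) else if k = l then 1 else 0)"
    if "k < n" "l < n" for k l
    using that assms by auto
  have "det (sgn_swap n i j) = 1"
    unfolding sgn_swap_def using assms by (subst det_mult[OF c]) (auto simp: det_swaprows_mat det_multrow_mat)
  with cs entry show "sgn_swap n i j \<in> SLZ n" by (simp add: SLZ_def SL_def)
  show "sgn_swap n i j * dgp n p i = dgp n p j * sgn_swap n i j"
  proof (rule eq_matI)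
    fix k l assume "k < dim_row (dgp n p j * sgn_swap n i j)" "l < dim_col (dgp n p j * sgn_swap n i j)"
    then have kl: "k < n" "l < n" using cs by (auto simp: dgp_def dg_def)
    show "index_mat (sgn_swap n i j * dgp n p i) (k, l) = index_mat (dgp n p j * sgn_swap n i j) (k, l)"
      unfolding dgp_def index_dg_mult[OF cs kl] entry[OF kl] using assms by auto
  qed (use cs in \<open>auto simp: dgp_def dg_def\<close>)
qed

definition unip :: "nat \<Rightarrow> (nat \<Rightarrow> int) \<Rightarrow> real mat" where
  "unip n a = mat n n (\<lambda>(i, j). if i = j then 1 else if j = n - 1 then of_int (a i) else 0)"

lemma unip_SLZ: "unip n a \<in> SLZ n"
proof -
  have "det (unip n a) = prod_list (diag_mat (unip n a))"
    by (rule det_upper_triangular[of _ n]) (auto simp: unip_def)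
  also have "diag_mat (unip n a) = map (\<lambda>_. 1) [0..<n]"
    by (auto simp: diag_mat_def unip_def intro!: map_cong)
  finally show ?thesis by (auto simp: SLZ_def SL_def unip_def map_replicate_const)
qed

text \<open>The rows span a scaled copy of the sublattice of index \<open>p\<close> given by the congruence
  \<open>z (n - 1) = (\<Sum>i<n - 1. a i * z i)\<close> modulo \<open>p\<close>.\<close>

definition hecke_mat :: "nat \<Rightarrow> nat \<Rightarrow> (nat \<Rightarrow> int) \<Rightarrow> real mat" where
  "hecke_mat n p a = dgp n p (n - 1) * unip n a"

lemma hecke_mat_SL: "n > 0 \<Longrightarrow> p > 0 \<Longrightarrow> hecke_mat n p a \<in> SL n"
  unfolding hecke_mat_def by (intro SL_mult dgp_SL SLZ_SL unip_SLZ) auto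

text \<open>In integer coordinates \<open>z\<close>, the matrix keeps the first \<open>n - 1\<close>
  entries and turns the last one into \<open>\<Sum>i<n - 1. a i * z i\<close> plus \<open>p\<close>
  times the old one, which is exactly the last entry being prescribed modulo
  \<open>p\<close>.\<close>

lemma row_lattice_hecke:
  assumes n: "n > 0" and p: "p > 0" and g: "g \<in> SL n"
  shows "row_lattice n (hecke_mat n p a * g) =
    (\<lambda>y :: nat \<Rightarrow> int. pt n g (\<lambda>i. scale n p * of_int (y i))) ` {y. int p dvd y (n - 1) - (\<Sum>i<n - 1. a i * y i)}"
proof -
  obtain n' where n': "n = Suc n'" using n by (cases n) auto
  have hc: "hecke_mat n p a \<in> carrier_mat n n" and gc: "g \<in> carrier_mat n n" and uc: "unip n a \<in> carrier_mat n n"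
    using hecke_mat_SL[OF n p] g SLZ_SL[OF unip_SLZ] by (auto dest: SL_carrier)
  have entry: "index_mat (hecke_mat n p a) (i, k) = scale n p * (if i = n - 1 then (if k = n - 1 then real p else 0)
      else if i = k then 1 else if k = n - 1 then of_int (a i) else 0)" if "i < n" "k < n" for i k
    unfolding hecke_mat_def dgp_def index_dg_mult(1)[OF uc that] using that by (auto simp: unip_def)
  have coord: "(\<Sum>i<n. index_mat (hecke_mat n p a) (i, k) * of_int (z i)) = scale n p * of_int
      (if k = n - 1 then (\<Sum>i<n - 1. a i * z i) + int p * z (n - 1) else z k)" if k: "k < n" for k and z :: "nat \<Rightarrow> int"
  proof (cases "k = n - 1")
    case True
    then show ?thesis using entry k
      by (simp add: n' sum_distrib_left distrib_left mult_ac)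
  next
    case False
    then have k': "k < n'" using k n' by simp
    have "(\<Sum>i<n. index_mat (hecke_mat n p a) (i, k) * of_int (z i)) = (\<Sum>i<n. if i = k then scale n p * of_int (z k) else 0)"
      using entry k False by (intro sum.cong) (auto simp: n')
    then show ?thesis using False k by simp
  qed
  have eq: "pt n (hecke_mat n p a * g) (\<lambda>i. of_int (z i)) = pt n g (\<lambda>k. scale n p * of_int
      (if k = n - 1 then (\<Sum>i<n - 1. a i * z i) + int p * z (n - 1) else z k))" for z :: "nat \<Rightarrow> int"
    unfolding pt_mult[OF hc gc] by (rule pt_cong) (rule coord)
  show ?thesis
  proof (intro subset_antisym subsetI)
    fix v assume "v \<in> row_lattice n (hecke_mat n p a * g)"
    then obtain z :: "nat \<Rightarrow> int" where v: "v = pt n (hecke_mat n p a * g) (\<lambda>i. of_int (z i))"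
      using row_lattice_pt[of "hecke_mat n p a * g" n] hc gc by auto
    show "v \<in> (\<lambda>y :: nat \<Rightarrow> int. pt n g (\<lambda>i. scale n p * of_int (y i))) ` {y. int p dvd y (n - 1) - (\<Sum>i<n - 1. a i * y i)}"
      unfolding v eq by (rule imageI) simp
  next
    fix v assume "v \<in> (\<lambda>y :: nat \<Rightarrow> int. pt n g (\<lambda>i. scale n p * of_int (y i))) ` {y. int p dvd y (n - 1) - (\<Sum>i<n - 1. a i * y i)}"
    then obtain y where y: "v = pt n g (\<lambda>i. scale n p * of_int (y i))" "int p dvd y (n - 1) - (\<Sum>i<n - 1. a i * y i)" by auto
    from y(2) obtain q where q: "y (n - 1) - (\<Sum>i<n - 1. a i * y i) = int p * q" by (auto elim: dvdE)
    define z where "z k = (if k = n - 1 then q else y k)" for k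
    have "v = pt n (hecke_mat n p a * g) (\<lambda>i. of_int (z i))"
      unfolding y(1) eq
    proof (rule pt_cong)
      fix i assume "i < n"
      have "(\<Sum>i<n - 1. a i * z i) = (\<Sum>i<n - 1. a i * y i)" by (intro sum.cong) (auto simp: z_def)
      then have "(if i = n - 1 then (\<Sum>i<n - 1. a i * z i) + int p * z (n - 1) else z i) = y i"
        using q by (simp add: z_def)
      then show "scale n p * of_int (y i) = scale n p * of_int (if i = n - 1 then (\<Sum>i<n - 1. a i * z i) + int p * z (n - 1) else z i)"
        by simp
    qed
    then show "v \<in> row_lattice n (hecke_mat n p a * g)"
      using row_lattice_pt[of "hecke_mat n p a * g" n] hc gc by auto
  qed
qed

abbreviation hecke_idx :: "nat \<Rightarrow> nat \<Rightarrow> (nat \<Rightarrow> int) set" where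
  "hecke_idx n p \<equiv> PiE {..<n - 1} (\<lambda>_. {0..<int p})"

lemma hecke_inj:
  assumes n: "n > 0" and p: "p > 0" and x: "x \<in> SL n"
    and ab: "a \<in> hecke_idx n p" "b \<in> hecke_idx n p"
    and eq: "row_lattice n (hecke_mat n p a * x) = row_lattice n (hecke_mat n p b * x)"
  shows "a = b"
proof (rule PiE_ext[OF ab])
  fix i assume i: "i \<in> {..<n - 1}"
  \<comment> \<open>This vector, with entry 1 at \<open>i\<close> and \<open>a i\<close> at the end,
    lies in the sublattice of \<open>a\<close>. Its membership in the sublattice of \<open>b\<close>
    reads \<open>a i = b i\<close> modulo \<open>p\<close>.\<close>
  define y where "y k = (if k = n - 1 then a i else if k = i then 1 else 0)" for k
  have sy: "(\<Sum>k<n - 1. c k * y k) = c i" for c :: "nat \<Rightarrow> int"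
  proof -
    have "(\<Sum>k<n - 1. c k * y k) = (\<Sum>k<n - 1. if k = i then c i else 0)"
      by (intro sum.cong) (auto simp: y_def)
    then show ?thesis using i by simp
  qed
  have "pt n x (\<lambda>i. scale n p * of_int (y i)) \<in> row_lattice n (hecke_mat n p a * x)"
    unfolding row_lattice_hecke[OF n p x] by (rule imageI) (simp only: mem_Collect_eq sy, simp add: y_def)
  from this[unfolded eq, unfolded row_lattice_hecke[OF n p x]] obtain y'
    where y'0: "pt n x (\<lambda>i. scale n p * of_int (y i)) = pt n x (\<lambda>i. scale n p * of_int (y' i))"
    and "y' \<in> {y. int p dvd y (n - 1) - (\<Sum>i<n - 1. b i * y i)}"
    by (rule imageE)
  then have y'1: "int p dvd y' (n - 1) - (\<Sum>i<n - 1. b i * y' i)" by simp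
  note y' = y'0 y'1
  have "y k = y' k" if "k < n" for k
    using pt_inj[OF x y'(1) that] scale_pos[OF p, of n] by simp
  then have "int p dvd y (n - 1) - (\<Sum>i<n - 1. b i * y i)" using y'(2) n by simp
  then have "int p dvd a i - b i" unfolding sy by (simp add: y_def)
  then have "a i mod int p = b i mod int p" by (simp add: mod_eq_dvd_iff)
  then show "a i = b i" using PiE_mem[OF ab(1) i] PiE_mem[OF ab(2) i] by simp
qed

section \<open>Lattices containing a given one with index p\<close>

text \<open>In the basis \<open>h\<close>, the integer vectors together with the multiples of
  \<open>c / p\<close>, rescaled to covolume one if \<open>p\<close> does not divide
  \<open>c\<close>. These are the lattices in which the lattice of \<open>h\<close> appears as
  rescaled sublattice of index \<open>p\<close>.\<close>

definition super_lattice :: "nat \<Rightarrow> nat \<Rightarrow> real mat \<Rightarrow> (nat \<Rightarrow> int) \<Rightarrow> real vec set" where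
  "super_lattice n p h c = {pt n h (\<lambda>i. (of_int (z i) + of_int k * of_int (c i) / real p) / scale n p) | (z :: nat \<Rightarrow> int) (k :: int). True}"

lemma super_lattice_subset:
  assumes "p > 0" "\<And>j. j < n \<Longrightarrow> int p dvd c' j - u * c j"
  shows "super_lattice n p h c' \<subseteq> super_lattice n p h c"
proof
  fix v assume "v \<in> super_lattice n p h c'"
  then obtain z :: "nat \<Rightarrow> int" and k :: int
    where v: "v = pt n h (\<lambda>i. (of_int (z i) + of_int k * of_int (c' i) / real p) / scale n p)"
    by (auto simp: super_lattice_def)
  define e where "e j = (c' j - u * c j) div int p" for j
  have "c' j = u * c j + int p * e j" if "j < n" for j
    using assms(2)[OF that] by (simp add: e_def)
  then have "v = pt n h (\<lambda>i. (of_int (z i + k * e i) + of_int (k * u) * of_int (c i) / real p) / scale n p)"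
    unfolding v using assms(1) by (intro pt_cong) (simp add: field_simps)
  then show "v \<in> super_lattice n p h c" unfolding super_lattice_def mem_Collect_eq
    by (intro exI[of _ "\<lambda>i. z i + k * e i"] exI[of _ "k * u"] conjI TrueI)
qed

text \<open>The points of projective space over the integers modulo \<open>p\<close>, with the last
  nonzero homogeneous coordinate normalised to 1; the cell whose normalised place is
  \<open>i\<close> has \<open>p ^ i\<close> elements.\<close>

definition proj_reps :: "nat \<Rightarrow> nat \<Rightarrow> (nat \<Rightarrow> int) set" where
  "proj_reps n p = (\<Union>i<n. PiE {..<n} (\<lambda>j. if j < i then {0..<int p} else if j = i then {1} else {0}))"

lemma proj_reps_card: "finite (proj_reps n p)" "card (proj_reps n p) \<le> (\<Sum>i<n. p ^ i)"
proof -
  show "finite (proj_reps n p)" unfolding proj_reps_def by (intro finite_UN_I finite_PiE) auto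
  have "card (PiE {..<n} (\<lambda>j. if j < i then {0..<int p} else if j = i then {1} else {0})) = p ^ i" if "i < n" for i
  proof -
    have "card (PiE {..<n} (\<lambda>j. if j < i then {0..<int p} else if j = i then {1} else {0})) = (\<Prod>j<n. if j < i then p else 1)"
      by (subst card_PiE) (auto intro!: prod.cong)
    also have "\<dots> = (\<Prod>j<i. p)" using that by (intro prod.mono_neutral_cong_right) auto
    also have "\<dots> = p ^ i" by simp
    finally show ?thesis .
  qed
  then show "card (proj_reps n p) \<le> (\<Sum>i<n. p ^ i)"
    unfolding proj_reps_def by (intro order.trans[OF card_UN_le]) auto
qed

text \<open>Multiplying \<open>c\<close> by a unit modulo \<open>p\<close> does not change the
  lattice it generates. The unit used is the inverse \<open>u\<close> of the last coordinate not
  divisible by \<open>p\<close>; congruences in both directions give both inclusions.\<close>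

lemma proj_normalise:
  assumes p: "prime p" and c: "\<exists>j<n. \<not> int p dvd c j"
  shows "\<exists>c'\<in>proj_reps n p. super_lattice n p h c = super_lattice n p h c'"
proof -
  define i where "i = Max {j. j < n \<and> \<not> int p dvd c j}"
  have "i \<in> {j. j < n \<and> \<not> int p dvd c j}"
    unfolding i_def using c by (intro Max_in) auto
  then have i: "i < n" "\<not> int p dvd c i" by auto
  have above: "int p dvd c j" if "i < j" "j < n" for j
  proof (rule ccontr)
    assume "\<not> ?thesis"
    with that have "j \<le> i" unfolding i_def by (intro Max_ge) auto
    with that show False by simp
  qed
  have "coprime (c i) (int p)"
    using i(2) p by (simp add: prime_imp_coprime coprime_commute)
  then obtain u where u: "[c i * u = 1] (mod int p)" using cong_solve_coprime_int by blast
  then have u': "int p dvd 1 - u * c i" by (metis cong_iff_dvd_diff cong_sym mult.commute)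
  define c' where "c' = (\<lambda>j\<in>{..<n}. if j < i then (u * c j) mod int p else if j = i then 1 else 0)"
  have p0: "p > 0" using p by (simp add: prime_gt_0_nat)
  have c'R: "c' \<in> proj_reps n p"
    unfolding proj_reps_def c'_def using i p0 by (auto intro!: bexI[of _ i])
  have d1: "int p dvd c' j - u * c j" if "j < n" for j
    using that above[of j] u' by (auto simp: c'_def mod_eq_dvd_iff[symmetric])
  have d2: "int p dvd c j - c i * c' j" if "j < n" for j
  proof -
    have "c j - c i * c' j = c j * (1 - u * c i) - c i * (c' j - u * c j)" by (simp add: algebra_simps)
    then show ?thesis using d1[OF that] u' by simp
  qed
  have "super_lattice n p h c = super_lattice n p h c'"
    using super_lattice_subset[of p n c' u c h, OF p0 d1] super_lattice_subset[of p n c "c i" c' h, OF p0 d2] by blast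
  with c'R show ?thesis by blast
qed

text \<open>The lattice of \<open>x\<close> is generated by its sublattice together with the last
  unit vector \<open>e\<close>, since the congruence can be repaired in the last coordinate. As
  \<open>p\<close> times \<open>e\<close> lies in the sublattice, \<open>e\<close> has coordinates
  \<open>c / p\<close> up to scaling in the basis \<open>h\<close>.\<close>

lemma row_lattice_super:
  assumes n: "n > 0" and p: "prime p" and x: "x \<in> SL n" and h: "h \<in> SL n"
    and eq: "row_lattice n (hecke_mat n p a * x) = row_lattice n h"
  shows "\<exists>c\<in>proj_reps n p. row_lattice n x = super_lattice n p h c"
proof -
  have p0: "p > 0" and p1: "p > 1" using p prime_gt_1_nat[of p] by (auto simp: prime_gt_0_nat)
  let ?s = "scale n p"
  have s: "?s > 0" using scale_pos[OF p0] .
  have xc: "x \<in> carrier_mat n n" and hc: "h \<in> carrier_mat n n" using x h by (auto dest: SL_carrier)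
  define T where "T w k = (\<Sum>i<n. index_mat (x * adj_mat h) (i, k) * w i)" for w :: "nat \<Rightarrow> real" and k
  have T: "pt n x w = pt n h (T w)" for w
    unfolding T_def using x h
    by (subst pt_mult[symmetric]) (auto simp: SL_carrier SL_mult SL_adj SL_adj_cancel[where n = n])
  have T_lin: "T (\<lambda>i. \<alpha> * w i + \<beta> * v i) k = \<alpha> * T w k + \<beta> * T v k" for \<alpha> \<beta> w v k
    unfolding T_def by (simp add: algebra_simps sum.distrib sum_distrib_left)
  have T_scale: "T (\<lambda>i. \<alpha> * w i) k = \<alpha> * T w k" for \<alpha> w k
    using T_lin[of \<alpha> w 0 w k] by simp
  have into: "\<exists>z :: nat \<Rightarrow> int. \<forall>k<n. ?s * T (\<lambda>i. of_int (y i)) k = of_int (z k)"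
    if "int p dvd y (n - 1) - (\<Sum>i<n - 1. a i * y i)" for y :: "nat \<Rightarrow> int"
  proof -
    have "pt n x (\<lambda>i. ?s * of_int (y i)) \<in> row_lattice n (hecke_mat n p a * x)"
      unfolding row_lattice_hecke[OF n p0 x] using that by auto
    then have "pt n h (T (\<lambda>i. ?s * of_int (y i))) \<in> row_lattice n h" unfolding eq T .
    then obtain z :: "nat \<Rightarrow> int" where "pt n h (T (\<lambda>i. ?s * of_int (y i))) = pt n h (\<lambda>i. of_int (z i))"
      unfolding row_lattice_pt[OF hc] by auto
    from pt_inj[OF h this] show ?thesis by (auto simp: T_scale intro!: exI[of _ z])
  qed
  have onto: "\<exists>y :: nat \<Rightarrow> int. int p dvd y (n - 1) - (\<Sum>i<n - 1. a i * y i) \<and> (\<forall>k<n. ?s * T (\<lambda>i. of_int (y i)) k = of_int (z k))"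
    for z :: "nat \<Rightarrow> int"
  proof -
    have "pt n h (\<lambda>i. of_int (z i)) \<in> row_lattice n (hecke_mat n p a * x)"
      unfolding eq row_lattice_pt[OF hc] by auto
    then obtain y where y: "int p dvd y (n - 1) - (\<Sum>i<n - 1. a i * y i)"
      "pt n h (\<lambda>i. of_int (z i)) = pt n h (T (\<lambda>i. ?s * of_int (y i)))"
      unfolding row_lattice_hecke[OF n p0 x] T by auto
    from pt_inj[OF h y(2)] y(1) show ?thesis by (auto simp: T_scale intro!: exI[of _ y])
  qed
  define e where "e k = (if k = n - 1 then 1 else 0 :: int)" for k
  have esum: "(\<Sum>i<n - 1. a i * (q * e i)) = 0" for q by (auto simp: e_def intro!: sum.neutral)
  have "\<exists>z :: nat \<Rightarrow> int. \<forall>k<n. ?s * T (\<lambda>i. of_int (int p * e i)) k = of_int (z k)"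
    by (rule into) (simp only: esum, simp add: e_def)
  then obtain c where c: "\<And>k. k < n \<Longrightarrow> ?s * T (\<lambda>i. of_int (int p * e i)) k = of_int (c k)" by blast
  have Te: "T (\<lambda>i. of_int (e i)) k = of_int (c k) / real p / ?s" if "k < n" for k
    using c[OF that] T_scale[of "real p" "\<lambda>i. of_int (e i)" k] p0 s by (simp add: field_simps)
  \<comment> \<open>If \<open>p\<close> divided \<open>c\<close>, the unit vector \<open>e\<close>
    itself would satisfy the congruence, that is, \<open>p\<close> would divide 1.\<close>
  have nd: "\<exists>j<n. \<not> int p dvd c j"
  proof (rule ccontr)
    assume "\<not> ?thesis"
    then have cd: "c j = int p * (c j div int p)" if "j < n" for j using that by auto
    obtain y :: "nat \<Rightarrow> int" where y: "int p dvd y (n - 1) - (\<Sum>i<n - 1. a i * y i)"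
      "\<And>k. k < n \<Longrightarrow> ?s * T (\<lambda>i. of_int (y i)) k = of_int (c k div int p)"
      using onto[of "\<lambda>j. c j div int p"] by blast
    have "T (\<lambda>i. of_int (y i)) k = T (\<lambda>i. of_int (e i)) k" if "k < n" for k
    proof -
      have "of_int (c k) = real p * of_int (c k div int p)"
        using cd[OF that] by (metis of_int_mult of_int_of_nat_eq)
      then have "?s * T (\<lambda>i. of_int (y i)) k = ?s * T (\<lambda>i. of_int (e i)) k"
        using y(2)[OF that] Te[OF that] p0 s by simp
      then show ?thesis using s by simp
    qed
    then have ye: "pt n x (\<lambda>i. of_int (y i)) = pt n x (\<lambda>i. of_int (e i))"
      unfolding T by (rule pt_cong)
    have "y k = e k" if "k < n" for k using pt_inj[OF x ye that] by simp
    then have "int p dvd e (n - 1) - (\<Sum>i<n - 1. a i * e i)" using y(1) n by simp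
    then have "int p dvd 1" using esum[of 1] by (simp add: e_def)
    then show False using p1 by simp
  qed
  have "row_lattice n x = super_lattice n p h c"
  proof (intro subset_antisym subsetI)
    fix v assume "v \<in> row_lattice n x"
    then obtain y :: "nat \<Rightarrow> int" where v: "v = pt n x (\<lambda>i. of_int (y i))"
      unfolding row_lattice_pt[OF xc] by auto
    define q where "q = y (n - 1) - (\<Sum>i<n - 1. a i * y i)"
    define y' where "y' k = y k - q * e k" for k
    have "(\<Sum>i<n - 1. a i * y' i) = (\<Sum>i<n - 1. a i * y i)"
      by (intro sum.cong) (auto simp: y'_def e_def)
    then have "int p dvd y' (n - 1) - (\<Sum>i<n - 1. a i * y' i)" by (simp add: y'_def e_def q_def)
    from into[OF this] obtain z :: "nat \<Rightarrow> int" where z: "\<And>k. k < n \<Longrightarrow> ?s * T (\<lambda>i. of_int (y' i)) k = of_int (z k)" by blast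
    have "v = pt n h (\<lambda>i. (of_int (z i) + of_int q * of_int (c i) / real p) / ?s)"
      unfolding v T
    proof (rule pt_cong)
      fix k assume k: "k < n"
      have "T (\<lambda>i. of_int (y i)) k = T (\<lambda>i. 1 * of_int (y' i) + of_int q * of_int (e i)) k" by (simp add: y'_def)
      also have "\<dots> = T (\<lambda>i. of_int (y' i)) k + of_int q * T (\<lambda>i. of_int (e i)) k" unfolding T_lin by simp
      also have "T (\<lambda>i. of_int (y' i)) k = of_int (z k) / ?s" using z[OF k] s by (simp add: field_simps)
      finally show "T (\<lambda>i. of_int (y i)) k = (of_int (z k) + of_int q * of_int (c k) / real p) / ?s"
        unfolding Te[OF k] by (simp add: add_divide_distrib)
    qed
    then show "v \<in> super_lattice n p h c" unfolding super_lattice_def mem_Collect_eq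
      by (intro exI[of _ z] exI[of _ q] conjI TrueI)
  next
    fix v assume "v \<in> super_lattice n p h c"
    then obtain z :: "nat \<Rightarrow> int" and k :: int
      where v: "v = pt n h (\<lambda>i. (of_int (z i) + of_int k * of_int (c i) / real p) / ?s)"
      by (auto simp: super_lattice_def)
    obtain y :: "nat \<Rightarrow> int" where y: "\<And>k. k < n \<Longrightarrow> ?s * T (\<lambda>i. of_int (y i)) k = of_int (z k)"
      using onto[of z] by blast
    have "v = pt n x (\<lambda>i. of_int (y i + k * e i))"
      unfolding v T
    proof (rule pt_cong)
      fix j assume j: "j < n"
      have "T (\<lambda>i. of_int (y i + k * e i)) j = T (\<lambda>i. 1 * of_int (y i) + of_int k * of_int (e i)) j" by simp
      also have "\<dots> = T (\<lambda>i. of_int (y i)) j + of_int k * T (\<lambda>i. of_int (e i)) j" unfolding T_lin by simp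
      also have "T (\<lambda>i. of_int (y i)) j = of_int (z j) / ?s" using y[OF j] s by (simp add: field_simps)
      finally show "(of_int (z j) + of_int k * of_int (c j) / real p) / ?s = T (\<lambda>i. of_int (y i + k * e i)) j"
        unfolding Te[OF j] by (simp add: add_divide_distrib)
    qed
    then show "v \<in> row_lattice n x" by (simp only: pt_int_mem[OF xc])
  qed
  with proj_normalise[OF p nd, of h] show ?thesis by metis
qed

section \<open>The Hecke inequality\<close>

context inv_lattice
begin

text \<open>The matrices \<open>dgp n p i\<close> are conjugate to each other by elements of
  \<open>SLZ n\<close>, where \<open>\<Delta>\<close> is 1, so they share one value of
  \<open>\<Delta>\<close>. Their product over all \<open>i\<close> is the identity, so this value is
  an \<open>n\<close>-th root of 1 among nonnegative numbers.\<close>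

lemma modular_dgp:
  assumes p: "p > 0" and i: "i < n"
  shows "\<Delta> (dgp n p i) = 1"
proof -
  let ?d = "\<Delta> (dgp n p i)"
  have same: "\<Delta> (dgp n p j) = ?d" if j: "j < n" for j
  proof (cases "i = j")
    case False
    have "\<Delta> (sgn_swap n i j) * ?d = \<Delta> (dgp n p j) * \<Delta> (sgn_swap n i j)"
      using sgn_swap[OF i j False] p i j
      by (simp add: modular_mult[symmetric] dgp_SL SLZ_SL)
    then show ?thesis by (simp add: modular_SLZ sgn_swap[OF i j False])
  qed simp
  \<comment> \<open>Partial products of the \<open>dgp n p i\<close>; at \<open>k = n\<close> every
    diagonal entry is \<open>scale n p ^ n * p = 1\<close>.\<close>
  define Q where "Q k = dg n (\<lambda>j. scale n p ^ k * (if j < k then real p else 1))" for k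
  have Q: "Q k \<in> SL n \<and> \<Delta> (Q k) = ?d ^ k" if "k \<le> n" for k
    using that
  proof (induction k)
    case 0
    have "Q 0 = 1\<^sub>m n" by (intro eq_matI) (auto simp: Q_def dg_def)
    moreover have "1\<^sub>m n \<in> SLZ n" using SL_one by (auto simp: SLZ_def)
    ultimately show ?case using modular_SLZ by (simp add: SL_one)
  next
    case (Suc k)
    have "Q (Suc k) = Q k * dgp n p k"
      unfolding Q_def dgp_def dg_mult by (intro arg_cong[where f = "dg n"]) (auto simp: fun_eq_iff)
    with Suc p show ?case by (simp add: SL_mult dgp_SL modular_mult same mult.commute)
  qed
  have "Q n = 1\<^sub>m n" using scale_power[OF n_pos p] by (intro eq_matI) (auto simp: Q_def dg_def)
  moreover have "1\<^sub>m n \<in> SLZ n" using SL_one by (auto simp: SLZ_def)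
  ultimately have d: "?d ^ n = 1" using Q[of n] modular_SLZ by simp
  have "?d \<noteq> \<infinity>" using d n_pos by (auto simp: power_0_left)
  then obtain r where r: "?d = ennreal r" "r \<ge> 0" by (cases ?d) auto
  have "ennreal (r ^ n) = ennreal 1" using d r by (simp add: ennreal_power)
  then have "r ^ n = 1" using r by (subst (asm) ennreal_inj) auto
  then have "r = 1" using r n_pos by (metis power_eq_imp_eq_base power_one zero_le_one)
  then show ?thesis using r by simp
qed

lemma modular_hecke: "p > 0 \<Longrightarrow> \<Delta> (hecke_mat n p a) = 1"
  unfolding hecke_mat_def using n_pos
  by (subst modular_mult) (auto simp: dgp_SL SLZ_SL unip_SLZ modular_dgp modular_SLZ)

text \<open>A matrix \<open>x\<close> contributes only if its lattice contains \<open>L\<close>,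
  rescaled, with index \<open>p\<close>: at most \<open>\<Sum>i<n. p ^ i\<close> lattices. By
  \<open>hecke_inj\<close> each \<open>x\<close> contributes for one \<open>a\<close> at most, so
  the total is bounded by the fibre sums of \<open>wt\<close> over these lattices, which are 1
  each.\<close>

lemma lsum_wt_hecke:
  assumes p: "prime p" and L: "L \<in> latt n"
  shows "(\<Sum>a\<in>hecke_idx n p. lsum n (\<lambda>h. wt (adj_mat (hecke_mat n p a) * h)) L) \<le> of_nat (\<Sum>i<n. p ^ i)"
proof -
  have p0: "p > 0" using p by (simp add: prime_gt_0_nat)
  note hS = hecke_mat_SL[OF n_pos p0]
  from L obtain h where h: "h \<in> SL n" "L = row_lattice n h" by (auto simp: latt_def)
  define X where "X a = {x \<in> SL n. row_lattice n (hecke_mat n p a * x) = L}" for a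
  define T where "T = super_lattice n p h ` proj_reps n p \<inter> latt n"
  have finT: "finite T" by (simp add: T_def proj_reps_card)
  have "card T \<le> card (super_lattice n p h ` proj_reps n p)"
    unfolding T_def by (intro card_mono) (auto simp: proj_reps_card)
  also have "\<dots> \<le> card (proj_reps n p)" by (intro card_image_le proj_reps_card)
  also have "\<dots> \<le> (\<Sum>i<n. p ^ i)" by (rule proj_reps_card)
  finally have cardT: "card T \<le> (\<Sum>i<n. p ^ i)" .
  have XT: "row_lattice n x \<in> T" if "x \<in> X a" for x a
    using row_lattice_super[OF n_pos p _ h(1), of x a] that h by (auto simp: X_def T_def latt_def)
  have fin: "finite (hecke_idx n p)" by (intro finite_PiE) auto
  have "(\<Sum>a\<in>hecke_idx n p. lsum n (\<lambda>h. wt (adj_mat (hecke_mat n p a) * h)) L)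
      = (\<Sum>a\<in>hecke_idx n p. \<integral>\<^sup>+x. wt x \<partial>count_space (X a))"
  proof (intro sum.cong refl)
    fix a
    show "lsum n (\<lambda>h. wt (adj_mat (hecke_mat n p a) * h)) L = (\<integral>\<^sup>+x. wt x \<partial>count_space (X a))"
      unfolding lsum_def
    proof (rule nn_integral_bij_count_space, rule bij_betwI[where g = "\<lambda>x. hecke_mat n p a * x"])
      show "(*) (adj_mat (hecke_mat n p a)) \<in> fib n L \<rightarrow> X a"
        using hS by (auto simp: fib_def X_def SL_mult SL_adj SL_adj_cancel[where n = n])
      show "(*) (hecke_mat n p a) \<in> X a \<rightarrow> fib n L"
        using hS by (auto simp: fib_def X_def SL_mult)
    qed (use hS in \<open>auto simp: fib_def X_def SL_adj_cancel[where n = n]\<close>)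
  qed
  also have "\<dots> = (\<Sum>a\<in>hecke_idx n p. \<integral>\<^sup>+x. wt x * indicator (X a) x \<partial>count_space UNIV)"
    by (intro sum.cong refl nn_integral_ind)
  also have "\<dots> = (\<integral>\<^sup>+x. (\<Sum>a\<in>hecke_idx n p. wt x * indicator (X a) x) \<partial>count_space UNIV)"
    by (rule nn_integral_sum[symmetric]) simp
  also have "\<dots> \<le> (\<integral>\<^sup>+x. (\<Sum>\<Lambda>\<in>T. wt x * indicator (fib n \<Lambda>) x) \<partial>count_space UNIV)"
  proof (rule nn_integral_mono)
    fix x
    show "(\<Sum>a\<in>hecke_idx n p. wt x * indicator (X a) x) \<le> (\<Sum>\<Lambda>\<in>T. wt x * indicator (fib n \<Lambda>) x)"
    proof (cases "\<exists>a\<in>hecke_idx n p. x \<in> X a")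
      case True
      then obtain a where a: "a \<in> hecke_idx n p" "x \<in> X a" by blast
      have xS: "x \<in> SL n" using a by (simp add: X_def)
      have uniq: "b = a" if "b \<in> hecke_idx n p" "x \<in> X b" for b
        using hecke_inj[OF n_pos p0 xS that(1) a(1)] that a by (simp add: X_def)
      have "wt x * indicator (X b) x = (if b = a then wt x else 0)" if "b \<in> hecke_idx n p" for b
        using uniq[OF that] a(2) by (cases "x \<in> X b") auto
      then have "(\<Sum>b\<in>hecke_idx n p. wt x * indicator (X b) x) = (\<Sum>b\<in>hecke_idx n p. if b = a then wt x else 0)"
        by (rule sum.cong[OF refl])
      also have "\<dots> = wt x" using a fin by simp
      also have "\<dots> = wt x * indicator (fib n (row_lattice n x)) x" using xS by (simp add: fib_def)
      also have "\<dots> \<le> (\<Sum>\<Lambda>\<in>T. wt x * indicator (fib n \<Lambda>) x)"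
        by (rule member_le_sum[of "row_lattice n x" T "\<lambda>\<Lambda>. wt x * indicator (fib n \<Lambda>) x"]) (auto simp: finT XT[OF a(2)])
      finally show ?thesis .
    next
      case False
      then have "(\<Sum>a\<in>hecke_idx n p. wt x * indicator (X a) x) = 0" by (intro sum.neutral) auto
      then show ?thesis by simp
    qed
  qed
  also have "\<dots> = (\<Sum>\<Lambda>\<in>T. \<integral>\<^sup>+x. wt x * indicator (fib n \<Lambda>) x \<partial>count_space UNIV)"
    by (rule nn_integral_sum) simp
  also have "\<dots> = (\<Sum>\<Lambda>\<in>T. lsum n wt \<Lambda>)"
    unfolding lsum_def by (intro sum.cong refl nn_integral_ind[symmetric])
  also have "\<dots> = of_nat (card T)" using lsum_wt by (simp add: T_def)
  also have "\<dots> \<le> of_nat (\<Sum>i<n. p ^ i)" using cardT by (simp only: of_nat_le_iff)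
  finally show ?thesis .
qed

text \<open>As \<open>\<Delta>\<close> is 1 on \<open>hecke_mat\<close>, the translation can be
  moved from \<open>F\<close> to the weight. Unfolding then leaves \<open>F L\<close> multiplied by
  the translated fibre sums of \<open>wt\<close>, which \<open>lsum_wt_hecke\<close> bounds for each
  \<open>L\<close>.\<close>

theorem hecke_inequality:
  assumes p: "prime p" and F[measurable]: "F \<in> borel_measurable (lattice_space n)"
  shows "(\<Sum>a\<in>hecke_idx n p. \<integral>\<^sup>+g. wt g * F (row_lattice n (hecke_mat n p a * g)) \<partial>m)
    \<le> of_nat (\<Sum>i<n. p ^ i) * (\<integral>\<^sup>+L. F L \<partial>\<mu>)"
proof -
  have p0: "p > 0" using p by (simp add: prime_gt_0_nat)
  note hS = hecke_mat_SL[OF n_pos p0]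
  have wm: "(\<lambda>h. wt (adj_mat (hecke_mat n p a) * h)) \<in> borel_measurable (SL_borel n)" for a
    by (rule measurable_compose[OF measurable_SL_left[OF SL_adj(1)[OF hS]] measurable_wt])
  have one: "(\<integral>\<^sup>+g. wt g * F (row_lattice n (hecke_mat n p a * g)) \<partial>m)
      = (\<integral>\<^sup>+L. F L * lsum n (\<lambda>h. wt (adj_mat (hecke_mat n p a) * h)) L \<partial>\<mu>)" for a
  proof -
    define f where "f x = wt (adj_mat (hecke_mat n p a) * x) * F (row_lattice n x)" for x
    have fm: "f \<in> borel_measurable (SL_borel n)"
      unfolding f_def using wm by measurable
    have "(\<integral>\<^sup>+g. wt g * F (row_lattice n (hecke_mat n p a * g)) \<partial>m) = (\<integral>\<^sup>+g. f (hecke_mat n p a * g) \<partial>m)"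
      by (intro nn_integral_cong) (simp add: f_def SL_adj_cancel[OF hS])
    also have "\<dots> = (\<integral>\<^sup>+g. f g \<partial>m)"
      by (simp add: modular[OF fm hS] modular_hecke[OF p0])
    also have "\<dots> = (\<integral>\<^sup>+L. lsum n f L \<partial>\<mu>)" by (rule nn_integral_m[OF fm])
    also have "\<dots> = (\<integral>\<^sup>+L. F L * lsum n (\<lambda>h. wt (adj_mat (hecke_mat n p a) * h)) L \<partial>\<mu>)"
    proof (intro nn_integral_cong)
      fix L
      have "lsum n f L = (\<integral>\<^sup>+x. wt (adj_mat (hecke_mat n p a) * x) * F L \<partial>count_space (fib n L))"
        unfolding lsum_def f_def by (intro nn_integral_cong) (simp add: fib_def)
      also have "\<dots> = lsum n (\<lambda>h. wt (adj_mat (hecke_mat n p a) * h)) L * F L"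
        unfolding lsum_def by (rule nn_integral_multc) auto
      finally show "lsum n f L = F L * lsum n (\<lambda>h. wt (adj_mat (hecke_mat n p a) * h)) L"
        by (simp only: mult.commute)
    qed
    finally show ?thesis .
  qed
  have "(\<Sum>a\<in>hecke_idx n p. \<integral>\<^sup>+g. wt g * F (row_lattice n (hecke_mat n p a * g)) \<partial>m)
      = (\<integral>\<^sup>+L. F L * (\<Sum>a\<in>hecke_idx n p. lsum n (\<lambda>h. wt (adj_mat (hecke_mat n p a) * h)) L) \<partial>\<mu>)"
    unfolding one sum_distrib_left using wm measurable_lsum[OF wm]
    by (subst nn_integral_sum) (auto cong: measurable_cong_sets simp: sets_mu)
  also have "\<dots> \<le> (\<integral>\<^sup>+L. of_nat (\<Sum>i<n. p ^ i) * F L \<partial>\<mu>)"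
    by (intro nn_integral_mono)
       (use mult_left_mono[OF lsum_wt_hecke[OF p]] in \<open>auto simp: space_mu mult.commute\<close>)
  also have "\<dots> = of_nat (\<Sum>i<n. p ^ i) * (\<integral>\<^sup>+L. F L \<partial>\<mu>)"
    by (rule nn_integral_cmult) measurable
  finally show ?thesis .
qed

end

section \<open>Volumes of ellipsoids\<close>

definition qf :: "nat \<Rightarrow> real mat \<Rightarrow> (nat \<Rightarrow> real) \<Rightarrow> real" where
  "qf n S x = (\<Sum>i<n. \<Sum>j<n. index_mat S (i, j) * x i * x j)"

abbreviation lbn :: "nat \<Rightarrow> (nat \<Rightarrow> real) measure" where
  "lbn n \<equiv> Pi\<^sub>M {..<n} (\<lambda>_. lborel)"

definition schur :: "nat \<Rightarrow> real mat \<Rightarrow> real mat" where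
  "schur n S = mat n n (\<lambda>(i, j). index_mat S (i, j) - index_mat S (i, n) * index_mat S (j, n) / index_mat S (n, n))"

definition posdef :: "nat \<Rightarrow> real mat \<Rightarrow> bool" where
  "posdef n S \<longleftrightarrow> S \<in> carrier_mat n n \<and> (\<forall>i<n. \<forall>j<n. index_mat S (i, j) = index_mat S (j, i))
     \<and> (\<forall>x. (\<exists>i<n. x i \<noteq> 0) \<longrightarrow> qf n S x > 0)"

lemma qf_cong: "(\<And>i. i < n \<Longrightarrow> x i = y i) \<Longrightarrow> qf n S x = qf n S y"
  unfolding qf_def by (intro sum.cong refl) auto

lemma posdefD: "posdef n S \<Longrightarrow> i < n \<Longrightarrow> x i \<noteq> 0 \<Longrightarrow> 0 < qf n S x"
  unfolding posdef_def by blast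

lemma posdef_diag: 
  assumes "posdef (Suc n) S" shows "index_mat S (n, n) > 0"
proof -
  let ?x = "\<lambda>i. if i = n then 1 else 0 :: real"
  have "qf (Suc n) S ?x > 0" by (rule posdefD[OF assms, of n]) auto
  moreover have "qf (Suc n) S ?x = index_mat S (n, n)" by (simp add: qf_def)
  ultimately show ?thesis by simp
qed

lemma qf_schur:
  assumes pd: "posdef (Suc n) S"
  shows "qf (Suc n) S x = index_mat S (n, n) * (x n + (\<Sum>i<n. index_mat S (i, n) * x i) / index_mat S (n, n))\<^sup>2 + qf n (schur n S) x"
proof -
  define s where "s = index_mat S (n, n)"
  define B where "B = (\<Sum>i<n. index_mat S (i, n) * x i)"
  have sp: "s > 0" using posdef_diag[OF pd] by (simp add: s_def)
  have sym: "index_mat S (i, j) = index_mat S (j, i)" if "i < Suc n" "j < Suc n" for i j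
    using pd that unfolding posdef_def by blast
  have "qf (Suc n) S x = (\<Sum>i<n. \<Sum>j<n. index_mat S (i, j) * x i * x j) + (\<Sum>i<n. index_mat S (i, n) * x i * x n)
      + ((\<Sum>j<n. index_mat S (n, j) * x n * x j) + s * x n * x n)"
    by (simp add: qf_def sum.distrib s_def)
  also have "(\<Sum>i<n. index_mat S (i, n) * x i * x n) = B * x n" by (simp add: B_def sum_distrib_right)
  also have "(\<Sum>j<n. index_mat S (n, j) * x n * x j) = B * x n"
    unfolding B_def sum_distrib_right using sym by (intro sum.cong) (auto simp: mult_ac)
  finally have 1: "qf (Suc n) S x = (\<Sum>i<n. \<Sum>j<n. index_mat S (i, j) * x i * x j) + 2 * B * x n + s * (x n)\<^sup>2"
    by (simp add: power2_eq_square)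
  have "qf n (schur n S) x = (\<Sum>i<n. \<Sum>j<n. index_mat S (i, j) * x i * x j - (index_mat S (i, n) * x i) * (index_mat S (j, n) * x j) / s)"
    unfolding qf_def schur_def s_def by (intro sum.cong refl) (simp add: algebra_simps)
  also have "\<dots> = (\<Sum>i<n. \<Sum>j<n. index_mat S (i, j) * x i * x j) - (\<Sum>i<n. \<Sum>j<n. (index_mat S (i, n) * x i) * (index_mat S (j, n) * x j)) / s"
    by (simp add: sum_subtractf sum_divide_distrib)
  also have "(\<Sum>i<n. \<Sum>j<n. (index_mat S (i, n) * x i) * (index_mat S (j, n) * x j)) = B * B"
    unfolding B_def by (simp add: sum_product)
  finally have 2: "qf n (schur n S) x = (\<Sum>i<n. \<Sum>j<n. index_mat S (i, j) * x i * x j) - B * B / s" .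
  have "s * (x n + B / s)\<^sup>2 = s * (x n)\<^sup>2 + 2 * B * x n + B * B / s"
    using sp by (simp add: power2_eq_square field_simps)
  then show ?thesis unfolding 1 2 s_def[symmetric] B_def[symmetric] by simp
qed

text \<open>Column operations, collected in the unipotent \<open>V\<close>, clear the last row up to
  the pivot. What remains is block triangular.\<close>

lemma det_schur:
  assumes pd: "posdef (Suc n) S"
  shows "det S = index_mat S (n, n) * det (schur n S)"
proof -
  let ?s = "index_mat S (n, n)"
  have S: "S \<in> carrier_mat (Suc n) (Suc n)" and s: "?s \<noteq> 0"
    using pd posdef_diag[OF pd] by (auto simp: posdef_def)
  have sym: "index_mat S (i, j) = index_mat S (j, i)" if "i < Suc n" "j < Suc n" for i j
    using pd that unfolding posdef_def by blast
  define V where "V = mat (Suc n) (Suc n) (\<lambda>(i, j). if i = j then 1 else if i = n then - index_mat S (j, n) / ?s else 0)"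
  have V: "V \<in> carrier_mat (Suc n) (Suc n)" by (simp add: V_def)
  have "det V = prod_list (diag_mat V)"
    by (rule det_lower_triangular[OF _ V]) (auto simp: V_def)
  also have "diag_mat V = map (\<lambda>_. 1) [0..<Suc n]"
    by (auto simp: diag_mat_def V_def intro!: map_cong)
  finally have dV: "det V = 1" by (simp add: map_replicate_const del: upt_Suc)
  define E where "E = four_block_mat (schur n S) (mat n 1 (\<lambda>(i, _). index_mat S (i, n))) (0\<^sub>m 1 n) (mat 1 1 (\<lambda>_. ?s))"
  have SV: "S * V = E"
  proof (rule eq_matI)
    fix i j assume "i < dim_row E" "j < dim_col E"
    then have i: "i < Suc n" and j: "j < Suc n" by (auto simp: E_def schur_def)
    have "index_mat (S * V) (i, j) = (\<Sum>k<Suc n. index_mat S (i, k) * index_mat V (k, j))"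
      using S V i j by (simp add: scalar_prod_def lessThan_atLeast0 del: sum.lessThan_Suc)
    also have "\<dots> = (\<Sum>k<n. index_mat S (i, k) * (if k = j then 1 else 0)) + index_mat S (i, n) * index_mat V (n, j)"
      using j by (auto simp: V_def intro!: sum.cong)
    also have "(\<Sum>k<n. index_mat S (i, k) * (if k = j then 1 else 0)) = (\<Sum>k<n. if k = j then index_mat S (i, j) else 0)"
      by (intro sum.cong) auto
    also have "\<dots> = (if j < n then index_mat S (i, j) else 0)" by simp
    finally have "index_mat (S * V) (i, j) = (if j < n then index_mat S (i, j) else 0) + index_mat S (i, n) * index_mat V (n, j)" .
    then show "index_mat (S * V) (i, j) = index_mat E (i, j)"
      using i j s sym[of j n] by (auto simp: E_def V_def schur_def less_Suc_eq)
  qed (use S V in \<open>auto simp: E_def schur_def\<close>)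
  have "det S = det S * det V" by (simp add: dV)
  also have "\<dots> = det E" using det_mult[OF S V] SV by simp
  also have "\<dots> = det (schur n S) * det (mat 1 1 (\<lambda>_. ?s))"
    unfolding E_def by (rule det_four_block_mat_lower_left_zero) (auto simp: schur_def)
  also have "det (mat 1 1 (\<lambda>_. ?s)) = ?s" by (simp add: det_def)
  finally show ?thesis by simp
qed

lemma posdef_schur:
  assumes "posdef (Suc n) S" shows "posdef n (schur n S)"
  unfolding posdef_def
proof (intro conjI allI impI)
  have sym: "index_mat S (i, j) = index_mat S (j, i)" if "i < Suc n" "j < Suc n" for i j
    using assms that unfolding posdef_def by blast
  show "schur n S \<in> carrier_mat n n" by (simp add: schur_def)
  show "index_mat (schur n S) (i, j) = index_mat (schur n S) (j, i)" if "i < n" "j < n" for i j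
    using that sym by (simp add: schur_def mult.commute)
  fix x :: "nat \<Rightarrow> real" assume x: "\<exists>i<n. x i \<noteq> 0"
  define y where "y = x(n := - (\<Sum>i<n. index_mat S (i, n) * x i) / index_mat S (n, n))"
  from x obtain i where "i < n" "x i \<noteq> 0" by blast
  then have "0 < qf (Suc n) S y" by (intro posdefD[OF assms, of i]) (auto simp: y_def)
  also have "qf (Suc n) S y = qf n (schur n S) y"
    unfolding qf_schur[OF assms] by (simp add: y_def)
  also have "\<dots> = qf n (schur n S) x" by (rule qf_cong) (simp add: y_def)
  finally show "0 < qf n (schur n S) x" .
qed

lemma measurable_qf [measurable]: "qf n S \<in> borel_measurable (Pi\<^sub>M {..<n} (\<lambda>_. lborel))"
  unfolding qf_def by (intro borel_measurable_sum borel_measurable_times) (auto intro!: measurable_component_singleton)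

lemma measurable_sumsq: "(\<lambda>x. \<Sum>i<n. (x i)\<^sup>2) \<in> borel_measurable (lbn n)"
  by (intro borel_measurable_sum borel_measurable_power) (auto intro!: measurable_component_singleton)

lemma nn_integral_square_shift:
  fixes F :: "real \<Rightarrow> ennreal" and s b q :: real
  assumes [measurable]: "F \<in> borel_measurable borel" and s: "s > 0"
  shows "ennreal (sqrt s) * (\<integral>\<^sup>+y. F (s * (y + b)\<^sup>2 + q) \<partial>lborel) = (\<integral>\<^sup>+y. F (y\<^sup>2 + q) \<partial>lborel)"
proof -
  have "(\<integral>\<^sup>+y. F (y\<^sup>2 + q) \<partial>lborel) = \<bar>sqrt s\<bar> * (\<integral>\<^sup>+y. F ((sqrt s * b + sqrt s * y)\<^sup>2 + q) \<partial>lborel)"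
    using s by (intro nn_integral_real_affine) auto
  also have "(\<lambda>y. F ((sqrt s * b + sqrt s * y)\<^sup>2 + q)) = (\<lambda>y. F (s * (y + b)\<^sup>2 + q))"
  proof
    fix y
    have "(sqrt s * b + sqrt s * y)\<^sup>2 = (sqrt s)\<^sup>2 * (y + b)\<^sup>2"
      unfolding power_mult_distrib[symmetric] by (simp add: algebra_simps)
    then show "F ((sqrt s * b + sqrt s * y)\<^sup>2 + q) = F (s * (y + b)\<^sup>2 + q)" using s by simp
  qed
  finally show ?thesis using s by simp
qed

text \<open>Completing the square in the last variable reduces the dimension by one and splits the
  pivot off the determinant, so a linear change of variables comes down to one-dimensional
  substitutions. The function \<open>F\<close> varies in the induction because the eliminated square
  is added to its argument.\<close>

lemma ellipsoid_integral:
  assumes "posdef n S" "F \<in> borel_measurable borel"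
  shows "det S > 0 \<and> ennreal (sqrt (det S)) * (\<integral>\<^sup>+x. F (qf n S x) \<partial>lbn n) = (\<integral>\<^sup>+x. F (\<Sum>i<n. (x i)\<^sup>2) \<partial>lbn n)"
  using assms
proof (induction n arbitrary: S F)
  case 0
  then have "det S = 1" by (simp add: posdef_def)
  then show ?case by (simp add: qf_def)
next
  case (Suc n)
  note pd = Suc.prems(1) and F[measurable] = Suc.prems(2)
  define s where "s = index_mat S (n, n)"
  have s: "s > 0" using posdef_diag[OF pd] by (simp add: s_def)
  have dS: "det S = s * det (schur n S)" using det_schur[OF pd] by (simp add: s_def)
  note IH = Suc.IH[OF posdef_schur[OF pd]]
  \<comment> \<open>Positivity of the determinant is carried along in the statement; any
    \<open>F\<close> gives access to it.\<close>
  have dpos: "det (schur n S) > 0" using IH[of "\<lambda>_. 0"] by simp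
  interpret product_sigma_finite "\<lambda>_ :: nat. lborel :: real measure"
    by (rule product_sigma_finite.intro) (rule sigma_finite_lborel)
  interpret pair_sigma_finite "lbn n" "lborel :: real measure"
    by (intro pair_sigma_finite.intro sigma_finite finite_lessThan sigma_finite_lborel)
  have qm: "(\<lambda>z. qf n S' (fst z)) \<in> borel_measurable (lbn n \<Otimes>\<^sub>M lborel)" for S'
    by (rule measurable_compose[OF measurable_fst measurable_qf])
  have qm2: "(\<lambda>z. qf n S' (snd z)) \<in> borel_measurable (lborel \<Otimes>\<^sub>M lbn n)" for S'
    by (rule measurable_compose[OF measurable_snd measurable_qf])
  have "ennreal (sqrt s) * (\<integral>\<^sup>+x. F (qf (Suc n) S x) \<partial>lbn (Suc n))
      = ennreal (sqrt s) * (\<integral>\<^sup>+x. \<integral>\<^sup>+y. F (qf (Suc n) S (x(n := y))) \<partial>lborel \<partial>lbn n)"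
    unfolding lessThan_Suc
    by (subst product_nn_integral_insert) (use measurable_qf[of "Suc n" S] in \<open>auto simp: lessThan_Suc\<close>)
  also have "\<dots> = ennreal (sqrt s) * (\<integral>\<^sup>+x. \<integral>\<^sup>+y. F (s * (y + (\<Sum>i<n. index_mat S (i, n) * x i) / s)\<^sup>2 + qf n (schur n S) x) \<partial>lborel \<partial>lbn n)"
  proof -
    have "qf (Suc n) S (x(n := y)) = s * (y + (\<Sum>i<n. index_mat S (i, n) * x i) / s)\<^sup>2 + qf n (schur n S) x" for x y
      unfolding qf_schur[OF pd]
      using qf_cong[of n "x(n := y)" x "schur n S"] by (simp add: s_def)
    then show ?thesis by simp
  qed
  also have "\<dots> = (\<integral>\<^sup>+x. ennreal (sqrt s) * (\<integral>\<^sup>+y. F (s * (y + (\<Sum>i<n. index_mat S (i, n) * x i) / s)\<^sup>2 + qf n (schur n S) x) \<partial>lborel) \<partial>lbn n)"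
  proof (rule nn_integral_cmult[symmetric])
    have [measurable]: "(\<lambda>z. \<Sum>i<n. index_mat S (i, n) * fst z i) \<in> borel_measurable (lbn n \<Otimes>\<^sub>M (lborel :: real measure))"
      by (rule measurable_compose[OF measurable_fst])
         (intro borel_measurable_sum borel_measurable_times, auto intro!: measurable_component_singleton)
    note qm[measurable]
    show "(\<lambda>x. \<integral>\<^sup>+y. F (s * (y + (\<Sum>i<n. index_mat S (i, n) * x i) / s)\<^sup>2 + qf n (schur n S) x) \<partial>lborel) \<in> borel_measurable (lbn n)"
      by (intro lborel.borel_measurable_nn_integral) (simp add: case_prod_beta)
  qed
  also have "\<dots> = (\<integral>\<^sup>+x. \<integral>\<^sup>+y. F (y\<^sup>2 + qf n (schur n S) x) \<partial>lborel \<partial>lbn n)"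
    by (intro nn_integral_cong nn_integral_square_shift F s)
  also have "\<dots> = (\<integral>\<^sup>+y. \<integral>\<^sup>+x. F (y\<^sup>2 + qf n (schur n S) x) \<partial>lbn n \<partial>lborel)"
    by (rule Fubini'[symmetric]) (use qm in \<open>simp add: case_prod_beta\<close>)
  finally have 1: "ennreal (sqrt s) * (\<integral>\<^sup>+x. F (qf (Suc n) S x) \<partial>lbn (Suc n))
      = (\<integral>\<^sup>+y. \<integral>\<^sup>+x. F (y\<^sup>2 + qf n (schur n S) x) \<partial>lbn n \<partial>lborel)" .
  have "ennreal (sqrt (det S)) * (\<integral>\<^sup>+x. F (qf (Suc n) S x) \<partial>lbn (Suc n))
      = ennreal (sqrt (det (schur n S))) * (ennreal (sqrt s) * (\<integral>\<^sup>+x. F (qf (Suc n) S x) \<partial>lbn (Suc n)))"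
    unfolding dS using s dpos by (simp add: real_sqrt_mult ennreal_mult mult_ac)
  also have "\<dots> = ennreal (sqrt (det (schur n S))) * (\<integral>\<^sup>+y. \<integral>\<^sup>+x. F (y\<^sup>2 + qf n (schur n S) x) \<partial>lbn n \<partial>lborel)"
    unfolding 1 ..
  also have "\<dots> = (\<integral>\<^sup>+y. ennreal (sqrt (det (schur n S))) * (\<integral>\<^sup>+x. F (y\<^sup>2 + qf n (schur n S) x) \<partial>lbn n) \<partial>lborel)"
  proof (rule nn_integral_cmult[symmetric])
    have "case_prod (\<lambda>y x. F (y\<^sup>2 + qf n (schur n S) x)) \<in> borel_measurable (lborel \<Otimes>\<^sub>M lbn n)"
      using qm2 by (simp add: case_prod_beta)
    then show "(\<lambda>y. \<integral>\<^sup>+x. F (y\<^sup>2 + qf n (schur n S) x) \<partial>lbn n) \<in> borel_measurable lborel"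
      by (rule M1.borel_measurable_nn_integral)
  qed
  also have "\<dots> = (\<integral>\<^sup>+y. \<integral>\<^sup>+x. F (y\<^sup>2 + (\<Sum>i<n. (x i)\<^sup>2)) \<partial>lbn n \<partial>lborel)"
  proof (rule nn_integral_cong)
    fix y :: real
    show "ennreal (sqrt (det (schur n S))) * (\<integral>\<^sup>+x. F (y\<^sup>2 + qf n (schur n S) x) \<partial>lbn n) = (\<integral>\<^sup>+x. F (y\<^sup>2 + (\<Sum>i<n. (x i)\<^sup>2)) \<partial>lbn n)"
      using IH[of "\<lambda>t. F (y\<^sup>2 + t)"] by simp
  qed
  also have "\<dots> = (\<integral>\<^sup>+x. F (\<Sum>i<Suc n. (x i)\<^sup>2) \<partial>lbn (Suc n))"
  proof -
    have "(\<Sum>i<Suc n. ((x(n := y)) i)\<^sup>2) = y\<^sup>2 + (\<Sum>i<n. (x i)\<^sup>2)" for x :: "nat \<Rightarrow> real" and y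
      by (simp add: add.commute)
    then show ?thesis
      unfolding lessThan_Suc
      by (subst product_nn_integral_insert_rev) (use measurable_sumsq[of "Suc n"] in \<open>auto simp: lessThan_Suc\<close>)
  qed
  finally show ?case using s dpos dS by simp
qed

section \<open>Counting lattice points\<close>

definition nq :: "nat \<Rightarrow> real mat \<Rightarrow> (nat \<Rightarrow> real) \<Rightarrow> real" where
  "nq n g x = L2_set (\<lambda>j. \<Sum>i<n. index_mat g (i, j) * x i) {..<n}"

lemma euclid_norm_pt: "euclid_norm (pt n g x) = nq n g x"
  by (simp add: euclid_norm_def pt_def nq_def L2_set_def scalar_prod_def power2_eq_square lessThan_atLeast0)

lemma nq_nonneg: "0 \<le> nq n g x"
  by (simp add: nq_def)

lemma nq_cong: "(\<And>i. i < n \<Longrightarrow> x i = y i) \<Longrightarrow> nq n g x = nq n g y"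
  unfolding euclid_norm_pt[symmetric] by (rule arg_cong[OF pt_cong])

lemma nq_scale: "nq n g (\<lambda>i. c * x i) = \<bar>c\<bar> * nq n g x"
proof -
  have "nq n g (\<lambda>i. c * x i) = L2_set (\<lambda>j. c * (\<Sum>i<n. index_mat g (i, j) * x i)) {..<n}"
    unfolding nq_def by (simp add: sum_distrib_left mult_ac)
  then show ?thesis
    unfolding nq_def L2_set_def by (simp add: power_mult_distrib sum_distrib_left[symmetric] real_sqrt_mult)
qed

lemma nq_triangle: "nq n g (\<lambda>i. x i + y i) \<le> nq n g x + nq n g y"
  unfolding nq_def using L2_set_triangle_ineq by (simp add: distrib_left sum.distrib)

lemma nq_le_nrm:
  assumes "\<And>i. i < n \<Longrightarrow> \<bar>x i\<bar> \<le> 1"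
  shows "nq n g x \<le> nrm n g"
proof -
  have "nq n g x \<le> (\<Sum>j<n. \<bar>\<Sum>i<n. index_mat g (i, j) * x i\<bar>)"
    unfolding nq_def by (rule L2_set_le_sum_abs)
  also have "\<dots> \<le> (\<Sum>j<n. \<Sum>i<n. \<bar>index_mat g (i, j)\<bar>)"
    using assms by (intro sum_mono order.trans[OF sum_abs]) (auto simp: abs_mult mult_left_le)
  also have "\<dots> = nrm n g" unfolding nrm_def by (rule sum.swap)
  finally show ?thesis .
qed

text \<open>The inverse matrix controls coordinates by the norm. This is what makes balls finite,
  keeps short nonzero vectors away from 0, and later makes coordinates smaller than the
  prime.\<close>

lemma coord_le_nq:
  assumes "g \<in> SL n" "i < n"
  shows "\<bar>x i\<bar> \<le> nrm n (adj_mat g) * nq n g x"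
proof -
  have "\<bar>vec_index (pt n g x) k\<bar> \<le> nq n g x" if "k < n" for k
    using that member_le_L2_set[of "{..<n}" k "\<lambda>j. \<bar>\<Sum>i<n. index_mat g (i, j) * x i\<bar>"]
    by (simp add: pt_def nq_def L2_set_def)
  then have "\<bar>x i\<bar> \<le> (\<Sum>k<n. \<bar>index_mat (adj_mat g) (k, i)\<bar> * nq n g x)"
    unfolding pt_recover[OF assms, of x]
    by (intro order.trans[OF sum_abs] sum_mono) (auto simp: abs_mult intro!: mult_left_mono)
  also have "\<dots> \<le> nrm n (adj_mat g) * nq n g x"
    unfolding sum_distrib_right[symmetric] nrm_def using assms(2)
    by (intro mult_right_mono nq_nonneg sum_mono member_le_sum) auto
  finally show ?thesis .
qed

lemma nq_zero_imp: "g \<in> SL n \<Longrightarrow> nq n g x = 0 \<Longrightarrow> i < n \<Longrightarrow> x i = 0"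
  using coord_le_nq[of g n i x] by simp

text \<open>The square of \<open>nq n g\<close> is the quadratic form of the Gram matrix
  \<open>g * transpose_mat g\<close>, whose determinant is 1, so the ellipsoid has the volume of a
  ball.\<close>

lemma emeasure_ellipsoid:
  assumes g: "g \<in> SL n" and T: "T > 0"
  shows "emeasure (lbn n) {x \<in> space (lbn n). nq n g x \<le> T} = ennreal (unit_ball_vol (real n) * T ^ n)"
proof -
  let ?S = "g * transpose_mat g"
  have gc: "g \<in> carrier_mat n n" and dg: "det g = 1" using g by (auto simp: SL_def)
  have entry: "index_mat ?S (i, j) = (\<Sum>k<n. index_mat g (i, k) * index_mat g (j, k))" if "i < n" "j < n" for i j
    using gc that by (simp add: scalar_prod_def lessThan_atLeast0)
  have q: "qf n ?S x = (nq n g x)\<^sup>2" for x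
  proof -
    have "(nq n g x)\<^sup>2 = (\<Sum>k<n. (\<Sum>i<n. index_mat g (i, k) * x i)\<^sup>2)"
      unfolding nq_def L2_set_def by (simp add: sum_nonneg)
    also have "\<dots> = (\<Sum>k<n. \<Sum>i<n. \<Sum>j<n. (index_mat g (i, k) * x i) * (index_mat g (j, k) * x j))"
      by (simp add: power2_eq_square sum_product)
    also have "\<dots> = (\<Sum>i<n. \<Sum>k<n. \<Sum>j<n. (index_mat g (i, k) * x i) * (index_mat g (j, k) * x j))"
      by (rule sum.swap)
    also have "\<dots> = (\<Sum>i<n. \<Sum>j<n. \<Sum>k<n. (index_mat g (i, k) * x i) * (index_mat g (j, k) * x j))"
      by (intro sum.cong refl sum.swap)
    also have "\<dots> = qf n ?S x"
      unfolding qf_def by (intro sum.cong refl) (simp add: entry sum_distrib_right sum_distrib_left mult_ac)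
    finally show ?thesis ..
  qed
  have pd: "posdef n ?S"
    unfolding posdef_def
  proof (intro conjI allI impI)
    show "?S \<in> carrier_mat n n" using gc by simp
    show "index_mat ?S (i, j) = index_mat ?S (j, i)" if "i < n" "j < n" for i j
      using that by (simp add: entry mult.commute)
    fix x :: "nat \<Rightarrow> real" assume "\<exists>i<n. x i \<noteq> 0"
    then have "nq n g x \<noteq> 0" using nq_zero_imp[OF g] by blast
    then show "0 < qf n ?S x" by (simp add: q)
  qed
  have dS: "det ?S = 1" using det_mult[OF gc, of "transpose_mat g"] gc dg by (simp add: det_transpose)
  have sp: "{x \<in> space (lbn n). nq n g x \<le> T} \<in> sets (lbn n)"
  proof -
    have "{x \<in> space (lbn n). qf n ?S x \<le> T\<^sup>2} \<in> sets (lbn n)" by measurable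
    then show ?thesis unfolding q using T nq_nonneg by (simp add: power2_le_iff_abs_le abs_le_square_iff[symmetric])
  qed
  have le: "nq n g x \<le> T \<longleftrightarrow> (nq n g x)\<^sup>2 \<in> {..T\<^sup>2}" for x
    using T nq_nonneg[of n g x] by (simp add: abs_le_square_iff[symmetric])
  have "emeasure (lbn n) {x \<in> space (lbn n). nq n g x \<le> T} = (\<integral>\<^sup>+x. indicator {x \<in> space (lbn n). nq n g x \<le> T} x \<partial>lbn n)"
    using sp by simp
  also have "\<dots> = (\<integral>\<^sup>+x. indicator {..T\<^sup>2} (qf n ?S x) \<partial>lbn n)"
    by (intro nn_integral_cong) (simp add: indicator_def q le)
  also have "\<dots> = (\<integral>\<^sup>+x. indicator {..T\<^sup>2} (\<Sum>i<n. (x i)\<^sup>2) \<partial>lbn n)"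
    using ellipsoid_integral[OF pd, of "indicator {..T\<^sup>2}"] dS by simp
  also have "\<dots> = (\<integral>\<^sup>+x. indicator ({x. sqrt (\<Sum>i<n. (x i)\<^sup>2) \<le> T} \<inter> space (lbn n)) x \<partial>lbn n)"
  proof (intro nn_integral_cong)
    fix x :: "nat \<Rightarrow> real" assume "x \<in> space (lbn n)"
    moreover have "sqrt (\<Sum>i<n. (x i)\<^sup>2) \<le> T \<longleftrightarrow> (\<Sum>i<n. (x i)\<^sup>2) \<le> T\<^sup>2"
      using T by (metis real_sqrt_le_iff real_sqrt_unique less_imp_le)
    ultimately show "indicator {..T\<^sup>2} (\<Sum>i<n. (x i)\<^sup>2) = (indicator ({x. sqrt (\<Sum>i<n. (x i)\<^sup>2) \<le> T} \<inter> space (lbn n)) x :: ennreal)"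
      by (simp add: indicator_def)
  qed
  also have "\<dots> = emeasure (lbn n) ({x. sqrt (\<Sum>i<n. (x i)\<^sup>2) \<le> T} \<inter> space (lbn n))"
  proof (rule nn_integral_indicator)
    have "{x \<in> space (lbn n). sqrt (\<Sum>i<n. (x i)\<^sup>2) \<le> T} \<in> sets (lbn n)"
      using measurable_sumsq[of n] by measurable
    then show "{x. sqrt (\<Sum>i<n. (x i)\<^sup>2) \<le> T} \<inter> space (lbn n) \<in> sets (lbn n)"
      by (simp add: Int_def conj_commute)
  qed
  also have "\<dots> = ennreal (unit_ball_vol (real n) * T ^ n)"
    using emeasure_cball_aux[of "{..<n}" T] T by simp
  finally show ?thesis .
qed

text \<open>Functions extensional on \<open>{..<n}\<close>, so that each lattice point is counted
  once.\<close>

definition zpts :: "nat \<Rightarrow> real mat \<Rightarrow> real \<Rightarrow> (nat \<Rightarrow> int) set" where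
  "zpts n g T = {z \<in> PiE {..<n} (\<lambda>_. UNIV). nq n g (\<lambda>i. of_int (z i)) \<le> T}"

lemma zptsD: "z \<in> zpts n g T \<Longrightarrow> nq n g (\<lambda>i. of_int (z i)) \<le> T"
  by (simp add: zpts_def)

lemma finite_zpts:
  assumes "g \<in> SL n"
  shows "finite (zpts n g T)"
proof -
  define K where "K = \<lceil>nrm n (adj_mat g) * \<bar>T\<bar>\<rceil>"
  have "zpts n g T \<subseteq> PiE {..<n} (\<lambda>_. {- K..K})"
  proof
    fix z assume z: "z \<in> zpts n g T"
    have "z i \<in> {- K..K}" if "i < n" for i
    proof -
      have "\<bar>real_of_int (z i)\<bar> \<le> nrm n (adj_mat g) * nq n g (\<lambda>i. of_int (z i))"
        using coord_le_nq[OF assms that, of "\<lambda>i. of_int (z i)"] .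
      also have "\<dots> \<le> nrm n (adj_mat g) * \<bar>T\<bar>"
        using zptsD[OF z] by (intro mult_left_mono nrm_nonneg) linarith
      finally show ?thesis unfolding K_def by (simp add: abs_le_iff) linarith
    qed
    with z show "z \<in> PiE {..<n} (\<lambda>_. {- K..K})" by (simp add: zpts_def PiE_iff)
  qed
  then show ?thesis by (rule finite_subset) (intro finite_PiE, auto)
qed

lemma emeasure_floor_set:
  assumes Z: "finite Z" "Z \<subseteq> PiE {..<n} (\<lambda>_. UNIV :: int set)"
  shows "{x \<in> space (lbn n). (\<lambda>i\<in>{..<n}. \<lfloor>x i\<rfloor>) \<in> Z} \<in> sets (lbn n)"
    "emeasure (lbn n) {x \<in> space (lbn n). (\<lambda>i\<in>{..<n}. \<lfloor>x i\<rfloor>) \<in> Z} = of_nat (card Z)"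
proof -
  interpret product_sigma_finite "\<lambda>_ :: nat. lborel :: real measure"
    by (rule product_sigma_finite.intro) (rule sigma_finite_lborel)
  define Q where "Q z = PiE {..<n} (\<lambda>i. {real_of_int (z i)..<of_int (z i) + 1})" for z :: "nat \<Rightarrow> int"
  have Qs: "Q z \<in> sets (lbn n)" for z unfolding Q_def by (intro sets_PiM_I_finite) auto
  have Qm: "emeasure (lbn n) (Q z) = 1" for z
    unfolding Q_def by (subst emeasure_PiM) auto
  have QI: "x \<in> Q z \<longleftrightarrow> x \<in> space (lbn n) \<and> (\<lambda>i\<in>{..<n}. \<lfloor>x i\<rfloor>) = z" if "z \<in> Z" for x z
  proof
    assume "x \<in> Q z"
    moreover have "z \<in> extensional {..<n}" using that Z by (auto simp: PiE_iff)
    ultimately show "x \<in> space (lbn n) \<and> (\<lambda>i\<in>{..<n}. \<lfloor>x i\<rfloor>) = z"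
      by (auto simp: Q_def space_PiM PiE_iff fun_eq_iff extensional_def floor_eq_iff)
  next
    assume "x \<in> space (lbn n) \<and> (\<lambda>i\<in>{..<n}. \<lfloor>x i\<rfloor>) = z"
    then show "x \<in> Q z"
      by (auto simp: Q_def space_PiM PiE_iff)
  qed
  have eq: "{x \<in> space (lbn n). (\<lambda>i\<in>{..<n}. \<lfloor>x i\<rfloor>) \<in> Z} = (\<Union>z\<in>Z. Q z)"
    using QI Z by (intro subset_antisym subsetI) auto
  show "{x \<in> space (lbn n). (\<lambda>i\<in>{..<n}. \<lfloor>x i\<rfloor>) \<in> Z} \<in> sets (lbn n)"
    unfolding eq using Z Qs by (intro sets.finite_UN) auto
  have "emeasure (lbn n) (\<Union>z\<in>Z. Q z) = (\<Sum>z\<in>Z. emeasure (lbn n) (Q z))"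
  proof (rule sym, rule sum_emeasure)
    show "disjoint_family_on Q Z"
      by (auto simp: disjoint_family_on_def QI)
  qed (use Qs Z in auto)
  then show "emeasure (lbn n) {x \<in> space (lbn n). (\<lambda>i\<in>{..<n}. \<lfloor>x i\<rfloor>) \<in> Z} = of_nat (card Z)"
    unfolding eq by (simp add: Qm)
qed

text \<open>Each counted point is assigned the unit cube of real points with this floor. Rounding
  moves a point by at most \<open>nrm n g\<close>, so the union of the cubes lies between the
  ellipsoids of radii \<open>T - nrm n g\<close> and \<open>T + nrm n g\<close>.\<close>

lemma card_zpts_bounds:
  assumes g: "g \<in> SL n" and T: "T > 0"
  shows "real (card (zpts n g T)) \<le> unit_ball_vol (real n) * (T + nrm n g) ^ n"
    "nrm n g < T \<Longrightarrow> unit_ball_vol (real n) * (T - nrm n g) ^ n \<le> real (card (zpts n g T))"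
proof -
  let ?C = "nrm n g" and ?fl = "\<lambda>x :: nat \<Rightarrow> real. \<lambda>i\<in>{..<n}. \<lfloor>x i\<rfloor>"
  let ?A = "{x \<in> space (lbn n). ?fl x \<in> zpts n g T}"
  have Zs: "zpts n g T \<subseteq> PiE {..<n} (\<lambda>_. UNIV)" by (auto simp: zpts_def)
  note fin = finite_zpts[OF g, of T]
  have A: "?A \<in> sets (lbn n)" "emeasure (lbn n) ?A = of_nat (card (zpts n g T))"
    using emeasure_floor_set[OF fin Zs] by auto
  have close1: "nq n g (\<lambda>i. of_int (?fl x i)) \<le> nq n g x + ?C" for x
  proof -
    have "nq n g (\<lambda>i. of_int (?fl x i)) = nq n g (\<lambda>i. x i + (of_int \<lfloor>x i\<rfloor> - x i))"
      by (rule nq_cong) simp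
    also have "\<dots> \<le> nq n g x + nq n g (\<lambda>i. of_int \<lfloor>x i\<rfloor> - x i)" by (rule nq_triangle)
    also have "nq n g (\<lambda>i. of_int \<lfloor>x i\<rfloor> - x i) \<le> ?C" by (rule nq_le_nrm) linarith
    finally show ?thesis by simp
  qed
  have close2: "nq n g x \<le> nq n g (\<lambda>i. of_int (?fl x i)) + ?C" for x
  proof -
    have "nq n g x = nq n g (\<lambda>i. of_int \<lfloor>x i\<rfloor> + (x i - of_int \<lfloor>x i\<rfloor>))" by simp
    also have "\<dots> \<le> nq n g (\<lambda>i. of_int \<lfloor>x i\<rfloor>) + nq n g (\<lambda>i. x i - of_int \<lfloor>x i\<rfloor>)" by (rule nq_triangle)
    also have "nq n g (\<lambda>i. of_int \<lfloor>x i\<rfloor>) = nq n g (\<lambda>i. of_int (?fl x i))" by (rule nq_cong) simp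
    also have "nq n g (\<lambda>i. x i - of_int \<lfloor>x i\<rfloor>) \<le> ?C" by (rule nq_le_nrm) linarith
    finally show ?thesis by simp
  qed
  have meas: "{x \<in> space (lbn n). nq n g x \<le> r} \<in> sets (lbn n)" for r
    unfolding nq_def L2_set_def by measurable
  have fl: "?fl x \<in> PiE {..<n} (\<lambda>_. UNIV)" for x by auto
  have "?A \<subseteq> {x \<in> space (lbn n). nq n g x \<le> T + ?C}"
  proof (intro subsetI CollectI conjI)
    fix x assume x: "x \<in> ?A"
    then show "x \<in> space (lbn n)" by simp
    have "nq n g (\<lambda>i. of_int (?fl x i)) \<le> T" using x by (simp add: zpts_def)
    then show "nq n g x \<le> T + ?C" using close2[of x] by linarith
  qed
  from emeasure_mono[OF this meas] have "of_nat (card (zpts n g T)) \<le> ennreal (unit_ball_vol (real n) * (T + ?C) ^ n)"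
    using A emeasure_ellipsoid[OF g, of "T + ?C"] T nrm_nonneg[of n g] by simp
  then show "real (card (zpts n g T)) \<le> unit_ball_vol (real n) * (T + ?C) ^ n"
    using T nrm_nonneg[of n g] by (simp add: ennreal_of_nat_eq_real_of_nat)
  assume TC: "?C < T"
  have "{x \<in> space (lbn n). nq n g x \<le> T - ?C} \<subseteq> ?A"
  proof (intro subsetI CollectI conjI)
    fix x assume x: "x \<in> {x \<in> space (lbn n). nq n g x \<le> T - ?C}"
    then show "x \<in> space (lbn n)" by simp
    have "nq n g (\<lambda>i. of_int (?fl x i)) \<le> T" using x close1[of x] by simp
    then show "?fl x \<in> zpts n g T" unfolding zpts_def using fl[of x] by blast
  qed
  from emeasure_mono[OF this A(1)] have "ennreal (unit_ball_vol (real n) * (T - ?C) ^ n) \<le> of_nat (card (zpts n g T))"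
    using A emeasure_ellipsoid[OF g, of "T - ?C"] TC by simp
  then show "unit_ball_vol (real n) * (T - ?C) ^ n \<le> real (card (zpts n g T))"
    by (simp add: ennreal_of_nat_eq_real_of_nat)
qed

lemma card_zpts_asymp:
  assumes g: "g \<in> SL n"
  shows "((\<lambda>T. real (card (zpts n g T)) / T ^ n) \<longlongrightarrow> unit_ball_vol (real n)) at_top"
proof (rule tendsto_sandwich)
  let ?v = "unit_ball_vol (real n)" and ?C = "nrm n g"
  show "\<forall>\<^sub>F T in at_top. ?v * (1 - ?C / T) ^ n \<le> real (card (zpts n g T)) / T ^ n"
    using eventually_gt_at_top[of "max 0 ?C"]
  proof eventually_elim
    case (elim T)
    have "?v * (1 - ?C / T) ^ n = ?v * (T - ?C) ^ n / T ^ n"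
    proof -
      have "1 - ?C / T = (T - ?C) / T" using elim by (simp add: field_simps)
      then show ?thesis by (simp add: power_divide)
    qed
    also have "\<dots> \<le> real (card (zpts n g T)) / T ^ n"
      using elim card_zpts_bounds(2)[OF g, of T] by (intro divide_right_mono) auto
    finally show ?case .
  qed
  show "\<forall>\<^sub>F T in at_top. real (card (zpts n g T)) / T ^ n \<le> ?v * (1 + ?C / T) ^ n"
    using eventually_gt_at_top[of "max 0 ?C"]
  proof eventually_elim
    case (elim T)
    have "real (card (zpts n g T)) / T ^ n \<le> ?v * (T + ?C) ^ n / T ^ n"
      using elim card_zpts_bounds(1)[OF g, of T] by (intro divide_right_mono) auto
    also have "\<dots> = ?v * (1 + ?C / T) ^ n"
    proof -
      have "1 + ?C / T = (T + ?C) / T" using elim by (simp add: field_simps)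
      then show ?thesis by (simp add: power_divide)
    qed
    finally show ?case .
  qed
  have "((\<lambda>T. ?C / T) \<longlongrightarrow> 0) at_top"
    by (intro tendsto_divide_0[OF tendsto_const] filterlim_at_top_imp_at_infinity filterlim_ident)
  then have "((\<lambda>T. ?v * (1 - ?C / T) ^ n) \<longlongrightarrow> ?v * (1 - 0) ^ n) at_top"
    "((\<lambda>T. ?v * (1 + ?C / T) ^ n) \<longlongrightarrow> ?v * (1 + 0) ^ n) at_top"
    by (intro tendsto_intros; assumption)+
  then show "((\<lambda>T. ?v * (1 - ?C / T) ^ n) \<longlongrightarrow> ?v) at_top" "((\<lambda>T. ?v * (1 + ?C / T) ^ n) \<longlongrightarrow> ?v) at_top"
    by simp_all
qed

definition zpts0 :: "nat \<Rightarrow> real mat \<Rightarrow> real \<Rightarrow> (nat \<Rightarrow> int) set" where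
  "zpts0 n g T = {z \<in> zpts n g T. \<exists>i<n. z i \<noteq> 0}"

lemma finite_zpts0: "g \<in> SL n \<Longrightarrow> finite (zpts0 n g T)"
  using finite_zpts by (auto simp: zpts0_def)

lemma card_zpts0:
  assumes "g \<in> SL n" "T \<ge> 0"
  shows "card (zpts n g T) = Suc (card (zpts0 n g T))"
proof -
  let ?o = "\<lambda>i\<in>{..<n}. 0 :: int"
  have "nq n g (\<lambda>i. of_int (?o i)) = nq n g (\<lambda>i. 0 * 0)" by (rule nq_cong) simp
  also have "\<dots> = 0" using nq_scale[of n g 0 "\<lambda>_. 0"] by simp
  finally have o: "?o \<in> zpts n g T" using assms(2) by (simp add: zpts_def)
  have "zpts n g T = insert ?o (zpts0 n g T)"
  proof (intro subset_antisym subsetI)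
    fix z assume z: "z \<in> zpts n g T"
    show "z \<in> insert ?o (zpts0 n g T)"
    proof (cases "\<exists>i<n. z i \<noteq> 0")
      case False
      with z have "z = ?o" by (simp add: zpts_def PiE_iff extensional_def fun_eq_iff)
      then show ?thesis by simp
    qed (use z in \<open>simp add: zpts0_def\<close>)
  qed (use o in \<open>auto simp: zpts0_def\<close>)
  moreover have "?o \<notin> zpts0 n g T" by (auto simp: zpts0_def)
  ultimately show ?thesis using finite_zpts0[OF assms(1)] by simp
qed

lemma card_zpts0_asymp:
  assumes g: "g \<in> SL n" and n: "n > 0"
  shows "((\<lambda>T. real (card (zpts0 n g T)) / T ^ n) \<longlongrightarrow> unit_ball_vol (real n)) at_top"
proof -
  have "((\<lambda>T :: real. 1 / T ^ n) \<longlongrightarrow> 0) at_top"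
    using n by (intro tendsto_divide_0[OF tendsto_const] filterlim_at_top_imp_at_infinity filterlim_pow_at_top filterlim_ident)
  from tendsto_diff[OF card_zpts_asymp[OF g] this]
  have "((\<lambda>T. real (card (zpts n g T)) / T ^ n - 1 / T ^ n) \<longlongrightarrow> unit_ball_vol (real n)) at_top" by simp
  then show ?thesis
    by (rule Lim_transform_eventually)
       (use eventually_ge_at_top[of 0] in eventually_elim, simp add: card_zpts0[OF g] add_divide_distrib)
qed

text \<open>A bound without additive error, valid down to small \<open>T\<close>, is needed for a
  summable majorant in \<open>D_props\<close>. For small \<open>T\<close> there is no nonzero point
  at all; otherwise the boundary term is absorbed into the constant.\<close>

lemma card_zpts0_bound:
  assumes g: "g \<in> SL n"
  shows "\<exists>K\<ge>0. \<forall>T>0. real (card (zpts0 n g T)) \<le> K * T ^ n"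
proof -
  define c where "c = 1 + nrm n (adj_mat g)"
  have c: "c > 0" using nrm_nonneg[of n "adj_mat g"] by (simp add: c_def)
  define K where "K = unit_ball_vol (real n) * (1 + c * nrm n g) ^ n"
  have K: "K \<ge> 0" using c nrm_nonneg[of n g] by (simp add: K_def)
  have "real (card (zpts0 n g T)) \<le> K * T ^ n" if T: "T > 0" for T
  proof (cases "c * T \<ge> 1")
    case True
    have "zpts0 n g T \<subseteq> zpts n g T" by (auto simp: zpts0_def)
    then have "real (card (zpts0 n g T)) \<le> real (card (zpts n g T))"
      using finite_zpts[OF g] by (simp add: card_mono)
    also have "\<dots> \<le> unit_ball_vol (real n) * (T + nrm n g) ^ n" by (rule card_zpts_bounds(1)[OF g T])
    also have "\<dots> \<le> unit_ball_vol (real n) * (T * (1 + c * nrm n g)) ^ n"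
    proof (intro mult_left_mono power_mono)
      have "1 * nrm n g \<le> (c * T) * nrm n g" using True nrm_nonneg by (intro mult_right_mono) auto
      then show "T + nrm n g \<le> T * (1 + c * nrm n g)" by (simp add: algebra_simps)
    qed (use T nrm_nonneg[of n g] in auto)
    also have "\<dots> = K * T ^ n" by (simp add: K_def power_mult_distrib)
    finally show ?thesis .
  next
    case False
    have "zpts0 n g T = {}"
    proof (rule ccontr)
      assume "zpts0 n g T \<noteq> {}"
      then obtain z i where z: "z \<in> zpts n g T" "i < n" "z i \<noteq> 0" by (auto simp: zpts0_def)
      have "1 \<le> \<bar>real_of_int (z i)\<bar>" using z(3) by simp
      also have "\<dots> \<le> nrm n (adj_mat g) * nq n g (\<lambda>i. of_int (z i))"
        using coord_le_nq[OF g z(2), of "\<lambda>i. of_int (z i)"] .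
      also have "\<dots> \<le> nrm n (adj_mat g) * T"
        using zptsD[OF z(1)] by (intro mult_left_mono nrm_nonneg)
      also have "\<dots> \<le> c * T" using T by (simp add: c_def)
      finally show False using False by simp
    qed
    then show ?thesis using K T by simp
  qed
  with K show ?thesis by blast
qed

section \<open>Counting solutions of congruences\<close>

text \<open>Since \<open>z i\<close> is invertible modulo \<open>p\<close>, the entry at
  \<open>i\<close> is determined by the others, which are free.\<close>

lemma card_affine_solutions:
  fixes z :: "'i \<Rightarrow> int" and c :: int
  assumes I: "finite I" "i \<in> I" and p: "prime p" and zi: "\<not> int p dvd z i"
  shows "card {a \<in> PiE I (\<lambda>_. {0..<int p}). int p dvd c - (\<Sum>k\<in>I. a k * z k)} = p ^ (card I - 1)"
proof -
  let ?S = "{a \<in> PiE I (\<lambda>_. {0..<int p}). int p dvd c - (\<Sum>k\<in>I. a k * z k)}"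
  let ?P = "PiE (I - {i}) (\<lambda>_. {0..<int p})"
  have p0: "int p > 0" using p by (simp add: prime_gt_0_nat)
  have "coprime (z i) (int p)" using zi p by (simp add: prime_imp_coprime coprime_commute)
  then obtain u where "[z i * u = 1] (mod int p)" using cong_solve_coprime_int by blast
  then have u: "int p dvd z i * u - 1" by (simp add: cong_iff_dvd_diff)
  define r where "r b = (\<Sum>k\<in>I - {i}. b k * z k)" for b :: "'i \<Rightarrow> int"
  have split: "(\<Sum>k\<in>I. a k * z k) = a i * z i + r a" for a :: "'i \<Rightarrow> int"
    unfolding r_def using I by (rule sum.remove)
  define v where "v b = (u * (c - r b)) mod int p" for b
  have v1: "int p dvd u * (c - r b) - v b" for b
    unfolding v_def by (simp add: mod_eq_dvd_iff[symmetric])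
  have "bij_betw (\<lambda>a. restrict a (I - {i})) ?S ?P"
  proof (rule bij_betwI[where g = "\<lambda>b. b(i := v b)"])
    show "(\<lambda>a. restrict a (I - {i})) \<in> ?S \<rightarrow> ?P" by (auto simp: PiE_iff)
    show "(\<lambda>b. b(i := v b)) \<in> ?P \<rightarrow> ?S"
    proof
      fix b assume b: "b \<in> ?P"
      have rb: "r (b(i := v b)) = r b" unfolding r_def by (intro sum.cong) auto
      have "c - (v b * z i + r b) = z i * (u * (c - r b) - v b) - (z i * u - 1) * (c - r b)"
        by (simp add: algebra_simps)
      then have "int p dvd c - (v b * z i + r b)" using u v1[of b] by simp
      then have d: "int p dvd c - (\<Sum>k\<in>I. (b(i := v b)) k * z k)" unfolding split rb by simp
      have "b(i := v b) \<in> PiE (insert i (I - {i})) (\<lambda>_. {0..<int p})"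
        using b p0 by (intro PiE_fun_upd) (auto simp: v_def)
      then show "b(i := v b) \<in> ?S" using d I by (simp add: insert_absorb)
    qed
    show "restrict (b(i := v b)) (I - {i}) = b" if "b \<in> ?P" for b
      using that by (auto simp: fun_eq_iff PiE_iff extensional_def restrict_def)
    show "(restrict a (I - {i}))(i := v (restrict a (I - {i}))) = a" if a: "a \<in> ?S" for a
    proof -
      have rr: "r (restrict a (I - {i})) = r a" unfolding r_def by (intro sum.cong) auto
      have ai: "a i \<in> {0..<int p}" using a I by (simp add: PiE_iff)
      have d: "int p dvd c - (a i * z i + r a)" using a unfolding split by simp
      have "u * (c - r a) - a i = u * (c - (a i * z i + r a)) + (z i * u - 1) * a i"
        by (simp add: algebra_simps)
      then have "int p dvd u * (c - r a) - a i" using d u by simp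
      then have "v a = a i" using ai by (simp add: v_def mod_eq_dvd_iff[symmetric])
      then have "v (restrict a (I - {i})) = a i" unfolding v_def rr .
      then show ?thesis using a I by (auto simp: fun_eq_iff PiE_iff extensional_def)
    qed
  qed
  then have "card ?S = card ?P" by (rule bij_betw_same_card)
  also have "\<dots> = p ^ (card I - 1)" using I by (simp add: card_PiE)
  finally show ?thesis .
qed

text \<open>Two solutions that agree off \<open>i\<close> and \<open>j\<close> differ there by a
  vector that a matrix with determinant \<open>z i * w j - z j * w i\<close> kills modulo
  \<open>p\<close>; so restriction to the other places is injective.\<close>

lemma card_affine_solutions2:
  fixes z w :: "'i \<Rightarrow> int" and c d :: int
  assumes I: "finite I" "i \<in> I" "j \<in> I" and p: "prime p" and zw: "\<not> int p dvd z i * w j - z j * w i"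
  shows "card {a \<in> PiE I (\<lambda>_. {0..<int p}). int p dvd c - (\<Sum>k\<in>I. a k * z k) \<and> int p dvd d - (\<Sum>k\<in>I. a k * w k)}
    \<le> p ^ (card I - 2)"
proof -
  let ?S = "{a \<in> PiE I (\<lambda>_. {0..<int p}). int p dvd c - (\<Sum>k\<in>I. a k * z k) \<and> int p dvd d - (\<Sum>k\<in>I. a k * w k)}"
  let ?J = "I - {i, j}" and ?P = "PiE (I - {i, j}) (\<lambda>_. {0..<int p})"
  have pI: "prime (int p)" using p by simp
  have ij: "i \<noteq> j" using zw by auto
  have split: "(\<Sum>k\<in>I. a k * y k) = a i * y i + a j * y j + (\<Sum>k\<in>?J. a k * y k)" for a y :: "'i \<Rightarrow> int"
  proof -
    have "(\<Sum>k\<in>I. a k * y k) = a i * y i + (\<Sum>k\<in>I - {i}. a k * y k)" using I by (intro sum.remove) auto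
    also have "(\<Sum>k\<in>I - {i}. a k * y k) = a j * y j + (\<Sum>k\<in>I - {i} - {j}. a k * y k)" using I ij by (intro sum.remove) auto
    also have "I - {i} - {j} = ?J" by auto
    finally show ?thesis by simp
  qed
  have "inj_on (\<lambda>a. restrict a ?J) ?S"
  proof (rule inj_onI)
    fix a b assume a: "a \<in> ?S" and b: "b \<in> ?S" and eq: "restrict a ?J = restrict b ?J"
    have eqJ: "a k = b k" if "k \<in> ?J" for k using fun_cong[OF eq, of k] that by simp
    have sJ: "(\<Sum>k\<in>?J. a k * y k) = (\<Sum>k\<in>?J. b k * y k)" for y using eqJ by (intro sum.cong) auto
    have aP: "a \<in> PiE I (\<lambda>_. {0..<int p})" and bP: "b \<in> PiE I (\<lambda>_. {0..<int p})" using a b by simp_all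
    have "int p dvd (c - (\<Sum>k\<in>I. b k * z k)) - (c - (\<Sum>k\<in>I. a k * z k))" by (rule dvd_diff) (use a b in auto)
    then have dz: "int p dvd (a i - b i) * z i + (a j - b j) * z j"
      unfolding split sJ by (simp add: algebra_simps)
    have "int p dvd (d - (\<Sum>k\<in>I. b k * w k)) - (d - (\<Sum>k\<in>I. a k * w k))" by (rule dvd_diff) (use a b in auto)
    then have dw: "int p dvd (a i - b i) * w i + (a j - b j) * w j"
      unfolding split sJ by (simp add: algebra_simps)
    have "(a i - b i) * (z i * w j - z j * w i) = w j * ((a i - b i) * z i + (a j - b j) * z j) - z j * ((a i - b i) * w i + (a j - b j) * w j)"
      by (simp add: algebra_simps)
    then have "int p dvd (a i - b i) * (z i * w j - z j * w i)" using dz dw by simp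
    then have di: "int p dvd a i - b i" using zw pI by (simp add: prime_dvd_mult_iff)
    have "(a j - b j) * (z i * w j - z j * w i) = z i * ((a i - b i) * w i + (a j - b j) * w j) - w i * ((a i - b i) * z i + (a j - b j) * z j)"
      by (simp add: algebra_simps)
    then have "int p dvd (a j - b j) * (z i * w j - z j * w i)" using dz dw by simp
    then have dj: "int p dvd a j - b j" using zw pI by (simp add: prime_dvd_mult_iff)
    have eqd: "a k = b k" if "int p dvd a k - b k" "k \<in> I" for k
    proof -
      have "a k mod int p = b k mod int p" using that(1) by (simp add: mod_eq_dvd_iff)
      then show ?thesis using PiE_mem[OF aP that(2)] PiE_mem[OF bP that(2)] by simp
    qed
    show "a = b"
    proof (rule PiE_ext[OF aP bP])
      fix k assume "k \<in> I"
      then show "a k = b k" using eqJ eqd[OF di I(2)] eqd[OF dj I(3)] by (cases "k \<in> ?J") auto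
    qed
  qed
  moreover have "(\<lambda>a. restrict a ?J) ` ?S \<subseteq> ?P" by (rule image_subsetI) (simp add: PiE_iff)
  moreover have "finite ?P" using I by (intro finite_PiE) auto
  ultimately have "card ?S \<le> card ?P" by (rule card_inj_on_le)
  also have "\<dots> = p ^ (card I - 2)" using I ij by (simp add: card_PiE numeral_2_eq_2)
  finally show ?thesis .
qed

text \<open>Membership of the integer vector \<open>z\<close> in the sublattice with label
  \<open>a\<close>, before rescaling.\<close>

definition hcong :: "nat \<Rightarrow> nat \<Rightarrow> (nat \<Rightarrow> int) \<Rightarrow> (nat \<Rightarrow> int) \<Rightarrow> bool" where
  "hcong n p a z \<longleftrightarrow> int p dvd z (n - 1) - (\<Sum>i<n - 1. a i * z i)"

lemma card_hcong:
  assumes n: "n \<ge> 2" and p: "prime p" and z: "\<exists>i<n - 1. \<not> int p dvd z i"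
  shows "card {a \<in> hecke_idx n p. hcong n p a z} = p ^ (n - 2)"
proof -
  from z obtain i where "i \<in> {..<n - 1}" "\<not> int p dvd z i" by auto
  then show ?thesis
    using card_affine_solutions[of "{..<n - 1}" i p z "z (n - 1)"] p by (simp add: hcong_def numeral_2_eq_2)
qed

text \<open>The new case is a vector that vanishes modulo \<open>p\<close> except in the last place:
  no \<open>a\<close> can satisfy the congruence.\<close>

lemma card_hcong_le:
  assumes n: "n \<ge> 2" and p: "prime p" and z: "\<exists>i<n. \<not> int p dvd z i"
  shows "card {a \<in> hecke_idx n p. hcong n p a z} \<le> p ^ (n - 2)"
proof (cases "\<exists>i<n - 1. \<not> int p dvd z i")
  case False
  then have d: "int p dvd z i" if "i < n - 1" for i using that by blast
  from z obtain i where "i < n" "\<not> int p dvd z i" by blast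
  with d[of i] have "i = n - 1" by (cases "i < n - 1") auto
  with \<open>\<not> int p dvd z i\<close> have nd: "\<not> int p dvd z (n - 1)" by simp
  have "\<not> hcong n p a z" for a
  proof -
    have "int p dvd (\<Sum>i<n - 1. a i * z i)" using d by (intro dvd_sum) auto
    then show ?thesis using nd by (simp add: hcong_def dvd_diff_right_iff dvd_diff_left_iff)
  qed
  then show ?thesis by simp
next
  case True
  then show ?thesis using card_hcong[OF n p True] by simp
qed

text \<open>If all minors within the first \<open>n - 1\<close> places vanish modulo
  \<open>p\<close>, a common solution \<open>a\<close> would force the minors with the last place to
  vanish as well, against the assumption; then there are no solutions.\<close>

lemma card_hcong2_le:
  assumes n: "n \<ge> 3" and p: "prime p" and zw: "\<exists>i<n. \<exists>j<n. \<not> int p dvd z i * w j - z j * w i"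
  shows "card {a \<in> hecke_idx n p. hcong n p a z \<and> hcong n p a w} \<le> p ^ (n - 3)"
proof (cases "\<exists>i<n - 1. \<exists>j<n - 1. \<not> int p dvd z i * w j - z j * w i")
  case True
  then obtain i j where ij: "i \<in> {..<n - 1}" "j \<in> {..<n - 1}" "\<not> int p dvd z i * w j - z j * w i" by auto
  then show ?thesis
    using card_affine_solutions2[of "{..<n - 1}" i j p z w "z (n - 1)" "w (n - 1)"] p
    by (simp add: hcong_def numeral_3_eq_3 numeral_2_eq_2)
next
  case False
  then have d: "int p dvd z i * w j - z j * w i" if "i < n - 1" "j < n - 1" for i j using that by blast
  have "\<not> (hcong n p a z \<and> hcong n p a w)" for a
  proof
    assume h: "hcong n p a z \<and> hcong n p a w"
    have last: "int p dvd z i * w (n - 1) - z (n - 1) * w i" if i: "i < n - 1" for i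
    proof -
      have "z i * w (n - 1) - z (n - 1) * w i = z i * (w (n - 1) - (\<Sum>k<n - 1. a k * w k))
          - w i * (z (n - 1) - (\<Sum>k<n - 1. a k * z k)) + (\<Sum>k<n - 1. a k * (z i * w k - z k * w i))"
        by (simp add: algebra_simps sum_distrib_left sum_subtractf)
      moreover have "int p dvd (\<Sum>k<n - 1. a k * (z i * w k - z k * w i))"
        using d[OF i] by (intro dvd_sum) auto
      ultimately show ?thesis using h by (simp add: hcong_def)
    qed
    from zw obtain i j where ij: "i < n" "j < n" and nd: "\<not> int p dvd z i * w j - z j * w i" by blast
    have "int p dvd z i * w j - z j * w i"
    proof (cases "i < n - 1")
      case i: True
      show ?thesis
      proof (cases "j < n - 1")
        case True then show ?thesis using d i by blast
      next
        case False
        then have "j = n - 1" using ij by simp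
        then show ?thesis using last[OF i] by simp
      qed
    next
      case i: False
      then have i': "i = n - 1" using ij by simp
      show ?thesis
      proof (cases "j < n - 1")
        case True
        have "z i * w j - z j * w i = - (z j * w i - z i * w j)" by simp
        then show ?thesis using last[OF True] i' by (metis dvd_minus_iff)
      next
        case False
        then have "j = n - 1" using ij by simp
        then show ?thesis using i' by simp
      qed
    qed
    with nd show False by simp
  qed
  then have "{a \<in> hecke_idx n p. hcong n p a z \<and> hcong n p a w} = {}" by blast
  then show ?thesis by (metis card.empty le0)
qed

section \<open>Dependent pairs of lattice points\<close>

definition dep_pairs :: "nat \<Rightarrow> real mat \<Rightarrow> real \<Rightarrow> ((nat \<Rightarrow> int) \<times> (nat \<Rightarrow> int)) set" where
  "dep_pairs n g T = {(z, w) \<in> zpts0 n g T \<times> zpts0 n g T. \<forall>i<n. \<forall>j<n. z i * w j = z j * w i}"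

lemma zpts0_iff: "z \<in> zpts0 n g T \<longleftrightarrow> z \<in> extensional {..<n} \<and> nq n g (\<lambda>i. of_int (z i)) \<le> T \<and> (\<exists>i<n. z i \<noteq> 0)"
  by (simp add: zpts0_def zpts_def PiE_iff)

text \<open>The fraction \<open>w k / z k\<close> in lowest terms exhibits both vectors as multiples of one.\<close>

lemma dependent_int_vectors:
  fixes z w :: "nat \<Rightarrow> int"
  assumes z: "z k \<noteq> 0" "k < n" and dep: "\<forall>i<n. \<forall>j<n. z i * w j = z j * w i"
  shows "\<exists>u i j. j > 0 \<and> (\<forall>l<n. z l = j * u l) \<and> (\<forall>l<n. w l = i * u l)"
proof -
  define d where "d = gcd (z k) (w k)"
  have d: "d \<noteq> 0" using z by (simp add: d_def)
  obtain j0 i0 where ji: "z k = d * j0" "w k = d * i0" "coprime j0 i0"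
    using gcd_coprime_exists[of "z k" "w k"] d unfolding d_def by (auto simp: mult.commute)
  have j0: "j0 \<noteq> 0" using ji z by auto
  define j where "j = \<bar>j0\<bar>"
  define i where "i = sgn j0 * i0"
  have "coprime j i" using ji(3) j0 by (auto simp: j_def i_def sgn_if abs_if)
  have jp: "j > 0" using j0 by (simp add: j_def)
  have rel: "w l * j = z l * i" if l: "l < n" for l
  proof -
    have "w l * z k = z l * w k" using dep l z(2) by (metis mult.commute)
    then have "d * (w l * j0) = d * (z l * i0)" by (simp add: ji mult_ac)
    then have "w l * j0 = z l * i0" using d by simp
    then show ?thesis by (auto simp: j_def i_def sgn_if abs_if)
  qed
  define u where "u l = z l div j" for l
  have "z l = j * u l" if "l < n" for l
  proof -
    have "j dvd z l * i" using rel[OF that] by (metis dvd_triv_right)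
    then have "j dvd z l" using \<open>coprime j i\<close> by (simp add: coprime_dvd_mult_left_iff)
    then show ?thesis by (simp add: u_def)
  qed
  moreover have "w l = i * u l" if "l < n" for l
  proof -
    have "j * w l = j * (i * u l)" using rel[OF that] calculation[OF that] by (simp add: mult_ac)
    then show ?thesis using jp by simp
  qed
  ultimately show ?thesis using jp by blast
qed

text \<open>If \<open>w\<close> is not longer than \<open>z\<close>, then \<open>z = j * u\<close>
  and \<open>w = i * u\<close> with \<open>\<bar>i\<bar> \<le> j\<close> and \<open>u\<close> of
  norm at most \<open>T / j\<close>. There are \<open>2 * j + 1 \<le> 3 * j\<close> choices of
  \<open>i\<close>, and exchanging \<open>z\<close> and \<open>w\<close> doubles the count; hence
  the 6. The bound \<open>J\<close> holds because \<open>j\<close> divides a nonzero coordinate of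
  \<open>z\<close>. In the sum, \<open>Suc j\<close> stands for this \<open>j\<close>.\<close>

lemma card_dep_pairs:
  assumes g: "g \<in> SL n" and T: "T > 0" and J: "nrm n (adj_mat g) * T \<le> real J"
  shows "real (card (dep_pairs n g T)) \<le> 6 * (\<Sum>j<J. real (Suc j) * real (card (zpts0 n g (T / real (Suc j)))))"
proof -
  define f where "f j = (\<lambda>(u, i). (\<lambda>l\<in>{..<n}. int (Suc j) * u l, \<lambda>l\<in>{..<n}. i * u l))" for j and x :: "(nat \<Rightarrow> int) \<times> int"
  define h where "h j = (\<lambda>(u :: nat \<Rightarrow> int, i :: int). (\<lambda>l\<in>{..<n}. int (Suc j) * u l, \<lambda>l\<in>{..<n}. i * u l))" for j
  define Q where "Q j = zpts0 n g (T / real (Suc j)) \<times> {- int (Suc j)..int (Suc j)}" for j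
  define S where "S = {(z, w) \<in> dep_pairs n g T. nq n g (\<lambda>i. of_int (w i)) \<le> nq n g (\<lambda>i. of_int (z i))}"
  have finZ: "finite (zpts0 n g T')" for T' by (rule finite_zpts0[OF g])
  have finQ: "finite (Q j)" for j unfolding Q_def using finZ by simp
  have "S \<subseteq> (\<Union>j<J. h j ` Q j)"
  proof
    fix x assume "x \<in> S"
    then obtain z w where x: "x = (z, w)" and zT: "z \<in> zpts0 n g T" and wT: "w \<in> zpts0 n g T"
      and dep: "\<forall>i<n. \<forall>j<n. z i * w j = z j * w i"
      and le: "nq n g (\<lambda>i. of_int (w i)) \<le> nq n g (\<lambda>i. of_int (z i))"
      by (auto simp: S_def dep_pairs_def)
    from zT obtain k where k: "k < n" "z k \<noteq> 0" by (auto simp: zpts0_iff)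
    obtain u i j where u: "j > 0" "\<And>l. l < n \<Longrightarrow> z l = j * u l" "\<And>l. l < n \<Longrightarrow> w l = i * u l"
      using dependent_int_vectors[OF k(2,1) dep] by blast
    define u' where "u' = (\<lambda>l\<in>{..<n}. u l)"
    define j' where "j' = nat j - 1"
    have j': "int (Suc j') = j" "real (Suc j') = of_int j" using u(1) by (auto simp: j'_def)
    let ?q = "nq n g (\<lambda>l. of_int (u' l))"
    have nz: "nq n g (\<lambda>l. of_int (z l)) = of_int j * ?q"
    proof -
      have "nq n g (\<lambda>l. of_int (z l)) = nq n g (\<lambda>l. of_int j * of_int (u' l))"
        by (rule nq_cong) (simp add: u u'_def)
      then show ?thesis using u(1) by (simp add: nq_scale)
    qed
    have nw: "nq n g (\<lambda>l. of_int (w l)) = \<bar>of_int i\<bar> * ?q"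
    proof -
      have "nq n g (\<lambda>l. of_int (w l)) = nq n g (\<lambda>l. of_int i * of_int (u' l))"
        by (rule nq_cong) (simp add: u u'_def)
      then show ?thesis by (simp add: nq_scale)
    qed
    have uk: "u k \<noteq> 0" using k u(2) by auto
    have q: "?q > 0"
      using nq_zero_imp[OF g _ k(1), of "\<lambda>l. of_int (u' l)"] uk k nq_nonneg[of n g "\<lambda>l. of_int (u' l)"]
      by (auto simp: u'_def less_le)
    have zq: "of_int j * ?q \<le> T" using zT nz by (simp add: zpts0_iff)
    have "?q \<le> T / real (Suc j')" using zq u(1) j' by (simp add: field_simps)
    then have uZ: "u' \<in> zpts0 n g (T / real (Suc j'))"
      using uk k by (auto simp: zpts0_iff u'_def)
    have "\<bar>of_int i\<bar> * ?q \<le> of_int j * ?q" using le nz nw by simp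
    then have "\<bar>i\<bar> \<le> j" using q by simp
    then have iQ: "i \<in> {- int (Suc j')..int (Suc j')}" unfolding j' by auto
    have "real (Suc j') \<le> of_int j * \<bar>of_int (u' k)\<bar>"
      using uk k u(1) unfolding j' by (simp add: u'_def)
    also have "\<dots> = \<bar>of_int (z k)\<bar>" using u k by (simp add: u'_def abs_mult)
    also have "\<dots> \<le> nrm n (adj_mat g) * nq n g (\<lambda>l. of_int (z l))"
      using coord_le_nq[OF g k(1), of "\<lambda>l. of_int (z l)"] .
    also have "\<dots> \<le> nrm n (adj_mat g) * T"
      using zq nz by (intro mult_left_mono nrm_nonneg) simp
    also have "\<dots> \<le> real J" by (rule J)
    finally have jJ: "j' < J" by simp
    have "z = (\<lambda>l\<in>{..<n}. int (Suc j') * u' l)" "w = (\<lambda>l\<in>{..<n}. i * u' l)"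
      using zT wT u unfolding j' by (auto simp: fun_eq_iff u'_def zpts0_iff extensional_def)
    then have "x = h j' (u', i)" by (simp add: x h_def)
    moreover have "(u', i) \<in> Q j'" using uZ iQ by (simp add: Q_def)
    ultimately show "x \<in> (\<Union>j<J. h j ` Q j)" using jJ by blast
  qed
  then have "card S \<le> card (\<Union>j<J. h j ` Q j)" using finQ by (intro card_mono) auto
  also have "\<dots> \<le> (\<Sum>j<J. card (h j ` Q j))" by (rule card_UN_le) simp
  also have "\<dots> \<le> (\<Sum>j<J. card (Q j))" using finQ by (intro sum_mono card_image_le) auto
  finally have "real (card S) \<le> (\<Sum>j<J. real (card (Q j)))" by (simp flip: of_nat_sum)
  also have "\<dots> \<le> (\<Sum>j<J. 3 * (real (Suc j) * real (card (zpts0 n g (T / real (Suc j))))))"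
  proof (rule sum_mono)
    fix j
    have "real (card (Q j)) = real (card (zpts0 n g (T / real (Suc j)))) * (2 * real (Suc j) + 1)"
      by (simp add: Q_def card_cartesian_product)
    also have "\<dots> \<le> real (card (zpts0 n g (T / real (Suc j)))) * (3 * real (Suc j))"
      by (intro mult_left_mono) auto
    finally show "real (card (Q j)) \<le> 3 * (real (Suc j) * real (card (zpts0 n g (T / real (Suc j)))))"
      by (simp only: mult_ac)
  qed
  finally have cS: "real (card S) \<le> 3 * (\<Sum>j<J. real (Suc j) * real (card (zpts0 n g (T / real (Suc j)))))"
    by (simp add: sum_distrib_left)
  have finD: "finite (dep_pairs n g T)"
    by (rule finite_subset[of _ "zpts0 n g T \<times> zpts0 n g T"]) (use finZ in \<open>auto simp: dep_pairs_def\<close>)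
  have finS: "finite S" using finD by (rule finite_subset[rotated]) (auto simp: S_def)
  have "dep_pairs n g T \<subseteq> S \<union> prod.swap ` S"
  proof
    fix x assume x: "x \<in> dep_pairs n g T"
    obtain z w where zw: "x = (z, w)" by (cases x)
    show "x \<in> S \<union> prod.swap ` S"
    proof (cases "nq n g (\<lambda>i. of_int (w i)) \<le> nq n g (\<lambda>i. of_int (z i))")
      case True
      then show ?thesis using x zw by (simp add: S_def)
    next
      case False
      then have "(w, z) \<in> S" using x zw by (simp add: S_def dep_pairs_def mult.commute)
      then show ?thesis unfolding zw by (intro UnI2 image_eqI[of _ _ "(w, z)"]) auto
    qed
  qed
  then have "card (dep_pairs n g T) \<le> card (S \<union> prod.swap ` S)"
    using finS by (intro card_mono) auto
  also have "\<dots> \<le> card S + card (prod.swap ` S)" by (rule card_Un_le)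
  also have "card (prod.swap ` S) \<le> card S" by (rule card_image_le[OF finS])
  finally have "real (card (dep_pairs n g T)) \<le> 2 * real (card S)" by simp
  with cS show ?thesis by simp
qed

section \<open>First and second moment over the sublattices of index p\<close>

definition hset :: "nat \<Rightarrow> real mat \<Rightarrow> real \<Rightarrow> nat \<Rightarrow> (nat \<Rightarrow> int) \<Rightarrow> (nat \<Rightarrow> int) set" where
  "hset n g T p a = {z \<in> zpts0 n g T. hcong n p a z}"

lemma card_hecke_idx: "n > 0 \<Longrightarrow> card (hecke_idx n p) = p ^ (n - 1)"
  by (simp add: card_PiE)

lemma finite_hecke_idx: "finite (hecke_idx n p)"
  by (intro finite_PiE) auto

lemma card_filter_sum:
  assumes "finite X"
  shows "real (card {x \<in> X. P x}) = (\<Sum>x\<in>X. if P x then 1 else 0)"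
  using assms by (simp add: sum.If_cases Int_def conj_commute)

lemma sum_card_hset:
  assumes g: "g \<in> SL n"
  shows "(\<Sum>a\<in>hecke_idx n p. real (card (hset n g T p a))) = (\<Sum>z\<in>zpts0 n g T. real (card {a \<in> hecke_idx n p. hcong n p a z}))"
  unfolding hset_def card_filter_sum[OF finite_zpts0[OF g]] card_filter_sum[OF finite_hecke_idx]
  by (rule sum.swap)

lemma square_card_filter:
  assumes "finite Z"
  shows "(real (card {z \<in> Z. P z}))\<^sup>2 = (\<Sum>x\<in>Z \<times> Z. if P (fst x) \<and> P (snd x) then 1 else 0)"
proof -
  have "{x \<in> Z \<times> Z. P (fst x) \<and> P (snd x)} = {z \<in> Z. P z} \<times> {z \<in> Z. P z}" by auto
  then have "real (card {x \<in> Z \<times> Z. P (fst x) \<and> P (snd x)}) = (real (card {z \<in> Z. P z}))\<^sup>2"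
    by (simp add: card_cartesian_product power2_eq_square)
  then show ?thesis using assms by (simp only: card_filter_sum[symmetric] finite_cartesian_product)
qed

lemma sum_card_hset_sq:
  assumes g: "g \<in> SL n"
  shows "(\<Sum>a\<in>hecke_idx n p. (real (card (hset n g T p a)))\<^sup>2)
    = (\<Sum>(z, w)\<in>zpts0 n g T \<times> zpts0 n g T. real (card {a \<in> hecke_idx n p. hcong n p a z \<and> hcong n p a w}))"
proof -
  have "(\<Sum>a\<in>hecke_idx n p. (real (card (hset n g T p a)))\<^sup>2)
      = (\<Sum>a\<in>hecke_idx n p. \<Sum>x\<in>zpts0 n g T \<times> zpts0 n g T. if hcong n p a (fst x) \<and> hcong n p a (snd x) then 1 else 0)"
    unfolding hset_def by (rule sum.cong[OF refl]) (rule square_card_filter[OF finite_zpts0[OF g]])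
  also have "\<dots> = (\<Sum>x\<in>zpts0 n g T \<times> zpts0 n g T. \<Sum>a\<in>hecke_idx n p. if hcong n p a (fst x) \<and> hcong n p a (snd x) then 1 else 0)"
    by (rule sum.swap)
  also have "\<dots> = (\<Sum>x\<in>zpts0 n g T \<times> zpts0 n g T. real (card {a \<in> hecke_idx n p. hcong n p a (fst x) \<and> hcong n p a (snd x)}))"
    unfolding card_filter_sum[OF finite_hecke_idx] ..
  finally show ?thesis by (simp add: case_prod_beta)
qed

text \<open>The coordinates are smaller than \<open>p\<close> in absolute value.\<close>

lemma zpts0_not_dvd:
  assumes g: "g \<in> SL n" and B: "nrm n (adj_mat g) * T < real p" and z: "z \<in> zpts0 n g T" and i: "i < n" "z i \<noteq> 0"
  shows "\<not> int p dvd z i"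
proof
  assume "int p dvd z i"
  then have "int p \<le> \<bar>z i\<bar>" using i zdvd_imp_le[of "int p" "\<bar>z i\<bar>"] by simp
  then have "real p \<le> \<bar>of_int (z i)\<bar>" by linarith
  also have "\<dots> \<le> nrm n (adj_mat g) * nq n g (\<lambda>i. of_int (z i))"
    using coord_le_nq[OF g i(1), of "\<lambda>i. of_int (z i)"] .
  also have "\<dots> \<le> nrm n (adj_mat g) * T"
    using z by (intro mult_left_mono nrm_nonneg) (simp add: zpts0_iff)
  finally show False using B by simp
qed

text \<open>Exchanging sums, each vector is counted once for every \<open>a\<close> that it
  satisfies, \<open>p ^ (n - 2)\<close> times as a rule. The exceptions are supported in the last
  coordinate and satisfy no congruence; one bounded integer describes each of them, whence the error
  \<open>2 * nrm n (adj_mat g) * T + 1\<close>.\<close>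

lemma first_moment:
  assumes n: "n \<ge> 3" and g: "g \<in> SL n" and p: "prime p" and B: "nrm n (adj_mat g) * T < real p"
    and T: "T > 0"
  shows "(\<Sum>a\<in>hecke_idx n p. real (card (hset n g T p a))) \<le> real (card (zpts0 n g T)) * real p ^ (n - 2)"
    "(real (card (zpts0 n g T)) - (2 * nrm n (adj_mat g) * T + 1)) * real p ^ (n - 2)
      \<le> (\<Sum>a\<in>hecke_idx n p. real (card (hset n g T p a)))"
proof -
  let ?Z = "zpts0 n g T"
  have fin: "finite ?Z" by (rule finite_zpts0[OF g])
  have "real (card {a \<in> hecke_idx n p. hcong n p a z}) \<le> real p ^ (n - 2)" if "z \<in> ?Z" for z
  proof -
    from that obtain i where i: "i < n" "z i \<noteq> 0" by (auto simp: zpts0_iff)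
    have "card {a \<in> hecke_idx n p. hcong n p a z} \<le> p ^ (n - 2)"
      using zpts0_not_dvd[OF g B that i] i n by (intro card_hcong_le p) auto
    then show ?thesis by (metis of_nat_le_iff of_nat_power)
  qed
  then show "(\<Sum>a\<in>hecke_idx n p. real (card (hset n g T p a))) \<le> real (card ?Z) * real p ^ (n - 2)"
    unfolding sum_card_hset[OF g] using sum_bounded_above[of ?Z _ "real p ^ (n - 2)"] by simp
  define Z1 where "Z1 = {z \<in> ?Z. \<exists>i<n - 1. z i \<noteq> 0}"
  define Z2 where "Z2 = {z \<in> ?Z. \<not> (\<exists>i<n - 1. z i \<noteq> 0)}"
  have Z12: "?Z = Z1 \<union> Z2" "Z1 \<inter> Z2 = {}" "finite Z1" "finite Z2"
    unfolding Z1_def Z2_def using fin by auto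
  define K where "K = \<lfloor>nrm n (adj_mat g) * T\<rfloor>"
  have "inj_on (\<lambda>z. z (n - 1)) Z2"
  proof (rule inj_onI)
    fix z w assume z: "z \<in> Z2" and w: "w \<in> Z2" and eq: "z (n - 1) = w (n - 1)"
    have "z i = w i" for i
    proof (cases "i < n")
      case True
      then consider "i < n - 1" | "i = n - 1" by linarith
      then show ?thesis using z w eq by cases (auto simp: Z2_def)
    next
      case False
      then show ?thesis using z w by (simp add: Z2_def zpts0_iff extensional_def)
    qed
    then show "z = w" by blast
  qed
  moreover have "(\<lambda>z. z (n - 1)) ` Z2 \<subseteq> {- K..K}"
  proof (rule image_subsetI)
    fix z assume z: "z \<in> Z2"
    have "\<bar>of_int (z (n - 1))\<bar> \<le> nrm n (adj_mat g) * nq n g (\<lambda>i. of_int (z i))"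
      using coord_le_nq[OF g, of "n - 1" "\<lambda>i. of_int (z i)"] n by simp
    also have "\<dots> \<le> nrm n (adj_mat g) * T"
      using z by (intro mult_left_mono nrm_nonneg) (simp add: Z2_def zpts0_iff)
    finally have "\<bar>z (n - 1)\<bar> \<le> K" unfolding K_def by (simp add: le_floor_iff)
    then show "z (n - 1) \<in> {- K..K}" by auto
  qed
  ultimately have "card Z2 \<le> card {- K..K}" by (rule card_inj_on_le) simp
  moreover have K0: "0 \<le> K" using T nrm_nonneg[of n "adj_mat g"] by (simp add: K_def)
  ultimately have "real (card Z2) \<le> 2 * of_int K + 1" by simp
  also have "\<dots> \<le> 2 * nrm n (adj_mat g) * T + 1" unfolding K_def by linarith
  finally have c2: "real (card Z2) \<le> 2 * nrm n (adj_mat g) * T + 1" .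
  have "real (card {a \<in> hecke_idx n p. hcong n p a z}) = real p ^ (n - 2)" if z: "z \<in> Z1" for z
  proof -
    from z obtain i where i: "i < n - 1" "z i \<noteq> 0" and zZ: "z \<in> ?Z" by (auto simp: Z1_def)
    have "\<exists>i<n - 1. \<not> int p dvd z i"
      using zpts0_not_dvd[OF g B zZ _ i(2)] i by (intro exI[of _ i]) auto
    then have "card {a \<in> hecke_idx n p. hcong n p a z} = p ^ (n - 2)"
      using n by (intro card_hcong p) auto
    then show ?thesis by simp
  qed
  then have "real (card Z1) * real p ^ (n - 2) = (\<Sum>z\<in>Z1. real (card {a \<in> hecke_idx n p. hcong n p a z}))"
    by simp
  also have "\<dots> \<le> (\<Sum>z\<in>?Z. real (card {a \<in> hecke_idx n p. hcong n p a z}))"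
    using fin by (intro sum_mono2) (auto simp: Z1_def)
  finally have "real (card Z1) * real p ^ (n - 2) \<le> (\<Sum>a\<in>hecke_idx n p. real (card (hset n g T p a)))"
    unfolding sum_card_hset[OF g] .
  moreover have "real (card ?Z) - (2 * nrm n (adj_mat g) * T + 1) \<le> real (card Z1)"
    using c2 Z12 by (simp add: card_Un_disjoint)
  then have "(real (card ?Z) - (2 * nrm n (adj_mat g) * T + 1)) * real p ^ (n - 2) \<le> real (card Z1) * real p ^ (n - 2)"
    by (rule mult_right_mono) simp
  ultimately show "(real (card ?Z) - (2 * nrm n (adj_mat g) * T + 1)) * real p ^ (n - 2)
      \<le> (\<Sum>a\<in>hecke_idx n p. real (card (hset n g T p a)))" by linarith
qed

text \<open>Hypothesis \<open>B\<close> makes all minors of two counted vectors smaller than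
  \<open>p\<close>, so independence over the integers persists modulo \<open>p\<close>. Independent
  pairs then satisfy two conditions on \<open>a\<close>; for a dependent pair only the condition
  from its first vector is used.\<close>

lemma second_moment:
  assumes n: "n \<ge> 3" and g: "g \<in> SL n" and p: "prime p" and T: "T > 0"
    and B: "2 * (1 + nrm n (adj_mat g) * T)\<^sup>2 < real p"
  shows "(\<Sum>a\<in>hecke_idx n p. (real (card (hset n g T p a)))\<^sup>2)
    \<le> (real (card (zpts0 n g T)))\<^sup>2 * real p ^ (n - 3) + real (card (dep_pairs n g T)) * real p ^ (n - 2)"
proof -
  let ?Z = "zpts0 n g T" and ?b = "nrm n (adj_mat g) * T"
  have b0: "0 \<le> ?b" using T nrm_nonneg by simp
  have fin: "finite (?Z \<times> ?Z)" using finite_zpts0[OF g] by simp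
  have aux: "x \<le> 2 * (1 + x)\<^sup>2 \<and> x * x + x * x \<le> 2 * (1 + x)\<^sup>2" if "0 \<le> x" for x :: real
    using that mult_nonneg_nonneg[OF that that] by (simp add: power2_eq_square distrib_left distrib_right)
  have "?b \<le> 2 * (1 + ?b)\<^sup>2" using aux[OF b0] by simp
  then have B1: "?b < real p" using B by simp
  have zb: "\<bar>real_of_int (z i)\<bar> \<le> ?b" if "z \<in> ?Z" "i < n" for z i
  proof -
    have "\<bar>real_of_int (z i)\<bar> \<le> nrm n (adj_mat g) * nq n g (\<lambda>i. of_int (z i))"
      using coord_le_nq[OF g that(2), of "\<lambda>i. of_int (z i)"] .
    also have "\<dots> \<le> ?b" using that(1) by (intro mult_left_mono nrm_nonneg) (simp add: zpts0_iff)
    finally show ?thesis .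
  qed
  define c where "c x = real (card {a \<in> hecke_idx n p. hcong n p a (fst x) \<and> hcong n p a (snd x)})" for x :: "(nat \<Rightarrow> int) \<times> (nat \<Rightarrow> int)"
  have dep: "c x \<le> real p ^ (n - 2)" if x: "x \<in> ?Z \<times> ?Z" for x
  proof -
    obtain z w where zw: "x = (z, w)" "z \<in> ?Z" using x by auto
    from zw obtain i where i: "i < n" "z i \<noteq> 0" by (auto simp: zpts0_iff)
    have "card {a \<in> hecke_idx n p. hcong n p a z \<and> hcong n p a w} \<le> card {a \<in> hecke_idx n p. hcong n p a z}"
      using finite_hecke_idx[of n p] by (intro card_mono) auto
    also have "\<dots> \<le> p ^ (n - 2)"
      using zpts0_not_dvd[OF g B1 zw(2) i] i n by (intro card_hcong_le p) auto
    finally show ?thesis unfolding c_def zw by (simp flip: of_nat_power)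
  qed
  have indep: "c x \<le> real p ^ (n - 3)" if x: "x \<in> ?Z \<times> ?Z - dep_pairs n g T" for x
  proof -
    obtain z w where zw: "x = (z, w)" "z \<in> ?Z" "w \<in> ?Z" using x by auto
    with x obtain i j where ij: "i < n" "j < n" "z i * w j \<noteq> z j * w i" by (auto simp: dep_pairs_def)
    have "\<not> int p dvd z i * w j - z j * w i"
    proof
      assume "int p dvd z i * w j - z j * w i"
      then have "int p \<le> \<bar>z i * w j - z j * w i\<bar>"
        using ij zdvd_imp_le[of "int p" "\<bar>z i * w j - z j * w i\<bar>"] by simp
      then have "real p \<le> \<bar>real_of_int (z i) * of_int (w j) - of_int (z j) * of_int (w i)\<bar>"
        by (metis of_int_abs of_int_diff of_int_le_iff of_int_mult of_int_of_nat_eq)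
      also have "\<dots> \<le> \<bar>real_of_int (z i)\<bar> * \<bar>real_of_int (w j)\<bar> + \<bar>real_of_int (z j)\<bar> * \<bar>real_of_int (w i)\<bar>"
        unfolding abs_mult[symmetric] by (rule abs_triangle_ineq4)
      also have "\<dots> \<le> ?b * ?b + ?b * ?b"
        using zb zw ij b0 by (intro add_mono mult_mono) auto
      also have "\<dots> \<le> 2 * (1 + ?b)\<^sup>2" using aux[OF b0] by simp
      finally show False using B by simp
    qed
    then have "card {a \<in> hecke_idx n p. hcong n p a z \<and> hcong n p a w} \<le> p ^ (n - 3)"
      using ij by (intro card_hcong2_le n p) blast
    then show ?thesis unfolding c_def zw by (simp flip: of_nat_power)
  qed
  have sub: "dep_pairs n g T \<subseteq> ?Z \<times> ?Z" by (auto simp: dep_pairs_def)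
  have "(\<Sum>a\<in>hecke_idx n p. (real (card (hset n g T p a)))\<^sup>2) = (\<Sum>x\<in>?Z \<times> ?Z. c x)"
    unfolding sum_card_hset_sq[OF g] c_def by (simp add: case_prod_beta)
  also have "\<dots> = (\<Sum>x\<in>?Z \<times> ?Z - dep_pairs n g T. c x) + (\<Sum>x\<in>dep_pairs n g T. c x)"
    by (rule sum.subset_diff[OF sub fin])
  also have "\<dots> \<le> real (card (?Z \<times> ?Z - dep_pairs n g T)) * real p ^ (n - 3) + real (card (dep_pairs n g T)) * real p ^ (n - 2)"
    using indep dep sub by (intro add_mono sum_bounded_above) auto
  also have "\<dots> \<le> real (card (?Z \<times> ?Z)) * real p ^ (n - 3) + real (card (dep_pairs n g T)) * real p ^ (n - 2)"
    using fin by (intro add_right_mono mult_right_mono) (auto intro!: card_mono)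
  finally show ?thesis by (simp add: card_cartesian_product power2_eq_square)
qed

section \<open>The limit over primes\<close>

text \<open>The lattice of \<open>g\<close> is fixed and the prime grows. Radius \<open>R\<close> in
  the rescaled sublattice is radius \<open>T j\<close> in the lattice of \<open>g\<close>; about
  \<open>V * pp j\<close> points lie within it, and each is in a fraction of about
  \<open>1 / pp j\<close> of the \<open>Mp j\<close> sublattices. So the mean of \<open>Np j\<close>
  tends to \<open>V\<close>.\<close>

locale prime_seq =
  fixes n :: nat and g :: "real mat" and R :: real and pp :: "nat \<Rightarrow> nat"
  assumes n: "n \<ge> 3" and g: "g \<in> SL n" and R: "R > 0"
    and pp: "\<And>j. prime (pp j)" and pp_lim: "filterlim pp at_top sequentially"
begin

definition V where "V = unit_ball_vol (real n) * R ^ n"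
definition T where "T j = R / scale n (pp j)"
definition c where "c = nrm n (adj_mat g)"
definition Np where "Np j a = real (card (hset n g (T j) (pp j) a))"
definition Mp where "Mp j = real (pp j) ^ (n - 1)"

lemma pp_pos: "pp j > 0"
  using pp[of j] by (simp add: prime_gt_0_nat)

lemma V_pos: "V > 0"
  using R by (simp add: V_def)

lemma T_pos: "T j > 0"
  using R scale_pos[OF pp_pos] by (simp add: T_def)

lemma T_power: "T j ^ n = R ^ n * real (pp j)"
proof -
  have "scale n (pp j) ^ n * real (pp j) = 1" using n by (intro scale_power pp_pos) simp
  then have "scale n (pp j) ^ n = 1 / real (pp j)" using pp_pos[of j] by (simp add: field_simps)
  then show ?thesis by (simp add: T_def power_divide)
qed

lemma c_nonneg: "c \<ge> 0"
  by (simp add: c_def nrm_nonneg)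

lemma T_lim: "filterlim T at_top sequentially"
  unfolding filterlim_at_top
proof
  fix C :: real
  define C' where "C' = max C 0"
  have "filterlim (\<lambda>j. real (pp j)) at_top sequentially"
    by (rule filterlim_compose[OF filterlim_real_sequentially pp_lim])
  then have "\<forall>\<^sub>F j in sequentially. C' ^ n / R ^ n \<le> real (pp j)" by (simp add: filterlim_at_top)
  then show "\<forall>\<^sub>F j in sequentially. C \<le> T j"
  proof eventually_elim
    case (elim j)
    then have "C' ^ n \<le> T j ^ n" using R by (simp add: T_power field_simps)
    then have "C' \<le> T j" using T_pos[of j] n by (simp add: C'_def power_mono_iff)
    then show ?case by (simp add: C'_def)
  qed
qed

lemma pp_eq: "real (pp j) = T j ^ n / R ^ n"
  using R by (simp add: T_power)

lemma zpts0_ratio: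
  "(\<lambda>j. real (card (zpts0 n g (T j / real (Suc k)))) / real (pp j)) \<longlonglongrightarrow> V / real (Suc k) ^ n"
proof -
  have lim: "filterlim (\<lambda>j. T j / real (Suc k)) at_top sequentially"
    using filterlim_tendsto_pos_mult_at_top[OF tendsto_const _ T_lim, of "1 / real (Suc k)"] by simp
  have "(\<lambda>j. real (card (zpts0 n g (T j / real (Suc k)))) / (T j / real (Suc k)) ^ n) \<longlonglongrightarrow> unit_ball_vol (real n)"
    using n by (intro filterlim_compose[OF card_zpts0_asymp[OF g] lim]) simp
  then have "(\<lambda>j. real (card (zpts0 n g (T j / real (Suc k)))) / (T j / real (Suc k)) ^ n * (R ^ n / real (Suc k) ^ n))
      \<longlonglongrightarrow> unit_ball_vol (real n) * (R ^ n / real (Suc k) ^ n)"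
    by (intro tendsto_intros)
  moreover have "real (card (zpts0 n g (T j / real (Suc k)))) / (T j / real (Suc k)) ^ n * (R ^ n / real (Suc k) ^ n)
      = real (card (zpts0 n g (T j / real (Suc k)))) / real (pp j)" for j
    using R T_pos[of j] pp_pos[of j] by (simp add: power_divide T_power del: of_nat_Suc)
  ultimately show ?thesis by (simp add: V_def)
qed

lemma zpts0_ratio1: "(\<lambda>j. real (card (zpts0 n g (T j))) / real (pp j)) \<longlonglongrightarrow> V"
  using zpts0_ratio[of 0] by simp

text \<open>The finite sum of \<open>card_dep_pairs\<close>, extended to a series: the number of its
  terms grows with \<open>j\<close>, and Tannery's theorem can pass to the limit in the
  series.\<close>

definition D where "D j = 6 * (\<Sum>k. real (Suc k) * real (card (zpts0 n g (T j / real (Suc k)))) / real (pp j))"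

text \<open>The terms tend to \<open>V / Suc k ^ (n - 1)\<close>, and \<open>n \<ge> 3\<close> makes
  them summable with \<open>1 / Suc k ^ 2\<close> as majorant. The sum of the inverse squares is
  estimated by 3, which gives \<open>6 * 3 = 18\<close>.\<close>

lemma D_props:
  "(\<lambda>k. real (Suc k) * real (card (zpts0 n g (T j / real (Suc k)))) / real (pp j)) sums (D j / 6)"
  "\<exists>l. D \<longlonglongrightarrow> l \<and> l \<le> 18 * V"
proof -
  obtain K where K: "K \<ge> 0" "\<And>T. T > 0 \<Longrightarrow> real (card (zpts0 n g T)) \<le> K * T ^ n"
    using card_zpts0_bound[OF g] by blast
  define a where "a k j = real (Suc k) * real (card (zpts0 n g (T j / real (Suc k)))) / real (pp j)" for k j
  define M where "M k = K * R ^ n * (1 / real (Suc k) ^ 2)" for k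
  have sq: "real (Suc k) / real (Suc k) ^ n \<le> 1 / real (Suc k) ^ 2" for k
  proof -
    have "real (Suc k) ^ 3 \<le> real (Suc k) ^ n" using n by (intro power_increasing) auto
    then have "real (Suc k) * real (Suc k) ^ 2 \<le> real (Suc k) ^ n" by (simp add: power3_eq_cube power2_eq_square mult_ac)
    then show ?thesis by (simp add: field_simps del: of_nat_Suc)
  qed
  have sums2: "(\<lambda>k. 1 / real (Suc k) ^ 2) sums (pi\<^sup>2 / 6)"
    using inverse_squares_sums by (simp add: add.commute)
  have summM: "summable M" unfolding M_def using sums2 by (intro summable_mult) (simp add: sums_iff)
  have bound: "norm (a k j) \<le> M k" for k j
  proof -
    have "a k j \<le> real (Suc k) * (K * (T j / real (Suc k)) ^ n) / real (pp j)"
      unfolding a_def using T_pos[of j] by (intro divide_right_mono mult_left_mono K) auto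
    also have "\<dots> = K * R ^ n * (real (Suc k) / real (Suc k) ^ n)"
      using pp_pos[of j] by (simp add: power_divide T_power del: of_nat_Suc)
    also have "\<dots> \<le> M k"
      unfolding M_def using K R sq[of k] by (intro mult_left_mono) auto
    finally show ?thesis by (simp add: a_def)
  qed
  have lim: "(\<lambda>j. a k j) \<longlonglongrightarrow> real (Suc k) * (V / real (Suc k) ^ n)" for k
    unfolding a_def times_divide_eq_right[symmetric] by (intro tendsto_intros zpts0_ratio)
  have ev: "\<forall>\<^sub>F (k, j) in sequentially \<times>\<^sub>F sequentially. norm (a k j) \<le> M k"
    by (rule always_eventually) (use bound in auto)
  have T: "(\<lambda>j. \<Sum>k. a k j) \<longlonglongrightarrow> (\<Sum>k. real (Suc k) * (V / real (Suc k) ^ n))"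
    "summable (\<lambda>k. norm (real (Suc k) * (V / real (Suc k) ^ n)))"
    using tannerys_theorem[OF lim ev summM] by auto
  have "summable (\<lambda>k. a k j)" by (rule summable_comparison_test'[OF summM bound])
  then show "(\<lambda>k. real (Suc k) * real (card (zpts0 n g (T j / real (Suc k)))) / real (pp j)) sums (D j / 6)"
    unfolding D_def a_def by (simp add: summable_sums)
  have "(\<Sum>k. real (Suc k) * (V / real (Suc k) ^ n)) \<le> (\<Sum>k. V * (1 / real (Suc k) ^ 2))"
  proof (rule suminf_le)
    fix k
    have "real (Suc k) * (V / real (Suc k) ^ n) = V * (real (Suc k) / real (Suc k) ^ n)" by simp
    also have "\<dots> \<le> V * (1 / real (Suc k) ^ 2)" using V_pos sq[of k] by (intro mult_left_mono) auto
    finally show "real (Suc k) * (V / real (Suc k) ^ n) \<le> V * (1 / real (Suc k) ^ 2)" .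
  next
    show "summable (\<lambda>k. real (Suc k) * (V / real (Suc k) ^ n))"
      using T(2) by (rule summable_norm_cancel)
    show "summable (\<lambda>k. V * (1 / real (Suc k) ^ 2))" using sums2 by (intro summable_mult) (simp add: sums_iff)
  qed
  also have "\<dots> = V * (pi\<^sup>2 / 6)" using sums_unique[OF sums_mult[OF sums2, of V]] by simp
  also have "\<dots> \<le> V * 3"
  proof (intro mult_left_mono)
    have "pi\<^sup>2 \<le> 4\<^sup>2" using pi_less_4 pi_ge_zero by (intro power_mono) auto
    then show "pi\<^sup>2 / 6 \<le> 3" by simp
  qed (use V_pos in simp)
  finally have le: "(\<Sum>k. real (Suc k) * (V / real (Suc k) ^ n)) \<le> V * 3" .
  have "D = (\<lambda>j. 6 * (\<Sum>k. a k j))" by (simp add: D_def a_def fun_eq_iff)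
  then have "D \<longlonglongrightarrow> 6 * (\<Sum>k. real (Suc k) * (V / real (Suc k) ^ n))"
    using T(1) by (simp only:) (intro tendsto_intros)
  with le show "\<exists>l. D \<longlonglongrightarrow> l \<and> l \<le> 18 * V" by (intro exI conjI) auto
qed

lemma dep_ratio: "real (card (dep_pairs n g (T j))) / real (pp j) \<le> D j"
proof -
  obtain J :: nat where J: "nrm n (adj_mat g) * T j \<le> real J" using real_arch_simple by blast
  let ?a = "\<lambda>k. real (Suc k) * real (card (zpts0 n g (T j / real (Suc k)))) / real (pp j)"
  have "real (card (dep_pairs n g (T j))) / real (pp j)
      \<le> 6 * (\<Sum>k<J. real (Suc k) * real (card (zpts0 n g (T j / real (Suc k))))) / real (pp j)"
    by (intro divide_right_mono card_dep_pairs g T_pos J) simp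
  also have "\<dots> = 6 * (\<Sum>k<J. ?a k)" by (simp only: sum_divide_distrib[symmetric] times_divide_eq_right)
  also have "\<dots> \<le> 6 * (\<Sum>k. ?a k)"
    using D_props(1)[of j] by (intro mult_left_mono sum_le_suminf) (auto simp: sums_iff)
  finally show ?thesis by (simp add: D_def)
qed

text \<open>The error of the first moment relative to the prime. It vanishes in the limit because
  \<open>T j ^ n\<close> is proportional to \<open>pp j\<close>.\<close>

definition E where "E j = (2 * c * T j + 1) / real (pp j)"

lemma T_ge: "\<forall>\<^sub>F j in sequentially. C \<le> T j"
  using T_lim by (simp add: filterlim_at_top)

lemma E_lim: "E \<longlonglongrightarrow> 0"
proof (rule tendsto_sandwich)
  show "\<forall>\<^sub>F j in sequentially. 0 \<le> E j"
    using c_nonneg T_pos by (intro always_eventually allI) (simp add: E_def less_imp_le)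
  show "\<forall>\<^sub>F j in sequentially. E j \<le> (2 * c + 1) * R ^ n / T j"
    using T_ge[of 1]
  proof eventually_elim
    case (elim j)
    have "T j ^ 2 \<le> T j ^ n" using elim n by (intro power_increasing) auto
    then have 1: "T j * T j \<le> T j ^ n" by (simp add: power2_eq_square)
    have "E j = (2 * c * T j + 1) * R ^ n / T j ^ n" by (simp add: E_def pp_eq)
    also have "\<dots> \<le> ((2 * c + 1) * T j) * R ^ n / (T j * T j)"
      using elim c_nonneg R 1 T_pos[of j]
      by (intro frac_le mult_right_mono) (auto simp: algebra_simps)
    also have "\<dots> = (2 * c + 1) * R ^ n / T j" using T_pos[of j] by simp
    finally show ?case .
  qed
  show "(\<lambda>j. (2 * c + 1) * R ^ n / T j) \<longlonglongrightarrow> 0"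
    by (intro tendsto_divide_0[OF tendsto_const] filterlim_at_top_imp_at_infinity T_lim)
qed simp

text \<open>The prime is of order \<open>T j ^ n\<close> with \<open>n \<ge> 3\<close>, hence beats
  any multiple of the square of \<open>T j\<close>. This is the hypothesis \<open>B\<close> of
  \<open>second_moment\<close>.\<close>

lemma large: "\<forall>\<^sub>F j in sequentially. 2 * (1 + nrm n (adj_mat g) * T j)\<^sup>2 < real (pp j)"
  using T_ge[of "max 1 (2 * (1 + c)\<^sup>2 * R ^ n + 1)"]
proof eventually_elim
  case (elim j)
  have "T j ^ 3 \<le> T j ^ n" using elim n by (intro power_increasing) auto
  then have 1: "T j * (T j)\<^sup>2 \<le> T j ^ n" by (simp add: power3_eq_cube power2_eq_square)
  have "(1 + c * T j)\<^sup>2 \<le> ((1 + c) * T j)\<^sup>2"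
    using elim c_nonneg T_pos[of j] by (intro power_mono) (auto simp: algebra_simps)
  then have "2 * (1 + c * T j)\<^sup>2 * R ^ n \<le> (2 * (1 + c)\<^sup>2 * R ^ n) * (T j)\<^sup>2"
    using R by (simp add: power_mult_distrib)
  also have "\<dots> < T j * (T j)\<^sup>2" using elim T_pos[of j] by (intro mult_strict_right_mono) auto
  also have "\<dots> \<le> T j ^ n" by (rule 1)
  finally show ?case using R by (simp add: pp_eq c_def field_simps)
qed

lemma large1: "2 * (1 + nrm n (adj_mat g) * T j)\<^sup>2 < real (pp j) \<Longrightarrow> nrm n (adj_mat g) * T j < real (pp j)"
proof -
  assume a: "2 * (1 + nrm n (adj_mat g) * T j)\<^sup>2 < real (pp j)"
  have "0 \<le> nrm n (adj_mat g) * T j" using nrm_nonneg T_pos[of j] by simp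
  then have "nrm n (adj_mat g) * T j \<le> 2 * (1 + nrm n (adj_mat g) * T j)\<^sup>2"
    using mult_nonneg_nonneg[of "nrm n (adj_mat g) * T j" "nrm n (adj_mat g) * T j"]
    by (simp add: power2_eq_square distrib_left distrib_right)
  with a show ?thesis by simp
qed

lemma Mp_pos: "Mp j > 0"
  using pp_pos by (simp add: Mp_def)

lemma Mp_div: "real (pp j) ^ (n - 2) = Mp j / real (pp j)" "real (pp j) ^ (n - 3) = Mp j / (real (pp j))\<^sup>2"
proof -
  have "n - 1 = Suc (n - 2)" "n - 1 = (n - 3) + 2" using n by auto
  then have 1: "Mp j = real (pp j) ^ (n - 2) * real (pp j)" and 2: "Mp j = real (pp j) ^ (n - 3) * (real (pp j))\<^sup>2"
    unfolding Mp_def by (metis power_Suc2, metis power_add)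
  show "real (pp j) ^ (n - 2) = Mp j / real (pp j)"
    unfolding 1 using pp_pos[of j] by simp
  show "real (pp j) ^ (n - 3) = Mp j / (real (pp j))\<^sup>2"
    unfolding 2 using pp_pos[of j] by simp
qed

lemma average_count:
  "\<forall>\<^sub>F j in sequentially. (\<Sum>a\<in>hecke_idx n (pp j). Np j a) / Mp j \<le> real (card (zpts0 n g (T j))) / real (pp j)"
  using large
proof eventually_elim
  case (elim j)
  have "(\<Sum>a\<in>hecke_idx n (pp j). Np j a) \<le> real (card (zpts0 n g (T j))) * (Mp j / real (pp j))"
    unfolding Np_def Mp_div(1)[symmetric] by (rule first_moment(1)[OF n g pp large1[OF elim] T_pos])
  then show ?case using Mp_pos[of j] pp_pos[of j] by (simp add: field_simps)
qed

text \<open>Chebyshev. The mean square deviation from \<open>V\<close> is at most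
  \<open>(Z j)\<^sup>2 + D j - 2 * V * (Z j - E j) + V\<^sup>2\<close>. With \<open>Z\<close>
  tending to \<open>V\<close> and \<open>E\<close> to 0, all but the limit of \<open>D\<close>
  cancels, and that is at most \<open>18 * V\<close>; division by the square of \<open>V / 2\<close>
  gives \<open>72 / V\<close>.\<close>

lemma few_below_half:
  "\<exists>U l. (\<forall>\<^sub>F j in sequentially. real (card {a \<in> hecke_idx n (pp j). Np j a < V / 2}) / Mp j \<le> U j)
     \<and> U \<longlonglongrightarrow> l \<and> l \<le> 72 / V"
proof -
  define Z where "Z j = real (card (zpts0 n g (T j))) / real (pp j)" for j
  define U where "U j = ((Z j)\<^sup>2 + D j - 2 * V * (Z j - E j) + V\<^sup>2) * (4 / V\<^sup>2)" for j
  obtain d where d: "D \<longlonglongrightarrow> d" "d \<le> 18 * V" using D_props(2) by blast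
  have Zlim: "Z \<longlonglongrightarrow> V" unfolding Z_def by (rule zpts0_ratio1)
  have U1: "U \<longlonglongrightarrow> (V\<^sup>2 + d - 2 * V * (V - 0) + V\<^sup>2) * (4 / V\<^sup>2)"
    unfolding U_def by (intro tendsto_intros Zlim d(1) E_lim)
  have eq: "(V\<^sup>2 + d - 2 * V * (V - 0) + V\<^sup>2) * (4 / V\<^sup>2) = 4 * d / V\<^sup>2"
    by (simp add: power2_eq_square)
  have "4 * d / V\<^sup>2 \<le> 72 / V"
    using d(2) V_pos by (simp add: power2_eq_square field_simps)
  moreover have "\<forall>\<^sub>F j in sequentially. real (card {a \<in> hecke_idx n (pp j). Np j a < V / 2}) / Mp j \<le> U j"
    using large
  proof eventually_elim
    case (elim j)
    let ?I = "hecke_idx n (pp j)" and ?B = "{a \<in> hecke_idx n (pp j). Np j a < V / 2}"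
    have p0: "real (pp j) > 0" using pp_pos by simp
    note M0 = Mp_pos[of j]
    have m1: "(Z j - E j) * Mp j \<le> (\<Sum>a\<in>?I. Np j a)"
    proof -
      have "(Z j - E j) * Mp j = (real (card (zpts0 n g (T j))) - (2 * nrm n (adj_mat g) * T j + 1)) * (Mp j / real (pp j))"
        using p0 by (simp add: Z_def E_def c_def field_simps)
      also have "\<dots> \<le> (\<Sum>a\<in>?I. Np j a)"
        unfolding Np_def Mp_div(1)[symmetric] by (rule first_moment(2)[OF n g pp large1[OF elim] T_pos])
      finally show ?thesis .
    qed
    have m2: "(\<Sum>a\<in>?I. (Np j a)\<^sup>2) \<le> ((Z j)\<^sup>2 + D j) * Mp j"
    proof -
      have "(\<Sum>a\<in>?I. (Np j a)\<^sup>2) \<le> (real (card (zpts0 n g (T j))))\<^sup>2 * (Mp j / (real (pp j))\<^sup>2)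
          + real (card (dep_pairs n g (T j))) * (Mp j / real (pp j))"
        unfolding Np_def Mp_div[symmetric] by (rule second_moment[OF n g pp T_pos elim])
      also have "\<dots> = ((Z j)\<^sup>2 + real (card (dep_pairs n g (T j))) / real (pp j)) * Mp j"
        by (simp add: Z_def power_divide distrib_right)
      also have "\<dots> \<le> ((Z j)\<^sup>2 + D j) * Mp j"
        using M0 dep_ratio[of j] by (intro mult_right_mono) auto
      finally show ?thesis .
    qed
    have fin: "finite ?I" by (rule finite_hecke_idx)
    have cI: "real (card ?I) = Mp j" using card_hecke_idx[of n "pp j"] n by (simp add: Mp_def)
    have "real (card ?B) * (V / 2)\<^sup>2 = (\<Sum>a\<in>?B. (V / 2)\<^sup>2)" by simp
    also have "\<dots> \<le> (\<Sum>a\<in>?B. (Np j a - V)\<^sup>2)"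
    proof (rule sum_mono)
      fix a assume "a \<in> ?B"
      then have "V / 2 \<le> V - Np j a" by simp
      then have "(V / 2)\<^sup>2 \<le> (V - Np j a)\<^sup>2" using V_pos by (intro power_mono) auto
      then show "(V / 2)\<^sup>2 \<le> (Np j a - V)\<^sup>2" by (simp add: power2_commute)
    qed
    also have "\<dots> \<le> (\<Sum>a\<in>?I. (Np j a - V)\<^sup>2)" using fin by (intro sum_mono2) auto
    also have "\<dots> = (\<Sum>a\<in>?I. (Np j a)\<^sup>2) - 2 * V * (\<Sum>a\<in>?I. Np j a) + V\<^sup>2 * Mp j"
      by (simp add: power2_diff sum.distrib sum_subtractf sum_distrib_left mult_ac cI[symmetric])
    also have "\<dots> \<le> ((Z j)\<^sup>2 + D j) * Mp j - 2 * V * ((Z j - E j) * Mp j) + V\<^sup>2 * Mp j"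
    proof -
      have "2 * V * ((Z j - E j) * Mp j) \<le> 2 * V * (\<Sum>a\<in>?I. Np j a)"
        using m1 V_pos by (intro mult_left_mono) auto
      then show ?thesis using m2 by linarith
    qed
    also have "\<dots> = ((Z j)\<^sup>2 + D j - 2 * V * (Z j - E j) + V\<^sup>2) * Mp j"
      by (simp add: algebra_simps)
    finally have "real (card ?B) * (V / 2)\<^sup>2 \<le> ((Z j)\<^sup>2 + D j - 2 * V * (Z j - E j) + V\<^sup>2) * Mp j" .
    then show "real (card ?B) / Mp j \<le> U j"
      unfolding U_def using V_pos M0 by (simp add: power2_eq_square field_simps)
  qed
  ultimately show ?thesis
    using U1[unfolded eq] by (intro exI[of _ U] exI[of _ "4 * d / V\<^sup>2"] conjI)
qed

end

section \<open>Sums over the nonzero vectors of a lattice\<close>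

definition zvecs :: "nat \<Rightarrow> (nat \<Rightarrow> int) set" where
  "zvecs n = {z \<in> PiE {..<n} (\<lambda>_. UNIV). \<exists>i<n. z i \<noteq> 0}"

definition lat_sum :: "nat \<Rightarrow> (real \<Rightarrow> ennreal) \<Rightarrow> real vec set \<Rightarrow> ennreal" where
  "lat_sum n f L = (\<integral>\<^sup>+v. f (euclid_norm v) \<partial>count_space (L - {0\<^sub>v n}))"

abbreviation gauss_sum :: "nat \<Rightarrow> real \<Rightarrow> real vec set \<Rightarrow> ennreal" where
  "gauss_sum n \<alpha> \<equiv> lat_sum n (\<lambda>r. ennreal (exp (- \<alpha> * r\<^sup>2)))"

abbreviation short :: "nat \<Rightarrow> real \<Rightarrow> real vec set \<Rightarrow> real vec set" where
  "short n B L \<equiv> {v \<in> L - {0\<^sub>v n}. euclid_norm v \<le> B}"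

lemma zvecs_iff: "z \<in> zvecs n \<longleftrightarrow> z \<in> extensional {..<n} \<and> (\<exists>i<n. z i \<noteq> 0)"
  by (simp add: zvecs_def PiE_iff)

lemma countable_zvecs: "countable (zvecs n)"
  unfolding zvecs_def by (rule countable_subset[of _ "PiE {..<n} (\<lambda>_. UNIV)"]) (auto intro!: countable_PiE)

lemma zpts0_zvecs: "zpts0 n g T = {z \<in> zvecs n. nq n g (\<lambda>i. of_int (z i)) \<le> T}"
  by (auto simp: zvecs_iff zpts0_iff)

lemma pt_zero: "pt n g (\<lambda>_. 0) = 0\<^sub>v n"
  by (intro eq_vecI) (auto simp: pt_def)

lemma pt_eq_zero_iff:
  assumes "g \<in> SL n"
  shows "pt n g x = 0\<^sub>v n \<longleftrightarrow> (\<forall>i<n. x i = 0)"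
proof
  assume "pt n g x = 0\<^sub>v n"
  then have "pt n g x = pt n g (\<lambda>_. 0)" by (simp only: pt_zero)
  then show "\<forall>i<n. x i = 0" using pt_inj[OF assms, of x "\<lambda>_. 0"] by blast
next
  assume "\<forall>i<n. x i = 0"
  then have "pt n g x = pt n g (\<lambda>_. 0)" by (intro pt_cong) simp
  then show "pt n g x = 0\<^sub>v n" by (simp only: pt_zero)
qed

lemma pt_int_restrict: "pt n g (\<lambda>i. s * of_int (restrict y {..<n} i)) = pt n g (\<lambda>i. s * of_int (y i))"
  by (rule pt_cong) simp

lemma inj_on_pt_int:
  assumes g: "g \<in> SL n" and s: "s \<noteq> 0"
  shows "inj_on (\<lambda>z. pt n g (\<lambda>i. s * of_int (z i))) (extensional {..<n} :: (nat \<Rightarrow> int) set)"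
proof (rule inj_onI)
  fix z w :: "nat \<Rightarrow> int" assume z: "z \<in> extensional {..<n}" "w \<in> extensional {..<n}"
    and eq: "pt n g (\<lambda>i. s * of_int (z i)) = pt n g (\<lambda>i. s * of_int (w i))"
  show "z = w"
  proof (rule extensionalityI[OF z])
    fix i assume "i \<in> {..<n}"
    then show "z i = w i" using pt_inj[OF g eq, of i] s by simp
  qed
qed

lemma bij_betw_zvecs:
  assumes g: "g \<in> SL n"
  shows "bij_betw (\<lambda>z. pt n g (\<lambda>i. of_int (z i))) (zvecs n) (row_lattice n g - {0\<^sub>v n})"
  unfolding bij_betw_def
proof
  show "inj_on (\<lambda>z. pt n g (\<lambda>i. of_int (z i))) (zvecs n)"
  proof (rule inj_on_subset)
    show "inj_on (\<lambda>z :: nat \<Rightarrow> int. pt n g (\<lambda>i. of_int (z i))) (extensional {..<n})"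
      using inj_on_pt_int[OF g, of 1] by simp
  qed (auto simp: zvecs_iff)
  have gc: "g \<in> carrier_mat n n" using g by (rule SL_carrier)
  show "(\<lambda>z. pt n g (\<lambda>i. of_int (z i))) ` zvecs n = row_lattice n g - {0\<^sub>v n}"
  proof (intro subset_antisym subsetI)
    fix v assume "v \<in> (\<lambda>z. pt n g (\<lambda>i. of_int (z i))) ` zvecs n"
    then obtain z where z: "v = pt n g (\<lambda>i. of_int (z i))" "z \<in> zvecs n" by blast
    from z(2) have "v \<noteq> 0\<^sub>v n" unfolding z(1) pt_eq_zero_iff[OF g] by (simp add: zvecs_iff)
    then show "v \<in> row_lattice n g - {0\<^sub>v n}" using pt_int_mem[OF gc] z(1) by simp
  next
    fix v assume v: "v \<in> row_lattice n g - {0\<^sub>v n}"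
    then obtain y :: "nat \<Rightarrow> int" where y: "v = pt n g (\<lambda>i. of_int (y i))"
      unfolding row_lattice_pt[OF gc] by blast
    have vy: "v = pt n g (\<lambda>i. of_int (restrict y {..<n} i))"
      unfolding y by (rule pt_cong) simp
    have "\<exists>i<n. y i \<noteq> 0" using v unfolding y by (simp add: pt_eq_zero_iff[OF g])
    then have rz: "restrict y {..<n} \<in> zvecs n" by (auto simp: zvecs_iff)
    show "v \<in> (\<lambda>z. pt n g (\<lambda>i. of_int (z i))) ` zvecs n"
      by (rule image_eqI[where x = "restrict y {..<n}"]) (rule vy, rule rz)
  qed
qed

lemma lat_sum_row:
  assumes "g \<in> SL n"
  shows "lat_sum n f (row_lattice n g) = (\<integral>\<^sup>+z. f (nq n g (\<lambda>i. of_int (z i))) \<partial>count_space (zvecs n))"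
  unfolding lat_sum_def nn_integral_bij_count_space[OF bij_betw_zvecs[OF assms], symmetric] euclid_norm_pt ..

lemma measurable_nq [measurable]: "(\<lambda>g. nq n g x) \<in> borel_measurable (SL_borel n)"
proof -
  have "(\<lambda>g. \<Sum>i<n. index_mat g (i, j) * x i) \<in> borel_measurable (SL_borel n)" if "j < n" for j
    using that by (intro borel_measurable_sum borel_measurable_times borel_measurable_const measurable_entry) auto
  then have [measurable]: "(\<lambda>g. \<Sum>j<n. (\<Sum>i<n. index_mat g (i, j) * x i)\<^sup>2) \<in> borel_measurable (SL_borel n)"
    by (intro borel_measurable_sum borel_measurable_power) auto
  have "(\<lambda>g. sqrt (\<Sum>j<n. (\<Sum>i<n. index_mat g (i, j) * x i)\<^sup>2)) \<in> borel_measurable (SL_borel n)"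
    by measurable
  then show ?thesis unfolding nq_def L2_set_def .
qed

lemma measurable_lat_sum [measurable]:
  assumes f[measurable]: "f \<in> borel_measurable borel"
  shows "lat_sum n f \<in> borel_measurable (lattice_space n)"
proof (rule measurable_lattice_spaceI)
  interpret sigma_finite_measure "count_space (zvecs n)"
    by (rule sigma_finite_measure_count_space_countable[OF countable_zvecs])
  have "(\<lambda>(z, g). f (nq n g (\<lambda>i. of_int (z i)))) \<in> borel_measurable (count_space (zvecs n) \<Otimes>\<^sub>M SL_borel n)"
    by (intro measurable_pair_measure_countable1 countable_zvecs) simp
  from measurable_pair_swap[OF this]
  have "(\<lambda>g. \<integral>\<^sup>+z. f (nq n g (\<lambda>i. of_int (z i))) \<partial>count_space (zvecs n)) \<in> borel_measurable (SL_borel n)"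
    by (intro borel_measurable_nn_integral) (simp add: case_prod_beta)
  then show "(\<lambda>g. lat_sum n f (row_lattice n g)) \<in> borel_measurable (SL_borel n)"
    by (rule measurable_cong[THEN iffD1, rotated]) (simp add: lat_sum_row)
qed

lemma lat_sum_hecke:
  assumes n: "n > 0" and p: "p > 0" and g: "g \<in> SL n"
  shows "lat_sum n (indicator {..R}) (row_lattice n (hecke_mat n p a * g)) = of_nat (card (hset n g (R / scale n p) p a))"
proof -
  let ?s = "scale n p" and ?L = "row_lattice n (hecke_mat n p a * g)"
  have s: "?s > 0" using p by (rule scale_pos)
  define A where "A = {z \<in> zvecs n. hcong n p a z}"
  let ?f = "\<lambda>z :: nat \<Rightarrow> int. pt n g (\<lambda>i. ?s * of_int (z i))"
  have L: "?L = ?f ` {y. hcong n p a y}"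
    unfolding row_lattice_hecke[OF n p g] hcong_def ..
  have "bij_betw ?f A (?L - {0\<^sub>v n})"
    unfolding bij_betw_def
  proof
    show "inj_on ?f A"
    proof (rule inj_on_subset)
      show "inj_on ?f (extensional {..<n})" using inj_on_pt_int[OF g, of ?s] s by simp
    qed (auto simp: A_def zvecs_iff)
    show "?f ` A = ?L - {0\<^sub>v n}"
    proof (intro subset_antisym subsetI)
      fix v assume "v \<in> ?f ` A"
      then obtain z where z: "v = ?f z" "z \<in> A" by blast
      from z(2) s have "v \<noteq> 0\<^sub>v n" unfolding z(1) pt_eq_zero_iff[OF g] by (simp add: A_def zvecs_iff)
      then show "v \<in> ?L - {0\<^sub>v n}" using z unfolding L by (simp add: A_def)
    next
      fix v assume v: "v \<in> ?L - {0\<^sub>v n}"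
      then obtain y where y: "v = ?f y" "hcong n p a y" unfolding L by blast
      have vy: "v = ?f (restrict y {..<n})" unfolding pt_int_restrict by (rule y(1))
      have "(\<Sum>i<n - 1. a i * restrict y {..<n} i) = (\<Sum>i<n - 1. a i * y i)" by (intro sum.cong) auto
      then have "hcong n p a (restrict y {..<n})" using y(2) n unfolding hcong_def by simp
      moreover have "\<exists>i<n. y i \<noteq> 0" using v s unfolding y(1) by (simp add: pt_eq_zero_iff[OF g])
      then have "restrict y {..<n} \<in> zvecs n" by (auto simp: zvecs_iff)
      ultimately have ry: "restrict y {..<n} \<in> A" by (simp add: A_def)
      show "v \<in> ?f ` A" by (rule image_eqI[where x = "restrict y {..<n}"]) (rule vy, rule ry)
    qed
  qed
  from nn_integral_bij_count_space[OF this, of "\<lambda>v. indicator {..R} (euclid_norm v)"]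
  have "lat_sum n (indicator {..R}) ?L = (\<integral>\<^sup>+z. indicator {..R} (euclid_norm (?f z)) \<partial>count_space A)"
    by (simp add: lat_sum_def)
  also have "\<dots> = (\<integral>\<^sup>+z. indicator (hset n g (R / ?s) p a) z \<partial>count_space A)"
  proof (rule nn_integral_cong)
    fix z assume "z \<in> space (count_space A)"
    then have z: "z \<in> A" by simp
    have "euclid_norm (?f z) = ?s * nq n g (\<lambda>i. of_int (z i))"
      using s by (simp add: euclid_norm_pt nq_scale)
    then have "euclid_norm (?f z) \<le> R \<longleftrightarrow> nq n g (\<lambda>i. of_int (z i)) \<le> R / ?s"
      using s by (simp add: pos_le_divide_eq mult.commute)
    then show "indicator {..R} (euclid_norm (?f z)) = (indicator (hset n g (R / ?s) p a) z :: ennreal)"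
      using z by (simp add: indicator_def hset_def zpts0_zvecs A_def)
  qed
  also have "\<dots> = emeasure (count_space A) (hset n g (R / ?s) p a)"
    by (rule nn_integral_indicator) (auto simp: hset_def zpts0_zvecs A_def)
  also have "\<dots> = of_nat (card (hset n g (R / ?s) p a))"
  proof (rule emeasure_count_space_finite)
    show "hset n g (R / ?s) p a \<subseteq> A" by (auto simp: hset_def zpts0_zvecs A_def)
    show "finite (hset n g (R / ?s) p a)" unfolding hset_def using finite_zpts0[OF g] by simp
  qed
  finally show ?thesis .
qed

section \<open>From Hecke averages to the invariant measure\<close>

context inv_lattice
begin

text \<open>A probability measure on the group whose image under \<open>row_lattice\<close> is
  \<open>\<mu>\<close>. Averages over sublattices depend on a basis, so they live here rather than
  on the space of lattices.\<close>

definition \<nu> :: "real mat measure" where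
  "\<nu> = density m wt"

lemma sets_nu [measurable_cong, simp]: "sets \<nu> = sets (SL_borel n)"
  by (simp add: \<nu>_def)

lemma space_nu [simp]: "space \<nu> = SL n"
  by (simp add: \<nu>_def)

lemma nn_integral_nu:
  "f \<in> borel_measurable (SL_borel n) \<Longrightarrow> (\<integral>\<^sup>+g. f g \<partial>\<nu>) = (\<integral>\<^sup>+g. wt g * f g \<partial>m)"
  unfolding \<nu>_def by (rule nn_integral_density) (simp_all add: measurable_m_iff)

lemma nn_integral_nu_lattice:
  assumes [measurable]: "F \<in> borel_measurable (lattice_space n)"
  shows "(\<integral>\<^sup>+g. F (row_lattice n g) \<partial>\<nu>) = (\<integral>\<^sup>+L. F L \<partial>\<mu>)"
  by (subst nn_integral_nu) (auto simp: nn_integral_wt_lattice)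

lemma emeasure_nu_space: "emeasure \<nu> (SL n) = 1"
  using nn_integral_nu_lattice[of "\<lambda>_. 1"] by (simp add: emeasure_space_1)

sublocale N: prob_space \<nu>
  by standard (simp add: emeasure_nu_space)

text \<open>\<open>hecke_inequality\<close> bounds averages by integrals. For \<open>1 - F\<close>
  this reverses into \<open>y \<le> x j + 1 / (pp j - 1)\<close>, where \<open>y\<close> is the
  integral of \<open>F\<close> and \<open>x j\<close> the \<open>\<nu>\<close>-mean of its Hecke
  averages. As \<open>F \<le> 1\<close>, the reverse Fatou lemma moves the limsup inside, where
  \<open>lim\<close> applies to each \<open>g\<close> separately.\<close>

lemma hecke_limit:
  assumes F[measurable]: "F \<in> borel_measurable (lattice_space n)" and F1: "\<And>L. F L \<le> 1"
    and pp: "\<And>j. prime (pp j)" and pp_lim: "filterlim pp at_top sequentially"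
    and B: "B \<ge> 0"
    and lim: "\<And>g. g \<in> SL n \<Longrightarrow>
      limsup (\<lambda>j. (\<Sum>a\<in>hecke_idx n (pp j). F (row_lattice n (hecke_mat n (pp j) a * g))) / of_nat (pp j ^ (n - 1))) \<le> ennreal B"
  shows "(\<integral>\<^sup>+L. F L \<partial>\<mu>) \<le> ennreal B"
proof -
  have p0: "pp j > 0" for j using pp[of j] by (simp add: prime_gt_0_nat)
  have [measurable]: "(\<lambda>g. F (row_lattice n (hecke_mat n (pp j) a * g))) \<in> borel_measurable (SL_borel n)" for j a
    by (rule measurable_compose[OF measurable_compose[OF measurable_SL_left[OF hecke_mat_SL[OF n_pos p0]] measurable_row_lattice] F])
  define Fa where "Fa j a g = F (row_lattice n (hecke_mat n (pp j) a * g))" for j a g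
  have Fam[measurable]: "Fa j a \<in> borel_measurable (SL_borel n)" for j a unfolding Fa_def by measurable
  have Fa1: "Fa j a g \<le> 1" for j a g unfolding Fa_def by (rule F1)
  let ?I = "\<lambda>j. hecke_idx n (pp j)"
  define M where "M j = real (pp j ^ (n - 1))" for j
  have M0: "M j > 0" for j using p0 by (simp add: M_def)
  have cI: "real (card (?I j)) = M j" for j using card_hecke_idx[OF n_pos] by (simp only: M_def)
  define u where "u j g = (\<Sum>a\<in>?I j. Fa j a g) / of_nat (pp j ^ (n - 1))" for j g
  have um[measurable]: "u j \<in> borel_measurable (SL_borel n)" for j
    unfolding u_def by (intro borel_measurable_divide_ennreal borel_measurable_sum) auto
  have u1: "u j g \<le> 1" for j g
  proof -
    have "(\<Sum>a\<in>?I j. Fa j a g) \<le> of_nat (card (?I j)) * 1" by (rule sum_bounded_above) (rule Fa1)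
    also have "card (?I j) = pp j ^ (n - 1)" by (rule card_hecke_idx[OF n_pos])
    finally have "u j g \<le> of_nat (pp j ^ (n - 1)) / of_nat (pp j ^ (n - 1))"
      unfolding u_def by (intro divide_right_mono_ennreal) simp
    moreover have "of_nat (pp j ^ (n - 1)) / of_nat (pp j ^ (n - 1)) = (1 :: ennreal)"
      by (rule ennreal_divide_self) (use p0[of j] in \<open>auto simp: of_nat_less_top simp del: of_nat_power\<close>)
    ultimately show ?thesis by simp
  qed
  have "limsup (\<lambda>j. \<integral>\<^sup>+g. u j g \<partial>\<nu>) \<le> (\<integral>\<^sup>+g. limsup (\<lambda>j. u j g) \<partial>\<nu>)"
    by (rule nn_integral_limsup[of _ _ "\<lambda>_. 1"]) (auto simp: u1 emeasure_nu_space cong: measurable_cong_sets)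
  also have "\<dots> \<le> (\<integral>\<^sup>+g. ennreal B \<partial>\<nu>)"
    using lim by (intro nn_integral_mono) (simp add: u_def Fa_def)
  also have "\<dots> = ennreal B" by (simp add: emeasure_nu_space)
  finally have lsup: "limsup (\<lambda>j. \<integral>\<^sup>+g. u j g \<partial>\<nu>) \<le> ennreal B" .
  define y where "y = enn2real (\<integral>\<^sup>+L. F L \<partial>\<mu>)"
  have yfin: "(\<integral>\<^sup>+L. F L \<partial>\<mu>) \<le> 1"
    using nn_integral_mono[of \<mu> F "\<lambda>_. 1"] F1 by (simp add: emeasure_space_1)
  then have "(\<integral>\<^sup>+L. F L \<partial>\<mu>) < \<infinity>" by (rule order.strict_trans1) simp
  then have y: "(\<integral>\<^sup>+L. F L \<partial>\<mu>) = ennreal y" unfolding y_def by simp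
  have y1: "y \<le> 1" unfolding y_def using yfin by (intro enn2real_leI) auto
  have y0: "y \<ge> 0" by (simp add: y_def)
  define t where "t j a = enn2real (\<integral>\<^sup>+g. Fa j a g \<partial>\<nu>)" for j a
  have tfin: "(\<integral>\<^sup>+g. Fa j a g \<partial>\<nu>) \<le> 1" for j a
    using nn_integral_mono[of \<nu> "Fa j a" "\<lambda>_. 1"] Fa1 by (simp add: emeasure_nu_space)
  have t: "(\<integral>\<^sup>+g. Fa j a g \<partial>\<nu>) = ennreal (t j a)" "0 \<le> t j a" "t j a \<le> 1" for j a
  proof -
    have "(\<integral>\<^sup>+g. Fa j a g \<partial>\<nu>) < \<infinity>" using tfin[of j a] by (rule order.strict_trans1) simp
    then show "(\<integral>\<^sup>+g. Fa j a g \<partial>\<nu>) = ennreal (t j a)" unfolding t_def by simp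
    show "t j a \<le> 1" unfolding t_def using tfin[of j a] by (intro enn2real_leI) auto
  qed (simp add: t_def)
  define x where "x j = (\<Sum>a\<in>?I j. t j a) / M j" for j
  have x: "(\<integral>\<^sup>+g. u j g \<partial>\<nu>) = ennreal (x j)" for j
  proof -
    have "(\<integral>\<^sup>+g. u j g \<partial>\<nu>) = (\<Sum>a\<in>?I j. \<integral>\<^sup>+g. Fa j a g \<partial>\<nu>) / of_nat (pp j ^ (n - 1))"
      unfolding u_def by (subst nn_integral_divide) (auto simp: nn_integral_sum cong: measurable_cong_sets)
    also have "\<dots> = ennreal (\<Sum>a\<in>?I j. t j a) / ennreal (M j)"
      unfolding t(1) M_def by (simp add: t(2) sum_ennreal ennreal_of_nat_eq_real_of_nat)
    also have "\<dots> = ennreal (x j)"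
      unfolding x_def using M0 by (intro divide_ennreal sum_nonneg t(2))
    finally show ?thesis .
  qed
  have main: "y \<le> x j + 1 / (real (pp j) - 1)" for j
  proof -
    define k where "k = (\<Sum>i<n. pp j ^ i)"
    have "(\<Sum>a\<in>?I j. \<integral>\<^sup>+g. wt g * (1 - F (row_lattice n (hecke_mat n (pp j) a * g))) \<partial>m)
        \<le> of_nat k * (\<integral>\<^sup>+L. (1 - F L) \<partial>\<mu>)"
      unfolding k_def by (rule hecke_inequality[OF pp]) measurable
    moreover have "(\<integral>\<^sup>+g. wt g * (1 - F (row_lattice n (hecke_mat n (pp j) a * g))) \<partial>m) = ennreal (1 - t j a)" for a
    proof -
      have "(\<integral>\<^sup>+g. wt g * (1 - F (row_lattice n (hecke_mat n (pp j) a * g))) \<partial>m) = (\<integral>\<^sup>+g. (1 - Fa j a g) \<partial>\<nu>)"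
        by (subst nn_integral_nu) (auto simp: Fa_def)
      also have "\<dots> = (\<integral>\<^sup>+g. 1 \<partial>\<nu>) - (\<integral>\<^sup>+g. Fa j a g \<partial>\<nu>)"
        using tfin[of j a] by (intro nn_integral_diff) (auto simp: Fa1 top_unique cong: measurable_cong_sets)
      also have "\<dots> = ennreal 1 - ennreal (t j a)" unfolding t(1) by (simp add: emeasure_nu_space)
      also have "\<dots> = ennreal (1 - t j a)" by (rule ennreal_minus[OF t(2)])
      finally show ?thesis .
    qed
    moreover have "(\<integral>\<^sup>+L. (1 - F L) \<partial>\<mu>) = ennreal (1 - y)"
    proof -
      have "(\<integral>\<^sup>+L. (1 - F L) \<partial>\<mu>) = (\<integral>\<^sup>+L. 1 \<partial>\<mu>) - (\<integral>\<^sup>+L. F L \<partial>\<mu>)"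
        using yfin by (intro nn_integral_diff) (auto simp: F1 top_unique sets_mu cong: measurable_cong_sets)
      also have "\<dots> = ennreal 1 - ennreal y" unfolding y by (simp add: emeasure_space_1)
      also have "\<dots> = ennreal (1 - y)" by (rule ennreal_minus[OF y0])
      finally show ?thesis .
    qed
    ultimately have "(\<Sum>a\<in>?I j. ennreal (1 - t j a)) \<le> of_nat k * ennreal (1 - y)" by simp
    then have "ennreal (\<Sum>a\<in>?I j. 1 - t j a) \<le> ennreal (real k * (1 - y))"
      using t(3)[of j] y1 by (simp add: sum_ennreal ennreal_mult ennreal_of_nat_eq_real_of_nat)
    then have "(\<Sum>a\<in>?I j. 1 - t j a) \<le> real k * (1 - y)"
      using y1 by (subst (asm) ennreal_le_iff) auto
    moreover have "(\<Sum>a\<in>?I j. 1 - t j a) = M j - M j * x j"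
      using M0[of j] by (simp only: sum_subtractf sum_constant cI x_def) simp
    ultimately have 1: "M j - M j * x j \<le> real k * (1 - y)" by simp
    \<comment> \<open>The surplus of \<open>k\<close> over \<open>M j\<close>, accounting for the
      sublattices that \<open>hecke_mat\<close> misses; a geometric sum, at most
      \<open>M j / (pp j - 1)\<close>.\<close>
    define r where "r = (\<Sum>i<n - 1. real (pp j) ^ i)"
    have "n = Suc (n - 1)" using n_pos by simp
    then have "real k = r + M j"
      unfolding k_def r_def M_def by (metis (no_types, lifting) of_nat_power of_nat_sum sum.cong sum.lessThan_Suc)
    moreover have q1: "real (pp j) - 1 > 0" using prime_gt_1_nat[OF pp[of j]] by simp
    have "(real (pp j) - 1) * r = M j - 1"
      unfolding r_def M_def using power_diff_1_eq[of "real (pp j)" "n - 1"] by simp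
    then have "r \<le> M j / (real (pp j) - 1)" using q1 by (simp add: field_simps)
    moreover have "r \<ge> 0" unfolding r_def by (simp add: sum_nonneg)
    ultimately have "M j - M j * x j \<le> M j * (1 - y) + M j / (real (pp j) - 1)"
    proof -
      have "real k * (1 - y) = r * (1 - y) + M j * (1 - y)" using \<open>real k = r + M j\<close> by (simp add: distrib_right)
      also have "r * (1 - y) \<le> r * 1" using y0 \<open>r \<ge> 0\<close> by (intro mult_left_mono) auto
      finally show ?thesis using 1 \<open>r \<le> M j / (real (pp j) - 1)\<close> by simp
    qed
    then have "M j * y \<le> M j * (x j + 1 / (real (pp j) - 1))" by (simp add: algebra_simps)
    then show ?thesis using M0[of j] by simp
  qed
  have "y \<le> B"
  proof (rule field_le_epsilon)
    fix e :: real assume e: "e > 0"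
    have "limsup (\<lambda>j. \<integral>\<^sup>+g. u j g \<partial>\<nu>) < ennreal (B + e / 2)"
      using lsup e B by (elim order.strict_trans1) (simp add: ennreal_less_iff)
    from Limsup_lessD[OF this] have e1: "\<forall>\<^sub>F j in sequentially. (\<integral>\<^sup>+g. u j g \<partial>\<nu>) < ennreal (B + e / 2)" .
    have "filterlim (\<lambda>j. real (pp j)) at_top sequentially"
      by (rule filterlim_compose[OF filterlim_real_sequentially pp_lim])
    then have e2: "\<forall>\<^sub>F j in sequentially. 2 / e + 2 \<le> real (pp j)" by (simp add: filterlim_at_top)
    have "\<forall>\<^sub>F j in sequentially. y \<le> B + e" using e1 e2
    proof eventually_elim
      case (elim j)
      have "x j < B + e / 2" using elim(1) e B unfolding x
        by (metis add_nonneg_nonneg ennreal_less_iff half_gt_zero leI ennreal_neg less_imp_le not_less order.strict_trans2 x ennreal_lessI)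
      moreover have "1 / (real (pp j) - 1) \<le> e / 2"
      proof -
        have "2 / e \<le> real (pp j) - 1" using elim(2) by simp
        then have "2 \<le> (real (pp j) - 1) * e" using e by (simp add: field_simps)
        moreover have "real (pp j) - 1 > 0" using elim(2) e by (smt (verit) divide_pos_pos)
        ultimately show ?thesis by (simp add: field_simps)
      qed
      ultimately show ?case using main[of j] by simp
    qed
    then show "y \<le> B + e" by (simp add: eventually_const_iff)
  qed
  then show ?thesis unfolding y by (rule ennreal_leI)
qed

end

section \<open>Siegel's mean value bound for balls and Gaussians, and a lower bound for counts of
  short vectors\<close>

lemma prime_seq_exists: "\<exists>pp :: nat \<Rightarrow> nat. (\<forall>j. prime (pp j)) \<and> filterlim pp at_top sequentially"
proof -
  have "\<forall>j. \<exists>p. prime p \<and> p > (j :: nat)" using bigger_prime by blast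
  then obtain pp :: "nat \<Rightarrow> nat" where pp: "\<And>j. prime (pp j)" "\<And>j. pp j > j" by metis
  have "filterlim pp at_top sequentially"
    by (rule filterlim_at_top_mono[OF filterlim_ident], rule always_eventually)
       (use pp(2) in \<open>auto intro: less_imp_le\<close>)
  with pp(1) show ?thesis by blast
qed

lemma SUP_min_of_nat: "(SUP k :: nat. min x (of_nat k)) = (x :: ennreal)"
proof -
  have "(SUP k :: nat. min x (of_nat k)) = inf x (SUP k :: nat. of_nat k)"
    unfolding inf_min[symmetric] by (rule inf_SUP[symmetric])
  also have "\<dots> = x" by (simp add: ennreal_SUP_of_nat_eq_top)
  finally show ?thesis .
qed

lemma nn_integral_exp_tail:
  "(\<integral>\<^sup>+x. ennreal (exp (- x)) * indicator {t..} x \<partial>lborel) = ennreal (exp (- t))"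
proof -
  have "(\<integral>\<^sup>+x. ennreal (exp (- x)) * indicator {t..} x \<partial>lborel) = ennreal (0 - (- exp (- t)))"
  proof (rule nn_integral_FTC_atLeast)
    show "((\<lambda>x :: real. - exp (- x)) has_real_derivative exp (- x)) (at x)" for x
      by (auto intro!: derivative_eq_intros)
    have "((\<lambda>x :: real. exp (- x)) \<longlongrightarrow> 0) at_top"
      by (rule filterlim_compose[OF exp_at_bot]) (simp add: filterlim_uminus_at_bot_at_top)
    then show "((\<lambda>x :: real. - exp (- x)) \<longlongrightarrow> 0) at_top"
      using tendsto_minus by fastforce
  qed auto
  then show ?thesis by simp
qed

context inv_lattice
begin

context
  fixes R :: real
  assumes n3: "n \<ge> 3" and R: "R > 0"
begin

lemma prime_seq_interp:
  assumes "g \<in> SL n" "\<And>j. prime (pp j)" "filterlim pp at_top sequentially"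
  shows "prime_seq n g R pp"
  using assms n3 R by unfold_locales auto

text \<open>\<open>hecke_limit\<close> for the indicator of the bad event: its Hecke average at
  \<open>g\<close> is the proportion of sublattices with a count below \<open>V / 2\<close>.\<close>

lemma count_below_half:
  "emeasure \<mu> {L \<in> space \<mu>. lat_sum n (indicator {..R}) L < ennreal (unit_ball_vol (real n) * R ^ n / 2)}
    \<le> ennreal (72 / (unit_ball_vol (real n) * R ^ n))"
proof -
  obtain pp :: "nat \<Rightarrow> nat" where pp: "\<And>j. prime (pp j)" "filterlim pp at_top sequentially"
    using prime_seq_exists by blast
  define V where "V = unit_ball_vol (real n) * R ^ n"
  have V: "V > 0" using R by (simp add: V_def)
  define A where "A = {L \<in> latt n. lat_sum n (indicator {..R}) L < ennreal (V / 2)}"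
  have A: "A \<in> sets (lattice_space n)"
  proof -
    have "{L \<in> space (lattice_space n). lat_sum n (indicator {..R}) L < ennreal (V / 2)} \<in> sets (lattice_space n)"
      by measurable
    then show ?thesis by (simp add: A_def)
  qed
  have "(\<integral>\<^sup>+L. indicator A L \<partial>\<mu>) \<le> ennreal (72 / V)"
  proof (rule hecke_limit[OF _ _ pp])
    show "indicator A \<in> borel_measurable (lattice_space n)" using A by simp
    show "indicator A L \<le> (1 :: ennreal)" for L by (simp add: indicator_def)
    show "0 \<le> 72 / V" using V by simp
    fix g assume g: "g \<in> SL n"
    interpret ps: prime_seq n g R pp by (rule prime_seq_interp[OF g pp])
    have VV: "ps.V = V" by (simp add: ps.V_def V_def)
    obtain U l where U: "\<forall>\<^sub>F j in sequentially. real (card {a \<in> hecke_idx n (pp j). ps.Np j a < V / 2}) / ps.Mp j \<le> U j"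
      "U \<longlonglongrightarrow> l" "l \<le> 72 / V" using ps.few_below_half unfolding VV by blast
    have eq: "(\<Sum>a\<in>hecke_idx n (pp j). indicator A (row_lattice n (hecke_mat n (pp j) a * g))) / of_nat (pp j ^ (n - 1))
        = ennreal (real (card {a \<in> hecke_idx n (pp j). ps.Np j a < V / 2}) / ps.Mp j)" for j
    proof -
      have p0: "pp j > 0" by (rule ps.pp_pos)
      have "indicator A (row_lattice n (hecke_mat n (pp j) a * g)) = ennreal (if ps.Np j a < V / 2 then 1 else 0)" for a
      proof -
        have "row_lattice n (hecke_mat n (pp j) a * g) \<in> latt n"
          using hecke_mat_SL[OF n_pos p0] g by (auto simp: latt_def SL_mult)
        moreover have "lat_sum n (indicator {..R}) (row_lattice n (hecke_mat n (pp j) a * g)) = ennreal (ps.Np j a)"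
          unfolding lat_sum_hecke[OF n_pos p0 g] by (simp add: ps.Np_def ps.T_def ennreal_of_nat_eq_real_of_nat)
        moreover have "ennreal (ps.Np j a) < ennreal (V / 2) \<longleftrightarrow> ps.Np j a < V / 2"
          by (rule ennreal_less_iff) (simp add: ps.Np_def)
        ultimately show ?thesis by (simp add: A_def indicator_def)
      qed
      then have "(\<Sum>a\<in>hecke_idx n (pp j). indicator A (row_lattice n (hecke_mat n (pp j) a * g)))
          = (\<Sum>a\<in>hecke_idx n (pp j). ennreal (if ps.Np j a < V / 2 then 1 else 0))"
        by (rule sum.cong[OF refl])
      also have "\<dots> = ennreal (\<Sum>a\<in>hecke_idx n (pp j). if ps.Np j a < V / 2 then 1 else 0)"
        by (rule sum_ennreal) simp
      also have "\<dots> = ennreal (real (card {a \<in> hecke_idx n (pp j). ps.Np j a < V / 2}))"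
        unfolding card_filter_sum[OF finite_hecke_idx] ..
      finally show ?thesis
        using p0 by (simp add: ps.Mp_def divide_ennreal[symmetric] ennreal_of_nat_eq_real_of_nat flip: of_nat_power)
    qed
    have "limsup (\<lambda>j. (\<Sum>a\<in>hecke_idx n (pp j). indicator A (row_lattice n (hecke_mat n (pp j) a * g))) / of_nat (pp j ^ (n - 1)))
        \<le> limsup (\<lambda>j. ennreal (U j))"
      unfolding eq by (rule Limsup_mono, use U(1) in eventually_elim) (rule ennreal_leI)
    also have "\<dots> = ennreal l"
      by (rule lim_imp_Limsup) (auto intro: tendsto_ennrealI U(2))
    also have "\<dots> \<le> ennreal (72 / V)" by (rule ennreal_leI[OF U(3)])
    finally show "limsup (\<lambda>j. (\<Sum>a\<in>hecke_idx n (pp j). indicator A (row_lattice n (hecke_mat n (pp j) a * g))) / of_nat (pp j ^ (n - 1)))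
        \<le> ennreal (72 / V)" .
  qed
  also have "(\<integral>\<^sup>+L. indicator A L \<partial>\<mu>) = emeasure \<mu> A" using A sets_mu by simp
  finally show ?thesis by (simp add: A_def space_mu V_def)
qed

text \<open>\<open>hecke_limit\<close> requires values at most 1, so the count is truncated at
  \<open>k\<close> and divided by \<open>k\<close>. Monotone convergence removes the truncation, as
  the bound does not depend on \<open>k\<close>.\<close>

lemma siegel_ball:
  "(\<integral>\<^sup>+L. lat_sum n (indicator {..R}) L \<partial>\<mu>) \<le> ennreal (unit_ball_vol (real n) * R ^ n)"
proof -
  obtain pp :: "nat \<Rightarrow> nat" where pp: "\<And>j. prime (pp j)" "filterlim pp at_top sequentially"
    using prime_seq_exists by blast
  define V where "V = unit_ball_vol (real n) * R ^ n"
  have V: "V > 0" using R by (simp add: V_def)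
  let ?N = "lat_sum n (indicator {..R})"
  have Nm[measurable]: "?N \<in> borel_measurable (lattice_space n)" by measurable
  have step: "(\<integral>\<^sup>+L. min (?N L) (of_nat k) \<partial>\<mu>) \<le> ennreal V" for k
  proof (cases "k = 0")
    case False
    then have k: "real k > 0" by simp
    have "(\<integral>\<^sup>+L. min (?N L) (of_nat k) / of_nat k \<partial>\<mu>) \<le> ennreal (V / real k)"
    proof (rule hecke_limit[OF _ _ pp])
      show "(\<lambda>L. min (?N L) (of_nat k) / of_nat k) \<in> borel_measurable (lattice_space n)"
        by (intro borel_measurable_divide_ennreal borel_measurable_min Nm) auto
      show "min (?N L) (of_nat k) / of_nat k \<le> 1" for L
      proof -
        have "min (?N L) (of_nat k) / of_nat k \<le> of_nat k / (of_nat k :: ennreal)"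
          by (intro divide_right_mono_ennreal) simp
        also have "\<dots> = 1" using False by (intro ennreal_divide_self) (auto simp: of_nat_less_top)
        finally show ?thesis .
      qed
      show "0 \<le> V / real k" using V k by simp
      fix g assume g: "g \<in> SL n"
      interpret ps: prime_seq n g R pp by (rule prime_seq_interp[OF g pp])
      have VV: "ps.V = V" by (simp add: ps.V_def V_def)
      define Z where "Z j = real (card (zpts0 n g (ps.T j))) / real (pp j)" for j
      have bound: "(\<Sum>a\<in>hecke_idx n (pp j). min (?N (row_lattice n (hecke_mat n (pp j) a * g))) (of_nat k) / of_nat k) / of_nat (pp j ^ (n - 1))
          \<le> ennreal ((\<Sum>a\<in>hecke_idx n (pp j). ps.Np j a) / ps.Mp j / real k)" for j
      proof -
        have p0: "pp j > 0" by (rule ps.pp_pos)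
        have Np0: "0 \<le> ps.Np j a" for a by (simp add: ps.Np_def)
        have "min (?N (row_lattice n (hecke_mat n (pp j) a * g))) (of_nat k) / of_nat k \<le> ennreal (ps.Np j a / real k)" for a
        proof -
          have "?N (row_lattice n (hecke_mat n (pp j) a * g)) = ennreal (ps.Np j a)"
            unfolding lat_sum_hecke[OF n_pos p0 g] by (simp add: ps.Np_def ps.T_def ennreal_of_nat_eq_real_of_nat)
          then have "min (?N (row_lattice n (hecke_mat n (pp j) a * g))) (of_nat k) / of_nat k \<le> ennreal (ps.Np j a) / of_nat k"
            by (intro divide_right_mono_ennreal) simp
          also have "\<dots> = ennreal (ps.Np j a / real k)"
            using k Np0 by (simp add: divide_ennreal ennreal_of_nat_eq_real_of_nat)
          finally show ?thesis .
        qed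
        then have "(\<Sum>a\<in>hecke_idx n (pp j). min (?N (row_lattice n (hecke_mat n (pp j) a * g))) (of_nat k) / of_nat k)
            \<le> (\<Sum>a\<in>hecke_idx n (pp j). ennreal (ps.Np j a / real k))" by (rule sum_mono)
        also have "\<dots> = ennreal ((\<Sum>a\<in>hecke_idx n (pp j). ps.Np j a) / real k)"
          using Np0 k by (simp add: sum_ennreal sum_divide_distrib)
        finally have "(\<Sum>a\<in>hecke_idx n (pp j). min (?N (row_lattice n (hecke_mat n (pp j) a * g))) (of_nat k) / of_nat k) / of_nat (pp j ^ (n - 1))
            \<le> ennreal ((\<Sum>a\<in>hecke_idx n (pp j). ps.Np j a) / real k) / ennreal (ps.Mp j)"
          unfolding ps.Mp_def ennreal_of_nat_eq_real_of_nat of_nat_power by (rule divide_right_mono_ennreal)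
        also have "\<dots> = ennreal ((\<Sum>a\<in>hecke_idx n (pp j). ps.Np j a) / real k / ps.Mp j)"
          using ps.Mp_pos Np0 by (intro divide_ennreal) (auto intro!: divide_nonneg_nonneg sum_nonneg)
        finally show ?thesis by (simp add: mult.commute)
      qed
      have "limsup (\<lambda>j. (\<Sum>a\<in>hecke_idx n (pp j). min (?N (row_lattice n (hecke_mat n (pp j) a * g))) (of_nat k) / of_nat k) / of_nat (pp j ^ (n - 1)))
          \<le> limsup (\<lambda>j. ennreal (Z j / real k))"
      proof (rule Limsup_mono, use ps.average_count in eventually_elim)
        case (elim j)
        have "(\<Sum>a\<in>hecke_idx n (pp j). ps.Np j a) / ps.Mp j / real k \<le> Z j / real k"
          unfolding Z_def using elim by (rule divide_right_mono) simp
        then show ?case using bound[of j] by (meson ennreal_leI order.trans)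
      qed
      also have "\<dots> = ennreal (V / real k)"
      proof (rule lim_imp_Limsup)
        have "Z \<longlonglongrightarrow> V" unfolding Z_def VV[symmetric] by (rule ps.zpts0_ratio1)
        then show "(\<lambda>j. ennreal (Z j / real k)) \<longlonglongrightarrow> ennreal (V / real k)"
          using k by (intro tendsto_ennrealI tendsto_divide) auto
      qed simp
      finally show "limsup (\<lambda>j. (\<Sum>a\<in>hecke_idx n (pp j). min (?N (row_lattice n (hecke_mat n (pp j) a * g))) (of_nat k) / of_nat k) / of_nat (pp j ^ (n - 1)))
          \<le> ennreal (V / real k)" .
    qed
    moreover have "(\<integral>\<^sup>+L. min (?N L) (of_nat k) / of_nat k \<partial>\<mu>) = (\<integral>\<^sup>+L. min (?N L) (of_nat k) \<partial>\<mu>) / of_nat k"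
      by (rule nn_integral_divide) (intro borel_measurable_min, auto cong: measurable_cong_sets simp: sets_mu)
    ultimately have "(\<integral>\<^sup>+L. min (?N L) (of_nat k) \<partial>\<mu>) / of_nat k \<le> ennreal V / of_nat k"
      using k V by (simp add: divide_ennreal ennreal_of_nat_eq_real_of_nat)
    then have "(\<integral>\<^sup>+L. min (?N L) (of_nat k) \<partial>\<mu>) / of_nat k * of_nat k \<le> ennreal V / of_nat k * of_nat k"
      by (rule mult_right_mono) simp
    then show ?thesis using False
      by (simp add: ennreal_divide_times mult_divide_eq_ennreal of_nat_less_top)
  qed simp
  have "(\<integral>\<^sup>+L. ?N L \<partial>\<mu>) = (\<integral>\<^sup>+L. (SUP k :: nat. min (?N L) (of_nat k)) \<partial>\<mu>)"
    unfolding SUP_min_of_nat ..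
  also have "\<dots> = (SUP k :: nat. \<integral>\<^sup>+L. min (?N L) (of_nat k) \<partial>\<mu>)"
  proof (rule nn_integral_monotone_convergence_SUP)
    show "incseq (\<lambda>k L. min (?N L) (of_nat k))"
      by (auto simp: incseq_def le_fun_def intro: min.coboundedI2)
    show "(\<lambda>L. min (?N L) (of_nat k)) \<in> borel_measurable \<mu>" for k
      by (intro borel_measurable_min) (auto cong: measurable_cong_sets simp: sets_mu)
  qed
  also have "\<dots> \<le> ennreal V" using step by (intro SUP_least) auto
  finally show ?thesis by (simp add: V_def)
qed

end

text \<open>The Gaussian is a superposition of indicators of balls of radius
  \<open>sqrt (x / \<alpha>)\<close> with weight \<open>exp (- x)\<close>. Integrating the bound for
  balls leaves a Gamma integral, which cancels the Gamma value in
  \<open>unit_ball_vol\<close>.\<close>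

lemma siegel_gaussian:
  assumes n3: "n \<ge> 3" and \<alpha>: "\<alpha> > 0"
  shows "(\<integral>\<^sup>+L. gauss_sum n \<alpha> L \<partial>\<mu>) \<le> ennreal ((pi / \<alpha>) powr (real n / 2))"
proof -
  define q where "q g z = nq n g (\<lambda>i. real_of_int (z i))" for g and z :: "nat \<Rightarrow> int"
  have \<alpha>m: "\<alpha> powr (- real n / 2) = 1 / \<alpha> powr (real n / 2)"
    by (simp only: minus_divide_left[symmetric] powr_minus inverse_eq_divide)
  define e where "e x = ennreal (exp (- x)) * indicator {0..} x" for x :: real
  have [measurable]: "e \<in> borel_measurable borel" unfolding e_def by measurable
  have qm[measurable]: "(\<lambda>g. q g z) \<in> borel_measurable \<nu>" for z
    unfolding q_def using measurable_nq[of n "\<lambda>i. real_of_int (z i)"] by (simp cong: measurable_cong_sets)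
  have layer: "ennreal (exp (- \<alpha> * r\<^sup>2)) = (\<integral>\<^sup>+x. e x * indicator {..sqrt (x / \<alpha>)} r \<partial>lborel)" if "r \<ge> 0" for r
  proof -
    have "ennreal (exp (- \<alpha> * r\<^sup>2)) = (\<integral>\<^sup>+x. ennreal (exp (- x)) * indicator {\<alpha> * r\<^sup>2..} x \<partial>lborel)"
      using nn_integral_exp_tail[of "\<alpha> * r\<^sup>2"] by simp
    also have "\<dots> = (\<integral>\<^sup>+x. e x * indicator {..sqrt (x / \<alpha>)} r \<partial>lborel)"
    proof (rule nn_integral_cong)
      fix x :: real
      have "\<alpha> * r\<^sup>2 \<le> x \<longleftrightarrow> 0 \<le> x \<and> r \<le> sqrt (x / \<alpha>)"
      proof
        assume a: "\<alpha> * r\<^sup>2 \<le> x"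
        have "0 \<le> \<alpha> * r\<^sup>2" using \<alpha> by simp
        then have "0 \<le> x" using a by simp
        moreover have "r\<^sup>2 \<le> x / \<alpha>" using a \<alpha> by (simp add: field_simps)
        then have "r \<le> sqrt (x / \<alpha>)" using that by (simp add: real_le_rsqrt)
        ultimately show "0 \<le> x \<and> r \<le> sqrt (x / \<alpha>)" ..
      next
        assume a: "0 \<le> x \<and> r \<le> sqrt (x / \<alpha>)"
        then have "r\<^sup>2 \<le> (sqrt (x / \<alpha>))\<^sup>2" using that by (intro power_mono) auto
        also have "\<dots> = x / \<alpha>" using a \<alpha> by simp
        finally show "\<alpha> * r\<^sup>2 \<le> x" using \<alpha> by (simp add: field_simps)
      qed
      then show "ennreal (exp (- x)) * indicator {\<alpha> * r\<^sup>2..} x = e x * indicator {..sqrt (x / \<alpha>)} r"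
        by (simp add: e_def indicator_def)
    qed
    finally show ?thesis .
  qed
  interpret pr: pair_sigma_finite \<nu> "lborel :: real measure" by unfold_locales
  define h where "h z g x = e x * indicator {..sqrt (x / \<alpha>)} (q g z)" for z g x
  have hm: "(\<lambda>(g, x). h z g x) \<in> borel_measurable (\<nu> \<Otimes>\<^sub>M lborel)" for z
  proof -
    have [measurable]: "(\<lambda>y. q (fst y) z) \<in> borel_measurable (\<nu> \<Otimes>\<^sub>M (lborel :: real measure))"
      by (rule measurable_compose[OF measurable_fst qm])
    have ind: "indicator {..sqrt (x / \<alpha>)} (q g z) = (if q g z \<le> sqrt (x / \<alpha>) then 1 else 0 :: ennreal)" for g x
      by (simp add: indicator_def)
    show ?thesis unfolding h_def ind case_prod_beta by measurable
  qed
  have hm1: "(\<lambda>g. \<integral>\<^sup>+x. h z g x \<partial>lborel) \<in> borel_measurable \<nu>" for z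
    by (rule lborel.borel_measurable_nn_integral[OF hm])
  have hm2: "(\<lambda>x. \<integral>\<^sup>+g. h z g x \<partial>\<nu>) \<in> borel_measurable lborel" for z
    using hm[of z] by (intro N.borel_measurable_nn_integral) (auto dest: measurable_pair_swap simp: case_prod_beta)
  have hm3: "(\<lambda>g. h z g x) \<in> borel_measurable \<nu>" for z x
  proof -
    have ind: "indicator {..sqrt (x / \<alpha>)} (q g z) = (if q g z \<le> sqrt (x / \<alpha>) then 1 else 0 :: ennreal)" for g
      by (simp add: indicator_def)
    show ?thesis unfolding h_def ind by measurable
  qed
  have "(\<integral>\<^sup>+L. gauss_sum n \<alpha> L \<partial>\<mu>)
      = (\<integral>\<^sup>+g. gauss_sum n \<alpha> (row_lattice n g) \<partial>\<nu>)"
    by (rule nn_integral_nu_lattice[symmetric]) measurable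
  also have "\<dots> = (\<integral>\<^sup>+g. \<integral>\<^sup>+z. \<integral>\<^sup>+x. h z g x \<partial>lborel \<partial>count_space (zvecs n) \<partial>\<nu>)"
  proof (rule nn_integral_cong)
    fix g assume "g \<in> space \<nu>"
    then have g: "g \<in> SL n" by simp
    show "gauss_sum n \<alpha> (row_lattice n g) = (\<integral>\<^sup>+z. \<integral>\<^sup>+x. h z g x \<partial>lborel \<partial>count_space (zvecs n))"
      unfolding lat_sum_row[OF g] h_def q_def by (intro nn_integral_cong layer nq_nonneg)
  qed
  also have "\<dots> = (\<integral>\<^sup>+z. \<integral>\<^sup>+g. \<integral>\<^sup>+x. h z g x \<partial>lborel \<partial>\<nu> \<partial>count_space (zvecs n))"
    by (rule nn_integral_count_space_nn_integral[OF countable_zvecs]) (rule hm1)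
  also have "\<dots> = (\<integral>\<^sup>+z. \<integral>\<^sup>+x. \<integral>\<^sup>+g. h z g x \<partial>\<nu> \<partial>lborel \<partial>count_space (zvecs n))"
    by (intro nn_integral_cong pr.Fubini'[symmetric] hm)
  also have "\<dots> = (\<integral>\<^sup>+x. \<integral>\<^sup>+z. \<integral>\<^sup>+g. h z g x \<partial>\<nu> \<partial>count_space (zvecs n) \<partial>lborel)"
    by (rule nn_integral_count_space_nn_integral[OF countable_zvecs, symmetric]) (rule hm2)
  also have "\<dots> = (\<integral>\<^sup>+x. \<integral>\<^sup>+g. \<integral>\<^sup>+z. h z g x \<partial>count_space (zvecs n) \<partial>\<nu> \<partial>lborel)"
    by (intro nn_integral_cong nn_integral_count_space_nn_integral[OF countable_zvecs, symmetric] hm3)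
  also have "\<dots> \<le> (\<integral>\<^sup>+x. ennreal (unit_ball_vol (real n) * \<alpha> powr (- real n / 2)) * ennreal (indicator {0..} x * x powr (real n / 2 + 1 - 1) / exp x) \<partial>lborel)"
  proof (rule nn_integral_mono_AE, use AE_lborel_singleton[of "0 :: real"] in eventually_elim)
    case (elim x)
    let ?r = "sqrt (x / \<alpha>)"
    have "(\<integral>\<^sup>+g. \<integral>\<^sup>+z. h z g x \<partial>count_space (zvecs n) \<partial>\<nu>) = (\<integral>\<^sup>+g. e x * lat_sum n (indicator {..?r}) (row_lattice n g) \<partial>\<nu>)"
    proof (rule nn_integral_cong)
      fix g assume "g \<in> space \<nu>"
      then have g: "g \<in> SL n" by simp
      show "(\<integral>\<^sup>+z. h z g x \<partial>count_space (zvecs n)) = e x * lat_sum n (indicator {..?r}) (row_lattice n g)"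
        unfolding lat_sum_row[OF g] h_def q_def by (rule nn_integral_cmult) simp
    qed
    also have "\<dots> = e x * (\<integral>\<^sup>+g. lat_sum n (indicator {..?r}) (row_lattice n g) \<partial>\<nu>)"
      by (rule nn_integral_cmult)
         (use measurable_compose[OF measurable_row_lattice measurable_lat_sum, of "indicator {..?r}" n] in \<open>simp cong: measurable_cong_sets\<close>)
    also have "(\<integral>\<^sup>+g. lat_sum n (indicator {..?r}) (row_lattice n g) \<partial>\<nu>) = (\<integral>\<^sup>+L. lat_sum n (indicator {..?r}) L \<partial>\<mu>)"
      by (rule nn_integral_nu_lattice) measurable
    finally have eq: "(\<integral>\<^sup>+g. \<integral>\<^sup>+z. h z g x \<partial>count_space (zvecs n) \<partial>\<nu>) = e x * (\<integral>\<^sup>+L. lat_sum n (indicator {..?r}) L \<partial>\<mu>)" .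
    show ?case
    proof (cases "x > 0")
      case True
      have rn: "?r ^ n = x powr (real n / 2) * \<alpha> powr (- real n / 2)"
      proof -
        have "?r ^ n = ?r powr real n" using True \<alpha> by (simp add: powr_realpow)
        also have "\<dots> = (x / \<alpha>) powr (real n / 2)" using True \<alpha> by (simp add: powr_half_sqrt[symmetric] powr_powr)
        also have "\<dots> = x powr (real n / 2) * \<alpha> powr (- real n / 2)"
          unfolding \<alpha>m using True \<alpha> by (subst powr_divide) auto
        finally show ?thesis .
      qed
      have "(\<integral>\<^sup>+L. lat_sum n (indicator {..?r}) L \<partial>\<mu>) \<le> ennreal (unit_ball_vol (real n) * ?r ^ n)"
        by (rule siegel_ball[OF n3]) (use True \<alpha> in simp)
      then have "e x * (\<integral>\<^sup>+L. lat_sum n (indicator {..?r}) L \<partial>\<mu>) \<le> ennreal (exp (- x)) * ennreal (unit_ball_vol (real n) * ?r ^ n)"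
        using True by (simp add: e_def mult_left_mono)
      also have "\<dots> = ennreal (exp (- x) * (unit_ball_vol (real n) * ?r ^ n))"
        by (rule ennreal_mult[symmetric]) (use True \<alpha> in auto)
      also have "\<dots> = ennreal ((unit_ball_vol (real n) * \<alpha> powr (- real n / 2)) * (indicator {0..} x * x powr (real n / 2 + 1 - 1) / exp x))"
        unfolding rn using True by (simp add: exp_minus field_simps)
      also have "\<dots> = ennreal (unit_ball_vol (real n) * \<alpha> powr (- real n / 2)) * ennreal (indicator {0..} x * x powr (real n / 2 + 1 - 1) / exp x)"
        by (rule ennreal_mult) (auto simp: indicator_def)
      finally show ?thesis unfolding eq .
    next
      case False
      with elim have "x < 0" by simp
      then have "e x = 0" by (simp add: e_def)
      then show ?thesis unfolding eq by simp
    qed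
  qed
  also have "\<dots> = ennreal (unit_ball_vol (real n) * \<alpha> powr (- real n / 2)) * (\<integral>\<^sup>+x. ennreal (indicator {0..} x * x powr (real n / 2 + 1 - 1) / exp x) \<partial>lborel)"
    by (rule nn_integral_cmult) measurable
  also have "(\<integral>\<^sup>+x. ennreal (indicator {0..} x * x powr (real n / 2 + 1 - 1) / exp x) \<partial>lborel) = ennreal (Gamma (real n / 2 + 1))"
    by (rule Gamma_conv_nn_integral_real[symmetric]) simp
  also have "ennreal (unit_ball_vol (real n) * \<alpha> powr (- real n / 2)) * ennreal (Gamma (real n / 2 + 1))
      = ennreal (unit_ball_vol (real n) * \<alpha> powr (- real n / 2) * Gamma (real n / 2 + 1))"
    by (rule ennreal_mult[symmetric]) (auto intro!: Gamma_real_nonneg)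
  also have "unit_ball_vol (real n) * \<alpha> powr (- real n / 2) * Gamma (real n / 2 + 1) = (pi / \<alpha>) powr (real n / 2)"
  proof -
    have "Gamma (real n / 2 + 1) > 0" by (rule Gamma_real_pos) simp
    then have "Gamma (real n / 2 + 1) \<noteq> 0" by (metis less_irrefl)
    moreover have "(pi / \<alpha>) powr (real n / 2) = pi powr (real n / 2) / \<alpha> powr (real n / 2)"
      by (rule powr_divide)
    ultimately show ?thesis unfolding \<alpha>m by (simp add: unit_ball_vol_def)
  qed
  finally show ?thesis .
qed

end

section \<open>Gaussian masses on a lattice\<close>

lemma latt_iff: "L \<in> latt n \<longleftrightarrow> (\<exists>g\<in>SL n. L = row_lattice n g)"
  by (auto simp: latt_def)

lemma latt_carrier: "L \<in> latt n \<Longrightarrow> v \<in> L \<Longrightarrow> v \<in> carrier_vec n"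
  using row_lattice_pt[OF SL_carrier] pt_carrier by (auto simp: latt_iff)

lemma latt_zero: "L \<in> latt n \<Longrightarrow> 0\<^sub>v n \<in> L"
  using pt_int_mem[OF SL_carrier, of _ n "\<lambda>_. 0"] by (auto simp: latt_iff pt_zero)

lemma pt_add: "pt n g x + c \<cdot>\<^sub>v pt n g y = pt n g (\<lambda>i. x i + c * y i)"
  by (intro eq_vecI) (auto simp: pt_def algebra_simps sum.distrib sum_distrib_left)

lemma pt_smult: "c \<cdot>\<^sub>v pt n g y = pt n g (\<lambda>i. c * y i)"
  by (intro eq_vecI) (auto simp: pt_def algebra_simps sum_distrib_left)

lemma latt_add:
  assumes "L \<in> latt n" "x \<in> L" "w \<in> L"
  shows "x + of_int k \<cdot>\<^sub>v w \<in> L"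
proof -
  from assms(1) obtain g where g: "g \<in> SL n" "L = row_lattice n g" by (auto simp: latt_iff)
  have gc: "g \<in> carrier_mat n n" using g by (auto dest: SL_carrier)
  from assms obtain y z :: "nat \<Rightarrow> int" where
    yz: "x = pt n g (\<lambda>i. of_int (y i))" "w = pt n g (\<lambda>i. of_int (z i))"
    unfolding g row_lattice_pt[OF gc] by blast
  have "x + of_int k \<cdot>\<^sub>v w = pt n g (\<lambda>i. of_int (y i + k * z i))"
    unfolding yz pt_add by simp
  then show ?thesis unfolding g by (simp only: pt_int_mem[OF gc])
qed

lemma euclid_norm_L2: "v \<in> carrier_vec n \<Longrightarrow> euclid_norm v = L2_set (vec_index v) {..<n}"
  by (auto simp: euclid_norm_def L2_set_def scalar_prod_def power2_eq_square lessThan_atLeast0)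

lemma euclid_norm_nonneg: "0 \<le> euclid_norm v"
  by (simp add: euclid_norm_def scalar_prod_def sum_nonneg)

lemma euclid_norm_zero_iff:
  assumes "v \<in> carrier_vec n"
  shows "euclid_norm v = 0 \<longleftrightarrow> v = 0\<^sub>v n"
proof -
  have "euclid_norm v = 0 \<longleftrightarrow> (\<forall>i<n. vec_index v i = 0)"
    unfolding euclid_norm_L2[OF assms] by (auto simp: L2_set_eq_0_iff)
  also have "\<dots> \<longleftrightarrow> v = 0\<^sub>v n" using assms by (auto intro!: eq_vecI)
  finally show ?thesis .
qed

lemma euclid_norm_smult:
  assumes "v \<in> carrier_vec n"
  shows "euclid_norm (c \<cdot>\<^sub>v v) = \<bar>c\<bar> * euclid_norm v"
proof -
  have "euclid_norm (c \<cdot>\<^sub>v v) = L2_set (\<lambda>i. c * vec_index v i) {..<n}"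
    using assms by (subst euclid_norm_L2[of _ n]) (auto intro!: L2_set_cong)
  then show ?thesis
    unfolding euclid_norm_L2[OF assms] L2_set_def
    by (simp add: power_mult_distrib sum_distrib_left[symmetric] real_sqrt_mult)
qed

lemma euclid_norm_add_sq:
  assumes "x \<in> carrier_vec n" "w \<in> carrier_vec n"
  shows "(euclid_norm (x + c \<cdot>\<^sub>v w))\<^sup>2 = (euclid_norm x)\<^sup>2 + 2 * c * scalar_prod x w + c\<^sup>2 * (euclid_norm w)\<^sup>2"
proof -
  have sq: "(euclid_norm v)\<^sup>2 = (\<Sum>i<n. (vec_index v i)\<^sup>2)" if "v \<in> carrier_vec n" for v
    unfolding euclid_norm_L2[OF that] L2_set_def by (simp add: sum_nonneg)
  have "(euclid_norm (x + c \<cdot>\<^sub>v w))\<^sup>2 = (\<Sum>i<n. (vec_index x i + c * vec_index w i)\<^sup>2)"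
    using assms by (subst sq) auto
  also have "\<dots> = (\<Sum>i<n. (vec_index x i)\<^sup>2) + 2 * c * (\<Sum>i<n. vec_index x i * vec_index w i) + c\<^sup>2 * (\<Sum>i<n. (vec_index w i)\<^sup>2)"
    by (simp add: power2_sum power_mult_distrib sum.distrib sum_distrib_left mult_ac)
  finally show ?thesis
    using assms by (simp add: sq scalar_prod_def lessThan_atLeast0)
qed

lemma euclid_norm_triangle_smult:
  assumes "x \<in> carrier_vec n" "w \<in> carrier_vec n"
  shows "\<bar>c\<bar> * euclid_norm w \<le> euclid_norm (x + c \<cdot>\<^sub>v w) + euclid_norm x"
proof -
  have "\<bar>c\<bar> * euclid_norm w = L2_set (\<lambda>i. (vec_index x i + c * vec_index w i) + (- vec_index x i)) {..<n}"
    using assms by (subst euclid_norm_smult[OF assms(2), symmetric], subst euclid_norm_L2[of _ n]) (auto intro!: L2_set_cong)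
  also have "\<dots> \<le> L2_set (\<lambda>i. vec_index x i + c * vec_index w i) {..<n} + L2_set (\<lambda>i. - vec_index x i) {..<n}"
    by (rule L2_set_triangle_ineq)
  also have "L2_set (\<lambda>i. - vec_index x i) {..<n} = euclid_norm x"
    unfolding euclid_norm_L2[OF assms(1)] by (simp add: L2_set_def)
  also have "L2_set (\<lambda>i. vec_index x i + c * vec_index w i) {..<n} = euclid_norm (x + c \<cdot>\<^sub>v w)"
    using assms by (subst euclid_norm_L2[of _ n]) (auto intro!: L2_set_cong)
  finally show ?thesis .
qed

lemma finite_latt_ball:
  assumes "L \<in> latt n"
  shows "finite {v \<in> L. euclid_norm v \<le> T}"
proof -
  from assms obtain g where g: "g \<in> SL n" "L = row_lattice n g" by (auto simp: latt_iff)
  have gc: "g \<in> carrier_mat n n" using g by (auto dest: SL_carrier)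
  have "{v \<in> L. euclid_norm v \<le> T} \<subseteq> (\<lambda>z. pt n g (\<lambda>i. of_int (z i))) ` zpts n g T"
  proof
    fix v assume v: "v \<in> {v \<in> L. euclid_norm v \<le> T}"
    then obtain y :: "nat \<Rightarrow> int" where y: "v = pt n g (\<lambda>i. of_int (y i))"
      unfolding g row_lattice_pt[OF gc] by blast
    have vy: "v = pt n g (\<lambda>i. of_int (restrict y {..<n} i))" unfolding y by (rule pt_cong) simp
    have "nq n g (\<lambda>i. of_int (restrict y {..<n} i)) \<le> T"
      using v unfolding vy by (simp add: euclid_norm_pt)
    then have "restrict y {..<n} \<in> zpts n g T" by (simp add: zpts_def)
    then show "v \<in> (\<lambda>z. pt n g (\<lambda>i. of_int (z i))) ` zpts n g T"
      by (rule image_eqI[where x = "restrict y {..<n}", rotated]) (rule vy)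
  qed
  then show ?thesis using finite_zpts[OF g(1)] by (rule finite_surj[rotated])
qed

lemma lat_sum_card:
  assumes L: "L \<in> latt n"
  shows "lat_sum n (indicator {..R}) L = of_nat (card (short n R L))"
proof -
  have "lat_sum n (indicator {..R}) L = (\<integral>\<^sup>+v. indicator (short n R L) v \<partial>count_space (L - {0\<^sub>v n}))"
    unfolding lat_sum_def by (intro nn_integral_cong) (simp add: indicator_def)
  also have "\<dots> = emeasure (count_space (L - {0\<^sub>v n})) (short n R L)"
    by (rule nn_integral_indicator) auto
  also have "\<dots> = of_nat (card (short n R L))"
    by (rule emeasure_count_space_finite) (auto intro: finite_subset[OF _ finite_latt_ball[OF L, of R]])
  finally show ?thesis .
qed

text \<open>Unnormalised Gaussian mass; \<open>\<alpha>\<close> stands for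
  \<open>pi / s\<^sup>2\<close>. Values in \<open>ennreal\<close> postpone summability to
  \<open>gmass_finite\<close>.\<close>

definition gmass :: "real \<Rightarrow> real vec set \<Rightarrow> ennreal" where
  "gmass \<alpha> A = (\<integral>\<^sup>+v. ennreal (exp (- \<alpha> * (euclid_norm v)\<^sup>2)) \<partial>count_space A)"

lemma gmass_mono: "A \<subseteq> B \<Longrightarrow> gmass \<alpha> A \<le> gmass \<alpha> B"
  unfolding gmass_def by (rule nn_integral_count_space_mono)

lemma gmass_lat_sum:
  assumes "L \<in> latt n"
  shows "gmass \<alpha> L = 1 + gauss_sum n \<alpha> L"
proof -
  let ?f = "\<lambda>v. ennreal (exp (- \<alpha> * (euclid_norm v)\<^sup>2))"
  have z: "euclid_norm (0\<^sub>v n) = 0" using euclid_norm_zero_iff[of "0\<^sub>v n" n] by simp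
  have "gmass \<alpha> L = (\<integral>\<^sup>+v. ?f v * indicator L v \<partial>count_space UNIV)"
    unfolding gmass_def by (rule nn_integral_ind)
  also have "\<dots> = (\<integral>\<^sup>+v. ?f v * indicator {0\<^sub>v n} v + ?f v * indicator (L - {0\<^sub>v n}) v \<partial>count_space UNIV)"
    using latt_zero[OF assms] by (intro nn_integral_cong) (auto simp: indicator_def)
  also have "\<dots> = (\<integral>\<^sup>+v. ?f v * indicator {0\<^sub>v n} v \<partial>count_space UNIV) + (\<integral>\<^sup>+v. ?f v * indicator (L - {0\<^sub>v n}) v \<partial>count_space UNIV)"
    by (rule nn_integral_add) auto
  also have "(\<integral>\<^sup>+v. ?f v * indicator {0\<^sub>v n} v \<partial>count_space UNIV) = 1"
    unfolding nn_integral_ind[symmetric] by (subst nn_integral_count_space_finite) (auto simp: z)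
  also have "(\<integral>\<^sup>+v. ?f v * indicator (L - {0\<^sub>v n}) v \<partial>count_space UNIV) = gauss_sum n \<alpha> L"
    unfolding lat_sum_def by (rule nn_integral_ind[symmetric])
  finally show ?thesis .
qed

lemma int_gaussian_sum_finite:
  assumes b: "\<beta> > 0"
  shows "(\<integral>\<^sup>+k. ennreal (exp (- \<beta> * (real_of_int k)\<^sup>2)) \<partial>count_space UNIV) < \<infinity>"
proof -
  \<comment> \<open>Chosen so that \<open>(1 + \<bar>x\<bar>)\<^sup>2 \<le> 2 + 2 * x\<^sup>2 \<le>
    C * (1 + \<beta> * x\<^sup>2)\<close>, after which \<open>1 + t \<le> exp t\<close>
    applies.\<close>
  define C where "C = 2 + 2 / \<beta>"
  have C: "C > 0" using b by (simp add: C_def add_pos_pos)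
  have "exp (- \<beta> * x\<^sup>2) \<le> C * (1 / (1 + \<bar>x\<bar>)\<^sup>2)" for x :: real
  proof -
    have "(1 + \<bar>x\<bar>)\<^sup>2 \<le> 2 + 2 * x\<^sup>2"
      using sum_squares_bound[of 1 "\<bar>x\<bar>"] by (simp add: power2_sum)
    also have "\<dots> \<le> C * (1 + \<beta> * x\<^sup>2)"
      using b by (simp add: C_def field_simps)
    also have "\<dots> \<le> C * exp (\<beta> * x\<^sup>2)" using C by (intro mult_left_mono exp_ge_add_one_self) auto
    finally have "(1 + \<bar>x\<bar>)\<^sup>2 \<le> C * exp (\<beta> * x\<^sup>2)" .
    then have "(1 + \<bar>x\<bar>)\<^sup>2 * exp (- \<beta> * x\<^sup>2) \<le> C * exp (\<beta> * x\<^sup>2) * exp (- \<beta> * x\<^sup>2)"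
      by (rule mult_right_mono) simp
    also have "\<dots> = C" by (simp add: mult.assoc exp_add[symmetric])
    finally show ?thesis by (simp add: field_simps add_pos_nonneg)
  qed
  then have "(\<integral>\<^sup>+k. ennreal (exp (- \<beta> * (real_of_int k)\<^sup>2)) \<partial>count_space UNIV)
      \<le> (\<integral>\<^sup>+k. ennreal C * ennreal (1 / (1 + \<bar>real_of_int k\<bar>)\<^sup>2) \<partial>count_space UNIV)"
    using C by (intro nn_integral_mono) (simp add: ennreal_mult[symmetric] del: times_divide_eq_right)
  also have "\<dots> = ennreal C * (\<integral>\<^sup>+k. ennreal (1 / (1 + \<bar>real_of_int k\<bar>)\<^sup>2) \<partial>count_space UNIV)"
    by (rule nn_integral_cmult) simp
  also have "\<dots> < \<infinity>" using int_inverse_square_sum_finite by (simp add: ennreal_mult_less_top)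
  finally show ?thesis .
qed

lemma gmass_finite:
  assumes L: "L \<in> latt n" and a: "\<alpha> > 0"
  shows "gmass \<alpha> L < \<infinity>"
proof -
  from L obtain g where g: "g \<in> SL n" "L = row_lattice n g" by (auto simp: latt_iff)
  define c where "c = 1 + nrm n (adj_mat g)"
  have c: "c > 0" using nrm_nonneg[of n "adj_mat g"] by (simp add: c_def)
  \<comment> \<open>Every coordinate is at most \<open>c\<close> times the norm, so the exponent can
    be shared evenly among the coordinates and the sum becomes a product. \<open>Suc n\<close>
    avoids division by zero for \<open>n = 0\<close>.\<close>
  define \<beta> where "\<beta> = \<alpha> / (real (Suc n) * c\<^sup>2)"
  have b: "\<beta> > 0" using a c by (simp add: \<beta>_def)
  interpret product_sigma_finite "\<lambda>_ :: nat. count_space (UNIV :: int set)"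
    by (rule product_sigma_finite.intro) (rule sigma_finite_measure_count_space)
  have le: "exp (- \<alpha> * (nq n g (\<lambda>i. of_int (z i)))\<^sup>2) \<le> (\<Prod>i<n. exp (- \<beta> * (of_int (z i))\<^sup>2))" for z :: "nat \<Rightarrow> int"
  proof -
    let ?q = "nq n g (\<lambda>i. of_int (z i))"
    have "(\<Sum>i<n. \<beta> * (of_int (z i))\<^sup>2) \<le> (\<Sum>i<n. \<beta> * (c * ?q)\<^sup>2)"
    proof (intro sum_mono mult_left_mono)
      fix i assume "i \<in> {..<n}"
      then have "\<bar>of_int (z i)\<bar> \<le> nrm n (adj_mat g) * ?q" using coord_le_nq[OF g(1), of i "\<lambda>i. of_int (z i)"] by simp
      also have "\<dots> \<le> c * ?q" unfolding c_def by (intro mult_right_mono nq_nonneg) simp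
      finally have "\<bar>of_int (z i)\<bar>\<^sup>2 \<le> (c * ?q)\<^sup>2" by (rule power_mono) simp
      then show "(of_int (z i))\<^sup>2 \<le> (c * ?q)\<^sup>2" by simp
    qed (use b in simp)
    also have "\<dots> = (real n / real (Suc n)) * (\<alpha> * ?q\<^sup>2)"
      using c by (simp add: \<beta>_def power_mult_distrib)
    also have "\<dots> \<le> 1 * (\<alpha> * ?q\<^sup>2)" using a by (intro mult_right_mono) auto
    finally have "(\<Sum>i<n. \<beta> * (of_int (z i))\<^sup>2) \<le> \<alpha> * ?q\<^sup>2" by simp
    then have "exp (- \<alpha> * ?q\<^sup>2) \<le> exp (\<Sum>i<n. - \<beta> * (of_int (z i))\<^sup>2)" by (simp add: sum_negf)
    then show ?thesis by (simp add: exp_sum)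
  qed
  have "gauss_sum n \<alpha> L = (\<integral>\<^sup>+z. ennreal (exp (- \<alpha> * (nq n g (\<lambda>i. of_int (z i)))\<^sup>2)) \<partial>count_space (zvecs n))"
    unfolding g(2) by (rule lat_sum_row[OF g(1)])
  also have "\<dots> \<le> (\<integral>\<^sup>+z. (\<Prod>i<n. ennreal (exp (- \<beta> * (of_int (z i))\<^sup>2))) \<partial>count_space (zvecs n))"
    by (intro nn_integral_mono) (use le in \<open>simp add: prod_ennreal ennreal_leI\<close>)
  also have "\<dots> \<le> (\<integral>\<^sup>+z. (\<Prod>i<n. ennreal (exp (- \<beta> * (of_int (z i))\<^sup>2))) \<partial>count_space (PiE {..<n} (\<lambda>_. UNIV)))"
    by (rule nn_integral_count_space_mono) (auto simp: zvecs_def)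
  also have "\<dots> = (\<integral>\<^sup>+z. (\<Prod>i<n. ennreal (exp (- \<beta> * (of_int (z i))\<^sup>2))) \<partial>Pi\<^sub>M {..<n} (\<lambda>_. count_space UNIV))"
    by (subst count_space_PiM_finite) auto
  also have "\<dots> = (\<Prod>i<n. \<integral>\<^sup>+k. ennreal (exp (- \<beta> * (real_of_int k)\<^sup>2)) \<partial>count_space UNIV)"
    by (rule product_nn_integral_prod) auto
  also have "\<dots> < \<infinity>" using int_gaussian_sum_finite[OF b] by (simp add: power_less_top_ennreal)
  finally show ?thesis by (simp add: gmass_lat_sum[OF L])
qed

lemma gmass_ge_1: "L \<in> latt n \<Longrightarrow> 1 \<le> gmass \<alpha> L"
  by (simp add: gmass_lat_sum)

section \<open>The discrete Gaussian\<close>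

text \<open>\<open>infsum\<close> is 0 by default when a family is not summable, so finiteness has
  to be known before the two sums can be identified.\<close>

lemma theta_gmass:
  assumes L: "L \<in> latt n" and s: "s \<noteq> 0"
  shows "gmass (pi / s\<^sup>2) L = ennreal (theta L s)"
proof -
  let ?f = "\<lambda>v. exp (- pi * (euclid_norm v)\<^sup>2 / s\<^sup>2)"
  have g: "gmass (pi / s\<^sup>2) L = (\<integral>\<^sup>+v. ennreal (?f v) \<partial>count_space L)"
    unfolding gmass_def by (intro nn_integral_cong) simp
  have fin: "(\<integral>\<^sup>+v. ennreal (?f v) \<partial>count_space L) < \<infinity>"
    using gmass_finite[OF L, of "pi / s\<^sup>2"] s unfolding g by simp
  then have "integrable (count_space L) ?f"
    by (intro integrableI_nonneg) auto
  then have sm: "Infinite_Set_Sum.abs_summable_on ?f L" by (simp add: abs_summable_on_def)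
  have "(\<integral>\<^sup>+v. ennreal (?f v) \<partial>count_space L) = ennreal (infsetsum ?f L)"
    by (rule nn_integral_conv_infsetsum[OF sm]) simp
  also have "infsetsum ?f L = infsum ?f L" by (rule infsetsum_infsum[OF sm])
  finally show ?thesis unfolding g theta_def .
qed

lemma emeasure_discrete_gaussian:
  assumes L: "L \<in> latt n" and s: "s \<noteq> 0"
  shows "emeasure (measure_pmf (discrete_gaussian L s)) A = gmass (pi / s\<^sup>2) (L \<inter> A) / gmass (pi / s\<^sup>2) L"
proof -
  let ?e = "\<lambda>v. exp (- pi * (euclid_norm v)\<^sup>2 / s\<^sup>2)"
  let ?f = "\<lambda>v. if v \<in> L then ?e v / theta L s else 0"
  have a: "pi / s\<^sup>2 > 0" using s by simp
  have G: "gmass (pi / s\<^sup>2) L = ennreal (theta L s)" by (rule theta_gmass[OF L s])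
  \<comment> \<open>The zero vector alone contributes 1, so the normalisation divides by a positive
    number.\<close>
  have "1 \<le> ennreal (theta L s)" using gmass_ge_1[OF L, of "pi / s\<^sup>2"] unfolding G .
  then have th: "1 \<le> theta L s" by (cases "theta L s \<ge> 0") (auto simp: ennreal_neg)
  have mass: "(\<integral>\<^sup>+v. ennreal (?f v) \<partial>count_space B) = gmass (pi / s\<^sup>2) (L \<inter> B) / gmass (pi / s\<^sup>2) L" for B
  proof -
    have "(\<integral>\<^sup>+v. ennreal (?f v) \<partial>count_space B) = (\<integral>\<^sup>+v. ennreal (?f v) * indicator B v \<partial>count_space UNIV)" by (rule nn_integral_ind)
    also have "\<dots> = (\<integral>\<^sup>+v. (ennreal (exp (- (pi / s\<^sup>2) * (euclid_norm v)\<^sup>2)) / ennreal (theta L s)) * indicator (L \<inter> B) v \<partial>count_space UNIV)"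
      using th by (intro nn_integral_cong) (auto simp: indicator_def divide_ennreal)
    also have "\<dots> = (\<integral>\<^sup>+v. ennreal (exp (- (pi / s\<^sup>2) * (euclid_norm v)\<^sup>2)) / ennreal (theta L s) \<partial>count_space (L \<inter> B))"
      by (rule nn_integral_ind[symmetric])
    also have "\<dots> = gmass (pi / s\<^sup>2) (L \<inter> B) / ennreal (theta L s)"
      unfolding gmass_def by (rule nn_integral_divide) simp
    finally show ?thesis unfolding G .
  qed
  have one: "(\<integral>\<^sup>+v. ennreal (?f v) \<partial>count_space UNIV) = 1"
    unfolding mass[of UNIV] using gmass_ge_1[OF L, of "pi / s\<^sup>2"] gmass_finite[OF L a]
    by (simp, intro ennreal_divide_self) auto
  have pmf: "pmf (discrete_gaussian L s) v = ?f v" for v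
    unfolding discrete_gaussian_def by (rule pmf_embed_pmf) (use th one in auto)
  show ?thesis
    unfolding nn_integral_pmf[symmetric] pmf mass[symmetric] ..
qed

lemma GH_pos: "n > 0 \<Longrightarrow> GH n > 0"
proof -
  have "unit_ball_vol (real n) \<noteq> 0" by (metis less_irrefl of_nat_0_le_iff unit_ball_vol_pos)
  then show ?thesis by (simp add: GH_def)
qed

lemma gauss_width_pos: "n > 0 \<Longrightarrow> c > 0 \<Longrightarrow> gauss_width n c > 0"
  using GH_pos[of n] by (simp add: gauss_width_def)

definition rate :: "nat \<Rightarrow> real \<Rightarrow> real" where
  "rate n c = c * real n / (2 * (GH n)\<^sup>2)"

lemma rate_pos: "n > 0 \<Longrightarrow> c > 0 \<Longrightarrow> rate n c > 0"
  using GH_pos[of n] by (simp add: rate_def)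

lemma rate_width: "n > 0 \<Longrightarrow> c > 0 \<Longrightarrow> pi / (gauss_width n c)\<^sup>2 = rate n c"
  using GH_pos[of n] by (simp add: gauss_width_def rate_def)

lemma emeasure_gaussian_rate:
  assumes "L \<in> latt n" "n > 0" "c > 0"
  shows "emeasure (measure_pmf (discrete_gaussian L (gauss_width n c))) A = gmass (rate n c) (L \<inter> A) / gmass (rate n c) L"
  using emeasure_discrete_gaussian[OF assms(1), of "gauss_width n c" A] gauss_width_pos[OF assms(2,3)]
  unfolding rate_width[OF assms(2,3)] by simp

section \<open>Shortest vectors and primitive parts\<close>

lemma latt_nonzero:
  assumes "L \<in> latt n" "n > 0"
  shows "L - {0\<^sub>v n} \<noteq> {}"
proof -
  from assms(1) obtain g where g: "g \<in> SL n" "L = row_lattice n g" by (auto simp: latt_iff)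
  have "(\<lambda>i\<in>{..<n}. 1 :: int) \<in> zvecs n" using assms(2) by (auto simp: zvecs_iff)
  then show ?thesis using bij_betw_imp_surj_on[OF bij_betw_zvecs[OF g(1)]] g(2) by blast
qed

text \<open>A ball that contains some nonzero lattice vector contains only finitely many, so the
  infimum is a minimum.\<close>

lemma lambda1_attained:
  assumes L: "L \<in> latt n" and n: "n > 0"
  obtains v where "v \<in> L - {0\<^sub>v n}" "euclid_norm v = lambda1 n L"
    "\<And>w. w \<in> L - {0\<^sub>v n} \<Longrightarrow> lambda1 n L \<le> euclid_norm w"
proof -
  obtain v0 where v0: "v0 \<in> L - {0\<^sub>v n}" using latt_nonzero[OF L n] by blast
  let ?S = "short n (euclid_norm v0) L"
  have fin: "finite ?S" by (rule finite_subset[OF _ finite_latt_ball[OF L, of "euclid_norm v0"]]) auto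
  have ne: "?S \<noteq> {}" using v0 by auto
  define v where "v = arg_min_on euclid_norm ?S"
  have v: "v \<in> ?S" "\<And>w. w \<in> ?S \<Longrightarrow> euclid_norm v \<le> euclid_norm w"
    unfolding v_def using arg_min_if_finite(1)[OF fin ne] arg_min_least[OF fin ne] by auto
  have min: "euclid_norm v \<le> euclid_norm w" if "w \<in> L - {0\<^sub>v n}" for w
    using v that by (cases "w \<in> ?S") auto
  have "lambda1 n L = euclid_norm v"
    unfolding lambda1_def using v(1) min by (intro cInf_eq_minimum) auto
  with v(1) min show ?thesis by (intro that[of v]) auto
qed

definition content :: "nat \<Rightarrow> (nat \<Rightarrow> int) \<Rightarrow> int" where
  "content n z = Gcd (z ` {..<n})"

lemma content_dvd: "i < n \<Longrightarrow> content n z dvd z i"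
  by (simp add: content_def)

lemma content_pos: "\<exists>i<n. z i \<noteq> 0 \<Longrightarrow> content n z > 0"
proof -
  assume "\<exists>i<n. z i \<noteq> 0"
  then have "content n z \<noteq> 0" by (auto simp: content_def)
  moreover have "content n z \<ge> 0" by (simp add: content_def)
  ultimately show ?thesis by simp
qed

lemma content_mult:
  assumes "\<And>i. i < n \<Longrightarrow> z i = int m * y i"
  shows "content n z = int m * content n y"
proof -
  have "z ` {..<n} = (*) (int m) ` (y ` {..<n})"
    unfolding image_image using assms by (intro image_cong) auto
  then have "content n z = normalize (int m * Gcd (y ` {..<n}))"
    unfolding content_def by (simp add: Gcd_mult)
  then show ?thesis by (simp add: content_def normalize_mult)
qed

lemma of_int_eq_of_nat_mult: "real_of_int a = real m * real_of_int b \<Longrightarrow> a = int m * b"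
  by (metis of_int_eq_iff of_int_mult of_int_of_nat_eq)

lemma primitive_iff:
  assumes g: "g \<in> SL n" and z: "\<exists>i<n. z i \<noteq> 0"
  shows "primitive n (row_lattice n g) (pt n g (\<lambda>i. of_int (z i))) \<longleftrightarrow> content n z = 1"
proof -
  have gc: "g \<in> carrier_mat n n" using g by (rule SL_carrier)
  have nz: "pt n g (\<lambda>i. of_int (z i)) \<noteq> 0\<^sub>v n" using z by (simp add: pt_eq_zero_iff[OF g])
  have "(\<exists>w'\<in>row_lattice n g. \<exists>m::nat. m \<ge> 2 \<and> pt n g (\<lambda>i. of_int (z i)) = real m \<cdot>\<^sub>v w') \<longleftrightarrow> content n z \<noteq> 1"
  proof
    assume "\<exists>w'\<in>row_lattice n g. \<exists>m::nat. m \<ge> 2 \<and> pt n g (\<lambda>i. of_int (z i)) = real m \<cdot>\<^sub>v w'"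
    then obtain y :: "nat \<Rightarrow> int" and m :: nat where y: "m \<ge> 2" "pt n g (\<lambda>i. of_int (z i)) = real m \<cdot>\<^sub>v pt n g (\<lambda>i. of_int (y i))"
      unfolding row_lattice_pt[OF gc] by blast
    have "z i = int m * y i" if "i < n" for i
      by (rule of_int_eq_of_nat_mult) (rule pt_inj[OF g y(2)[unfolded pt_smult] that])
    then have "content n z = int m * content n y" by (rule content_mult)
    then show "content n z \<noteq> 1" using y(1) by (auto simp: zmult_eq_1_iff)
  next
    assume c: "content n z \<noteq> 1"
    define m where "m = nat (content n z)"
    have m: "int m = content n z" "m \<ge> 2" using content_pos[OF z] c by (auto simp: m_def)
    define y where "y i = z i div int m" for i
    have "z i = int m * y i" if "i < n" for i
      using content_dvd[OF that, of z] unfolding m(1)[symmetric] by (simp add: y_def)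
    then have "pt n g (\<lambda>i. of_int (z i)) = pt n g (\<lambda>i. real m * of_int (y i))"
      by (intro pt_cong) (metis of_int_mult of_int_of_nat_eq)
    then show "\<exists>w'\<in>row_lattice n g. \<exists>m::nat. m \<ge> 2 \<and> pt n g (\<lambda>i. of_int (z i)) = real m \<cdot>\<^sub>v w'"
      unfolding pt_smult[symmetric] using m(2) pt_int_mem[OF gc, of y] by blast
  qed
  then show ?thesis unfolding primitive_def using nz pt_int_mem[OF gc, of z] by blast
qed

text \<open>Dividing by the content leaves content 1. For uniqueness, the content of
  \<open>k\<close> times a vector is \<open>k\<close> times its content, so a primitive
  \<open>w\<close> with \<open>v = k w\<close> has \<open>k\<close> equal to the content of
  \<open>v\<close>.\<close>

lemma primitive_part_pt:
  assumes g: "g \<in> SL n" and z: "\<exists>i<n. z i \<noteq> 0"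
  shows "primitive_part n (row_lattice n g) (pt n g (\<lambda>i. of_int (z i))) = pt n g (\<lambda>i. of_int (z i div content n z))"
proof -
  let ?L = "row_lattice n g" and ?v = "pt n g (\<lambda>i. of_int (z i))"
  have gc: "g \<in> carrier_mat n n" using g by (rule SL_carrier)
  have nz: "?v \<noteq> 0\<^sub>v n" using z by (simp add: pt_eq_zero_iff[OF g])
  define m where "m = nat (content n z)"
  have m: "int m = content n z" "m \<ge> 1" using content_pos[OF z] by (auto simp: m_def)
  define y where "y i = z i div content n z" for i
  have zy: "z i = int m * y i" if "i < n" for i
    using content_dvd[OF that, of z] unfolding m(1) by (simp add: y_def)
  have yn: "\<exists>i<n. y i \<noteq> 0" using z zy by auto
  have "content n z = int m * content n y" by (rule content_mult) (rule zy)
  then have cy: "content n y = 1" using m by simp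
  have vy: "?v = real m \<cdot>\<^sub>v pt n g (\<lambda>i. of_int (y i))"
    unfolding pt_smult by (rule pt_cong) (simp add: zy)
  have "(THE w. primitive n ?L w \<and> (\<exists>m::nat. m \<ge> 1 \<and> ?v = real m \<cdot>\<^sub>v w)) = pt n g (\<lambda>i. of_int (y i))"
  proof (rule the_equality)
    show "primitive n ?L (pt n g (\<lambda>i. of_int (y i))) \<and> (\<exists>m::nat. m \<ge> 1 \<and> ?v = real m \<cdot>\<^sub>v pt n g (\<lambda>i. of_int (y i)))"
      using primitive_iff[OF g yn] cy m(2) vy by blast
    fix w assume w: "primitive n ?L w \<and> (\<exists>m::nat. m \<ge> 1 \<and> ?v = real m \<cdot>\<^sub>v w)"
    then obtain k :: nat where k: "k \<ge> 1" "?v = real k \<cdot>\<^sub>v w" by blast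
    from w obtain x :: "nat \<Rightarrow> int" where x: "w = pt n g (\<lambda>i. of_int (x i))"
      unfolding primitive_def row_lattice_pt[OF gc] by blast
    have zx: "z i = int k * x i" if "i < n" for i
      by (rule of_int_eq_of_nat_mult) (rule pt_inj[OF g k(2)[unfolded x pt_smult] that])
    have xn: "\<exists>i<n. x i \<noteq> 0" using z zx by auto
    have "content n x = 1" using w unfolding x primitive_iff[OF g xn] by blast
    then have "content n z = int k" using content_mult[of n z k x] zx by simp
    then have km: "k = m" using m by simp
    have "x i = y i" if "i < n" for i using zx[OF that] zy[OF that] m(2) km by simp
    then show "w = pt n g (\<lambda>i. of_int (y i))" unfolding x by (intro pt_cong) simp
  qed
  then show ?thesis unfolding primitive_part_def y_def using nz by simp
qed

lemma primitive_part_props: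
  assumes L: "L \<in> latt n" and v: "v \<in> L - {0\<^sub>v n}"
  shows "primitive_part n L v \<in> L - {0\<^sub>v n}" "\<exists>m\<ge>1. v = real m \<cdot>\<^sub>v primitive_part n L v"
proof -
  from L obtain g where g: "g \<in> SL n" "L = row_lattice n g" by (auto simp: latt_iff)
  have gc: "g \<in> carrier_mat n n" using g by (auto dest: SL_carrier)
  from v obtain z :: "nat \<Rightarrow> int" where z: "v = pt n g (\<lambda>i. of_int (z i))"
    unfolding g row_lattice_pt[OF gc] by blast
  have zn: "\<exists>i<n. z i \<noteq> 0" using v unfolding z by (simp add: pt_eq_zero_iff[OF g(1)])
  note P = primitive_part_pt[OF g(1) zn]
  define m where "m = nat (content n z)"
  have m: "int m = content n z" "m \<ge> 1" using content_pos[OF zn] by (auto simp: m_def)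
  have zy: "z i = int m * (z i div content n z)" if "i < n" for i
    using content_dvd[OF that, of z] unfolding m(1) by simp
  show 2: "\<exists>m\<ge>1. v = real m \<cdot>\<^sub>v primitive_part n L v"
  proof (intro exI[of _ m] conjI m(2))
    show "v = real m \<cdot>\<^sub>v primitive_part n L v"
      unfolding g(2) z P pt_smult by (rule pt_cong) (metis zy of_int_mult of_int_of_nat_eq)
  qed
  have "primitive_part n L v \<noteq> 0\<^sub>v n" 
  proof
    assume "primitive_part n L v = 0\<^sub>v n"
    with 2 obtain m :: nat where "v = real m \<cdot>\<^sub>v 0\<^sub>v n" by auto
    then have "v = 0\<^sub>v n" by (intro eq_vecI) auto
    with v show False by simp
  qed
  then show "primitive_part n L v \<in> L - {0\<^sub>v n}"
    unfolding g(2) z P using pt_int_mem[OF gc, of "\<lambda>i. z i div content n z"] by simp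
qed

section \<open>The mass of the multiples of a vector\<close>

definition mults :: "real vec \<Rightarrow> real vec set" where
  "mults w = (\<lambda>k :: int. of_int k \<cdot>\<^sub>v w) ` {1..}"

lemma gmass_cover:
  assumes "finite W" "A \<subseteq> (\<Union>w\<in>W. B w)"
  shows "gmass \<alpha> A \<le> (\<Sum>w\<in>W. gmass \<alpha> (B w))"
proof -
  let ?f = "\<lambda>v. ennreal (exp (- \<alpha> * (euclid_norm v)\<^sup>2))"
  have "gmass \<alpha> A = (\<integral>\<^sup>+v. ?f v * indicator A v \<partial>count_space UNIV)"
    unfolding gmass_def by (rule nn_integral_ind)
  also have "\<dots> \<le> (\<integral>\<^sup>+v. (\<Sum>w\<in>W. ?f v * indicator (B w) v) \<partial>count_space UNIV)"
  proof (rule nn_integral_mono)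
    fix v
    show "?f v * indicator A v \<le> (\<Sum>w\<in>W. ?f v * indicator (B w) v)"
    proof (cases "v \<in> A")
      case True
      then obtain w where w: "w \<in> W" "v \<in> B w" using assms(2) by blast
      have "?f v * indicator (B w) v \<le> (\<Sum>w\<in>W. ?f v * indicator (B w) v)"
        using w(1) assms(1) by (intro member_le_sum) auto
      then show ?thesis using w True by simp
    qed simp
  qed
  also have "\<dots> = (\<Sum>w\<in>W. \<integral>\<^sup>+v. ?f v * indicator (B w) v \<partial>count_space UNIV)"
    by (rule nn_integral_sum) simp
  also have "\<dots> = (\<Sum>w\<in>W. gmass \<alpha> (B w))"
    unfolding gmass_def by (intro sum.cong refl nn_integral_ind[symmetric])
  finally show ?thesis .
qed

lemma gmass_finite_set:
  assumes "finite W"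
  shows "gmass \<alpha> W = (\<Sum>w\<in>W. ennreal (exp (- \<alpha> * (euclid_norm w)\<^sup>2)))"
  unfolding gmass_def by (rule nn_integral_count_space_finite[OF assms])

text \<open>The one-dimensional theta sum over all integer multiples, zero included, of a vector of
  norm \<open>r\<close>.\<close>

definition line_theta :: "real \<Rightarrow> real \<Rightarrow> ennreal" where
  "line_theta \<alpha> r = (\<integral>\<^sup>+k. ennreal (exp (- \<alpha> * (real_of_int k * r)\<^sup>2)) \<partial>count_space UNIV)"

lemma nonzero_coord:
  assumes "w \<in> carrier_vec n" "w \<noteq> 0\<^sub>v n"
  shows "\<exists>i<n. vec_index w i \<noteq> 0"
proof (rule ccontr)
  assume "\<not> (\<exists>i<n. vec_index w i \<noteq> 0)"
  then have "w = 0\<^sub>v n" using assms(1) by (intro eq_vecI) auto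
  with assms(2) show False by simp
qed

lemma inj_on_mults:
  fixes w :: "real vec"
  assumes "w \<in> carrier_vec n" "w \<noteq> 0\<^sub>v n"
  shows "inj (\<lambda>k :: int. of_int k \<cdot>\<^sub>v w)"
proof (rule injI)
  fix k l :: int assume eq: "of_int k \<cdot>\<^sub>v w = of_int l \<cdot>\<^sub>v w"
  obtain i where i: "i < n" "vec_index w i \<noteq> 0" using nonzero_coord[OF assms] by blast
  have "vec_index (of_int k \<cdot>\<^sub>v w) i = vec_index (of_int l \<cdot>\<^sub>v w) i" by (simp only: eq)
  then show "k = l" using i assms(1) by simp
qed

lemma gmass_mults:
  assumes "w \<in> carrier_vec n" "w \<noteq> 0\<^sub>v n"
  shows "gmass \<alpha> (mults w) = (\<integral>\<^sup>+k. ennreal (exp (- \<alpha> * (real_of_int k * euclid_norm w)\<^sup>2)) \<partial>count_space {1..})"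
proof -
  have "bij_betw (\<lambda>k :: int. of_int k \<cdot>\<^sub>v w) {1..} (mults w)"
    unfolding mults_def using inj_on_mults[OF assms] by (intro inj_on_imp_bij_betw) (rule inj_on_subset, auto)
  from nn_integral_bij_count_space[OF this, symmetric]
  show ?thesis unfolding gmass_def
    by (simp add: euclid_norm_smult[OF assms(1)] power_mult_distrib)
qed

text \<open>For \<open>k \<ge> 1\<close>, the square of \<open>k\<close> is at least 1 plus the
  square of \<open>k - 1\<close>. This splits off the full Gaussian factor of \<open>w\<close>
  itself and leaves a part of the line's theta sum, the same quantity that
  \<open>gmass_line_count\<close> puts into the denominator.\<close>

lemma gmass_mults_le_line:
  assumes w: "w \<in> carrier_vec n" "w \<noteq> 0\<^sub>v n" and a: "\<alpha> > 0"
  shows "gmass \<alpha> (mults w) \<le> ennreal (exp (- \<alpha> * (euclid_norm w)\<^sup>2)) * line_theta \<alpha> (euclid_norm w)"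
proof -
  let ?r = "euclid_norm w"
  have "gmass \<alpha> (mults w) = (\<integral>\<^sup>+k. ennreal (exp (- \<alpha> * (real_of_int k * ?r)\<^sup>2)) \<partial>count_space {1..})"
    by (rule gmass_mults[OF w])
  also have "\<dots> \<le> (\<integral>\<^sup>+k. ennreal (exp (- \<alpha> * ?r\<^sup>2)) * ennreal (exp (- \<alpha> * (real_of_int (k - 1) * ?r)\<^sup>2)) \<partial>count_space {1..})"
  proof (rule nn_integral_mono)
    fix k :: int assume "k \<in> space (count_space {1..})"
    then have k: "1 \<le> real_of_int k" by simp
    define K J where "K = real_of_int k" and "J = real_of_int (k - 1)"
    have J: "K = 1 + J" "0 \<le> J" using k by (simp_all add: K_def J_def)
    have "1 + J\<^sup>2 \<le> K\<^sup>2" unfolding J(1) power2_sum using J(2) by simp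
    then have "\<alpha> * ?r\<^sup>2 * (1 + J\<^sup>2) \<le> \<alpha> * ?r\<^sup>2 * K\<^sup>2"
      using a by (intro mult_left_mono) auto
    then have "exp (- \<alpha> * (K * ?r)\<^sup>2) \<le> exp (- \<alpha> * ?r\<^sup>2) * exp (- \<alpha> * (J * ?r)\<^sup>2)"
      by (simp add: exp_add[symmetric] power_mult_distrib algebra_simps)
    then have "exp (- \<alpha> * (real_of_int k * ?r)\<^sup>2) \<le> exp (- \<alpha> * ?r\<^sup>2) * exp (- \<alpha> * (real_of_int (k - 1) * ?r)\<^sup>2)"
      unfolding K_def J_def .
    then show "ennreal (exp (- \<alpha> * (real_of_int k * ?r)\<^sup>2)) \<le> ennreal (exp (- \<alpha> * ?r\<^sup>2)) * ennreal (exp (- \<alpha> * (real_of_int (k - 1) * ?r)\<^sup>2))"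
      by (simp add: ennreal_mult[symmetric] ennreal_leI)
  qed
  also have "\<dots> = ennreal (exp (- \<alpha> * ?r\<^sup>2)) * (\<integral>\<^sup>+k. ennreal (exp (- \<alpha> * (real_of_int (k - 1) * ?r)\<^sup>2)) \<partial>count_space {1..})"
    by (rule nn_integral_cmult) simp
  also have "(\<integral>\<^sup>+k. ennreal (exp (- \<alpha> * (real_of_int (k - 1) * ?r)\<^sup>2)) \<partial>count_space {1..})
      = (\<integral>\<^sup>+k. ennreal (exp (- \<alpha> * (real_of_int k * ?r)\<^sup>2)) \<partial>count_space {0..})"
    by (rule nn_integral_bij_count_space) (rule bij_betwI[where g = "\<lambda>k. k + 1"], auto)
  also have "\<dots> \<le> line_theta \<alpha> ?r" unfolding line_theta_def by (rule nn_integral_count_space_mono) simp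
  finally show ?thesis by (simp add: mult_left_mono)
qed

text \<open>Pairing \<open>k\<close> with \<open>-k\<close>, the cross terms contribute a factor \<open>cosh \<ge> 1\<close>.\<close>

lemma line_translate:
  assumes x: "x \<in> carrier_vec n" and w: "w \<in> carrier_vec n"
  shows "ennreal (exp (- \<alpha> * (euclid_norm x)\<^sup>2)) * line_theta \<alpha> (euclid_norm w)
    \<le> (\<integral>\<^sup>+k. ennreal (exp (- \<alpha> * (euclid_norm (x + of_int k \<cdot>\<^sub>v w))\<^sup>2)) \<partial>count_space UNIV)" (is "?l \<le> ?r")
proof -
  define f where "f k = exp (- \<alpha> * (euclid_norm (x + of_int k \<cdot>\<^sub>v w))\<^sup>2)" for k :: int
  define h where "h k = exp (- \<alpha> * (euclid_norm x)\<^sup>2) * exp (- \<alpha> * (real_of_int k * euclid_norm w)\<^sup>2)" for k :: int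
  have fh: "2 * h k \<le> f k + f (- k)" for k
  proof -
    define t where "t = \<alpha> * (2 * real_of_int k * scalar_prod x w)"
    have "f k = h k * exp (- t)" "f (- k) = h k * exp t"
      unfolding f_def h_def t_def euclid_norm_add_sq[OF x w] exp_add[symmetric]
      by (simp_all add: power_mult_distrib algebra_simps)
    moreover have "2 \<le> exp (- t) + exp t" using exp_ge_add_one_self[of t] exp_ge_add_one_self[of "- t"] by linarith
    then have "h k * 2 \<le> h k * (exp (- t) + exp t)" by (intro mult_left_mono) (auto simp: h_def)
    ultimately show ?thesis by (simp add: algebra_simps)
  qed
  have "(\<integral>\<^sup>+k. ennreal (f (- k)) \<partial>count_space UNIV) = (\<integral>\<^sup>+k. ennreal (f k) \<partial>count_space UNIV)"
    by (rule nn_integral_bij_count_space) (rule bij_betwI[where g = uminus], auto)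
  then have "2 * ?r = (\<integral>\<^sup>+k. ennreal (f k) \<partial>count_space UNIV) + (\<integral>\<^sup>+k. ennreal (f (- k)) \<partial>count_space UNIV)"
    by (simp add: f_def mult_2)
  also have "\<dots> = (\<integral>\<^sup>+k. ennreal (f k) + ennreal (f (- k)) \<partial>count_space UNIV)"
    by (rule nn_integral_add[symmetric]) auto
  also have "\<dots> \<ge> (\<integral>\<^sup>+k. 2 * ennreal (h k) \<partial>count_space UNIV)"
  proof (rule nn_integral_mono)
    fix k :: int
    have "2 * ennreal (h k) = ennreal (2 * h k)" by (simp add: ennreal_mult h_def)
    also have "\<dots> \<le> ennreal (f k + f (- k))" by (rule ennreal_leI[OF fh])
    also have "\<dots> = ennreal (f k) + ennreal (f (- k))" by (rule ennreal_plus) (auto simp: f_def)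
    finally show "2 * ennreal (h k) \<le> ennreal (f k) + ennreal (f (- k))" .
  qed
  also have "(\<integral>\<^sup>+k. 2 * ennreal (h k) \<partial>count_space UNIV) = 2 * (\<integral>\<^sup>+k. ennreal (h k) \<partial>count_space UNIV)"
    by (rule nn_integral_cmult) simp
  also have "(\<integral>\<^sup>+k. ennreal (h k) \<partial>count_space UNIV) = ?l"
    unfolding h_def line_theta_def by (subst nn_integral_cmult[symmetric]) (auto simp: ennreal_mult)
  finally have le: "2 * ?l \<le> 2 * ?r" .
  have "(2 :: ennreal) < \<infinity>" "(2 :: ennreal) \<noteq> 0" by (auto simp: less_top[symmetric])
  with le show ?thesis by (simp only: ennreal_mult_le_mult_iff infinity_ennreal_def less_irrefl not_False_eq_True less_top[symmetric])
qed

lemma card_int_diff_le: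
  fixes K :: "int set"
  assumes "\<And>k l. k \<in> K \<Longrightarrow> l \<in> K \<Longrightarrow> \<bar>k - l\<bar> \<le> int d" "finite K"
  shows "card K \<le> d + 1"
proof (cases "K = {}")
  case False
  have "K \<subseteq> {Min K..Min K + int d}"
  proof
    fix k assume k: "k \<in> K"
    have "\<bar>k - Min K\<bar> \<le> int d" by (rule assms(1)[OF k Min_in[OF assms(2) False]])
    moreover have "Min K \<le> k" by (rule Min_le[OF assms(2) k])
    ultimately show "k \<in> {Min K..Min K + int d}" by auto
  qed
  then have "card K \<le> card {Min K..Min K + int d}" by (rule card_mono[rotated]) simp
  then show ?thesis by simp
qed simp

text \<open>Each \<open>x\<close> in \<open>S\<close> places a translate of the line of
  \<open>w\<close> into the lattice, of mass at least
  \<open>exp (- \<alpha> * \<rho>\<^sup>2) * line_theta\<close>. Base points on a common translate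
  differ by \<open>k w\<close> with \<open>\<bar>k\<bar> < 7\<close>, by the bound on
  \<open>2 * \<rho>\<close>, so no lattice vector is covered more than 7 times.\<close>

lemma gmass_line_count:
  assumes L: "L \<in> latt n" and w: "w \<in> L - {0\<^sub>v n}" and a: "\<alpha> > 0" and \<rho>: "2 * \<rho> < 7 * euclid_norm w"
  defines "S \<equiv> {x \<in> L. euclid_norm x \<le> \<rho>}"
  shows "of_nat (card S) * (ennreal (exp (- \<alpha> * \<rho>\<^sup>2)) * line_theta \<alpha> (euclid_norm w)) \<le> 7 * gmass \<alpha> L"
proof -
  let ?e = "\<lambda>v. ennreal (exp (- \<alpha> * (euclid_norm v)\<^sup>2))"
  let ?T = "line_theta \<alpha> (euclid_norm w)"
  have wc: "w \<in> carrier_vec n" "w \<noteq> 0\<^sub>v n" using w latt_carrier[OF L] by auto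
  have r0: "euclid_norm w > 0" using euclid_norm_zero_iff[OF wc(1)] wc(2) euclid_norm_nonneg[of w] by (simp add: less_le)
  have finS: "finite S" unfolding S_def by (rule finite_latt_ball[OF L])
  define Ln where "Ln x = (\<lambda>k :: int. x + of_int k \<cdot>\<^sub>v w) ` UNIV" for x
  have xc: "x \<in> carrier_vec n" if "x \<in> S" for x using that latt_carrier[OF L] by (auto simp: S_def)
  have injx: "inj (\<lambda>k :: int. x + of_int k \<cdot>\<^sub>v w)" if "x \<in> S" for x
  proof (rule injI)
    fix k l :: int assume eq: "x + of_int k \<cdot>\<^sub>v w = x + of_int l \<cdot>\<^sub>v w"
    obtain i where i: "i < n" "vec_index w i \<noteq> 0" using nonzero_coord[OF wc] by blast
    have "vec_index (x + of_int k \<cdot>\<^sub>v w) i = vec_index (x + of_int l \<cdot>\<^sub>v w) i" by (simp only: eq)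
    then show "k = l" using i wc xc[OF that] by simp
  qed
  have one: "ennreal (exp (- \<alpha> * \<rho>\<^sup>2)) * ?T \<le> (\<integral>\<^sup>+v. ?e v * indicator (Ln x) v \<partial>count_space L)" if x: "x \<in> S" for x
  proof -
    have "(euclid_norm x)\<^sup>2 \<le> \<rho>\<^sup>2" using x euclid_norm_nonneg[of x] by (intro power_mono) (auto simp: S_def)
    then have "ennreal (exp (- \<alpha> * \<rho>\<^sup>2)) * ?T \<le> ?e x * ?T"
      using a by (intro mult_right_mono ennreal_leI) auto
    also have "\<dots> \<le> (\<integral>\<^sup>+k. ?e (x + of_int k \<cdot>\<^sub>v w) \<partial>count_space UNIV)"
      by (rule line_translate[OF xc[OF x] wc(1)])
    also have "\<dots> = (\<integral>\<^sup>+v. ?e v \<partial>count_space (Ln x))"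
      by (rule nn_integral_bij_count_space) (simp add: Ln_def inj_on_imp_bij_betw injx[OF x])
    also have "\<dots> = (\<integral>\<^sup>+v. ?e v * indicator (Ln x) v \<partial>count_space UNIV)" by (rule nn_integral_ind)
    also have "\<dots> = (\<integral>\<^sup>+v. (?e v * indicator (Ln x) v) * indicator L v \<partial>count_space UNIV)"
    proof (rule nn_integral_cong)
      fix v
      have "Ln x \<subseteq> L" using latt_add[OF L, of x w] x w by (auto simp: Ln_def S_def)
      then show "?e v * indicator (Ln x) v = (?e v * indicator (Ln x) v) * indicator L v"
        by (auto simp: indicator_def)
    qed
    also have "\<dots> = (\<integral>\<^sup>+v. ?e v * indicator (Ln x) v \<partial>count_space L)" by (rule nn_integral_ind[symmetric])
    finally show ?thesis .
  qed
  have mult: "card {x \<in> S. v \<in> Ln x} \<le> 7" for v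
  proof (cases "{x \<in> S. v \<in> Ln x} = {}")
    case False
    define kk where "kk x = (SOME k :: int. v = x + of_int k \<cdot>\<^sub>v w)" for x
    have kk: "v = x + of_int (kk x) \<cdot>\<^sub>v w" if "x \<in> {x \<in> S. v \<in> Ln x}" for x
    proof -
      have "\<exists>k :: int. v = x + of_int k \<cdot>\<^sub>v w" using that unfolding Ln_def by blast
      then show ?thesis unfolding kk_def by (rule someI_ex)
    qed
    have rel: "y = x + of_int (kk x - kk y) \<cdot>\<^sub>v w" if x: "x \<in> {x \<in> S. v \<in> Ln x}" and y: "y \<in> {x \<in> S. v \<in> Ln x}" for x y
    proof (rule eq_vecI)
      have c: "x \<in> carrier_vec n" "y \<in> carrier_vec n" using x y xc by auto
      show "dim_vec y = dim_vec (x + of_int (kk x - kk y) \<cdot>\<^sub>v w)" using c wc by auto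
      fix i assume "i < dim_vec (x + of_int (kk x - kk y) \<cdot>\<^sub>v w)"
      then have i: "i < n" using c wc by auto
      have "vec_index (x + of_int (kk x) \<cdot>\<^sub>v w) i = vec_index (y + of_int (kk y) \<cdot>\<^sub>v w) i"
        using kk[OF x] kk[OF y] by (simp only:)
      then show "vec_index y i = vec_index (x + of_int (kk x - kk y) \<cdot>\<^sub>v w) i"
        using i c wc by (simp add: algebra_simps)
    qed
    have "inj_on kk {x \<in> S. v \<in> Ln x}"
    proof (rule inj_onI)
      fix x y assume x: "x \<in> {x \<in> S. v \<in> Ln x}" and y: "y \<in> {x \<in> S. v \<in> Ln x}" and "kk x = kk y"
      then have "y = x + 0 \<cdot>\<^sub>v w" using rel[OF x y] by simp
      also have "\<dots> = x"
      proof -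
        have "x \<in> S" using x by simp
        then have "dim_vec x = n" "dim_vec w = n" using carrier_vecD[OF xc] carrier_vecD[OF wc(1)] by auto
        then show ?thesis by (intro eq_vecI) simp_all
      qed
      finally show "x = y" ..
    qed
    then have "card {x \<in> S. v \<in> Ln x} = card (kk ` {x \<in> S. v \<in> Ln x})" by (rule card_image[symmetric])
    also have "\<dots> \<le> 6 + 1"
    proof (rule card_int_diff_le)
      show "finite (kk ` {x \<in> S. v \<in> Ln x})" using finS by simp
      fix k l assume "k \<in> kk ` {x \<in> S. v \<in> Ln x}" "l \<in> kk ` {x \<in> S. v \<in> Ln x}"
      then obtain x y where x: "x \<in> {x \<in> S. v \<in> Ln x}" "k = kk x" and y: "y \<in> {x \<in> S. v \<in> Ln x}" "l = kk y" by blast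
      have "\<bar>of_int (k - l)\<bar> * euclid_norm w \<le> euclid_norm y + euclid_norm x"
        using euclid_norm_triangle_smult[of x n w "of_int (k - l)"] rel[OF x(1) y(1)] x y xc wc by simp
      also have "\<dots> \<le> 2 * \<rho>" using x y by (simp add: S_def)
      also have "\<dots> < 7 * euclid_norm w" by (rule \<rho>)
      finally have "\<bar>real_of_int (k - l)\<bar> < 7" using r0 by simp
      then have "\<bar>k - l\<bar> < 7" by linarith
      then show "\<bar>k - l\<bar> \<le> int 6" by simp
    qed
    finally show ?thesis by simp
  next
    case True
    then show ?thesis by (simp only: card.empty)
  qed
  have "of_nat (card S) * (ennreal (exp (- \<alpha> * \<rho>\<^sup>2)) * ?T) = (\<Sum>x\<in>S. ennreal (exp (- \<alpha> * \<rho>\<^sup>2)) * ?T)" by simp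
  also have "\<dots> \<le> (\<Sum>x\<in>S. \<integral>\<^sup>+v. ?e v * indicator (Ln x) v \<partial>count_space L)" by (rule sum_mono[OF one])
  also have "\<dots> = (\<integral>\<^sup>+v. (\<Sum>x\<in>S. ?e v * indicator (Ln x) v) \<partial>count_space L)" by (rule nn_integral_sum[symmetric]) simp
  also have "\<dots> \<le> (\<integral>\<^sup>+v. 7 * ?e v \<partial>count_space L)"
  proof (rule nn_integral_mono)
    fix v
    have "(\<Sum>x\<in>S. ?e v * indicator (Ln x) v) = ?e v * (\<Sum>x\<in>S. indicator (Ln x) v)" by (simp add: sum_distrib_left)
    also have "(\<Sum>x\<in>S. indicator (Ln x) v :: ennreal) = of_nat (card {x \<in> S. v \<in> Ln x})"
      using finS by (simp add: indicator_def sum.If_cases Int_def)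
    also have "?e v * of_nat (card {x \<in> S. v \<in> Ln x}) \<le> ?e v * of_nat 7"
      using mult[of v] by (intro mult_left_mono) (simp_all only: of_nat_le_iff zero_le)
    finally show "(\<Sum>x\<in>S. ?e v * indicator (Ln x) v) \<le> 7 * ?e v" by (simp add: mult.commute)
  qed
  also have "\<dots> = 7 * gmass \<alpha> L" unfolding gmass_def by (rule nn_integral_cmult) simp
  finally show ?thesis .
qed

text \<open>Replacing the square of the multiplier by the multiplier and \<open>\<alpha>\<close> by
  \<open>\<beta>\<close> leaves a geometric series with ratio at most 1/2.\<close>

lemma gmass_mults_small:
  assumes w: "w \<in> carrier_vec n" "w \<noteq> 0\<^sub>v n" and a: "0 < \<beta>" "\<beta> \<le> \<alpha>"
    and half: "exp (- \<beta> * (euclid_norm w)\<^sup>2) \<le> 1 / 2"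
  shows "gmass \<alpha> (mults w) \<le> ennreal (2 * exp (- \<beta> * (euclid_norm w)\<^sup>2))"
proof -
  define q where "q = exp (- \<beta> * (euclid_norm w)\<^sup>2)"
  have q: "0 < q" "q \<le> 1 / 2" using half by (auto simp: q_def)
  have "gmass \<alpha> (mults w) = (\<integral>\<^sup>+k. ennreal (exp (- \<alpha> * (real_of_int k * euclid_norm w)\<^sup>2)) \<partial>count_space {1..})"
    by (rule gmass_mults[OF w])
  also have "\<dots> = (\<integral>\<^sup>+m. ennreal (exp (- \<alpha> * (real_of_int (int m + 1) * euclid_norm w)\<^sup>2)) \<partial>count_space UNIV)"
    by (rule nn_integral_bij_count_space[symmetric], rule bij_betwI[where g = "\<lambda>k. nat (k - 1)"]) auto
  also have "\<dots> \<le> (\<integral>\<^sup>+m. ennreal (q * q ^ m) \<partial>count_space UNIV)"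
  proof (rule nn_integral_mono)
    fix m :: nat
    have "real (Suc m) * 1 \<le> real (Suc m) * real (Suc m)" by (intro mult_left_mono) auto
    then have "\<beta> * (euclid_norm w)\<^sup>2 * real (Suc m) \<le> \<alpha> * (euclid_norm w)\<^sup>2 * (real (Suc m))\<^sup>2"
      unfolding power2_eq_square[of "real (Suc m)"] using a by (intro mult_mono) auto
    moreover have "real_of_int (int m + 1) = real (Suc m)" by simp
    ultimately have "exp (- \<alpha> * (real_of_int (int m + 1) * euclid_norm w)\<^sup>2) \<le> exp (real (Suc m) * (- \<beta> * (euclid_norm w)\<^sup>2))"
      by (simp only: power_mult_distrib exp_le_cancel_iff mult_ac mult_minus_left mult_minus_right neg_le_iff_le)
    also have "\<dots> = q ^ Suc m" unfolding q_def by (rule exp_of_nat_mult)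
    finally show "ennreal (exp (- \<alpha> * (real_of_int (int m + 1) * euclid_norm w)\<^sup>2)) \<le> ennreal (q * q ^ m)"
      by (intro ennreal_leI) simp
  qed
  also have "\<dots> = (\<Sum>m. ennreal (q * q ^ m))" by (rule nn_integral_count_space_nat)
  also have "\<dots> = ennreal (q * (1 / (1 - q)))"
    using q by (intro suminf_ennreal_eq sums_mult geometric_sums) auto
  also have "\<dots> \<le> ennreal (2 * q)"
    using q by (intro ennreal_leI) (simp add: field_simps)
  finally show ?thesis unfolding q_def .
qed

section \<open>Success probabilities of one query\<close>

definition succ_mass :: "nat \<Rightarrow> real \<Rightarrow> real vec set \<Rightarrow> real \<Rightarrow> ennreal" where
  "succ_mass n \<gamma> L \<alpha> = gmass \<alpha> (short n (\<gamma> * lambda1 n L) L) / gmass \<alpha> L"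

definition succ_mass_hat :: "nat \<Rightarrow> real \<Rightarrow> real vec set \<Rightarrow> real \<Rightarrow> ennreal" where
  "succ_mass_hat n \<gamma> L \<alpha> = gmass \<alpha> {v \<in> L - {0\<^sub>v n}. euclid_norm (primitive_part n L v) \<le> \<gamma> * lambda1 n L} / gmass \<alpha> L"

lemma u_prob_eq:
  assumes L: "L \<in> latt n" and n: "n > 0" and c: "c > 0"
  shows "ennreal (u_prob n \<gamma> c L) = succ_mass n \<gamma> L (rate n c)"
proof -
  have "L \<inter> {v. 0 < euclid_norm v \<and> euclid_norm v \<le> \<gamma> * lambda1 n L} = short n (\<gamma> * lambda1 n L) L"
    using euclid_norm_zero_iff[OF latt_carrier[OF L]] euclid_norm_nonneg by (auto simp: less_le)
  then show ?thesis
    unfolding u_prob_def succ_mass_def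
    by (simp add: measure_pmf.emeasure_eq_measure[symmetric] emeasure_gaussian_rate[OF L n c])
qed

lemma u_hat_prob_eq:
  assumes L: "L \<in> latt n" and n: "n > 0" and c: "c > 0"
  shows "ennreal (u_hat_prob n \<gamma> c L) = succ_mass_hat n \<gamma> L (rate n c)"
proof -
  have "0 < euclid_norm (primitive_part n L v) \<longleftrightarrow> v \<noteq> 0\<^sub>v n" if "v \<in> L" for v
  proof (cases "v = 0\<^sub>v n")
    case True
    then show ?thesis using euclid_norm_zero_iff[of "0\<^sub>v n" n] by (simp add: primitive_part_def)
  next
    case False
    then have P: "primitive_part n L v \<in> L - {0\<^sub>v n}" using primitive_part_props(1)[OF L] that by blast
    then have "euclid_norm (primitive_part n L v) \<noteq> 0"
      using euclid_norm_zero_iff[OF latt_carrier[OF L]] by blast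
    then show ?thesis using False euclid_norm_nonneg[of "primitive_part n L v"] by (simp add: less_le)
  qed
  then have "L \<inter> {v. 0 < euclid_norm (primitive_part n L v) \<and> euclid_norm (primitive_part n L v) \<le> \<gamma> * lambda1 n L}
      = {v \<in> L - {0\<^sub>v n}. euclid_norm (primitive_part n L v) \<le> \<gamma> * lambda1 n L}" by auto
  then show ?thesis
    unfolding u_hat_prob_def succ_mass_hat_def
    by (simp add: measure_pmf.emeasure_eq_measure[symmetric] emeasure_gaussian_rate[OF L n c])
qed

lemma norm_primitive_part_le:
  assumes L: "L \<in> latt n" and v: "v \<in> L - {0\<^sub>v n}"
  shows "euclid_norm (primitive_part n L v) \<le> euclid_norm v"
proof -
  obtain m :: nat where m: "m \<ge> 1" "v = real m \<cdot>\<^sub>v primitive_part n L v" using primitive_part_props(2)[OF L v] by blast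
  have c: "primitive_part n L v \<in> carrier_vec n" using primitive_part_props(1)[OF L v] latt_carrier[OF L] by blast
  have "1 * euclid_norm (primitive_part n L v) \<le> real m * euclid_norm (primitive_part n L v)"
    using m(1) euclid_norm_nonneg by (intro mult_right_mono) auto
  also have "\<dots> = euclid_norm v" by (subst m(2), subst euclid_norm_smult[OF c]) simp
  finally show ?thesis by simp
qed

lemma succ_mass_le_hat:
  assumes L: "L \<in> latt n"
  shows "succ_mass n \<gamma> L \<alpha> \<le> succ_mass_hat n \<gamma> L \<alpha>"
  unfolding succ_mass_def succ_mass_hat_def
proof (intro divide_right_mono_ennreal gmass_mono subsetI)
  fix v assume v: "v \<in> short n (\<gamma> * lambda1 n L) L"
  then have "euclid_norm (primitive_part n L v) \<le> \<gamma> * lambda1 n L"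
    using norm_primitive_part_le[OF L, of v] by auto
  then show "v \<in> {v \<in> L - {0\<^sub>v n}. euclid_norm (primitive_part n L v) \<le> \<gamma> * lambda1 n L}" using v by simp
qed

lemma ennreal_divide_leI:
  fixes x y z :: ennreal
  assumes "x \<le> z * y" "y \<noteq> 0" "y \<noteq> \<infinity>"
  shows "x / y \<le> z"
proof -
  have "x / y \<le> z * y / y" by (rule divide_right_mono_ennreal[OF assms(1)])
  also have "\<dots> = z" using assms(2,3) by (simp add: mult_divide_eq_ennreal)
  finally show ?thesis .
qed

text \<open>For \<open>c \<le> 1/e\<close> the denominator is bounded below through the lattice points of norm at most
  \<open>\<rho> = sqrt e * GH n\<close>, and the resulting bound increases with \<open>c\<close>; for \<open>c \<ge> 1/e\<close> the
  zero vector suffices and the bound decreases with \<open>c\<close>.\<close>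

lemma succ_mass_hat_bound:
  assumes L: "L \<in> latt n" and n: "n > 0" and a: "\<alpha> > 0"
    and b: "\<beta> = rate n (exp (- 1))" and \<rho>: "\<rho> = sqrt (exp 1) * GH n"
    and lam: "GH n / 2 \<le> lambda1 n L" and half: "exp (- (real n / (8 * exp 1))) \<le> 1 / 2"
    and S: "exp (real n / 2) / 2 \<le> real (card {x \<in> L. euclid_norm x \<le> \<rho>})"
    and \<gamma>: "\<gamma> * lambda1 n L \<le> \<rho>"
  shows "succ_mass_hat n \<gamma> L \<alpha> \<le> 14 * gmass \<beta> (short n (\<gamma> * lambda1 n L) L)"
proof -
  define W where "W = short n (\<gamma> * lambda1 n L) L"
  have finW: "finite W"
    by (rule finite_subset[OF _ finite_latt_ball[OF L, of "\<gamma> * lambda1 n L"]]) (auto simp: W_def)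
  have G: "GH n > 0" using GH_pos[OF n] .
  have b0: "\<beta> > 0" unfolding b by (rule rate_pos[OF n]) simp
  have br: "\<beta> * \<rho>\<^sup>2 = real n / 2" using G by (simp add: b rate_def \<rho> power_mult_distrib exp_minus field_simps)
  have Lpos: "gmass \<alpha> L \<noteq> 0" using gmass_ge_1[OF L, of \<alpha>] by auto
  have Lfin: "gmass \<alpha> L \<noteq> \<infinity>" using gmass_finite[OF L a] by auto
  \<comment> \<open>Vectors with a short primitive part are positive multiples of vectors in
    \<open>W\<close>. Using the multiples of every vector in \<open>W\<close>, primitive or not,
    only enlarges the bound.\<close>
  have cover: "{v \<in> L - {0\<^sub>v n}. euclid_norm (primitive_part n L v) \<le> \<gamma> * lambda1 n L} \<subseteq> (\<Union>w\<in>W. mults w)"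
  proof
    fix v assume v: "v \<in> {v \<in> L - {0\<^sub>v n}. euclid_norm (primitive_part n L v) \<le> \<gamma> * lambda1 n L}"
    then have P: "primitive_part n L v \<in> W" using primitive_part_props(1)[OF L, of v] by (auto simp: W_def)
    obtain m :: nat where m: "m \<ge> 1" "v = real m \<cdot>\<^sub>v primitive_part n L v" using primitive_part_props(2)[OF L, of v] v by blast
    then have "v \<in> mults (primitive_part n L v)"
      unfolding mults_def by (intro image_eqI[of _ _ "int m"]) auto
    with P show "v \<in> (\<Union>w\<in>W. mults w)" by blast
  qed
  \<comment> \<open>The square of 1.65 is 2.7225, which exceeds \<open>e\<close>. Thus
    \<open>2 * \<rho> < 3.3 * GH n\<close>, while \<open>7 * ?r \<ge> 3.5 * GH n\<close> because
    every nonzero vector has norm at least half of \<open>GH n\<close>; this is where the 7 comes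
    from.\<close>
  have e1: "exp (1 :: real) < 2.7225" using e_less_272 by simp
  have "sqrt (exp 1) < (1.65 :: real)"
    by (rule real_less_lsqrt) (use e1 in \<open>auto simp: power2_eq_square\<close>)
  then have r165: "\<rho> < 1.65 * GH n" unfolding \<rho> using G by simp
  have per: "gmass \<alpha> (mults w) \<le> ennreal (14 * exp (- \<beta> * (euclid_norm w)\<^sup>2)) * gmass \<alpha> L" if w: "w \<in> W" for w
  proof -
    let ?r = "euclid_norm w"
    have wL: "w \<in> L - {0\<^sub>v n}" and rB: "?r \<le> \<gamma> * lambda1 n L" using w by (auto simp: W_def)
    have wc: "w \<in> carrier_vec n" "w \<noteq> 0\<^sub>v n" using wL latt_carrier[OF L] by auto
    obtain v0 where "\<And>w. w \<in> L - {0\<^sub>v n} \<Longrightarrow> lambda1 n L \<le> euclid_norm w" using lambda1_attained[OF L n] by metis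
    then have rl: "GH n / 2 \<le> ?r" using wL lam by (meson order.trans)
    have r\<rho>: "?r \<le> \<rho>" using rB \<gamma> by simp
    show ?thesis
    proof (cases "\<beta> \<le> \<alpha>")
      case True
      have "(GH n / 2)\<^sup>2 \<le> ?r\<^sup>2" using rl G by (intro power_mono) auto
      then have "\<beta> * (GH n / 2)\<^sup>2 \<le> \<beta> * ?r\<^sup>2" using b0 by (intro mult_left_mono) auto
      moreover have "\<beta> * (GH n / 2)\<^sup>2 = real n / (8 * exp 1)"
        using G by (simp add: b rate_def power_divide exp_minus field_simps)
      ultimately have "exp (- \<beta> * ?r\<^sup>2) \<le> exp (- (real n / (8 * exp 1)))" by simp
      then have "exp (- \<beta> * ?r\<^sup>2) \<le> 1 / 2" using half by linarith
      from gmass_mults_small[OF wc b0 True this]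
      have "gmass \<alpha> (mults w) \<le> ennreal (2 * exp (- \<beta> * ?r\<^sup>2)) * 1" by simp
      also have "\<dots> \<le> ennreal (14 * exp (- \<beta> * ?r\<^sup>2)) * gmass \<alpha> L"
        by (intro mult_mono ennreal_leI gmass_ge_1[OF L]) auto
      finally show ?thesis .
    next
      case False
      let ?N = "card {x \<in> L. euclid_norm x \<le> \<rho>}"
      define N where "N = real ?N"
      have N: "exp (real n / 2) / 2 \<le> N" "N > 0"
        using S exp_gt_zero[of "real n / 2"] unfolding N_def by linarith+
      let ?T = "line_theta \<alpha> ?r"
      have "2 * \<rho> < 7 * ?r" using r165 rl G by (simp add: field_simps)
      from gmass_line_count[OF L wL a this]
      have cnt: "ennreal N * (ennreal (exp (- \<alpha> * \<rho>\<^sup>2)) * ?T) \<le> 7 * gmass \<alpha> L"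
        by (simp add: N_def ennreal_of_nat_eq_real_of_nat)
      \<comment> \<open>The logarithm of the count, \<open>real n / 2\<close> up to a constant, is
        exactly \<open>\<beta> * \<rho>\<^sup>2\<close>. What remains is the sign of
        \<open>(\<alpha> - \<beta>) * (\<rho>\<^sup>2 - ?r\<^sup>2)\<close>, nonpositive since
        \<open>\<alpha> < \<beta>\<close> and \<open>?r \<le> \<rho>\<close>.\<close>
      have key: "exp (- \<alpha> * ?r\<^sup>2) \<le> (2 * exp (- \<beta> * ?r\<^sup>2)) * (N * exp (- \<alpha> * \<rho>\<^sup>2))"
      proof -
        have sq: "?r\<^sup>2 \<le> \<rho>\<^sup>2" using r\<rho> euclid_norm_nonneg[of w] by (intro power_mono) auto
        then have "\<alpha> * (\<rho>\<^sup>2 - ?r\<^sup>2) \<le> \<beta> * (\<rho>\<^sup>2 - ?r\<^sup>2)" using False by (intro mult_right_mono) auto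
        then have "- \<alpha> * ?r\<^sup>2 \<le> - \<beta> * ?r\<^sup>2 + real n / 2 + - \<alpha> * \<rho>\<^sup>2"
          using br by (simp add: algebra_simps)
        then have "exp (- \<alpha> * ?r\<^sup>2) \<le> exp (- \<beta> * ?r\<^sup>2 + real n / 2 + - \<alpha> * \<rho>\<^sup>2)" by simp
        also have "\<dots> = exp (- \<beta> * ?r\<^sup>2) * exp (real n / 2) * exp (- \<alpha> * \<rho>\<^sup>2)" by (simp only: exp_add)
        also have "\<dots> \<le> exp (- \<beta> * ?r\<^sup>2) * (2 * N) * exp (- \<alpha> * \<rho>\<^sup>2)"
          using N by (intro mult_right_mono mult_left_mono) auto
        finally show ?thesis by (simp add: mult_ac)
      qed
      have "gmass \<alpha> (mults w) \<le> ennreal (exp (- \<alpha> * ?r\<^sup>2)) * ?T" by (rule gmass_mults_le_line[OF wc a])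
      also have "\<dots> \<le> ennreal ((2 * exp (- \<beta> * ?r\<^sup>2)) * (N * exp (- \<alpha> * \<rho>\<^sup>2))) * ?T"
        by (intro mult_right_mono ennreal_leI key) simp
      also have "\<dots> = ennreal (2 * exp (- \<beta> * ?r\<^sup>2)) * (ennreal N * (ennreal (exp (- \<alpha> * \<rho>\<^sup>2)) * ?T))"
        using N by (simp add: ennreal_mult mult_ac)
      also have "\<dots> \<le> ennreal (2 * exp (- \<beta> * ?r\<^sup>2)) * (7 * gmass \<alpha> L)" by (rule mult_left_mono[OF cnt]) simp
      also have "\<dots> = (ennreal (2 * exp (- \<beta> * ?r\<^sup>2)) * ennreal 7) * gmass \<alpha> L" by (simp add: mult_ac)
      also have "ennreal (2 * exp (- \<beta> * ?r\<^sup>2)) * ennreal 7 = ennreal (14 * exp (- \<beta> * ?r\<^sup>2))"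
        by (subst ennreal_mult[symmetric]) auto
      finally show ?thesis .
    qed
  qed
  have "gmass \<alpha> {v \<in> L - {0\<^sub>v n}. euclid_norm (primitive_part n L v) \<le> \<gamma> * lambda1 n L}
      \<le> (\<Sum>w\<in>W. gmass \<alpha> (mults w))" by (rule gmass_cover[OF finW cover])
  also have "\<dots> \<le> (\<Sum>w\<in>W. ennreal (14 * exp (- \<beta> * (euclid_norm w)\<^sup>2)) * gmass \<alpha> L)" by (rule sum_mono[OF per])
  also have "\<dots> = (\<Sum>w\<in>W. ennreal 14 * ennreal (exp (- \<beta> * (euclid_norm w)\<^sup>2))) * gmass \<alpha> L"
    unfolding sum_distrib_right by (intro sum.cong refl) (subst ennreal_mult, auto)
  also have "(\<Sum>w\<in>W. ennreal 14 * ennreal (exp (- \<beta> * (euclid_norm w)\<^sup>2))) = 14 * gmass \<beta> W"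
    unfolding gmass_finite_set[OF finW] sum_distrib_left by simp
  finally show ?thesis
    unfolding succ_mass_hat_def W_def[symmetric] using Lpos Lfin by (rule ennreal_divide_leI)
qed

section \<open>Measurability on the space of lattices\<close>

text \<open>This expresses an infimum over a varying lattice by a lattice sum, whose measurability
  is known.\<close>

lemma lambda1_less_iff:
  assumes L: "L \<in> latt n" and n: "n > 0"
  shows "lambda1 n L < t \<longleftrightarrow> lat_sum n (indicator {..<t}) L \<noteq> 0"
proof -
  have "lat_sum n (indicator {..<t}) L = 0 \<longleftrightarrow> (\<forall>v\<in>L - {0\<^sub>v n}. indicator {..<t} (euclid_norm v) = (0 :: ennreal))"
    unfolding lat_sum_def by (subst nn_integral_0_iff_AE) (auto simp: AE_count_space)
  also have "\<dots> \<longleftrightarrow> (\<forall>v\<in>L - {0\<^sub>v n}. t \<le> euclid_norm v)"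
    by (intro ball_cong refl) (auto simp: indicator_def not_less)
  also have "\<dots> \<longleftrightarrow> t \<le> lambda1 n L"
  proof
    obtain v where v: "v \<in> L - {0\<^sub>v n}" "euclid_norm v = lambda1 n L" using lambda1_attained[OF L n] by metis
    assume "\<forall>v\<in>L - {0\<^sub>v n}. t \<le> euclid_norm v"
    then show "t \<le> lambda1 n L" using v by metis
  next
    assume t: "t \<le> lambda1 n L"
    obtain v0 where "\<And>w. w \<in> L - {0\<^sub>v n} \<Longrightarrow> lambda1 n L \<le> euclid_norm w" using lambda1_attained[OF L n] by metis
    then show "\<forall>v\<in>L - {0\<^sub>v n}. t \<le> euclid_norm v" using t by (meson order.trans)
  qed
  finally show ?thesis by auto
qed

lemma measurable_lambda1 [measurable]:
  assumes n: "n > 0"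
  shows "lambda1 n \<in> borel_measurable (lattice_space n)"
proof (rule borel_measurableI_less)
  fix t
  have "{L \<in> space (lattice_space n). lambda1 n L < t} = {L \<in> space (lattice_space n). lat_sum n (indicator {..<t}) L \<noteq> 0}"
    using lambda1_less_iff[OF _ n] by auto
  also have "\<dots> \<in> sets (lattice_space n)" by measurable
  finally show "{L \<in> space (lattice_space n). lambda1 n L < t} \<in> sets (lattice_space n)" .
qed

text \<open>\<open>P\<close> will be the identity or the primitive part. In integer coordinates it
  acts by a map \<open>p\<close> that does not depend on the basis, so after pulling back to
  \<open>SL n\<close> the sum runs over the fixed countable set \<open>zvecs n\<close>.\<close>

lemma measurable_gmass_restrict:
  fixes P :: "real vec set \<Rightarrow> real vec \<Rightarrow> real vec" and p :: "(nat \<Rightarrow> int) \<Rightarrow> nat \<Rightarrow> int"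
  assumes n: "n > 0"
    and P: "\<And>g z. g \<in> SL n \<Longrightarrow> z \<in> zvecs n \<Longrightarrow>
      P (row_lattice n g) (pt n g (\<lambda>i. of_int (z i))) = pt n g (\<lambda>i. of_int (p z i))"
  shows "(\<lambda>L. gmass \<alpha> {v \<in> L - {0\<^sub>v n}. euclid_norm (P L v) \<le> \<gamma> * lambda1 n L}) \<in> borel_measurable (lattice_space n)"
proof (rule measurable_lattice_spaceI)
  note [measurable] = measurable_lambda1[OF n]
  interpret sigma_finite_measure "count_space (zvecs n)"
    by (rule sigma_finite_measure_count_space_countable[OF countable_zvecs])
  let ?q = "\<lambda>g z. nq n g (\<lambda>i. of_int (z i))"
  let ?F = "\<lambda>g z. ennreal (exp (- \<alpha> * (?q g z)\<^sup>2)) * indicator {r. r \<le> \<gamma> * lambda1 n (row_lattice n g)} (?q g (p z))"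
  have "(\<lambda>g. ?F g z) \<in> borel_measurable (SL_borel n)" for z
  proof -
    have "(\<lambda>g. indicator {r. r \<le> \<gamma> * lambda1 n (row_lattice n g)} (?q g (p z)) :: ennreal)
      = (\<lambda>g. if ?q g (p z) \<le> \<gamma> * lambda1 n (row_lattice n g) then 1 else 0)" by (auto simp: fun_eq_iff)
    then have "(\<lambda>g. indicator {r. r \<le> \<gamma> * lambda1 n (row_lattice n g)} (?q g (p z)) :: ennreal) \<in> borel_measurable (SL_borel n)"
      by simp
    then show ?thesis by measurable
  qed
  then have "(\<lambda>(z, g). ?F g z) \<in> borel_measurable (count_space (zvecs n) \<Otimes>\<^sub>M SL_borel n)"
    by (intro measurable_pair_measure_countable1 countable_zvecs) simp
  from measurable_pair_swap[OF this]
  have "(\<lambda>g. \<integral>\<^sup>+z. ?F g z \<partial>count_space (zvecs n)) \<in> borel_measurable (SL_borel n)"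
    by (intro borel_measurable_nn_integral) (simp add: case_prod_beta)
  moreover have "gmass \<alpha> {v \<in> row_lattice n g - {0\<^sub>v n}. euclid_norm (P (row_lattice n g) v) \<le> \<gamma> * lambda1 n (row_lattice n g)}
      = (\<integral>\<^sup>+z. ?F g z \<partial>count_space (zvecs n))" if g: "g \<in> SL n" for g
  proof -
    let ?L = "row_lattice n g"
    let ?e = "\<lambda>v. ennreal (exp (- \<alpha> * (euclid_norm v)\<^sup>2))"
    let ?i = "\<lambda>v. indicator {r. r \<le> \<gamma> * lambda1 n ?L} (euclid_norm (P ?L v)) :: ennreal"
    have "gmass \<alpha> {v \<in> ?L - {0\<^sub>v n}. euclid_norm (P ?L v) \<le> \<gamma> * lambda1 n ?L}
        = (\<integral>\<^sup>+v. ?e v * indicator {v \<in> ?L - {0\<^sub>v n}. euclid_norm (P ?L v) \<le> \<gamma> * lambda1 n ?L} v \<partial>count_space UNIV)"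
      unfolding gmass_def by (rule nn_integral_ind)
    also have "\<dots> = (\<integral>\<^sup>+v. (?e v * ?i v) * indicator (?L - {0\<^sub>v n}) v \<partial>count_space UNIV)"
      by (intro nn_integral_cong) (simp add: indicator_def)
    also have "\<dots> = (\<integral>\<^sup>+v. ?e v * ?i v \<partial>count_space (?L - {0\<^sub>v n}))" by (rule nn_integral_ind[symmetric])
    also have "\<dots> = (\<integral>\<^sup>+z. ?e (pt n g (\<lambda>i. of_int (z i))) * ?i (pt n g (\<lambda>i. of_int (z i))) \<partial>count_space (zvecs n))"
      by (rule nn_integral_bij_count_space[OF bij_betw_zvecs[OF g], symmetric])
    also have "\<dots> = (\<integral>\<^sup>+z. ?F g z \<partial>count_space (zvecs n))"
      by (intro nn_integral_cong) (simp add: P[OF g] euclid_norm_pt)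
    finally show ?thesis .
  qed
  ultimately show "(\<lambda>g. gmass \<alpha> {v \<in> row_lattice n g - {0\<^sub>v n}. euclid_norm (P (row_lattice n g) v) \<le> \<gamma> * lambda1 n (row_lattice n g)})
      \<in> borel_measurable (SL_borel n)"
    by (subst measurable_cong) auto
qed

lemma measurable_gmass: "gmass \<alpha> \<in> borel_measurable (lattice_space n)"
proof -
  have "(\<lambda>L. 1 + gauss_sum n \<alpha> L) \<in> borel_measurable (lattice_space n)"
    by (intro borel_measurable_add measurable_lat_sum borel_measurable_const) measurable
  then show ?thesis by (rule measurable_cong[THEN iffD1, rotated]) (simp add: gmass_lat_sum)
qed

lemma measurable_succ_mass:
  assumes n: "n > 0"
  shows "(\<lambda>L. succ_mass n \<gamma> L \<alpha>) \<in> borel_measurable (lattice_space n)"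
    "(\<lambda>L. succ_mass_hat n \<gamma> L \<alpha>) \<in> borel_measurable (lattice_space n)"
proof -
  have "(\<lambda>L. gmass \<alpha> (short n (\<gamma> * lambda1 n L) L)) \<in> borel_measurable (lattice_space n)"
    by (rule measurable_gmass_restrict[where P = "\<lambda>L v. v" and p = "\<lambda>z. z", OF n]) simp
  then show "(\<lambda>L. succ_mass n \<gamma> L \<alpha>) \<in> borel_measurable (lattice_space n)"
    unfolding succ_mass_def using measurable_gmass by (rule borel_measurable_divide_ennreal)
  have "(\<lambda>L. gmass \<alpha> {v \<in> L - {0\<^sub>v n}. euclid_norm (primitive_part n L v) \<le> \<gamma> * lambda1 n L}) \<in> borel_measurable (lattice_space n)"
    by (rule measurable_gmass_restrict[where P = "primitive_part n" and p = "\<lambda>z i. z i div content n z", OF n])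
      (auto simp: zvecs_iff intro!: primitive_part_pt)
  then show "(\<lambda>L. succ_mass_hat n \<gamma> L \<alpha>) \<in> borel_measurable (lattice_space n)"
    unfolding succ_mass_hat_def using measurable_gmass by (rule borel_measurable_divide_ennreal)
qed

lemma gmass_lim:
  assumes "\<alpha> \<longlonglongrightarrow> a" "\<And>k. gmass (\<alpha> k) A \<le> B"
  shows "gmass a A \<le> B"
proof -
  have "gmass a A = (\<integral>\<^sup>+v. liminf (\<lambda>k. ennreal (exp (- \<alpha> k * (euclid_norm v)\<^sup>2))) \<partial>count_space A)"
    unfolding gmass_def
  proof (intro nn_integral_cong lim_imp_Liminf[symmetric])
    fix v
    show "(\<lambda>k. ennreal (exp (- \<alpha> k * (euclid_norm v)\<^sup>2))) \<longlonglongrightarrow> ennreal (exp (- a * (euclid_norm v)\<^sup>2))"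
      by (intro tendsto_ennrealI tendsto_intros assms(1))
  qed simp
  also have "\<dots> \<le> liminf (\<lambda>k. gmass (\<alpha> k) A)"
    unfolding gmass_def by (rule nn_integral_liminf) simp
  also have "\<dots> \<le> liminf (\<lambda>k :: nat. B)" by (intro Liminf_mono always_eventually allI assms(2))
  also have "\<dots> = B" by (simp add: Liminf_const)
  finally show ?thesis .
qed

lemma gmass_antimono: "\<alpha> \<le> \<beta> \<Longrightarrow> gmass \<beta> A \<le> gmass \<alpha> A"
  unfolding gmass_def by (intro nn_integral_mono ennreal_leI) (simp add: mult_right_mono)

text \<open>Only rational parameters are needed: the numerator is continuous from the right and the
  denominator decreases.\<close>

lemma SUP_ratio_rationals:
  assumes L: "L \<in> latt n" and n: "n > 0"
  shows "(SUP c\<in>{0<..}. gmass (rate n c) A / gmass (rate n c) L)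
    = (SUP c\<in>{0<..} \<inter> \<rat>. gmass (rate n c) A / gmass (rate n c) L)" (is "?l = ?r")
proof (rule antisym)
  show "?r \<le> ?l" by (rule SUP_subset_mono) auto
  show "?l \<le> ?r"
  proof (rule SUP_least)
    fix c :: real assume "c \<in> {0<..}"
    then have c: "c > 0" by simp
    have "\<exists>q\<in>\<rat>. c < q \<and> q < c + 1 / real (Suc k)" for k
      by (rule Rats_dense_in_real) simp
    then obtain q where q: "\<And>k. q k \<in> \<rat>" "\<And>k. c < q k" "\<And>k. q k < c + 1 / real (Suc k)" by metis
    have "(\<lambda>k. c + 1 / real (Suc k)) \<longlonglongrightarrow> c + 0"
      by (intro tendsto_add tendsto_const LIMSEQ_Suc[OF lim_1_over_n])
    then have "q \<longlonglongrightarrow> c"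
      by (intro tendsto_sandwich[of "\<lambda>_. c" q sequentially "\<lambda>k. c + 1 / real (Suc k)"] always_eventually allI)
        (use q in \<open>auto intro: less_imp_le\<close>)
    then have lim: "(\<lambda>k. rate n (q k)) \<longlonglongrightarrow> rate n c"
      unfolding rate_def using GH_pos[OF n] by (intro tendsto_intros) auto
    have fin: "gmass (rate n c) L \<noteq> 0" "gmass (rate n c) L \<noteq> \<infinity>" if "c > 0" for c
      using gmass_finite[OF L rate_pos[OF n that]] gmass_ge_1[OF L, of "rate n c"] by auto
    have "gmass (rate n c) A \<le> ?r * gmass (rate n c) L"
    proof (rule gmass_lim[OF lim])
      fix k
      have qk: "q k > 0" using q(2)[of k] c by simp
      have "gmass (rate n (q k)) A = gmass (rate n (q k)) A / gmass (rate n (q k)) L * gmass (rate n (q k)) L"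
      proof -
        let ?Z = "gmass (rate n (q k)) L"
        have "?Z / ?Z = 1" using fin[OF qk] by (intro ennreal_divide_self) (auto simp: less_top[symmetric])
        then show ?thesis by (simp add: ennreal_divide_times ennreal_times_divide[symmetric])
      qed
      also have "\<dots> \<le> ?r * gmass (rate n c) L"
      proof (intro mult_mono gmass_antimono SUP_upper)
        show "rate n c \<le> rate n (q k)" unfolding rate_def using q(2)[of k]
          by (intro divide_right_mono mult_right_mono) auto
      qed (use q qk in auto)
      finally show "gmass (rate n (q k)) A \<le> ?r * gmass (rate n c) L" .
    qed
    then show "gmass (rate n c) A / gmass (rate n c) L \<le> ?r"
      using fin[OF c] by (rule ennreal_divide_leI)
  qed
qed

section \<open>Suprema over the width parameter: measurability and agreement with the real
  suprema\<close>

definition best_mass :: "nat \<Rightarrow> real \<Rightarrow> real vec set \<Rightarrow> ennreal" where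
  "best_mass n \<gamma> L = (SUP c\<in>{0<..}. succ_mass n \<gamma> L (rate n c))"

definition best_mass_hat :: "nat \<Rightarrow> real \<Rightarrow> real vec set \<Rightarrow> ennreal" where
  "best_mass_hat n \<gamma> L = (SUP c\<in>{0<..}. succ_mass_hat n \<gamma> L (rate n c))"

lemma measurable_best_mass:
  assumes n: "n > 0"
  shows "best_mass n \<gamma> \<in> borel_measurable (lattice_space n)"
    "best_mass_hat n \<gamma> \<in> borel_measurable (lattice_space n)"
proof -
  have co: "countable ({0<..} \<inter> \<rat> :: real set)" by (intro countable_Int2 countable_rat)
  have "(\<lambda>L. SUP c\<in>{0<..} \<inter> \<rat>. succ_mass n \<gamma> L (rate n c)) \<in> borel_measurable (lattice_space n)"
    by (intro borel_measurable_SUP co measurable_succ_mass(1)[OF n])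
  then show "best_mass n \<gamma> \<in> borel_measurable (lattice_space n)"
    by (rule measurable_cong[THEN iffD1, rotated]) (simp add: best_mass_def succ_mass_def SUP_ratio_rationals n)
  have "(\<lambda>L. SUP c\<in>{0<..} \<inter> \<rat>. succ_mass_hat n \<gamma> L (rate n c)) \<in> borel_measurable (lattice_space n)"
    by (intro borel_measurable_SUP co measurable_succ_mass(2)[OF n])
  then show "best_mass_hat n \<gamma> \<in> borel_measurable (lattice_space n)"
    by (rule measurable_cong[THEN iffD1, rotated]) (simp add: best_mass_hat_def succ_mass_hat_def SUP_ratio_rationals n)
qed

lemma best_mass_real:
  assumes L: "L \<in> latt n" and n: "n > 0"
  shows "best_mass n \<gamma> L = ennreal (SUP c\<in>{0<..}. u_prob n \<gamma> c L)"
    "best_mass_hat n \<gamma> L = ennreal (SUP c\<in>{0<..}. u_hat_prob n \<gamma> c L)"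
    "best_mass_hat n \<gamma> L \<le> 1"
proof -
  have le1: "(SUP c\<in>{0 :: real<..}. ennreal (f c)) \<le> 1" if "\<And>c. f c \<le> 1" for f
    by (intro SUP_least) (use that in \<open>simp add: ennreal_le_1\<close>)
  have sup: "ennreal (SUP c\<in>{0 :: real<..}. f c) = (SUP c\<in>{0 :: real<..}. ennreal (f c))" if "\<And>c. f c \<le> 1" for f
  proof (rule ennreal_SUP)
    show "(SUP c\<in>{0 :: real<..}. ennreal (f c)) \<noteq> Orderings.top_class.top"
      using le1[of f, OF that] by (auto dest: neq_top_trans[rotated])
  qed (auto intro: exI[of _ 1])
  have b: "u_prob n \<gamma> c L \<le> 1" "u_hat_prob n \<gamma> c L \<le> 1" for c
    by (simp_all add: u_prob_def u_hat_prob_def)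
  show "best_mass n \<gamma> L = ennreal (SUP c\<in>{0<..}. u_prob n \<gamma> c L)"
    unfolding sup[of "\<lambda>c. u_prob n \<gamma> c L", OF b(1)] best_mass_def
    by (intro SUP_cong refl) (simp add: u_prob_eq[OF L n])
  show *: "best_mass_hat n \<gamma> L = ennreal (SUP c\<in>{0<..}. u_hat_prob n \<gamma> c L)"
    unfolding sup[of "\<lambda>c. u_hat_prob n \<gamma> c L", OF b(2)] best_mass_hat_def
    by (intro SUP_cong refl) (simp add: u_hat_prob_eq[OF L n])
  show "best_mass_hat n \<gamma> L \<le> 1"
    unfolding * sup[of "\<lambda>c. u_hat_prob n \<gamma> c L", OF b(2)] by (rule le1[OF b(2)])
qed

section \<open>Asymptotics of the Gaussian integral\<close>

text \<open>A crude form of Stirling's formula. The extra factor \<open>y\<close> in the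
  denominator, where the true order is \<open>sqrt y\<close>, makes the ratio decrease under unit
  steps by the elementary \<open>ln (1 + 1 / y) \<ge> 1 / (y + 1)\<close>.\<close>

lemma Gamma_ratio_step:
  fixes y :: real
  assumes y: "y > 0"
  defines "b \<equiv> \<lambda>y :: real. Gamma (y + 1) * exp y / (y powr y * y)"
  shows "b (y + 1) \<le> b y"
proof -
  have "ln (y / (y + 1)) \<le> y / (y + 1) - 1" by (rule ln_le_minus_one) (use y in auto)
  then have "(y + 1) * (ln y - ln (y + 1)) \<le> (y + 1) * (y / (y + 1) - 1)"
    using y by (intro mult_left_mono) (auto simp: ln_div)
  also have "\<dots> = - 1" using y by (simp add: field_simps)
  finally have "1 + y * ln y + ln y \<le> (y + 1) * ln (y + 1)" by (simp add: algebra_simps)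
  then have "exp (1 + y * ln y + ln y) \<le> exp ((y + 1) * ln (y + 1))" by simp
  then have le: "exp 1 * (y powr y * y) \<le> (y + 1) powr (y + 1)"
    using y by (simp add: powr_def exp_add)
  have G: "Gamma (y + 1 + 1) = (y + 1) * Gamma (y + 1)" using y by (intro Gamma_plus1) (auto elim!: nonpos_Ints_cases)
  have pos: "Gamma (y + 1) > 0" "y powr y > 0" "(y + 1) powr (y + 1) > 0" using y by (auto intro!: Gamma_real_pos)
  have "b (y + 1) = (y + 1) * Gamma (y + 1) * (exp y * exp 1) / ((y + 1) powr (y + 1) * (y + 1))"
    unfolding b_def G exp_add by simp
  also have "\<dots> = Gamma (y + 1) * exp y * (exp 1 / (y + 1) powr (y + 1))"
    using y by simp
  also have "\<dots> \<le> Gamma (y + 1) * exp y * (1 / (y powr y * y))"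
    using le y pos by (intro mult_left_mono) (auto simp: field_simps)
  also have "\<dots> = b y" by (simp add: b_def)
  finally show ?thesis .
qed

text \<open>A unit step in \<open>n / 2\<close> is a step of 2 in \<open>n\<close>, hence the two
  starting values that define \<open>D\<close>.\<close>

lemma Gamma_half_bound:
  obtains C :: real where "C > 0" "\<And>n :: nat. n > 0 \<Longrightarrow>
    Gamma (real n / 2 + 1) \<le> C * real n * (real n / 2) powr (real n / 2) * exp (- (real n / 2))"
proof -
  define b where "b y = Gamma (y + 1) * exp y / (y powr y * y)" for y :: real
  define D where "D = max (b (1/2)) (b 1)"
  have bD: "b (real n / 2) \<le> D" if "n > 0" for n :: nat
    using that
  proof (induction n rule: less_induct)
    case (less n)
    consider "n = 1" | "n = 2" | m where "m > 0" "n = m + 2" "m < n"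
      using less.prems by (metis One_nat_def Suc_1 add_2_eq_Suc' lessI less_Suc_eq not0_implies_Suc not_gr_zero)
    then show ?case
    proof cases
      case 3
      have "real n / 2 = real m / 2 + 1" unfolding 3 by simp
      have "b (real m / 2 + 1) \<le> b (real m / 2)"
        using Gamma_ratio_step[of "real m / 2"] 3(1) unfolding b_def by (simp only: half_gt_zero_iff of_nat_0_less_iff)
      then have "b (real n / 2) \<le> b (real m / 2)"
        by (simp only: \<open>real n / 2 = real m / 2 + 1\<close>)
      also have "\<dots> \<le> D" by (rule less.IH[OF 3(3,1)])
      finally show ?thesis .
    qed (auto simp: D_def)
  qed
  have "b 1 = exp 1" by (simp add: b_def Gamma_numeral)
  then have D: "D > 0" by (simp add: D_def max_def not_le) (smt (verit) exp_gt_zero)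
  show ?thesis
  proof (rule that[of "D / 2"])
    show "D / 2 > 0" using D by simp
    fix n :: nat assume n: "n > 0"
    let ?y = "real n / 2"
    have p: "?y powr ?y * ?y > 0" using n by simp
    have "Gamma (?y + 1) = b ?y * (?y powr ?y * ?y) * exp (- ?y)"
      using n by (simp add: b_def exp_minus)
    also have "\<dots> \<le> D * (?y powr ?y * ?y) * exp (- ?y)"
      using bD[OF n] p by (intro mult_right_mono) auto
    finally show "Gamma (?y + 1) \<le> D / 2 * real n * ?y powr ?y * exp (- ?y)" by (simp add: mult_ac)
  qed
qed

lemma GH_power: "n > 0 \<Longrightarrow> unit_ball_vol (real n) * (GH n) ^ n = 1"
proof -
  assume n: "n > 0"
  have v: "unit_ball_vol (real n) > 0" by (rule unit_ball_vol_pos) simp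
  have "(GH n) ^ n = (GH n) powr real n"
    by (rule powr_realpow[symmetric]) (metis GH_def powr_gt_zero v less_irrefl)
  also have "\<dots> = unit_ball_vol (real n) powr (- 1)" unfolding GH_def powr_powr using n by simp
  also have "\<dots> = 1 / unit_ball_vol (real n)" using v by (subst powr_minus_divide) simp
  finally have "(GH n) ^ n = 1 / unit_ball_vol (real n)" .
  moreover have "u * (1 / u) = 1" if "u > 0" for u :: real using that by simp
  ultimately show ?thesis using v by metis
qed

text \<open>For this rate \<open>r ^ n * exp (- \<alpha> * r\<^sup>2)\<close> peaks at
  \<open>r = x * GH n\<close>, so the Gaussian integral should be the ball volume
  \<open>x ^ n\<close> times the value \<open>exp (- n / 2)\<close> at the peak. The Stirling bound
  confirms this up to a factor linear in \<open>n\<close>.\<close>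

lemma gaussian_integral_bound:
  obtains C :: real where "C > 0" "\<And>(n :: nat) x. n > 0 \<Longrightarrow> x > 0 \<Longrightarrow>
    (pi / (real n / (2 * (x * GH n)\<^sup>2))) powr (real n / 2) \<le> C * real n * x ^ n * exp (- (real n / 2))"
proof -
  obtain C :: real where C: "C > 0" "\<And>n :: nat. n > 0 \<Longrightarrow>
    Gamma (real n / 2 + 1) \<le> C * real n * (real n / 2) powr (real n / 2) * exp (- (real n / 2))"
    using Gamma_half_bound by metis
  show ?thesis
  proof (rule that[OF C(1)])
    fix n :: nat and x :: real assume n: "n > 0" and x: "x > 0"
    let ?y = "real n / 2"
    have y: "?y > 0" using n by simp
    have v: "unit_ball_vol (real n) > 0" by (rule unit_ball_vol_pos) simp
    have G: "GH n > 0" unfolding GH_def using v by (metis less_irrefl powr_gt_zero)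
    have gam: "Gamma (?y + 1) > 0" using y by (intro Gamma_real_pos) simp
    have GHn: "(GH n) ^ n = Gamma (?y + 1) / pi powr ?y"
    proof -
      have "unit_ball_vol (real n) = pi powr ?y / Gamma (?y + 1)" by (simp add: unit_ball_vol_def)
      then show ?thesis using GH_power[OF n] gam by (simp add: field_simps)
    qed
    have "(pi / (real n / (2 * (x * GH n)\<^sup>2))) = (pi / ?y) * (x * GH n) powr 2"
      using n x G by (simp add: field_simps)
    then have "(pi / (real n / (2 * (x * GH n)\<^sup>2))) powr ?y = (pi / ?y) powr ?y * ((x * GH n) powr 2) powr ?y"
      by (simp only: powr_mult)
    also have "((x * GH n) powr 2) powr ?y = (x * GH n) ^ n"
    proof -
      have p: "x * GH n > 0" using x G by simp
      have "((x * GH n) powr 2) powr ?y = (x * GH n) powr real n" unfolding powr_powr by simp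
      then show ?thesis by (simp only: powr_realpow[OF p])
    qed
    also have "(pi / ?y) powr ?y = pi powr ?y / ?y powr ?y" by (rule powr_divide)
    also have "pi powr ?y / ?y powr ?y * (x * GH n) ^ n = x ^ n * (Gamma (?y + 1) / ?y powr ?y)"
      using y by (simp add: power_mult_distrib GHn)
    also have "\<dots> \<le> x ^ n * (C * real n * exp (- ?y))"
    proof (intro mult_left_mono)
      show "Gamma (?y + 1) / ?y powr ?y \<le> C * real n * exp (- ?y)"
        using C(2)[OF n] y by (simp add: field_simps)
    qed (use x in simp)
    finally show "(pi / (real n / (2 * (x * GH n)\<^sup>2))) powr ?y \<le> C * real n * x ^ n * exp (- ?y)"
      by (simp add: mult_ac)
  qed
qed

section \<open>Events of probability tending to one\<close>

text \<open>Stated through measurable exceptional sets, so that events can be weakened and combined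
  without showing that \<open>P n\<close> itself cuts out a measurable set.\<close>

definition whp :: "(nat \<Rightarrow> 'a measure) \<Rightarrow> (nat \<Rightarrow> 'a \<Rightarrow> bool) \<Rightarrow> bool" where
  "whp M P \<longleftrightarrow> (\<exists>B. (\<forall>\<^sub>F n in sequentially. B n \<in> sets (M n) \<and> (\<forall>x\<in>space (M n) - B n. P n x)) \<and>
     (\<lambda>n. emeasure (M n) (B n)) \<longlonglongrightarrow> 0)"

lemma whp_mono:
  assumes "whp M P" "\<forall>\<^sub>F n in sequentially. \<forall>x\<in>space (M n). P n x \<longrightarrow> Q n x"
  shows "whp M Q"
proof -
  obtain B where B: "\<forall>\<^sub>F n in sequentially. B n \<in> sets (M n) \<and> (\<forall>x\<in>space (M n) - B n. P n x)"
    "(\<lambda>n. emeasure (M n) (B n)) \<longlonglongrightarrow> 0" using assms(1) unfolding whp_def by blast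
  have "\<forall>\<^sub>F n in sequentially. B n \<in> sets (M n) \<and> (\<forall>x\<in>space (M n) - B n. Q n x)"
    using B(1) assms(2) by eventually_elim blast
  with B(2) show ?thesis unfolding whp_def by blast
qed

lemma whp_conj:
  assumes "whp M P" "whp M Q"
  shows "whp M (\<lambda>n x. P n x \<and> Q n x)"
proof -
  obtain B where B: "\<forall>\<^sub>F n in sequentially. B n \<in> sets (M n) \<and> (\<forall>x\<in>space (M n) - B n. P n x)"
    "(\<lambda>n. emeasure (M n) (B n)) \<longlonglongrightarrow> 0" using assms(1) unfolding whp_def by blast
  obtain B' where B': "\<forall>\<^sub>F n in sequentially. B' n \<in> sets (M n) \<and> (\<forall>x\<in>space (M n) - B' n. Q n x)"
    "(\<lambda>n. emeasure (M n) (B' n)) \<longlonglongrightarrow> 0" using assms(2) unfolding whp_def by blast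
  have 1: "\<forall>\<^sub>F n in sequentially. B n \<union> B' n \<in> sets (M n) \<and> (\<forall>x\<in>space (M n) - (B n \<union> B' n). P n x \<and> Q n x)"
    using B(1) B'(1) by eventually_elim auto
  have s: "(\<lambda>n. emeasure (M n) (B n) + emeasure (M n) (B' n)) \<longlonglongrightarrow> 0"
    using tendsto_add[OF B(2) B'(2)] by simp
  have "(\<lambda>n. emeasure (M n) (B n \<union> B' n)) \<longlonglongrightarrow> 0"
  proof (rule tendsto_sandwich[OF _ _ tendsto_const s])
    show "\<forall>\<^sub>F n in sequentially. emeasure (M n) (B n \<union> B' n) \<le> emeasure (M n) (B n) + emeasure (M n) (B' n)"
      using B(1) B'(1) by eventually_elim (auto intro: emeasure_subadditive)
  qed simp
  with 1 show ?thesis unfolding whp_def by (intro exI[of _ "\<lambda>n. B n \<union> B' n"]) blast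
qed

lemma whp_markov:
  fixes f :: "nat \<Rightarrow> 'a \<Rightarrow> ennreal"
  assumes f: "\<forall>\<^sub>F n in sequentially. f n \<in> borel_measurable (M n) \<and> (\<integral>\<^sup>+x. f n x \<partial>M n) \<le> ennreal (a n)"
    and c: "\<And>n. c n > 0" and lim: "(\<lambda>n. a n / c n) \<longlonglongrightarrow> 0"
  shows "whp M (\<lambda>n x. f n x < ennreal (c n))"
proof -
  define B where "B n = {x \<in> space (M n). 1 \<le> ennreal (1 / c n) * f n x}" for n
  have "B n \<in> sets (M n) \<and> (\<forall>x\<in>space (M n) - B n. f n x < ennreal (c n))"
    "emeasure (M n) (B n) \<le> ennreal (a n / c n)"
    if "f n \<in> borel_measurable (M n) \<and> (\<integral>\<^sup>+x. f n x \<partial>M n) \<le> ennreal (a n)" for n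
  proof -
    have [measurable]: "f n \<in> borel_measurable (M n)" using that by simp
    have "f n x < ennreal (c n)" if "x \<in> space (M n) - B n" for x
    proof (rule ccontr)
      assume "\<not> f n x < ennreal (c n)"
      then have "ennreal (1 / c n) * ennreal (c n) \<le> ennreal (1 / c n) * f n x" by (intro mult_left_mono) (auto simp: not_less)
      moreover have "ennreal (1 / c n) * ennreal (c n) = 1"
        using c[of n] by (subst ennreal_mult[symmetric]) auto
      ultimately show False using that by (simp add: B_def)
    qed
    moreover have "B n \<in> sets (M n)" unfolding B_def by measurable
    ultimately show "B n \<in> sets (M n) \<and> (\<forall>x\<in>space (M n) - B n. f n x < ennreal (c n))" by blast
    have "emeasure (M n) {x \<in> space (M n). 1 \<le> ennreal (1 / c n) * f n x}
        \<le> ennreal (1 / c n) * (\<integral>\<^sup>+x. f n x * indicator (space (M n)) x \<partial>M n)"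
      by (rule nn_integral_Markov_inequality[OF _ sets.top]) auto
    also have "(\<integral>\<^sup>+x. f n x * indicator (space (M n)) x \<partial>M n) = (\<integral>\<^sup>+x. f n x \<partial>M n)"
      by (intro nn_integral_cong) simp
    also have "ennreal (1 / c n) * (\<integral>\<^sup>+x. f n x \<partial>M n) \<le> ennreal (1 / c n) * ennreal (a n)"
      using that by (intro mult_left_mono) auto
    also have "\<dots> = ennreal (a n / c n)" using c[of n] by (subst ennreal_mult'[symmetric]) auto
    finally show "emeasure (M n) (B n) \<le> ennreal (a n / c n)" by (simp add: B_def Int_def conj_commute)
  qed
  note * = this
  have "(\<lambda>n. ennreal (a n / c n)) \<longlonglongrightarrow> 0" using tendsto_ennrealI[OF lim] by simp
  then have "(\<lambda>n. emeasure (M n) (B n)) \<longlonglongrightarrow> 0"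
    by (rule tendsto_sandwich[OF _ _ tendsto_const, rotated 2]) (use f in \<open>auto elim!: eventually_mono intro: *(2)\<close>)
  moreover have "\<forall>\<^sub>F n in sequentially. B n \<in> sets (M n) \<and> (\<forall>x\<in>space (M n) - B n. f n x < ennreal (c n))"
    using f by eventually_elim (rule *(1))
  ultimately show ?thesis unfolding whp_def by blast
qed

lemma whp_nn_integral_tendsto_0:
  fixes h :: "nat \<Rightarrow> 'a \<Rightarrow> ennreal"
  assumes M: "\<forall>\<^sub>F n in sequentially. prob_space (M n)" and "whp M (\<lambda>n x. h n x \<le> ennreal (t n))" and t: "t \<longlonglongrightarrow> 0"
    and h: "\<forall>\<^sub>F n in sequentially. \<forall>x\<in>space (M n). h n x \<le> 1"
  shows "(\<lambda>n. \<integral>\<^sup>+x. h n x \<partial>M n) \<longlonglongrightarrow> 0"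
proof -
  obtain B where B: "\<forall>\<^sub>F n in sequentially. B n \<in> sets (M n) \<and> (\<forall>x\<in>space (M n) - B n. h n x \<le> ennreal (t n))"
    "(\<lambda>n. emeasure (M n) (B n)) \<longlonglongrightarrow> 0" using assms(2) unfolding whp_def by blast
  have s: "(\<lambda>n. ennreal (t n) + emeasure (M n) (B n)) \<longlonglongrightarrow> 0"
    using tendsto_add[OF tendsto_ennrealI[OF t] B(2)] by simp
  have "\<forall>\<^sub>F n in sequentially. (\<integral>\<^sup>+x. h n x \<partial>M n) \<le> ennreal (t n) + emeasure (M n) (B n)"
    using B(1) h M
  proof eventually_elim
    case (elim n)
    interpret prob_space "M n" by (rule elim)
    have [measurable]: "B n \<in> sets (M n)" using elim by simp
    have "(\<integral>\<^sup>+x. h n x \<partial>M n) \<le> (\<integral>\<^sup>+x. ennreal (t n) + indicator (B n) x \<partial>M n)"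
    proof (rule nn_integral_mono)
      fix x assume x: "x \<in> space (M n)"
      then show "h n x \<le> ennreal (t n) + indicator (B n) x"
        using elim by (cases "x \<in> B n") (auto intro: order.trans[of _ 1])
    qed
    also have "\<dots> = ennreal (t n) + emeasure (M n) (B n)"
      by (subst nn_integral_add) (auto simp: emeasure_space_1)
    finally show ?case .
  qed
  then show ?thesis by (intro tendsto_sandwich[OF _ _ tendsto_const s]) auto
qed

section \<open>Typical lattices\<close>

text \<open>At \<open>c = 1/e\<close>, minus the exponential rate per dimension of the mass near
  norm \<open>x * GH n\<close>. It decreases up to \<open>sqrt e\<close>, where it is 0.\<close>

definition gexp :: "real \<Rightarrow> real" where
  "gexp x = x\<^sup>2 / (2 * exp 1) - ln x"

lemma gexp_sqrt_e: "gexp (sqrt (exp 1)) = 0"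
  by (simp add: gexp_def ln_sqrt)

lemma K_star_gexp: "K_star \<gamma> = gexp (min \<gamma> (sqrt (exp 1)))"
  using gexp_sqrt_e by (auto simp: K_star_def gexp_def min_def)

lemma isCont_gexp: "x > 0 \<Longrightarrow> isCont gexp x"
  unfolding gexp_def by (intro continuous_intros) auto

lemma power_exp_ln: "x > 0 \<Longrightarrow> x ^ n = exp (real n * ln x)"
  by (simp add: exp_of_nat_mult)

lemma rate_e: "rate n (exp (- 1)) = real n / (2 * (sqrt (exp 1) * GH n)\<^sup>2)"
  by (simp add: rate_def power_mult_distrib exp_minus field_simps)

lemma rate_e_mult: "n > 0 \<Longrightarrow> rate n (exp (- 1)) * (x * GH n)\<^sup>2 = real n * (x\<^sup>2 / (2 * exp 1))"
  using GH_pos[of n] by (simp add: rate_def power_mult_distrib exp_minus field_simps)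

lemma GH_scale: "n > 0 \<Longrightarrow> unit_ball_vol (real n) * (x * GH n) ^ n = x ^ n"
  using GH_power[of n] by (simp add: power_mult_distrib mult.left_commute)

text \<open>Exponential tilting: on the ball the rate may be raised to the one peaking at its
  boundary, at the cost of a factor that is largest on the boundary. Since
  \<open>x \<le> sqrt e\<close>, this really raises the rate. The tilted sum can then be extended to
  the whole lattice and bounded by its mean.\<close>

lemma chernoff_gmass:
  assumes n: "n > 0" and x: "0 < x" "x \<le> sqrt (exp 1)"
  shows "gmass (rate n (exp (- 1))) (short n (x * GH n) L)
    \<le> ennreal (exp (real n / 2 - real n * (x\<^sup>2 / (2 * exp 1)))) *
      gauss_sum n (real n / (2 * (x * GH n)\<^sup>2)) L"
proof -
  let ?\<beta> = "rate n (exp (- 1))" and ?\<alpha> = "real n / (2 * (x * GH n)\<^sup>2)" and ?B = "x * GH n"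
  let ?A = "short n ?B L"
  let ?d = "real n / 2 - real n * (x\<^sup>2 / (2 * exp 1))"
  have G: "GH n > 0" by (rule GH_pos[OF n])
  have B: "?B > 0" using x G by simp
  have "?B\<^sup>2 \<le> (sqrt (exp 1) * GH n)\<^sup>2" using x G by (intro power_mono mult_right_mono) auto
  then have ba: "?\<beta> \<le> ?\<alpha>" unfolding rate_e using B G x by (intro divide_left_mono mult_pos_pos zero_less_power) auto
  have aB: "?\<alpha> * ?B\<^sup>2 = real n / 2" using x G by (simp add: field_simps)
  have "gmass ?\<beta> ?A \<le> (\<integral>\<^sup>+v. ennreal (exp ?d) * ennreal (exp (- ?\<alpha> * (euclid_norm v)\<^sup>2)) \<partial>count_space ?A)"
    unfolding gmass_def
  proof (rule nn_integral_mono)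
    fix v assume "v \<in> space (count_space ?A)"
    then have "(euclid_norm v)\<^sup>2 \<le> ?B\<^sup>2" by (intro power_mono euclid_norm_nonneg) auto
    then have "(?\<alpha> - ?\<beta>) * (euclid_norm v)\<^sup>2 \<le> (?\<alpha> - ?\<beta>) * ?B\<^sup>2" using ba by (intro mult_left_mono) auto
    also have "\<dots> = ?d" unfolding left_diff_distrib aB rate_e_mult[OF n] ..
    finally have "- ?\<beta> * (euclid_norm v)\<^sup>2 \<le> ?d + - ?\<alpha> * (euclid_norm v)\<^sup>2" by (simp add: left_diff_distrib)
    then have "exp (- ?\<beta> * (euclid_norm v)\<^sup>2) \<le> exp ?d * exp (- ?\<alpha> * (euclid_norm v)\<^sup>2)"
      unfolding exp_add[symmetric] by (simp only: exp_le_cancel_iff)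
    then have "ennreal (exp (- ?\<beta> * (euclid_norm v)\<^sup>2)) \<le> ennreal (exp ?d * exp (- ?\<alpha> * (euclid_norm v)\<^sup>2))"
      by (rule ennreal_leI)
    then show "ennreal (exp (- ?\<beta> * (euclid_norm v)\<^sup>2)) \<le> ennreal (exp ?d) * ennreal (exp (- ?\<alpha> * (euclid_norm v)\<^sup>2))"
      by (subst ennreal_mult[symmetric]) auto
  qed
  also have "\<dots> = ennreal (exp ?d) * (\<integral>\<^sup>+v. ennreal (exp (- ?\<alpha> * (euclid_norm v)\<^sup>2)) \<partial>count_space ?A)"
    by (rule nn_integral_cmult) simp
  also have "\<dots> \<le> ennreal (exp ?d) * lat_sum n (\<lambda>r. ennreal (exp (- ?\<alpha> * r\<^sup>2))) L"
    unfolding lat_sum_def by (intro mult_left_mono nn_integral_count_space_mono) auto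
  finally show ?thesis .
qed

lemma exp_linear_eventually:
  fixes c K :: real
  assumes "c > 0"
  shows "\<forall>\<^sub>F n in sequentially. K \<le> exp (real n * c)"
proof -
  have "filterlim (\<lambda>n. exp (real n * c)) at_top sequentially"
    by (intro filterlim_compose[OF exp_at_top] filterlim_at_top_mult_tendsto_pos[OF tendsto_const assms] filterlim_real_sequentially)
  then show ?thesis by (simp add: filterlim_at_top)
qed

lemma poly_exp_tendsto_0:
  fixes c C :: real
  assumes "c > 0"
  shows "(\<lambda>n. C * real n * exp (- (c * real n))) \<longlonglongrightarrow> 0"
proof -
  have "(\<lambda>n. real n * (exp (- c)) ^ n) \<longlonglongrightarrow> 0" by (rule powser_times_n_limit_0) (use assms in simp)
  then have "(\<lambda>n. C * (real n * (exp (- c)) ^ n)) \<longlonglongrightarrow> C * 0" by (rule tendsto_mult_left)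
  then show ?thesis by (simp add: exp_of_nat_mult[symmetric] mult_ac)
qed

locale lattice_seq =
  fixes M :: "nat \<Rightarrow> real vec set measure"
  assumes mu: "\<And>n. n \<ge> 1 \<Longrightarrow> invariant_lattice_prob n (M n)"
begin

lemma inv_lattice_M: "n \<ge> 1 \<Longrightarrow> inv_lattice (M n) n"
  using mu[of n] by (intro inv_lattice.intro inv_lattice_axioms.intro) (auto simp: invariant_lattice_prob_def)

lemma space_M: "n \<ge> 1 \<Longrightarrow> space (M n) = latt n"
  by (rule inv_lattice.space_mu[OF inv_lattice_M])

lemma sets_M: "n \<ge> 1 \<Longrightarrow> sets (M n) = sets (lattice_space n)"
  by (rule inv_lattice.sets_mu[OF inv_lattice_M])

lemma prob_space_M: "n \<ge> 1 \<Longrightarrow> prob_space (M n)"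
  using inv_lattice_M[of n] by (simp add: inv_lattice_def)

lemma measurable_M: "n \<ge> 1 \<Longrightarrow> f \<in> measurable (lattice_space n) N \<Longrightarrow> f \<in> measurable (M n) N"
  using measurable_cong_sets[OF sets_M[of n] refl] by blast

text \<open>For this radius the expected number is \<open>x ^ n\<close>, so the exceptional
  probability is at most \<open>72 / x ^ n\<close>, which tends to 0.\<close>

lemma whp_count:
  assumes x: "x > 1"
  shows "whp M (\<lambda>n L. x ^ n / 2 \<le> real (card (short n (x * GH n) L)))"
proof -
  define B where "B n = {L \<in> space (M n). lat_sum n (indicator {..x * GH n}) L < ennreal (x ^ n / 2)}" for n
  have v: "unit_ball_vol (real n) * (x * GH n) ^ n = x ^ n" if "n \<ge> 1" for n
    using GH_scale that by simp
  have 1: "\<forall>\<^sub>F n in sequentially. B n \<in> sets (M n) \<and>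
    (\<forall>L\<in>space (M n) - B n. x ^ n / 2 \<le> real (card (short n (x * GH n) L)))"
    using eventually_ge_at_top[of 1]
  proof eventually_elim
    case (elim n)
    have [measurable]: "lat_sum n (indicator {..x * GH n}) \<in> borel_measurable (M n)"
      by (rule measurable_M[OF elim]) measurable
    have "B n \<in> sets (M n)" unfolding B_def by measurable
    moreover have "x ^ n / 2 \<le> real (card (short n (x * GH n) L))" if "L \<in> space (M n) - B n" for L
    proof -
      have "ennreal (x ^ n / 2) \<le> lat_sum n (indicator {..x * GH n}) L" using that by (auto simp: B_def not_less)
      also have "\<dots> = ennreal (real (card (short n (x * GH n) L)))"
        using lat_sum_card[of L n "x * GH n"] that by (simp add: space_M[OF elim] ennreal_of_nat_eq_real_of_nat)
      finally show ?thesis by (simp add: ennreal_le_iff)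
    qed
    ultimately show ?case by blast
  qed
  have ub: "\<forall>\<^sub>F n in sequentially. emeasure (M n) (B n) \<le> ennreal (72 * (1 / x) ^ n)"
    using eventually_ge_at_top[of 3]
  proof eventually_elim
    case (elim n)
    then have n1: "n \<ge> 1" by simp
    then have "x * GH n > 0" using x GH_pos[of n] by simp
    from inv_lattice.count_below_half[OF inv_lattice_M[OF n1] elim this]
    show ?case unfolding v[OF n1] B_def using x by (simp add: power_divide)
  qed
  have "(\<lambda>n. 72 * (1 / x) ^ n) \<longlonglongrightarrow> 72 * 0"
    using x by (intro tendsto_mult_left LIMSEQ_power_zero) auto
  then have "(\<lambda>n. ennreal (72 * (1 / x) ^ n)) \<longlonglongrightarrow> 0" using tendsto_ennrealI by fastforce
  then have "(\<lambda>n. emeasure (M n) (B n)) \<longlonglongrightarrow> 0"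
    by (rule tendsto_sandwich[OF _ ub tendsto_const, rotated]) simp
  with 1 show ?thesis unfolding whp_def by blast
qed

text \<open>The expected number of nonzero vectors in the ball is at most \<open>y ^ n\<close>, and
  a count below 1 is 0.\<close>

lemma whp_lambda1_ge:
  assumes y: "0 < y" "y < 1"
  shows "whp M (\<lambda>n L. y * GH n < lambda1 n L)"
proof -
  have "whp M (\<lambda>n L. lat_sum n (indicator {..y * GH n}) L < ennreal 1)"
  proof (rule whp_markov[where a = "\<lambda>n. y ^ n"])
    show "\<forall>\<^sub>F n in sequentially. lat_sum n (indicator {..y * GH n}) \<in> borel_measurable (M n) \<and>
        (\<integral>\<^sup>+L. lat_sum n (indicator {..y * GH n}) L \<partial>M n) \<le> ennreal (y ^ n)"
      using eventually_ge_at_top[of 3]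
    proof eventually_elim
      case (elim n)
      then have n1: "n \<ge> 1" by simp
      have "y * GH n > 0" using y GH_pos[of n] n1 by simp
      from inv_lattice.siegel_ball[OF inv_lattice_M[OF n1] elim this]
      have "(\<integral>\<^sup>+L. lat_sum n (indicator {..y * GH n}) L \<partial>M n) \<le> ennreal (y ^ n)"
        using GH_scale[of n y] n1 by simp
      moreover have "lat_sum n (indicator {..y * GH n}) \<in> borel_measurable (M n)"
        by (rule measurable_M[OF n1]) measurable
      ultimately show ?case by blast
    qed
    show "(\<lambda>n. y ^ n / 1) \<longlonglongrightarrow> 0" using y by (simp add: LIMSEQ_power_zero)
  qed simp
  then show ?thesis
  proof (rule whp_mono)
    show "\<forall>\<^sub>F n in sequentially. \<forall>L\<in>space (M n). lat_sum n (indicator {..y * GH n}) L < ennreal 1 \<longrightarrow> y * GH n < lambda1 n L"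
      using eventually_ge_at_top[of 1]
    proof eventually_elim
      case (elim n)
      show ?case
      proof (intro ballI impI)
        fix L assume L: "L \<in> space (M n)" and l: "lat_sum n (indicator {..y * GH n}) L < ennreal 1"
        have LL: "L \<in> latt n" using L space_M[OF elim] by simp
        have "real (card (short n (y * GH n) L)) < 1"
          using l unfolding lat_sum_card[OF LL] ennreal_of_nat_eq_real_of_nat by (simp add: ennreal_less_iff del: ennreal_1)
        then have e: "short n (y * GH n) L = {}"
        proof -
          have "finite (short n (y * GH n) L)"
            by (rule finite_subset[OF _ finite_latt_ball[OF LL, of "y * GH n"]]) auto
          then show ?thesis using \<open>real (card _) < 1\<close> by (simp only: of_nat_less_1_iff less_one card_0_eq)
        qed
        obtain v where "v \<in> L - {0\<^sub>v n}" "euclid_norm v = lambda1 n L" using lambda1_attained[OF LL] elim by (metis One_nat_def Suc_le_eq)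
        with e show "y * GH n < lambda1 n L" by (auto simp: not_le)
      qed
    qed
  qed
qed

lemma whp_lambda1_le:
  assumes x: "x > 1"
  shows "whp M (\<lambda>n L. lambda1 n L \<le> x * GH n)"
  using whp_count[OF x]
proof (rule whp_mono)
  show "\<forall>\<^sub>F n in sequentially. \<forall>L\<in>space (M n). x ^ n / 2 \<le> real (card (short n (x * GH n) L))
    \<longrightarrow> lambda1 n L \<le> x * GH n"
    using eventually_ge_at_top[of 1]
  proof eventually_elim
    case (elim n)
    show ?case
    proof (intro ballI impI)
      fix L assume L: "L \<in> space (M n)" and l: "x ^ n / 2 \<le> real (card (short n (x * GH n) L))"
      have LL: "L \<in> latt n" using L space_M[OF elim] by simp
      have "x ^ n / 2 > 0" using x by simp
      then have "card (short n (x * GH n) L) \<noteq> 0" using l by linarith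
      then obtain v where v: "v \<in> L - {0\<^sub>v n}" "euclid_norm v \<le> x * GH n" by (metis (no_types, lifting) card.empty empty_Collect_eq)
      obtain v0 where "\<And>w. w \<in> L - {0\<^sub>v n} \<Longrightarrow> lambda1 n L \<le> euclid_norm w" using lambda1_attained[OF LL] elim by (metis One_nat_def Suc_le_eq)
      then show "lambda1 n L \<le> x * GH n" using v by (meson order.trans)
    qed
  qed
qed

text \<open>Markov's inequality: \<open>exp (\<delta> * n)\<close> exceeds the linear factor by
  which the mean may surpass \<open>x ^ n * exp (- n / 2)\<close>.\<close>

lemma whp_gauss:
  assumes x: "x > 0" and d: "\<delta> > 0"
  shows "whp M (\<lambda>n L. gauss_sum n (real n / (2 * (x * GH n)\<^sup>2)) L
    < ennreal (exp (\<delta> * real n) * (x ^ n * exp (- (real n / 2)))))"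
proof -
  obtain C :: real where C: "C > 0" "\<And>(n :: nat) x. n > 0 \<Longrightarrow> x > 0 \<Longrightarrow>
    (pi / (real n / (2 * (x * GH n)\<^sup>2))) powr (real n / 2) \<le> C * real n * x ^ n * exp (- (real n / 2))"
    using gaussian_integral_bound by metis
  show ?thesis
  proof (rule whp_markov[where a = "\<lambda>n. C * real n * x ^ n * exp (- (real n / 2))"])
    show "\<forall>\<^sub>F n in sequentially. gauss_sum n (real n / (2 * (x * GH n)\<^sup>2)) \<in> borel_measurable (M n) \<and>
        (\<integral>\<^sup>+L. gauss_sum n (real n / (2 * (x * GH n)\<^sup>2)) L \<partial>M n)
          \<le> ennreal (C * real n * x ^ n * exp (- (real n / 2)))"
      using eventually_ge_at_top[of 3]
    proof eventually_elim
      case (elim n)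
      then have n1: "n \<ge> 1" and n0: "n > 0" by simp_all
      have "real n / (2 * (x * GH n)\<^sup>2) > 0" using x GH_pos[OF n0] n0 by simp
      from inv_lattice.siegel_gaussian[OF inv_lattice_M[OF n1] elim this]
      have "(\<integral>\<^sup>+L. gauss_sum n (real n / (2 * (x * GH n)\<^sup>2)) L \<partial>M n)
          \<le> ennreal (C * real n * x ^ n * exp (- (real n / 2)))"
        using ennreal_leI[OF C(2)[OF n0 x]] by (rule order.trans)
      moreover have "gauss_sum n (real n / (2 * (x * GH n)\<^sup>2)) \<in> borel_measurable (M n)"
        by (rule measurable_M[OF n1], rule measurable_lat_sum) measurable
      ultimately show ?case by blast
    qed
    show "0 < exp (\<delta> * real n) * (x ^ n * exp (- (real n / 2)))" for n using x by simp
    have "C * real n * x ^ n * exp (- (real n / 2)) / (exp (\<delta> * real n) * (x ^ n * exp (- (real n / 2)))) = C * real n * exp (- (\<delta> * real n))" for n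
      using x by (simp add: exp_minus field_simps)
    then show "(\<lambda>n. C * real n * x ^ n * exp (- (real n / 2)) / (exp (\<delta> * real n) * (x ^ n * exp (- (real n / 2))))) \<longlonglongrightarrow> 0"
      using poly_exp_tendsto_0[OF d, of C] by simp
  qed
qed

end

section \<open>Exponential upper and lower bounds for the optimal success mass\<close>

context lattice_seq
begin

text \<open>For \<open>\<gamma> \<ge> sqrt e\<close> the rate is 0 and a probability is at most 1.
  Otherwise \<open>lambda1\<close> may slightly exceed \<open>GH n\<close>, so the ball is enlarged
  to radius \<open>x * GH n\<close> with \<open>x\<close> just above \<open>\<gamma>\<close>. The
  three thirds of \<open>\<epsilon>\<close> pay for this change of radius, for the fluctuation of
  the Gaussian sum and for the constant 14.\<close>

lemma whp_best_mass_hat_le: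
  assumes g: "\<gamma> \<ge> 1" and e: "\<epsilon> > 0"
  shows "whp M (\<lambda>n L. best_mass_hat n \<gamma> L \<le> ennreal (exp (- (real n * (K_star \<gamma> - \<epsilon>)))))"
proof (cases "\<gamma> < sqrt (exp 1)")
  case False
  then have K: "K_star \<gamma> = 0" by (simp add: K_star_def)
  have "\<forall>\<^sub>F n in sequentially. \<forall>L\<in>space (M n). best_mass_hat n \<gamma> L \<le> ennreal (exp (- (real n * (K_star \<gamma> - \<epsilon>))))"
    using eventually_ge_at_top[of 1]
  proof eventually_elim
    case (elim n)
    have t: "(1 :: ennreal) \<le> ennreal (exp (- (real n * (K_star \<gamma> - \<epsilon>))))" using e unfolding K by simp
    show ?case
    proof
      fix L assume "L \<in> space (M n)"
      then have "best_mass_hat n \<gamma> L \<le> 1" using best_mass_real(3)[of L n \<gamma>] elim space_M[OF elim] by simp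
      then show "best_mass_hat n \<gamma> L \<le> ennreal (exp (- (real n * (K_star \<gamma> - \<epsilon>))))" using t by (rule order.trans)
    qed
  qed
  then show ?thesis unfolding whp_def by (intro exI[of _ "\<lambda>_. {}"]) (simp add: eventually_mono)
next
  case True
  have g0: "\<gamma> > 0" using g by simp
  have K: "K_star \<gamma> = gexp \<gamma>" using True by (simp add: K_star_def gexp_def)
  have "(gexp \<longlongrightarrow> gexp \<gamma>) (at_right \<gamma>)"
    using isCont_gexp[OF g0] by (meson filterlim_at_split isCont_def)
  then have "\<forall>\<^sub>F x in at_right \<gamma>. gexp \<gamma> - \<epsilon> / 3 < gexp x" by (rule order_tendstoD) (use e in simp)
  moreover have "\<forall>\<^sub>F x in at_right \<gamma>. x \<in> {\<gamma><..<sqrt (exp 1)}" by (rule eventually_at_right_real[OF True])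
  ultimately have "\<forall>\<^sub>F x in at_right \<gamma>. gexp \<gamma> - \<epsilon> / 3 < gexp x \<and> x \<in> {\<gamma><..<sqrt (exp 1)}" by (rule eventually_conj)
  then obtain x where x: "gexp \<gamma> - \<epsilon> / 3 < gexp x" "\<gamma> < x" "x < sqrt (exp 1)"
    using eventually_happens[of _ "at_right \<gamma>"] trivial_limit_at_right_real by force
  have x0: "x > 0" using x g0 by simp
  have xg: "x / \<gamma> > 1" using x g0 by simp
  have se: "sqrt (exp 1) > (1 :: real)" by simp
  have half: "\<forall>\<^sub>F n in sequentially. 2 \<le> exp (real n * (1 / (8 * exp 1)))" by (rule exp_linear_eventually) simp
  have big: "\<forall>\<^sub>F n in sequentially. 14 \<le> exp (real n * (\<epsilon> / 3))" by (rule exp_linear_eventually) (use e in simp)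
  have e3: "\<epsilon> / 3 > 0" using e by simp
  have "whp M (\<lambda>n L. ((1 / 2) * GH n < lambda1 n L \<and> lambda1 n L \<le> (x / \<gamma>) * GH n) \<and>
     (sqrt (exp 1) ^ n / 2 \<le> real (card (short n (sqrt (exp 1) * GH n) L)) \<and>
     gauss_sum n (real n / (2 * (x * GH n)\<^sup>2)) L
    < ennreal (exp (\<epsilon> / 3 * real n) * (x ^ n * exp (- (real n / 2))))))"
    by (intro whp_conj whp_lambda1_ge whp_lambda1_le whp_count whp_gauss x0 xg se e3) auto
  then show ?thesis
  proof (rule whp_mono)
    show "\<forall>\<^sub>F n in sequentially. \<forall>L\<in>space (M n). ((1 / 2) * GH n < lambda1 n L \<and> lambda1 n L \<le> (x / \<gamma>) * GH n) \<and>
     (sqrt (exp 1) ^ n / 2 \<le> real (card (short n (sqrt (exp 1) * GH n) L)) \<and>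
     gauss_sum n (real n / (2 * (x * GH n)\<^sup>2)) L
    < ennreal (exp (\<epsilon> / 3 * real n) * (x ^ n * exp (- (real n / 2))))) \<longrightarrow>
      best_mass_hat n \<gamma> L \<le> ennreal (exp (- (real n * (K_star \<gamma> - \<epsilon>))))"
      using eventually_ge_at_top[of 1] half big
    proof eventually_elim
      case (elim n)
      then have n0: "n > 0" by simp
      show ?case
      proof (intro ballI impI, elim conjE)
        fix L assume LM: "L \<in> space (M n)" and l1: "(1 / 2) * GH n < lambda1 n L" and l2: "lambda1 n L \<le> (x / \<gamma>) * GH n"
          and cnt: "sqrt (exp 1) ^ n / 2 \<le> real (card (short n (sqrt (exp 1) * GH n) L))"
          and gs: "gauss_sum n (real n / (2 * (x * GH n)\<^sup>2)) L
            < ennreal (exp (\<epsilon> / 3 * real n) * (x ^ n * exp (- (real n / 2))))"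
        have L: "L \<in> latt n" using LM space_M[OF elim(1)] by simp
        have G: "GH n > 0" by (rule GH_pos[OF n0])
        have gl: "\<gamma> * lambda1 n L \<le> x * GH n"
          using mult_left_mono[OF l2, of \<gamma>] g0 by simp
        also have "\<dots> \<le> sqrt (exp 1) * GH n" using x G by (intro mult_right_mono) auto
        finally have gl2: "\<gamma> * lambda1 n L \<le> sqrt (exp 1) * GH n" .
        have S: "exp (real n / 2) / 2 \<le> real (card {v \<in> L. euclid_norm v \<le> sqrt (exp 1) * GH n})"
        proof -
          have "sqrt (exp 1) ^ n = exp (real n / 2)" using power_exp_ln[of "sqrt (exp 1)" n] by (simp add: ln_sqrt)
          moreover have "card (short n (sqrt (exp 1) * GH n) L) \<le> card {v \<in> L. euclid_norm v \<le> sqrt (exp 1) * GH n}"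
            by (rule card_mono[OF finite_latt_ball[OF L]]) auto
          ultimately show ?thesis using cnt by simp
        qed
        have hf: "exp (- (real n / (8 * exp 1))) \<le> 1 / 2" using elim(2) by (simp add: exp_minus field_simps)
        have "gmass (rate n (exp (- 1))) (short n (\<gamma> * lambda1 n L) L)
          \<le> gmass (rate n (exp (- 1))) (short n (x * GH n) L)"
          by (rule gmass_mono) (use gl in auto)
        also have "\<dots> \<le> ennreal (exp (real n / 2 - real n * (x\<^sup>2 / (2 * exp 1)))) *
            gauss_sum n (real n / (2 * (x * GH n)\<^sup>2)) L"
          by (rule chernoff_gmass[OF n0 x0]) (use x in simp)
        also have "\<dots> \<le> ennreal (exp (real n / 2 - real n * (x\<^sup>2 / (2 * exp 1)))) *
            ennreal (exp (\<epsilon> / 3 * real n) * (x ^ n * exp (- (real n / 2))))"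
          by (rule mult_left_mono[OF less_imp_le[OF gs]]) simp
        also have "\<dots> = ennreal (exp (- (real n * (gexp x - \<epsilon> / 3))))"
          unfolding power_exp_ln[OF x0, of n] exp_add[symmetric]
          by (subst ennreal_mult[symmetric]) (auto simp: exp_add[symmetric] gexp_def algebra_simps)
        finally have num: "gmass (rate n (exp (- 1))) (short n (\<gamma> * lambda1 n L) L)
          \<le> ennreal (exp (- (real n * (gexp x - \<epsilon> / 3))))" .
        have "real n * (K_star \<gamma> - \<epsilon>) + real n * (\<epsilon> / 3) \<le> real n * (gexp x - \<epsilon> / 3)"
          unfolding K distrib_left[symmetric] using x(1) by (intro mult_left_mono) auto
        then have "14 * exp (- (real n * (gexp x - \<epsilon> / 3))) \<le> exp (real n * (\<epsilon> / 3)) * exp (- (real n * (K_star \<gamma> - \<epsilon>)) - real n * (\<epsilon> / 3))"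
          using elim(3) by (intro mult_mono) auto
        also have "\<dots> = exp (- (real n * (K_star \<gamma> - \<epsilon>)))" unfolding exp_add[symmetric] by simp
        finally have fin: "ennreal (14 * exp (- (real n * (gexp x - \<epsilon> / 3)))) \<le> ennreal (exp (- (real n * (K_star \<gamma> - \<epsilon>))))"
          by (rule ennreal_leI)
        show "best_mass_hat n \<gamma> L \<le> ennreal (exp (- (real n * (K_star \<gamma> - \<epsilon>))))"
          unfolding best_mass_hat_def
        proof (rule SUP_least)
          fix c :: real assume "c \<in> {0<..}"
          then have rc: "rate n c > 0" using rate_pos[OF n0] by simp
          have "succ_mass_hat n \<gamma> L (rate n c) \<le> 14 * gmass (rate n (exp (- 1))) (short n (\<gamma> * lambda1 n L) L)"
            by (rule succ_mass_hat_bound[OF L n0 rc refl refl _ hf S gl2]) (use l1 in simp)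
          also have "\<dots> \<le> 14 * ennreal (exp (- (real n * (gexp x - \<epsilon> / 3))))" by (rule mult_left_mono[OF num]) simp
          also have "\<dots> = ennreal (14 * exp (- (real n * (gexp x - \<epsilon> / 3))))" by (subst ennreal_mult) auto
          also note fin
          finally show "succ_mass_hat n \<gamma> L (rate n c) \<le> ennreal (exp (- (real n * (K_star \<gamma> - \<epsilon>))))" .
        qed
      qed
    qed
  qed
qed

text \<open>The count of vectors within \<open>y * GH n\<close> needs \<open>1 < y\<close>, and
  \<open>y < \<gamma>\<close> keeps them within reach even if \<open>lambda1\<close> is slightly
  below \<open>GH n\<close>. At \<open>\<gamma> = 1\<close> no such \<open>y\<close> exists; there
  the shortest vector alone has enough mass.\<close>

lemma whp_numerator_ge:
  assumes g: "\<gamma> \<ge> 1" and e: "\<epsilon> > 0"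
  shows "whp M (\<lambda>n L. ennreal (exp (- (real n * (K_star \<gamma> + \<epsilon>))) / 2)
    \<le> gmass (rate n (exp (- 1))) (short n (\<gamma> * lambda1 n L) L))"
proof (cases "\<gamma> = 1")
  case True
  have K: "K_star \<gamma> = 1\<^sup>2 / (2 * exp 1)" using True by (simp add: K_star_def)
  have "((\<lambda>y. y\<^sup>2 / (2 * exp 1)) \<longlongrightarrow> (1 :: real)\<^sup>2 / (2 * exp 1)) (at_right 1)" by (intro tendsto_intros) auto
  then have "\<forall>\<^sub>F y in at_right (1 :: real). y\<^sup>2 / (2 * exp 1) < K_star \<gamma> + \<epsilon>" unfolding K by (rule order_tendstoD) (use e in simp)
  moreover have "\<forall>\<^sub>F y in at_right (1 :: real). y \<in> {1<..<2}" by (rule eventually_at_right_real) simp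
  ultimately have "\<forall>\<^sub>F y in at_right (1 :: real). y\<^sup>2 / (2 * exp 1) < K_star \<gamma> + \<epsilon> \<and> y \<in> {1<..<2}" by (rule eventually_conj)
  then obtain y :: real where y: "y\<^sup>2 / (2 * exp 1) < K_star \<gamma> + \<epsilon>" "y > 1"
    using eventually_happens[of _ "at_right (1 :: real)"] trivial_limit_at_right_real by force
  show ?thesis
  proof (rule whp_mono[OF whp_lambda1_le[OF y(2)]])
    show "\<forall>\<^sub>F n in sequentially. \<forall>L\<in>space (M n). lambda1 n L \<le> y * GH n \<longrightarrow>
       ennreal (exp (- (real n * (K_star \<gamma> + \<epsilon>))) / 2) \<le> gmass (rate n (exp (- 1))) (short n (\<gamma> * lambda1 n L) L)"
      using eventually_ge_at_top[of 1]
    proof eventually_elim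
      case (elim n)
      then have n0: "n > 0" by simp
      show ?case
      proof (intro ballI impI)
        fix L assume LM: "L \<in> space (M n)" and l: "lambda1 n L \<le> y * GH n"
        have L: "L \<in> latt n" using LM space_M[OF elim(1)] by simp
        obtain v where v: "v \<in> L - {0\<^sub>v n}" "euclid_norm v = lambda1 n L" using lambda1_attained[OF L n0] by metis
        have "rate n (exp (- 1)) * (euclid_norm v)\<^sup>2 \<le> rate n (exp (- 1)) * (y * GH n)\<^sup>2"
          using rate_pos[OF n0, of "exp (- 1)"] l euclid_norm_nonneg[of v] unfolding v(2) by (intro mult_left_mono power_mono) auto
        also have "\<dots> = real n * (y\<^sup>2 / (2 * exp 1))" by (rule rate_e_mult[OF n0])
        also have "\<dots> \<le> real n * (K_star \<gamma> + \<epsilon>)" using y(1) by (intro mult_left_mono) auto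
        finally have "exp (- (real n * (K_star \<gamma> + \<epsilon>))) \<le> exp (- rate n (exp (- 1)) * (euclid_norm v)\<^sup>2)" by simp
        then have "exp (- (real n * (K_star \<gamma> + \<epsilon>))) / 2 \<le> exp (- rate n (exp (- 1)) * (euclid_norm v)\<^sup>2)"
          by (smt (verit) exp_gt_zero field_sum_of_halves)
        then have "ennreal (exp (- (real n * (K_star \<gamma> + \<epsilon>))) / 2) \<le> gmass (rate n (exp (- 1))) {v}"
          by (simp add: gmass_finite_set ennreal_leI)
        also have "\<dots> \<le> gmass (rate n (exp (- 1))) (short n (\<gamma> * lambda1 n L) L)"
          by (rule gmass_mono) (use v True in auto)
        finally show "ennreal (exp (- (real n * (K_star \<gamma> + \<epsilon>))) / 2) \<le> gmass (rate n (exp (- 1))) (short n (\<gamma> * lambda1 n L) L)" .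
      qed
    qed
  qed
next
  case False
  \<comment> \<open>The heaviest shell within reach: beyond \<open>sqrt e\<close> the mass per shell
    decreases again, so larger \<open>\<gamma>\<close> gains nothing.\<close>
  define \<rho> where "\<rho> = min \<gamma> (sqrt (exp 1))"
  have g1: "\<gamma> > 1" using False g by simp
  have r1: "1 < \<rho>" using g1 by (simp add: \<rho>_def)
  have K: "K_star \<gamma> = gexp \<rho>" unfolding \<rho>_def by (rule K_star_gexp)
  have "(gexp \<longlongrightarrow> gexp \<rho>) (at_left \<rho>)"
  proof -
    have "\<rho> > 0" using r1 by simp
    from isCont_gexp[OF this] show ?thesis by (meson filterlim_at_split isCont_def)
  qed
  then have "\<forall>\<^sub>F y in at_left \<rho>. gexp y < K_star \<gamma> + \<epsilon>" unfolding K by (rule order_tendstoD) (use e in simp)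
  moreover have "\<forall>\<^sub>F y in at_left \<rho>. y \<in> {1<..<\<rho>}" by (rule eventually_at_left_real[OF r1])
  ultimately have "\<forall>\<^sub>F y in at_left \<rho>. gexp y < K_star \<gamma> + \<epsilon> \<and> y \<in> {1<..<\<rho>}" by (rule eventually_conj)
  then obtain y where y: "gexp y < K_star \<gamma> + \<epsilon>" "y > 1" "y < \<rho>"
    using eventually_happens[of _ "at_left \<rho>"] trivial_limit_at_left_real by force
  have yg: "0 < y / \<gamma>" "y / \<gamma> < 1" using y g1 by (auto simp: \<rho>_def)
  have y0: "y > 0" using y by simp
  show ?thesis
  proof (rule whp_mono[OF whp_conj[OF whp_lambda1_ge[OF yg] whp_count[OF y(2)]]])
    show "\<forall>\<^sub>F n in sequentially. \<forall>L\<in>space (M n). y / \<gamma> * GH n < lambda1 n L \<and> y ^ n / 2 \<le> real (card (short n (y * GH n) L)) \<longrightarrow>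
       ennreal (exp (- (real n * (K_star \<gamma> + \<epsilon>))) / 2) \<le> gmass (rate n (exp (- 1))) (short n (\<gamma> * lambda1 n L) L)"
      using eventually_ge_at_top[of 1]
    proof eventually_elim
      case (elim n)
      then have n0: "n > 0" by simp
      show ?case
      proof (intro ballI impI, elim conjE)
        fix L assume LM: "L \<in> space (M n)" and l: "y / \<gamma> * GH n < lambda1 n L"
          and cnt: "y ^ n / 2 \<le> real (card (short n (y * GH n) L))"
        let ?S = "short n (y * GH n) L" and ?b = "rate n (exp (- 1))"
        have L: "L \<in> latt n" using LM space_M[OF elim(1)] by simp
        have fS: "finite ?S" by (rule finite_subset[OF _ finite_latt_ball[OF L, of "y * GH n"]]) auto
        have gl: "y * GH n \<le> \<gamma> * lambda1 n L"
          using mult_left_mono[OF less_imp_le[OF l], of \<gamma>] g1 by simp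
        have "exp (- (real n * (K_star \<gamma> + \<epsilon>))) / 2 \<le> exp (- (real n * gexp y)) / 2"
          using y(1) by (simp add: mult_left_mono)
        also have "\<dots> = y ^ n / 2 * exp (- (real n * (y\<^sup>2 / (2 * exp 1))))"
          unfolding power_exp_ln[OF y0, of n] by (simp add: gexp_def exp_add[symmetric] algebra_simps)
        also have "\<dots> \<le> real (card ?S) * exp (- (real n * (y\<^sup>2 / (2 * exp 1))))" by (rule mult_right_mono[OF cnt]) simp
        finally have "ennreal (exp (- (real n * (K_star \<gamma> + \<epsilon>))) / 2) \<le> ennreal (real (card ?S) * exp (- (real n * (y\<^sup>2 / (2 * exp 1)))))"
          by (rule ennreal_leI)
        also have "\<dots> = (\<Sum>v\<in>?S. ennreal (exp (- (real n * (y\<^sup>2 / (2 * exp 1))))))"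
          by (simp add: ennreal_mult ennreal_of_nat_eq_real_of_nat)
        also have "\<dots> \<le> (\<Sum>v\<in>?S. ennreal (exp (- ?b * (euclid_norm v)\<^sup>2)))"
        proof (intro sum_mono ennreal_leI)
          fix v assume "v \<in> ?S"
          then have "?b * (euclid_norm v)\<^sup>2 \<le> ?b * (y * GH n)\<^sup>2"
            using rate_pos[OF n0, of "exp (- 1)"] euclid_norm_nonneg[of v] by (intro mult_left_mono power_mono) auto
          then show "exp (- (real n * (y\<^sup>2 / (2 * exp 1)))) \<le> exp (- ?b * (euclid_norm v)\<^sup>2)"
            unfolding rate_e_mult[OF n0] by simp
        qed
        also have "\<dots> = gmass ?b ?S" by (rule gmass_finite_set[OF fS, symmetric])
        also have "\<dots> \<le> gmass ?b (short n (\<gamma> * lambda1 n L) L)"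
          by (rule gmass_mono) (use gl in auto)
        finally show "ennreal (exp (- (real n * (K_star \<gamma> + \<epsilon>))) / 2) \<le> gmass ?b (short n (\<gamma> * lambda1 n L) L)" .
      qed
    qed
  qed
qed

text \<open>At \<open>c = 1/e\<close> the nonzero part of the theta sum is subexponential, and the
  zero vector adds only 1. So the numerator alone decides the rate.\<close>

lemma whp_succ_mass_ge:
  assumes g: "\<gamma> \<ge> 1" and e: "\<epsilon> > 0"
  shows "whp M (\<lambda>n L. ennreal (exp (- (real n * (K_star \<gamma> + \<epsilon>)))) \<le> succ_mass n \<gamma> L (rate n (exp (- 1))))"
proof -
  have e3: "\<epsilon> / 3 > 0" using e by simp
  have big: "\<forall>\<^sub>F n in sequentially. 4 \<le> exp (real n * (\<epsilon> / 3))" by (rule exp_linear_eventually[OF e3])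
  have se: "sqrt (exp 1) > (0 :: real)" by simp
  show ?thesis
  proof (rule whp_mono[OF whp_conj[OF whp_numerator_ge[OF g e3] whp_gauss[OF se e3]]])
    show "\<forall>\<^sub>F n in sequentially. \<forall>L\<in>space (M n).
      ennreal (exp (- (real n * (K_star \<gamma> + \<epsilon> / 3))) / 2) \<le> gmass (rate n (exp (- 1))) (short n (\<gamma> * lambda1 n L) L) \<and>
      gauss_sum n (real n / (2 * (sqrt (exp 1) * GH n)\<^sup>2)) L
        < ennreal (exp (\<epsilon> / 3 * real n) * (sqrt (exp 1) ^ n * exp (- (real n / 2)))) \<longrightarrow>
      ennreal (exp (- (real n * (K_star \<gamma> + \<epsilon>)))) \<le> succ_mass n \<gamma> L (rate n (exp (- 1)))"
      using eventually_ge_at_top[of 1] big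
    proof eventually_elim
      case (elim n)
      then have n0: "n > 0" by simp
      show ?case
      proof (intro ballI impI, elim conjE)
        fix L assume LM: "L \<in> space (M n)"
          and num: "ennreal (exp (- (real n * (K_star \<gamma> + \<epsilon> / 3))) / 2) \<le> gmass (rate n (exp (- 1))) (short n (\<gamma> * lambda1 n L) L)"
          and gs: "gauss_sum n (real n / (2 * (sqrt (exp 1) * GH n)\<^sup>2)) L
        < ennreal (exp (\<epsilon> / 3 * real n) * (sqrt (exp 1) ^ n * exp (- (real n / 2))))"
        let ?b = "rate n (exp (- 1))" and ?E = "exp (\<epsilon> / 3 * real n)" and ?t = "exp (- (real n * (K_star \<gamma> + \<epsilon>)))"
        have L: "L \<in> latt n" using LM space_M[OF elim(1)] by simp
        have b: "?b > 0" by (rule rate_pos[OF n0]) simp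
        \<comment> \<open>The rate at \<open>c = 1/e\<close> is the one of \<open>whp_gauss\<close>
          with \<open>x = sqrt e\<close>, where the count and the Gaussian weight cancel
          exactly.\<close>
        have "sqrt (exp 1) ^ n = exp (real n / 2)" using power_exp_ln[of "sqrt (exp 1)" n] by (simp add: ln_sqrt)
        then have "sqrt (exp 1) ^ n * exp (- (real n / 2)) = 1" by (simp add: exp_minus)
        then have "gauss_sum n ?b L \<le> ennreal ?E" using gs unfolding rate_e by simp
        then have "gmass ?b L \<le> 1 + ennreal ?E" unfolding gmass_lat_sum[OF L] by (rule add_left_mono)
        also have "\<dots> = ennreal (1 + ?E)" by (simp add: ennreal_plus)
        also have "\<dots> \<le> ennreal (2 * ?E)" using e by (intro ennreal_leI) simp
        finally have den: "gmass ?b L \<le> ennreal (2 * ?E)" .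
        have eq: "exp (- (real n * (K_star \<gamma> + \<epsilon> / 3))) = ?t * (?E * exp (real n * (\<epsilon> / 3)))"
          unfolding exp_add[symmetric] by (simp add: algebra_simps)
        have "?t * (2 * ?E) \<le> ?t * (?E * exp (real n * (\<epsilon> / 3)) / 2)"
          using elim(2) by (intro mult_left_mono) auto
        also have "\<dots> = exp (- (real n * (K_star \<gamma> + \<epsilon> / 3))) / 2" unfolding eq by simp
        finally have tt: "?t * (2 * ?E) \<le> exp (- (real n * (K_star \<gamma> + \<epsilon> / 3))) / 2" .
        have "ennreal ?t * gmass ?b L \<le> ennreal ?t * ennreal (2 * ?E)" by (rule mult_left_mono[OF den]) simp
        also have "\<dots> = ennreal (?t * (2 * ?E))" by (rule ennreal_mult[symmetric]) auto
        also have "\<dots> \<le> ennreal (exp (- (real n * (K_star \<gamma> + \<epsilon> / 3))) / 2)" by (rule ennreal_leI[OF tt])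
        also note num
        finally have le: "ennreal ?t * gmass ?b L \<le> gmass ?b (short n (\<gamma> * lambda1 n L) L)" .
        have "gmass ?b L \<noteq> 0" "gmass ?b L < \<infinity>" using gmass_ge_1[OF L, of ?b] gmass_finite[OF L b] by auto
        then have "ennreal ?t = ennreal ?t * gmass ?b L / gmass ?b L" by (intro mult_divide_eq_ennreal[symmetric]) auto
        also have "\<dots> \<le> succ_mass n \<gamma> L ?b" unfolding succ_mass_def by (rule divide_right_mono_ennreal[OF le])
        finally show "ennreal ?t \<le> succ_mass n \<gamma> L ?b" .
      qed
    qed
  qed
qed

end

section \<open>Convergence in probability\<close>

text \<open>\<open>F\<close> is the \<open>ennreal\<close> version of \<open>f\<close>:
  measurability and the two exponential bounds are available for it, and both pass to the logarithm
  of \<open>f\<close>.\<close>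

lemma (in lattice_seq) converges_in_prob_exponent:
  assumes meas: "\<And>n. n \<ge> 1 \<Longrightarrow> F n \<in> borel_measurable (lattice_space n)"
    and F: "\<And>n L. n \<ge> 1 \<Longrightarrow> L \<in> latt n \<Longrightarrow> F n L = ennreal (f n L) \<and> 0 \<le> f n L"
    and up: "\<And>\<epsilon>. \<epsilon> > 0 \<Longrightarrow> whp M (\<lambda>n L. F n L \<le> ennreal (exp (- (real n * (K - \<epsilon>)))))"
    and lo: "\<And>\<epsilon>. \<epsilon> > 0 \<Longrightarrow> whp M (\<lambda>n L. ennreal (exp (- (real n * (K + \<epsilon>)))) \<le> F n L)"
  shows "converges_in_prob M (\<lambda>n L. - (1 / real n) * ln (f n L)) K"
  unfolding converges_in_prob_def
proof (intro conjI allI impI)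
  show "\<forall>\<^sub>F n in sequentially. (\<lambda>L. - (1 / real n) * ln (f n L)) \<in> borel_measurable (M n)"
    using eventually_ge_at_top[of 1]
  proof eventually_elim
    case (elim n)
    note [measurable] = meas[OF elim]
    have "(\<lambda>L. - (1 / real n) * ln (enn2real (F n L))) \<in> borel_measurable (lattice_space n)" by measurable
    then have "(\<lambda>L. - (1 / real n) * ln (f n L)) \<in> borel_measurable (lattice_space n)"
      by (rule measurable_cong[THEN iffD1, rotated]) (simp add: F[OF elim])
    then show ?case by (rule measurable_M[OF elim])
  qed
next
  fix \<epsilon> :: real assume e: "\<epsilon> > 0"
  have "whp M (\<lambda>n L. \<bar>- (1 / real n) * ln (f n L) - K\<bar> \<le> \<epsilon>)"
  proof (rule whp_mono[OF whp_conj[OF up[OF e] lo[OF e]]])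
    show "\<forall>\<^sub>F n in sequentially. \<forall>L\<in>space (M n). F n L \<le> ennreal (exp (- (real n * (K - \<epsilon>)))) \<and>
        ennreal (exp (- (real n * (K + \<epsilon>)))) \<le> F n L \<longrightarrow> \<bar>- (1 / real n) * ln (f n L) - K\<bar> \<le> \<epsilon>"
      using eventually_ge_at_top[of 1]
    proof eventually_elim
      case (elim n)
      show ?case
      proof (intro ballI impI, elim conjE)
        fix L assume "L \<in> space (M n)" and 1: "F n L \<le> ennreal (exp (- (real n * (K - \<epsilon>))))"
          and 2: "ennreal (exp (- (real n * (K + \<epsilon>)))) \<le> F n L"
        then have L: "L \<in> latt n" using space_M[OF elim] by simp
        have u: "f n L \<le> exp (- (real n * (K - \<epsilon>)))" and l: "exp (- (real n * (K + \<epsilon>))) \<le> f n L"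
          using 1 2 F[OF elim L] by (simp_all add: ennreal_le_iff)
        \<comment> \<open>The lower bound excludes the value 0, at which \<open>ln\<close> is only a
          default.\<close>
        have pos: "f n L > 0" using l exp_gt_zero less_le_trans by blast
        define a where "a = ln (f n L) / real n"
        have n0: "real n > 0" using elim by simp
        then have lna: "ln (f n L) = real n * a" by (simp add: a_def)
        have "ln (f n L) \<le> - (real n * (K - \<epsilon>))" using u pos by (metis exp_gt_zero ln_exp ln_le_cancel_iff)
        then have "real n * a \<le> real n * (- (K - \<epsilon>))" unfolding lna by (simp only: mult_minus_right)
        then have "a \<le> - (K - \<epsilon>)" by (rule mult_left_le_imp_le) (rule n0)
        moreover have "- (real n * (K + \<epsilon>)) \<le> ln (f n L)" using l pos by (metis exp_gt_zero ln_exp ln_le_cancel_iff)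
        then have "real n * (- (K + \<epsilon>)) \<le> real n * a" unfolding lna by (simp only: mult_minus_right)
        then have "- (K + \<epsilon>) \<le> a" by (rule mult_left_le_imp_le) (rule n0)
        ultimately have "\<bar>- a - K\<bar> \<le> \<epsilon>" by linarith
        then show "\<bar>- (1 / real n) * ln (f n L) - K\<bar> \<le> \<epsilon>" by (simp add: a_def)
      qed
    qed
  qed
  then obtain B where B: "\<forall>\<^sub>F n in sequentially. B n \<in> sets (M n) \<and> (\<forall>L\<in>space (M n) - B n. \<bar>- (1 / real n) * ln (f n L) - K\<bar> \<le> \<epsilon>)"
    "(\<lambda>n. emeasure (M n) (B n)) \<longlonglongrightarrow> 0" unfolding whp_def by blast
  have "(\<lambda>n. enn2real (emeasure (M n) (B n))) \<longlonglongrightarrow> 0" using B(2) by (intro tendsto_enn2real) simp_all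
  then have lim: "(\<lambda>n. measure (M n) (B n)) \<longlonglongrightarrow> 0" by (simp add: measure_def)
  have "\<forall>\<^sub>F n in sequentially. measure (M n) {L \<in> space (M n). \<bar>- (1 / real n) * ln (f n L) - K\<bar> > \<epsilon>} \<le> measure (M n) (B n)"
    using B(1) eventually_ge_at_top[of 1]
  proof eventually_elim
    case (elim n)
    interpret prob_space "M n" using prob_space_M elim by simp
    show ?case using elim(1) by (intro finite_measure_mono) (auto simp: not_less[symmetric])
  qed
  then show "(\<lambda>n. measure (M n) {L \<in> space (M n). \<bar>- (1 / real n) * ln (f n L) - K\<bar> > \<epsilon>}) \<longlonglongrightarrow> 0"
    by (intro tendsto_sandwich[OF _ _ tendsto_const lim]) auto
qed

section \<open>Direct search procedures\<close>

lemma set_pmf_gaussian: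
  assumes "L \<in> latt n" "n > 0" "c > 0"
  shows "set_pmf (discrete_gaussian L (gauss_width n c)) \<subseteq> L"
proof
  fix v assume v: "v \<in> set_pmf (discrete_gaussian L (gauss_width n c))"
  show "v \<in> L"
  proof (rule ccontr)
    assume "v \<notin> L"
    then have "emeasure (measure_pmf (discrete_gaussian L (gauss_width n c))) {v} = 0"
      unfolding emeasure_gaussian_rate[OF assms] by (simp add: gmass_finite_set)
    then show False using v by (simp add: emeasure_pmf_single set_pmf_iff)
  qed
qed

text \<open>A sample is judged by its primitive part. As the primitive part is never longer than the
  sample, this covers both forms of answer.\<close>

definition hits :: "nat \<Rightarrow> real \<Rightarrow> real vec set \<Rightarrow> real vec list \<Rightarrow> bool" where
  "hits n \<gamma> L xs \<longleftrightarrow> (\<exists>v\<in>set xs. v \<noteq> 0\<^sub>v n \<and> euclid_norm (primitive_part n L v) \<le> \<gamma> * lambda1 n L)"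

lemma space_decision_space:
  "space (decision_space n R j) = latt n \<times> space R \<times> {xs. length xs = j \<and> set xs \<subseteq> carrier_vec n}"
  by (simp add: decision_space_def history_space_def space_pair_measure)

lemma succeeds_imp_hits:
  assumes A: "is_direct_search n N R A" and L: "L \<in> latt n" and w: "\<omega> \<in> space R"
    and xs: "length xs \<le> N" "set xs \<subseteq> L" and s: "succeeds n \<gamma> L (returned n A L \<omega> xs)"
  shows "hits n \<gamma> L xs"
proof -
  obtain y where y: "returned n A L \<omega> xs = Some y" "y \<noteq> 0\<^sub>v n" "euclid_norm y \<le> \<gamma> * lambda1 n L"
    using s unfolding succeeds_def by blast
  then obtain i p where ip: "answer A L \<omega> xs = Some (i, p)" "y = (if p then primitive_part n L (xs ! i) else xs ! i)"
    unfolding returned_def by (auto split: option.splits)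
  have "(L, \<omega>, xs) \<in> space (decision_space n R (length xs))"
    using L w xs latt_carrier[OF L] by (auto simp: space_decision_space)
  moreover have "\<forall>(L, \<omega>, xs) \<in> space (decision_space n R (length xs)). \<forall>i p.
           answer A L \<omega> xs = Some (i, p) \<longrightarrow> i < length xs \<and> xs ! i \<noteq> 0\<^sub>v n"
    by (rule A[unfolded is_direct_search_def, THEN conjunct2, THEN spec, THEN mp, OF xs(1), THEN conjunct2])
  ultimately have i: "i < length xs" "xs ! i \<noteq> 0\<^sub>v n" using ip(1) by blast+
  then have v: "xs ! i \<in> set xs" "xs ! i \<in> L - {0\<^sub>v n}" using xs(2) by auto
  have "euclid_norm (primitive_part n L (xs ! i)) \<le> \<gamma> * lambda1 n L"
    using norm_primitive_part_le[OF L v(2)] y(3) ip(2) by (cases p) auto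
  then show ?thesis using v i unfolding hits_def by blast
qed

text \<open>Union bound along the transcript: whatever \<open>c\<close> is chosen from the history,
  the next sample hits with probability at most \<open>best_mass_hat n \<gamma> L\<close>. The
  \<open>of_bool\<close> term carries hits already in the history through the induction.\<close>

lemma transcript_success_le:
  assumes A: "is_direct_search n N R A" and L: "L \<in> latt n" and n: "n > 0" and w: "\<omega> \<in> space R"
    and "length xs + k \<le> N" "set xs \<subseteq> L"
  shows "emeasure (measure_pmf (transcript n A L \<omega> k xs)) {ys. succeeds n \<gamma> L (returned n A L \<omega> ys)}
    \<le> of_nat k * best_mass_hat n \<gamma> L + of_bool (hits n \<gamma> L xs)"
  using assms(5,6)
proof (induction k arbitrary: xs)
  case 0
  then show ?case using succeeds_imp_hits[OF A L w, of xs \<gamma>] by (auto simp: indicator_def)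
next
  case (Suc k)
  let ?b = "best_mass_hat n \<gamma> L" and ?S = "{ys. succeeds n \<gamma> L (returned n A L \<omega> ys)}"
  show ?case
  proof (cases "stop A L \<omega> xs")
    case True
    have "emeasure (measure_pmf (transcript n A L \<omega> (Suc k) xs)) ?S \<le> of_bool (hits n \<gamma> L xs)"
      using True succeeds_imp_hits[OF A L w, of xs \<gamma>] Suc.prems by (auto simp: indicator_def)
    also have "\<dots> \<le> of_nat (Suc k) * ?b + of_bool (hits n \<gamma> L xs)" by simp
    finally show ?thesis .
  next
    case False
    define c where "c = param A L \<omega> xs"
    have "(L, \<omega>, xs) \<in> space (decision_space n R (length xs))"
      using L w Suc.prems latt_carrier[OF L] by (auto simp: space_decision_space)
    moreover have "\<forall>(L, \<omega>, xs) \<in> space (decision_space n R (length xs)). param A L \<omega> xs > 0"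
    proof -
      have "length xs < N" using Suc.prems(1) by simp
      from A[unfolded is_direct_search_def, THEN conjunct1, THEN spec, THEN mp, OF this, THEN conjunct2, THEN conjunct2]
      show ?thesis .
    qed
    ultimately have c: "c > 0" unfolding c_def by blast
    let ?p = "discrete_gaussian L (gauss_width n c)"
    let ?H = "{v. v \<noteq> 0\<^sub>v n \<and> euclid_norm (primitive_part n L v) \<le> \<gamma> * lambda1 n L}"
    have "L \<inter> ?H = {v \<in> L - {0\<^sub>v n}. euclid_norm (primitive_part n L v) \<le> \<gamma> * lambda1 n L}" by auto
    then have "emeasure (measure_pmf ?p) ?H = succ_mass_hat n \<gamma> L (rate n c)"
      unfolding emeasure_gaussian_rate[OF L n c] succ_mass_hat_def by simp
    also have "\<dots> \<le> ?b" unfolding best_mass_hat_def using c by (intro SUP_upper) auto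
    finally have H: "emeasure (measure_pmf ?p) ?H \<le> ?b" .
    have "emeasure (measure_pmf (transcript n A L \<omega> (Suc k) xs)) ?S
        = (\<integral>\<^sup>+v. emeasure (measure_pmf (transcript n A L \<omega> k (xs @ [v]))) ?S \<partial>measure_pmf ?p)"
      using False by (simp add: c_def)
    also have "\<dots> \<le> (\<integral>\<^sup>+v. (of_nat k * ?b + of_bool (hits n \<gamma> L xs)) + indicator ?H v \<partial>measure_pmf ?p)"
    proof (rule nn_integral_mono_AE, unfold AE_measure_pmf_iff, rule ballI)
      fix v assume "v \<in> set_pmf ?p"
      then have v: "v \<in> L" using set_pmf_gaussian[OF L n c] by blast
      have "emeasure (measure_pmf (transcript n A L \<omega> k (xs @ [v]))) ?S \<le> of_nat k * ?b + of_bool (hits n \<gamma> L (xs @ [v]))"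
        by (rule Suc.IH) (use Suc.prems v in auto)
      also have "of_bool (hits n \<gamma> L (xs @ [v])) \<le> of_bool (hits n \<gamma> L xs) + (indicator ?H v :: ennreal)"
        by (auto simp: hits_def indicator_def of_bool_def)
      finally show "emeasure (measure_pmf (transcript n A L \<omega> k (xs @ [v]))) ?S \<le> (of_nat k * ?b + of_bool (hits n \<gamma> L xs)) + indicator ?H v"
        by (simp add: add.assoc add_left_mono)
    qed
    also have "\<dots> = (of_nat k * ?b + of_bool (hits n \<gamma> L xs)) + emeasure (measure_pmf ?p) ?H"
      by (subst nn_integral_add) (auto simp: measure_pmf.emeasure_space_1)
    also have "\<dots> \<le> (of_nat k * ?b + of_bool (hits n \<gamma> L xs)) + ?b" by (rule add_left_mono[OF H])
    also have "\<dots> = of_nat (Suc k) * ?b + of_bool (hits n \<gamma> L xs)" by (simp add: distrib_right add_ac)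
    finally show ?thesis .
  qed
qed

lemma shortest_sample_succeeds:
  assumes "v \<in> set ys" "v \<noteq> 0\<^sub>v n" "euclid_norm v \<le> \<gamma> * lambda1 n L"
  shows "succeeds n \<gamma> L (returned n (shortest_sample_search n c) L \<omega> ys)"
proof -
  define P where "P i \<longleftrightarrow> i < length ys \<and> ys ! i \<noteq> 0\<^sub>v n \<and>
    (\<forall>j<length ys. ys ! j \<noteq> 0\<^sub>v n \<longrightarrow> euclid_norm (ys ! i) \<le> euclid_norm (ys ! j))" for i
  let ?I = "{i. i < length ys \<and> ys ! i \<noteq> 0\<^sub>v n}"
  obtain j where j: "j < length ys" "v = ys ! j" using assms(1) by (metis in_set_conv_nth)
  have ne: "\<exists>i<length ys. ys ! i \<noteq> 0\<^sub>v n" using j assms(2) by blast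
  have fin: "finite ?I" and nI: "?I \<noteq> {}" using ne by auto
  define i0 where "i0 = arg_min_on (\<lambda>i. euclid_norm (ys ! i)) ?I"
  have "i0 \<in> ?I" unfolding i0_def by (rule arg_min_if_finite(1)[OF fin nI])
  moreover have "euclid_norm (ys ! i0) \<le> euclid_norm (ys ! i)" if "i \<in> ?I" for i
    unfolding i0_def by (rule arg_min_least[OF fin nI that])
  ultimately have "P i0" by (simp add: P_def)
  then have P: "P (LEAST i. P i)" by (rule LeastI)
  define i1 where "i1 = (LEAST i. P i)"
  have r: "returned n (shortest_sample_search n c) L \<omega> ys = Some (ys ! i1)"
    unfolding returned_def shortest_sample_search_def i1_def P_def using ne by simp
  have "P i1" using P by (simp only: i1_def)
  then have "ys ! i1 \<noteq> 0\<^sub>v n" "euclid_norm (ys ! i1) \<le> euclid_norm v"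
    using j assms(2) by (auto simp: P_def)
  then have "ys ! i1 \<noteq> 0\<^sub>v n" "euclid_norm (ys ! i1) \<le> \<gamma> * lambda1 n L" using assms(3) by auto
  then show ?thesis unfolding succeeds_def r by blast
qed

text \<open>Each fresh sample avoids \<open>Q\<close> with probability \<open>1 - u\<close>,
  independently of the history; earlier samples enter through the \<open>of_bool\<close>
  factor.\<close>

lemma transcript_miss_le:
  assumes u: "u = measure_pmf.prob (discrete_gaussian L (gauss_width n c)) Q"
  shows "emeasure (measure_pmf (transcript n (shortest_sample_search n c) L \<omega> k xs)) {ys. \<forall>v\<in>set ys. v \<notin> Q}
    \<le> of_bool (\<forall>v\<in>set xs. v \<notin> Q) * ennreal ((1 - u) ^ k)"
proof (induction k arbitrary: xs)
  case 0
  show ?case by (simp add: indicator_def)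
next
  case (Suc k)
  let ?p = "discrete_gaussian L (gauss_width n c)" and ?A = "shortest_sample_search n c"
  let ?S = "{ys. \<forall>v\<in>set ys. v \<notin> Q}"
  have u1: "0 \<le> 1 - u" unfolding u by simp
  have "stop ?A L \<omega> xs = False" "param ?A L \<omega> xs = c" by (simp_all add: shortest_sample_search_def)
  then have "emeasure (measure_pmf (transcript n ?A L \<omega> (Suc k) xs)) ?S
      = (\<integral>\<^sup>+v. emeasure (measure_pmf (transcript n ?A L \<omega> k (xs @ [v]))) ?S \<partial>measure_pmf ?p)" by simp
  also have "\<dots> \<le> (\<integral>\<^sup>+v. (of_bool (\<forall>v\<in>set xs. v \<notin> Q) * ennreal ((1 - u) ^ k)) * indicator (- Q) v \<partial>measure_pmf ?p)"
  proof (rule nn_integral_mono)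
    fix v
    show "emeasure (measure_pmf (transcript n ?A L \<omega> k (xs @ [v]))) ?S \<le> (of_bool (\<forall>v\<in>set xs. v \<notin> Q) * ennreal ((1 - u) ^ k)) * indicator (- Q) v"
      using Suc.IH[of "xs @ [v]"] by (cases "v \<in> Q"; cases "\<forall>v\<in>set xs. v \<notin> Q") auto
  qed
  also have "\<dots> = (of_bool (\<forall>v\<in>set xs. v \<notin> Q) * ennreal ((1 - u) ^ k)) * emeasure (measure_pmf ?p) (- Q)"
    by (simp add: nn_integral_cmult)
  also have "emeasure (measure_pmf ?p) (- Q) = ennreal (1 - u)"
    using measure_pmf.prob_compl[of Q ?p] by (simp add: measure_pmf.emeasure_eq_measure u Compl_eq_Diff_UNIV)
  also have "of_bool (\<forall>v\<in>set xs. v \<notin> Q) * ennreal ((1 - u) ^ k) * ennreal (1 - u) = of_bool (\<forall>v\<in>set xs. v \<notin> Q) * ennreal ((1 - u) ^ Suc k)"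
    using u1 by (simp add: mult.assoc ennreal_mult[symmetric] mult.commute)
  finally show ?case .
qed

lemma shortest_sample_success_ge:
  assumes n: "n > 0"
  shows "1 - ennreal ((1 - u_prob n \<gamma> c L) ^ k)
    \<le> emeasure (measure_pmf (transcript n (shortest_sample_search n c) L \<omega> k [])) {ys. succeeds n \<gamma> L (returned n (shortest_sample_search n c) L \<omega> ys)}"
proof -
  let ?A = "shortest_sample_search n c"
  let ?T = "measure_pmf (transcript n ?A L \<omega> k [])"
  let ?Q = "{v. 0 < euclid_norm v \<and> euclid_norm v \<le> \<gamma> * lambda1 n L}"
  let ?S = "{ys. succeeds n \<gamma> L (returned n ?A L \<omega> ys)}"
  have z: "euclid_norm (0\<^sub>v n) = 0" using euclid_norm_zero_iff[of "0\<^sub>v n" n] by simp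
  have sub: "- ?S \<subseteq> {ys. \<forall>v\<in>set ys. v \<notin> ?Q}"
  proof (rule subsetI, rule CollectI, rule ballI, rule notI)
    fix ys v assume ys: "ys \<in> - ?S" and v: "v \<in> set ys" "v \<in> ?Q"
    then have "v \<noteq> 0\<^sub>v n" using z by auto
    then show False using shortest_sample_succeeds[OF v(1), of n \<gamma> L c \<omega>] v(2) ys by simp
  qed
  have "emeasure ?T (- ?S) \<le> emeasure ?T {ys. \<forall>v\<in>set ys. v \<notin> ?Q}" by (rule emeasure_mono[OF sub]) simp
  also have "\<dots> \<le> ennreal ((1 - u_prob n \<gamma> c L) ^ k)"
    using transcript_miss_le[where Q = ?Q and xs = "[]", OF refl] by (simp add: u_prob_def)
  finally have le: "emeasure ?T (- ?S) \<le> ennreal ((1 - u_prob n \<gamma> c L) ^ k)" .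
  have "1 = emeasure ?T (?S \<union> - ?S)" using measure_pmf.emeasure_space_1[of "transcript n ?A L \<omega> k []"] by (simp add: Un_commute)
  also have "\<dots> \<le> emeasure ?T ?S + emeasure ?T (- ?S)" by (rule emeasure_subadditive) auto
  also have "\<dots> \<le> ennreal ((1 - u_prob n \<gamma> c L) ^ k) + emeasure ?T ?S" using le by (simp add: add.commute add_right_mono)
  finally show ?thesis by (simp add: ennreal_minus_le_iff)
qed

section \<open>The two regimes of query complexity\<close>

lemma nn_integral_pair_fst:
  assumes R: "prob_space R" and f: "f \<in> borel_measurable N"
  shows "(\<integral>\<^sup>+x. f (fst x) \<partial>(N \<Otimes>\<^sub>M R)) = (\<integral>\<^sup>+x. f x \<partial>N)"
proof -
  have "(\<integral>\<^sup>+x. f x \<partial>N) = (\<integral>\<^sup>+x. f x \<partial>distr (N \<Otimes>\<^sub>M R) N fst)"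
    by (simp only: prob_space.distr_pair_fst[OF R])
  also have "\<dots> = (\<integral>\<^sup>+x. f (fst x) \<partial>(N \<Otimes>\<^sub>M R))" by (rule nn_integral_distr) (use f in auto)
  finally show ?thesis ..
qed

lemma exp_tendsto_0:
  fixes a :: "nat \<Rightarrow> real"
  assumes "a \<longlonglongrightarrow> l" "l < 0"
  shows "(\<lambda>n. exp (real n * a n)) \<longlonglongrightarrow> 0"
proof -
  have "filterlim (\<lambda>n. a n * real n) at_bot sequentially"
    by (rule filterlim_tendsto_neg_mult_at_bot[OF assms filterlim_real_sequentially])
  then have "filterlim (\<lambda>n. real n * a n) at_bot sequentially" by (simp add: mult.commute)
  then show ?thesis by (rule filterlim_compose[OF exp_at_bot])
qed

lemma exp_at_top_seq:
  fixes a :: "nat \<Rightarrow> real"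
  assumes "a \<longlonglongrightarrow> l" "0 < l"
  shows "filterlim (\<lambda>n. exp (real n * a n)) at_top sequentially"
  by (intro filterlim_compose[OF exp_at_top])
    (rule filterlim_tendsto_pos_mult_at_top[OF assms filterlim_real_sequentially, unfolded mult.commute[of "a _"]])

context lattice_seq
begin

lemma joint_success_tendsto_0:
  fixes N :: "nat \<Rightarrow> nat" and R :: "nat \<Rightarrow> 'r measure"
  assumes seed: "\<And>n. prob_space (R n)" and g: "\<gamma> \<ge> 1" and N0: "\<And>n. N n > 0"
    and N: "(\<lambda>n. ln (real (N n)) / real n) \<longlonglongrightarrow> r" and r: "r < K_star \<gamma>"
    and A: "\<And>n. n \<ge> 1 \<Longrightarrow> is_direct_search n (N n) (R n) (A n)"
  shows "(\<lambda>n. joint_success n \<gamma> (M n) (R n) (N n) (A n)) \<longlonglongrightarrow> 0"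
proof -
  define \<epsilon> where "\<epsilon> = (K_star \<gamma> - r) / 2"
  have e: "\<epsilon> > 0" using r by (simp add: \<epsilon>_def)
  \<comment> \<open>The truncation at 1 supplies the domination on exceptional lattices. On the
    others \<open>h\<close> is at most \<open>t n\<close>, whose exponent per dimension tends to
    \<open>r - K_star \<gamma> + \<epsilon>\<close>, minus half of the gap.\<close>
  define h where "h n L = min 1 (of_nat (N n) * best_mass_hat n \<gamma> L)" for n L
  define t where "t n = exp (real n * (ln (real (N n)) / real n - (K_star \<gamma> - \<epsilon>)))" for n
  have t: "t \<longlonglongrightarrow> 0"
    unfolding t_def by (rule exp_tendsto_0[OF tendsto_diff[OF N tendsto_const]]) (use r in \<open>simp add: \<epsilon>_def field_simps\<close>)
  have "whp M (\<lambda>n L. h n L \<le> ennreal (t n))"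
  proof (rule whp_mono[OF whp_best_mass_hat_le[OF g e]])
    show "\<forall>\<^sub>F n in sequentially. \<forall>L\<in>space (M n). best_mass_hat n \<gamma> L \<le> ennreal (exp (- (real n * (K_star \<gamma> - \<epsilon>)))) \<longrightarrow> h n L \<le> ennreal (t n)"
      using eventually_ge_at_top[of 1]
    proof eventually_elim
      case (elim n)
      have "real n * (ln (real (N n)) / real n - (K_star \<gamma> - \<epsilon>)) = ln (real (N n)) + - (real n * (K_star \<gamma> - \<epsilon>))"
        using elim by (simp add: right_diff_distrib)
      then have tn: "t n = real (N n) * exp (- (real n * (K_star \<gamma> - \<epsilon>)))"
        unfolding t_def using N0[of n] by (simp only: exp_add) simp
      show ?case
      proof (intro ballI impI)
        fix L assume b: "best_mass_hat n \<gamma> L \<le> ennreal (exp (- (real n * (K_star \<gamma> - \<epsilon>))))"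
        have "h n L \<le> of_nat (N n) * best_mass_hat n \<gamma> L" by (simp add: h_def)
        also have "\<dots> \<le> of_nat (N n) * ennreal (exp (- (real n * (K_star \<gamma> - \<epsilon>))))" by (rule mult_left_mono[OF b]) simp
        also have "\<dots> = ennreal (t n)" unfolding tn by (simp add: ennreal_mult ennreal_of_nat_eq_real_of_nat)
        finally show "h n L \<le> ennreal (t n)" .
      qed
    qed
  qed
  then have "(\<lambda>n. \<integral>\<^sup>+L. h n L \<partial>M n) \<longlonglongrightarrow> 0"
    by (intro whp_nn_integral_tendsto_0[OF _ _ t]) (auto simp: h_def eventually_sequentially intro: exI[of _ 1] prob_space_M)
  then have lim: "(\<lambda>n. enn2real (\<integral>\<^sup>+L. h n L \<partial>M n)) \<longlonglongrightarrow> 0"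
    by (intro tendsto_enn2real) simp_all
  have ub: "\<forall>\<^sub>F n in sequentially. joint_success n \<gamma> (M n) (R n) (N n) (A n) \<le> enn2real (\<integral>\<^sup>+L. h n L \<partial>M n)"
    using eventually_ge_at_top[of 1]
  proof eventually_elim
    case (elim n)
    then have n0: "n > 0" by simp
    interpret prob_space "M n" by (rule prob_space_M[OF elim])
    have hm: "h n \<in> borel_measurable (M n)"
    proof (rule measurable_M[OF elim])
      note [measurable] = measurable_best_mass(2)[OF n0, of \<gamma>]
      show "h n \<in> borel_measurable (lattice_space n)" unfolding h_def by measurable
    qed
    have "(\<integral>\<^sup>+ (L, \<omega>). emeasure (measure_pmf (transcript n (A n) L \<omega> (N n) []))
         {xs. succeeds n \<gamma> L (returned n (A n) L \<omega> xs)} \<partial>(M n \<Otimes>\<^sub>M R n)) \<le> (\<integral>\<^sup>+x. h n (fst x) \<partial>(M n \<Otimes>\<^sub>M R n))"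
    proof (rule nn_integral_mono)
      fix x assume "x \<in> space (M n \<Otimes>\<^sub>M R n)"
      then obtain L \<omega> where x: "x = (L, \<omega>)" "L \<in> latt n" "\<omega> \<in> space (R n)"
        using space_M[OF elim] by (auto simp: space_pair_measure)
      have "emeasure (measure_pmf (transcript n (A n) L \<omega> (N n) [])) {xs. succeeds n \<gamma> L (returned n (A n) L \<omega> xs)}
        \<le> of_nat (N n) * best_mass_hat n \<gamma> L"
        using transcript_success_le[OF A[OF elim] x(2) n0 x(3), of "[]" "N n" \<gamma>] by (simp add: hits_def)
      then show "(case x of (L, \<omega>) \<Rightarrow> emeasure (measure_pmf (transcript n (A n) L \<omega> (N n) []))
         {xs. succeeds n \<gamma> L (returned n (A n) L \<omega> xs)}) \<le> h n (fst x)"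
        by (simp add: x(1) h_def measure_pmf.emeasure_le_1)
    qed
    also have "\<dots> = (\<integral>\<^sup>+L. h n L \<partial>M n)" by (rule nn_integral_pair_fst[OF seed hm])
    finally have le: "(\<integral>\<^sup>+ (L, \<omega>). emeasure (measure_pmf (transcript n (A n) L \<omega> (N n) []))
         {xs. succeeds n \<gamma> L (returned n (A n) L \<omega> xs)} \<partial>(M n \<Otimes>\<^sub>M R n)) \<le> (\<integral>\<^sup>+L. h n L \<partial>M n)" .
    have "(\<integral>\<^sup>+L. h n L \<partial>M n) \<le> (\<integral>\<^sup>+L. 1 \<partial>M n)" by (intro nn_integral_mono) (simp add: h_def)
    also have "\<dots> = 1" by (simp add: emeasure_space_1)
    also have "\<dots> < Orderings.top_class.top" by simp
    finally show ?case unfolding joint_success_def using le by (intro enn2real_mono)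
  qed
  show ?thesis
    by (rule tendsto_sandwich[OF _ ub tendsto_const lim]) (simp add: joint_success_def)
qed

lemma joint_success_tendsto_1:
  fixes N :: "nat \<Rightarrow> nat" and R :: "nat \<Rightarrow> 'r measure"
  assumes seed: "\<And>n. prob_space (R n)" and g: "\<gamma> \<ge> 1" and N0: "\<And>n. N n > 0"
    and N: "(\<lambda>n. ln (real (N n)) / real n) \<longlonglongrightarrow> r" and r: "r > K_star \<gamma>"
  shows "(\<lambda>n. joint_success n \<gamma> (M n) (R n) (N n) (shortest_sample_search n (exp (- 1)))) \<longlonglongrightarrow> 1"
proof -
  let ?c = "exp (- 1) :: real"
  define \<epsilon> where "\<epsilon> = (r - K_star \<gamma>) / 2"
  have e: "\<epsilon> > 0" using r by (simp add: \<epsilon>_def)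
  \<comment> \<open>An upper bound for the failure probability given the lattice. On typical
    lattices it is at most \<open>exp (- t n)\<close>, with \<open>t n\<close> growing exponentially
    because \<open>\<epsilon>\<close> is only half of the gap.\<close>
  define h where "h n L = ennreal ((1 - u_prob n \<gamma> ?c L) ^ N n)" for n L
  define t where "t n = exp (real n * (ln (real (N n)) / real n - (K_star \<gamma> + \<epsilon>)))" for n
  have "filterlim t at_top sequentially"
    unfolding t_def by (rule exp_at_top_seq[OF tendsto_diff[OF N tendsto_const]]) (use r in \<open>simp add: \<epsilon>_def field_simps\<close>)
  then have "filterlim (\<lambda>n. - t n) at_bot sequentially" by (simp add: filterlim_uminus_at_top)
  then have t: "(\<lambda>n. exp (- t n)) \<longlonglongrightarrow> 0" by (rule filterlim_compose[OF exp_at_bot])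
  have u01: "0 \<le> u_prob n \<gamma> ?c L" "u_prob n \<gamma> ?c L \<le> 1" for n L by (simp_all add: u_prob_def)
  have h1: "h n L \<le> 1" for n L unfolding h_def using u01[of n L] by (simp add: power_le_one ennreal_le_1)
  have "whp M (\<lambda>n L. h n L \<le> ennreal (exp (- t n)))"
  proof (rule whp_mono[OF whp_succ_mass_ge[OF g e]])
    show "\<forall>\<^sub>F n in sequentially. \<forall>L\<in>space (M n). ennreal (exp (- (real n * (K_star \<gamma> + \<epsilon>)))) \<le> succ_mass n \<gamma> L (rate n (exp (- 1)))
       \<longrightarrow> h n L \<le> ennreal (exp (- t n))"
      using eventually_ge_at_top[of 1]
    proof eventually_elim
      case (elim n)
      have "real n * (ln (real (N n)) / real n - (K_star \<gamma> + \<epsilon>)) = ln (real (N n)) + - (real n * (K_star \<gamma> + \<epsilon>))"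
        using elim by (simp add: right_diff_distrib)
      then have tn: "t n = real (N n) * exp (- (real n * (K_star \<gamma> + \<epsilon>)))"
        unfolding t_def using N0[of n] by (simp only: exp_add) simp
      show ?case
      proof (intro ballI impI)
        fix L assume "L \<in> space (M n)" and s: "ennreal (exp (- (real n * (K_star \<gamma> + \<epsilon>)))) \<le> succ_mass n \<gamma> L (rate n ?c)"
        then have L: "L \<in> latt n" using space_M[OF elim] by simp
        let ?u = "u_prob n \<gamma> ?c L"
        have "ennreal (exp (- (real n * (K_star \<gamma> + \<epsilon>)))) \<le> ennreal ?u"
          using s u_prob_eq[OF L, of ?c \<gamma>] elim by simp
        then have u: "exp (- (real n * (K_star \<gamma> + \<epsilon>))) \<le> ?u" using u01[of n L] by (simp add: ennreal_le_iff)
        have "(1 - ?u) ^ N n \<le> exp (- ?u) ^ N n"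
          using u01[of n L] exp_ge_add_one_self[of "- ?u"] by (intro power_mono) auto
        also have "\<dots> = exp (real (N n) * (- ?u))" by (rule exp_of_nat_mult[symmetric])
        also have "\<dots> \<le> exp (- t n)" unfolding tn using u by (simp add: mult_left_mono)
        finally show "h n L \<le> ennreal (exp (- t n))" unfolding h_def by (rule ennreal_leI)
      qed
    qed
  qed
  then have "(\<lambda>n. \<integral>\<^sup>+L. h n L \<partial>M n) \<longlonglongrightarrow> 0"
    by (intro whp_nn_integral_tendsto_0[OF _ _ t]) (auto simp: h1 eventually_sequentially intro: exI[of _ 1] prob_space_M)
  then have "(\<lambda>n. enn2real (\<integral>\<^sup>+L. h n L \<partial>M n)) \<longlonglongrightarrow> 0"
    by (intro tendsto_enn2real) simp_all
  then have lim: "(\<lambda>n. 1 - enn2real (\<integral>\<^sup>+L. h n L \<partial>M n)) \<longlonglongrightarrow> 1"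
    using tendsto_diff[OF tendsto_const[of "1 :: real"]] by fastforce
  have bounds: "\<forall>\<^sub>F n in sequentially. 1 - enn2real (\<integral>\<^sup>+L. h n L \<partial>M n) \<le> joint_success n \<gamma> (M n) (R n) (N n) (shortest_sample_search n ?c)
      \<and> joint_success n \<gamma> (M n) (R n) (N n) (shortest_sample_search n ?c) \<le> 1"
    using eventually_ge_at_top[of 1]
  proof eventually_elim
    case (elim n)
    then have n0: "n > 0" by simp
    interpret prob_space "M n" by (rule prob_space_M[OF elim])
    interpret S: prob_space "R n" by (rule seed)
    interpret P: pair_prob_space "M n" "R n" by unfold_locales
    let ?A = "shortest_sample_search n ?c :: 'r direct_search"
    let ?f = "\<lambda>(L, \<omega>). emeasure (measure_pmf (transcript n ?A L \<omega> (N n) [])) {xs. succeeds n \<gamma> L (returned n ?A L \<omega> xs)}"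
    define J where "J = (\<integral>\<^sup>+x. ?f x \<partial>(M n \<Otimes>\<^sub>M R n))"
    have hm: "h n \<in> borel_measurable (M n)"
    proof (rule measurable_M[OF elim])
      have "(\<lambda>L. ennreal ((1 - enn2real (succ_mass n \<gamma> L (rate n ?c))) ^ N n)) \<in> borel_measurable (lattice_space n)"
        using measurable_succ_mass(1)[OF n0, of \<gamma> "rate n ?c"] by measurable
      then show "h n \<in> borel_measurable (lattice_space n)"
        by (rule measurable_cong[THEN iffD1, rotated]) (simp add: h_def u_prob_eq[OF _ n0, symmetric] u_prob_def)
    qed
    have J1: "J \<le> 1"
    proof -
      have "J \<le> (\<integral>\<^sup>+x. 1 \<partial>(M n \<Otimes>\<^sub>M R n))"
        unfolding J_def by (intro nn_integral_mono) (auto simp: measure_pmf.emeasure_le_1)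
      also have "\<dots> = 1" by (simp add: P.emeasure_space_1)
      finally show ?thesis .
    qed
    \<comment> \<open>The part \<open>1 - h\<close> is compared with the success probability by
      monotonicity alone; the seed is integrated out because \<open>h\<close> depends only on the
      lattice.\<close>
    have "1 = (\<integral>\<^sup>+L. (1 - h n L) + h n L \<partial>M n)"
      using h1 by (simp add: emeasure_space_1 diff_add_cancel_ennreal)
    also have "\<dots> = (\<integral>\<^sup>+L. 1 - h n L \<partial>M n) + (\<integral>\<^sup>+L. h n L \<partial>M n)"
      using hm by (intro nn_integral_add) auto
    also have "(\<integral>\<^sup>+L. 1 - h n L \<partial>M n) = (\<integral>\<^sup>+x. 1 - h n (fst x) \<partial>(M n \<Otimes>\<^sub>M R n))"
      using hm by (intro nn_integral_pair_fst[OF seed, symmetric]) measurable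
    also have "\<dots> \<le> J"
      unfolding J_def h_def by (intro nn_integral_mono) (auto simp: shortest_sample_success_ge[OF n0])
    finally have 1: "1 \<le> J + (\<integral>\<^sup>+L. h n L \<partial>M n)" by (simp add: add_right_mono)
    have H1: "(\<integral>\<^sup>+L. h n L \<partial>M n) \<le> 1"
    proof -
      have "(\<integral>\<^sup>+L. h n L \<partial>M n) \<le> (\<integral>\<^sup>+L. 1 \<partial>M n)" by (intro nn_integral_mono) (rule h1)
      also have "\<dots> = 1" by (simp add: emeasure_space_1)
      finally show ?thesis .
    qed
    have fin: "x \<le> 1 \<Longrightarrow> ennreal (enn2real x) = x" for x :: ennreal
      by (intro ennreal_enn2real) (metis ennreal_one_less_top le_less_trans)
    have "ennreal 1 \<le> ennreal (enn2real J + enn2real (\<integral>\<^sup>+L. h n L \<partial>M n))"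
      using 1 fin[OF J1] fin[OF H1] by (simp add: ennreal_plus)
    then have "1 \<le> enn2real J + enn2real (\<integral>\<^sup>+L. h n L \<partial>M n)"
      by (subst (asm) ennreal_le_iff) auto
    moreover have "enn2real J \<le> 1" using enn2real_mono[OF J1] by simp
    ultimately show ?case unfolding joint_success_def J_def by linarith
  qed
  show ?thesis
    by (rule tendsto_sandwich[OF _ _ lim tendsto_const]) (use bounds in \<open>auto elim: eventually_mono\<close>)
qed

lemma converges_best_mass:
  assumes g: "\<gamma> \<ge> 1"
  shows "converges_in_prob M (\<lambda>n L. - (1 / real n) * ln (SUP c\<in>{0<..}. u_prob n \<gamma> c L)) (K_star \<gamma>)"
    "converges_in_prob M (\<lambda>n L. - (1 / real n) * ln (SUP c\<in>{0<..}. u_hat_prob n \<gamma> c L)) (K_star \<gamma>)"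
proof -
  have SUP_nonneg: "0 \<le> (SUP c\<in>{0 :: real<..}. f c)" if "\<And>c. 0 \<le> f c" "\<And>c. f c \<le> 1" for f :: "real \<Rightarrow> real"
  proof -
    have "f 1 \<le> (SUP c\<in>{0 :: real<..}. f c)"
      by (rule cSUP_upper) (use that in \<open>auto intro: bdd_aboveI[of _ 1]\<close>)
    then show ?thesis using that(1)[of 1] by linarith
  qed
  have b: "best_mass n \<gamma> L \<le> best_mass_hat n \<gamma> L" if "L \<in> latt n" for n L
    unfolding best_mass_def best_mass_hat_def by (intro SUP_mono' succ_mass_le_hat that)
  have lo: "succ_mass n \<gamma> L (rate n (exp (- 1))) \<le> best_mass n \<gamma> L" for n L
    unfolding best_mass_def by (intro SUP_upper) simp
  have ev: "\<forall>\<^sub>F n in sequentially. \<forall>L\<in>space (M n). best_mass n \<gamma> L \<le> best_mass_hat n \<gamma> L"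
    using eventually_ge_at_top[of 1] by eventually_elim (auto simp: space_M intro: b)
  have up_hat: "whp M (\<lambda>n L. best_mass_hat n \<gamma> L \<le> ennreal (exp (- (real n * (K_star \<gamma> - \<epsilon>)))))" if "\<epsilon> > 0" for \<epsilon>
    by (rule whp_best_mass_hat_le[OF g that])
  have up: "whp M (\<lambda>n L. best_mass n \<gamma> L \<le> ennreal (exp (- (real n * (K_star \<gamma> - \<epsilon>)))))" if "\<epsilon> > 0" for \<epsilon>
    by (rule whp_mono[OF up_hat[OF that]], rule eventually_mono[OF ev]) (blast intro: order.trans)
  have lo': "whp M (\<lambda>n L. ennreal (exp (- (real n * (K_star \<gamma> + \<epsilon>)))) \<le> best_mass n \<gamma> L)" if "\<epsilon> > 0" for \<epsilon>
    by (rule whp_mono[OF whp_succ_mass_ge[OF g that]]) (intro always_eventually allI ballI impI, erule order.trans, rule lo)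
  have lo_hat: "whp M (\<lambda>n L. ennreal (exp (- (real n * (K_star \<gamma> + \<epsilon>)))) \<le> best_mass_hat n \<gamma> L)" if "\<epsilon> > 0" for \<epsilon>
    by (rule whp_mono[OF lo'[OF that]], rule eventually_mono[OF ev]) (blast intro: order.trans)
  show "converges_in_prob M (\<lambda>n L. - (1 / real n) * ln (SUP c\<in>{0<..}. u_prob n \<gamma> c L)) (K_star \<gamma>)"
  proof (rule converges_in_prob_exponent[where F = "\<lambda>n. best_mass n \<gamma>", OF _ _ up lo'])
    show "best_mass n \<gamma> L = ennreal (SUP c\<in>{0<..}. u_prob n \<gamma> c L) \<and> 0 \<le> (SUP c\<in>{0<..}. u_prob n \<gamma> c L)"
      if "n \<ge> 1" "L \<in> latt n" for n L
      using best_mass_real(1)[OF that(2)] that(1) SUP_nonneg[of "\<lambda>c. u_prob n \<gamma> c L"] by (simp add: u_prob_def)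
  qed (auto intro: measurable_best_mass(1))
  show "converges_in_prob M (\<lambda>n L. - (1 / real n) * ln (SUP c\<in>{0<..}. u_hat_prob n \<gamma> c L)) (K_star \<gamma>)"
  proof (rule converges_in_prob_exponent[where F = "\<lambda>n. best_mass_hat n \<gamma>", OF _ _ up_hat lo_hat])
    show "best_mass_hat n \<gamma> L = ennreal (SUP c\<in>{0<..}. u_hat_prob n \<gamma> c L) \<and> 0 \<le> (SUP c\<in>{0<..}. u_hat_prob n \<gamma> c L)"
      if "n \<ge> 1" "L \<in> latt n" for n L
      using best_mass_real(2)[OF that(2)] that(1) SUP_nonneg[of "\<lambda>c. u_hat_prob n \<gamma> c L"] by (simp add: u_hat_prob_def)
  qed (auto intro: measurable_best_mass(2))
qed

end

lemma K_star_1: "K_star 1 = 1 / (2 * exp 1)"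
  by (simp add: K_star_def)

text \<open>Both bounds follow from enclosing the product of \<open>e\<close> and
  \<open>ln 2\<close>, using rational approximations of the two factors.\<close>

lemma K_star_1_numeric: "0.2653689 \<le> K_star 1 / ln 2" "K_star 1 / ln 2 < 0.2653690"
proof -
  define e l where "e = exp (1 :: real)" and "l = ln (2 :: real)"
  have e: "2.718281828 < e" "e < 2.718281829"
  proof -
    have a: "\<bar>e - 5837465777 / 2147483648\<bar> \<le> 1 / 4294967296"
      using e_approx_32 by (simp add: e_def)
    show "2.718281828 < e" "e < 2.718281829"
      using abs_le_D1[OF a] abs_le_D2[OF a] by simp_all
  qed
  have l: "0.69314718 < l" "l < 0.693147181"
    using ln_approx_bounds[of 2 9] unfolding l_def[symmetric] by (simp_all add: eval_nat_numeral)
  have eq: "K_star 1 / ln 2 = 1 / (2 * (e * l))" by (simp add: K_star_1 e_def l_def)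
  have lo: "2.718281828 * 0.69314718 < e * l" by (intro mult_strict_mono) (use e l in auto)
  have hi: "e * l < 2.718281829 * 0.693147181" by (intro mult_strict_mono) (use e l in auto)
  have pos: "e * l > 0" using e l by (intro mult_pos_pos) auto
  show "0.2653689 \<le> K_star 1 / ln 2" "K_star 1 / ln 2 < 0.2653690"
    unfolding eq using lo hi pos by (simp_all add: field_simps)
qed

theorem theorem1p1:
  fixes \<gamma> :: real
    and M :: "nat \<Rightarrow> real vec set measure"
    and R :: "nat \<Rightarrow> 'r measure"
  assumes gamma: "\<gamma> \<ge> 1"
    and mu: "\<And>n. n \<ge> 1 \<Longrightarrow> invariant_lattice_prob n (M n)"
    and seed: "\<And>n. prob_space (R n)"
  shows "K_star 1 = 1 / (2 * exp 1)
    \<and> K_star 1 / ln 2 = 1 / (2 * exp 1 * ln 2)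
    \<and> 0.2653689 \<le> K_star 1 / ln 2 \<and> K_star 1 / ln 2 < 0.2653690
    \<and> converges_in_prob M
        (\<lambda>n L. - (1 / real n) * ln (SUP c\<in>{0<..}. u_prob n \<gamma> c L)) (K_star \<gamma>)
    \<and> converges_in_prob M
        (\<lambda>n L. - (1 / real n) * ln (SUP c\<in>{0<..}. u_hat_prob n \<gamma> c L)) (K_star \<gamma>)
    \<and> (\<forall>(N :: nat \<Rightarrow> nat) (r :: real).
          (\<forall>n. N n > 0) \<longrightarrow> (\<lambda>n. ln (real (N n)) / real n) \<longlonglongrightarrow> r \<longrightarrow>
          (r < K_star \<gamma> \<longrightarrow>
             (\<forall>A :: nat \<Rightarrow> 'r direct_search.
                (\<forall>n\<ge>1. is_direct_search n (N n) (R n) (A n)) \<longrightarrow>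
                (\<lambda>n. joint_success n \<gamma> (M n) (R n) (N n) (A n)) \<longlonglongrightarrow> 0)) \<and>
          (r > K_star \<gamma> \<longrightarrow>
             (\<lambda>n. joint_success n \<gamma> (M n) (R n) (N n) (shortest_sample_search n (exp (- 1))))
                \<longlonglongrightarrow> 1))"
proof -
  interpret lattice_seq M by unfold_locales (rule mu)
  have "K_star 1 / ln 2 = 1 / (2 * exp 1 * ln 2)" by (simp add: K_star_1)
  then show ?thesis
    using K_star_1 K_star_1_numeric converges_best_mass[OF gamma]
      joint_success_tendsto_0[of R \<gamma>, OF seed gamma] joint_success_tendsto_1[of R \<gamma>, OF seed gamma] by blast
qed

end
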